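(* Suppose $f\in C([0,T];L^2(\Omega))$ and $u_0,\bar u_0\in L^2(\Omega)$. Then the variable-exponent fractional diffusion-wave problem $$\int_0^t k(t-s)\,\partial_s^2u(\boldsymbol x,s)\,ds-\kappa A u(\boldsymbol x,t)=f(\boldsymbol x,t),\quad (\boldsymbol x,t)\in\Omega\times(0,T],\qquad k(t)=\frac{t^{1-\alpha(t)}}{\Gamma(2-\alpha(t))},$$ $$u(\cdot,0)=u_0,\quad \partial_tu(\cdot,0)=\bar u_0 \text{ in }\Omega,\qquad u=0\text{ on }\partial\Omega\times[0,T],$$ admits a unique mild solution $u\in C([0,T];L^2(\Omega))$, and there is a constant $Q>0$, independent of $f,u_0,\bar u_0$, such that $$\|u\|_{C([0,T];L^2(\Omega))}\le Q\big(\|f\|_{C([0,T];L^2(\Omega))}+\|u_0\|+\|\bar u_0\|\big).$$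
   Context: Standing setting: $T>0$, $\kappa>0$, $1\le d\le 3$; $\Omega\subset\mathbb R^d$ is a simply-connected bounded domain with piecewise smooth boundary $\partial\Omega$ with convex corners. $A$ is the Laplacian with zero Dirichlet boundary condition, with eigenpairs $-A\phi_i=\lambda_i\phi_i$. $\alpha:[0,T]\to(1,2)$ is three times differentiable with $|\alpha'(t)|+|\alpha''(t)|+|\alpha'''(t)|\le L$ for some $L>0$; $\alpha_0:=\alpha(0)$. $\|\cdot\|$ is the $L^2(\Omega)$ norm. The symbol $*$ is convolution in time, $(a*b)(t)=\int_0^t a(t-s)b(s)\,ds$, and $\beta_\mu(t):=t^{\mu-1}/\Gamma(\mu)$ for $\mu>0$ (so $\beta_1\equiv1$). The generalized identity function is $$g(t):=(\beta_{\alpha_0-1}*k)(t)=\int_0^1\frac{(tz)^{\alpha(0)-\alpha(tz)}}{\Gamma(\alpha(0)-1)\Gamma(2-\alpha(tz))}(1-z)^{\alpha(0)-2}z^{1-\alpha(0)}\,dz,\qquad g(0)=1.$$ Mild solution: a function $u\in C([0,T];L^2(\Omega))$ is called a mild solution of the problem if it satisfies $$u-u_0-\kappa\,\beta_{\alpha_0}*Au=P_u,\qquad P_u:=\beta_{\alpha_0}*f-g'*(u-u_0)+(\beta_1*g)\,\bar u_0,$$ with zero boundary conditions. Since $u(t)$ is only in $L^2(\Omega)$, $\beta_{\alpha_0}*Au$ is understood as $A(\beta_{\alpha_0}*u)$ with $A$ the Dirichlet Laplacian; equivalently, the identity holds after testing with every Dirichlet eigenfunction $\phi_i$, where $(Au,\phi_i)=-\lambda_i(u,\phi_i)$.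 *)

theory Defs
  imports "HOL-Analysis.Analysis"
begin

definition sq_integrable :: "('a::euclidean_space \<Rightarrow> real) \<Rightarrow> bool" where
  "sq_integrable f \<longleftrightarrow>
     f \<in> borel_measurable lebesgue \<and> integrable lebesgue (\<lambda>x. (f x)\<^sup>2)"

lemma sq_integrable_measurable [measurable_dest]:
  "sq_integrable f \<Longrightarrow> f \<in> borel_measurable lebesgue"
  by (simp add: sq_integrable_def)

lemma sq_integrable_mult:
  assumes "sq_integrable f" "sq_integrable g"
  shows "integrable lebesgue (\<lambda>x. f x * g x)"
proof (rule Bochner_Integration.integrable_bound)
  show "integrable lebesgue (\<lambda>x. (f x)\<^sup>2 + (g x)\<^sup>2)"
    using assms by (simp add: sq_integrable_def)
  show "(\<lambda>x. f x * g x) \<in> borel_measurable lebesgue"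
    using assms by (auto simp: sq_integrable_def intro: borel_measurable_times)
  show "AE x in lebesgue. norm (f x * g x) \<le> norm ((f x)\<^sup>2 + (g x)\<^sup>2)"
  proof (rule AE_I2)
    fix x
    have "2 * \<bar>f x\<bar> * \<bar>g x\<bar> \<le> \<bar>f x\<bar>\<^sup>2 + \<bar>g x\<bar>\<^sup>2"
      by (rule sum_squares_bound)
    moreover have "0 \<le> \<bar>f x\<bar> * \<bar>g x\<bar>"
      by simp
    ultimately have "\<bar>f x\<bar> * \<bar>g x\<bar> \<le> (f x)\<^sup>2 + (g x)\<^sup>2"
      by (simp only: power2_abs mult.assoc)
    then show "norm (f x * g x) \<le> norm ((f x)\<^sup>2 + (g x)\<^sup>2)"
      by (simp add: abs_mult)
  qed
qed

lemma sq_integrable_zero: "sq_integrable (\<lambda>x. 0)"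
  by (simp add: sq_integrable_def)

lemma sq_integrable_scale: "sq_integrable f \<Longrightarrow> sq_integrable (\<lambda>x. c * f x)"
  by (auto simp: sq_integrable_def power_mult_distrib intro: borel_measurable_times)

lemma sq_integrable_add:
  assumes "sq_integrable f" "sq_integrable g"
  shows "sq_integrable (\<lambda>x. f x + g x)"
proof -
  have "integrable lebesgue (\<lambda>x. (f x)\<^sup>2 + (g x)\<^sup>2 + 2 * (f x * g x))"
    using assms sq_integrable_mult[OF assms] by (simp add: sq_integrable_def)
  then show ?thesis
    using assms
    by (auto simp: sq_integrable_def power2_sum mult.assoc intro: borel_measurable_add)
qed

lemma sq_integrable_uminus: "sq_integrable f \<Longrightarrow> sq_integrable (\<lambda>x. - f x)"
  by (simp add: sq_integrable_def)

lemma sq_integrable_diff: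
  "sq_integrable f \<Longrightarrow> sq_integrable g \<Longrightarrow> sq_integrable (\<lambda>x. f x - g x)"
  using sq_integrable_add[of f "\<lambda>x. - g x"] by (simp add: sq_integrable_uminus)

definition l2_rel :: "('a::euclidean_space \<Rightarrow> real) \<Rightarrow> ('a \<Rightarrow> real) \<Rightarrow> bool" where
  "l2_rel f g \<longleftrightarrow> sq_integrable f \<and> sq_integrable g \<and> (AE x in lebesgue. f x = g x)"

lemma l2_rel_refl_iff: "l2_rel f f \<longleftrightarrow> sq_integrable f"
  by (simp add: l2_rel_def)

quotient_type (overloaded) 'a l2 = "'a::euclidean_space \<Rightarrow> real" / partial: l2_rel
proof (rule part_equivpI)
  show "\<exists>f::'a \<Rightarrow> real. l2_rel f f"
    using sq_integrable_zero l2_rel_refl_iff by blast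
  show "symp (l2_rel :: ('a \<Rightarrow> real) \<Rightarrow> _)"
    by (auto simp: symp_def l2_rel_def elim: AE_mp)
  show "transp (l2_rel :: ('a \<Rightarrow> real) \<Rightarrow> _)"
    by (auto simp: transp_def l2_rel_def elim: AE_mp)
qed

instantiation l2 :: (euclidean_space) real_inner
begin

lift_definition zero_l2 :: "'a l2" is "\<lambda>x. 0"
  by (simp add: l2_rel_def sq_integrable_zero)

lift_definition plus_l2 :: "'a l2 \<Rightarrow> 'a l2 \<Rightarrow> 'a l2" is "\<lambda>f g x. f x + g x"
  by (auto simp: l2_rel_def intro: sq_integrable_add elim: AE_mp)

lift_definition minus_l2 :: "'a l2 \<Rightarrow> 'a l2 \<Rightarrow> 'a l2" is "\<lambda>f g x. f x - g x"
  by (auto simp: l2_rel_def intro: sq_integrable_diff elim: AE_mp)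

lift_definition uminus_l2 :: "'a l2 \<Rightarrow> 'a l2" is "\<lambda>f x. - f x"
  by (auto simp: l2_rel_def intro: sq_integrable_uminus elim: AE_mp)

lift_definition scaleR_l2 :: "real \<Rightarrow> 'a l2 \<Rightarrow> 'a l2" is "\<lambda>c f x. c * f x"
  by (auto simp: l2_rel_def intro: sq_integrable_scale elim: AE_mp)

lift_definition inner_l2 :: "'a l2 \<Rightarrow> 'a l2 \<Rightarrow> real"
  is "\<lambda>f g. integral\<^sup>L lebesgue (\<lambda>x. f x * g x)"
  by (rule integral_cong_AE) (auto simp: l2_rel_def sq_integrable_def elim: AE_mp)

definition norm_l2 :: "'a l2 \<Rightarrow> real" where
  "norm_l2 v = sqrt (inner v v)"

definition sgn_l2 :: "'a l2 \<Rightarrow> 'a l2" where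
  "sgn_l2 v = inverse (norm v) *\<^sub>R v"

definition dist_l2 :: "'a l2 \<Rightarrow> 'a l2 \<Rightarrow> real" where
  "dist_l2 v w = norm (v - w)"

definition uniformity_l2 :: "('a l2 \<times> 'a l2) filter" where
  "uniformity_l2 = (INF e\<in>{0<..}. principal {(v, w). dist v w < e})"

definition open_l2 :: "'a l2 set \<Rightarrow> bool" where
  "open_l2 U \<longleftrightarrow> (\<forall>v\<in>U. \<forall>\<^sub>F (v', w) in uniformity. v' = v \<longrightarrow> w \<in> U)"

instance
proof
  fix u v w :: "'a l2" and a b :: real
  show "u + v + w = u + (v + w)"
    by transfer (auto simp: l2_rel_def add.assoc intro: sq_integrable_add)
  show "u + v = v + u"
    by transfer (auto simp: l2_rel_def add.commute intro: sq_integrable_add)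
  show "0 + u = u"
    by transfer (auto simp: l2_rel_def)
  show "- u + u = 0"
    by transfer (auto simp: l2_rel_def sq_integrable_zero)
  show "u - v = u + - v"
    by transfer (auto simp: l2_rel_def intro: sq_integrable_diff)
  show "a *\<^sub>R (u + v) = a *\<^sub>R u + a *\<^sub>R v"
    by transfer (auto simp: l2_rel_def distrib_left intro!: sq_integrable_add sq_integrable_scale)
  show "(a + b) *\<^sub>R u = a *\<^sub>R u + b *\<^sub>R u"
    by transfer (auto simp: l2_rel_def distrib_right intro!: sq_integrable_add sq_integrable_scale)
  show "a *\<^sub>R b *\<^sub>R u = (a * b) *\<^sub>R u"
    by transfer (auto simp: l2_rel_def mult.assoc[symmetric] intro!: sq_integrable_scale)
  show "1 *\<^sub>R u = u"
    by transfer (auto simp: l2_rel_def)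
  show "dist u v = norm (u - v)"
    by (rule dist_l2_def)
  show "sgn u = inverse (norm u) *\<^sub>R u"
    by (rule sgn_l2_def)
  show "uniformity = (INF e\<in>{0<..}. principal {(v::'a l2, w). dist v w < e})"
    by (rule uniformity_l2_def)
  show "open U \<longleftrightarrow> (\<forall>v\<in>U. \<forall>\<^sub>F (v', w) in uniformity. v' = v \<longrightarrow> w \<in> U)" for U :: "'a l2 set"
    by (rule open_l2_def)
  show "inner u v = inner v u"
    by transfer (simp add: mult.commute)
  show "inner (u + v) w = inner u w + inner v w"
    by transfer (simp add: l2_rel_refl_iff sq_integrable_mult distrib_right)
  show "inner (a *\<^sub>R u) v = a * inner u v"
    by transfer (simp add: mult.assoc)
  show "0 \<le> inner u u"
    by transfer simp
  show "inner u u = 0 \<longleftrightarrow> u = 0"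
    by transfer (auto simp: l2_rel_def sq_integrable_zero sq_integrable_def
        power2_eq_square integral_nonneg_eq_0_iff_AE)
  show "norm u = sqrt (inner u u)"
    by (rule norm_l2_def)
qed

end

abbreviation l2_of :: "('a::euclidean_space \<Rightarrow> real) \<Rightarrow> 'a l2" where
  "l2_of \<equiv> abs_l2"

lemma inner_l2_of:
  "sq_integrable f \<Longrightarrow> sq_integrable g \<Longrightarrow>
     inner (l2_of f) (l2_of g) = integral\<^sup>L lebesgue (\<lambda>x. f x * g x)"
  by (simp add: inner_l2.abs_eq l2_rel_refl_iff)

lemma norm_l2_of:
  "sq_integrable f \<Longrightarrow> norm (l2_of f) = sqrt (integral\<^sup>L lebesgue (\<lambda>x. (f x)\<^sup>2))"
  by (simp add: norm_l2_def inner_l2_of power2_eq_square)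

text \<open>\<open>L\<^sup>2(\<Omega>)\<close> is identified, by zero extension, with the closed subspace of
  \<open>L\<^sup>2(\<real>\<^sup>d)\<close> of the classes that vanish almost everywhere outside \<open>\<Omega>\<close>.\<close>

lift_definition vanishes_outside :: "'a::euclidean_space set \<Rightarrow> 'a l2 \<Rightarrow> bool"
  is "\<lambda>\<Omega> f. AE x in lebesgue. x \<notin> \<Omega> \<longrightarrow> f x = 0"
  by (auto simp: l2_rel_def elim: AE_mp)

definition L2 :: "'a::euclidean_space set \<Rightarrow> 'a l2 set" where
  "L2 \<Omega> = {v. vanishes_outside \<Omega> v}"

definition C_L2 :: "real \<Rightarrow> 'a::euclidean_space set \<Rightarrow> (real \<Rightarrow> 'a l2) set" where
  "C_L2 T \<Omega> = {u. continuous_on {0..T} u \<and> (\<forall>t\<in>{0..T}. u t \<in> L2 \<Omega>)}"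

definition C_L2_norm :: "real \<Rightarrow> (real \<Rightarrow> 'a::euclidean_space l2) \<Rightarrow> real" where
  "C_L2_norm T u = (SUP t\<in>{0..T}. norm (u t))"

definition partial :: "'a::euclidean_space \<Rightarrow> ('a \<Rightarrow> real) \<Rightarrow> 'a \<Rightarrow> real" where
  "partial b f x = frechet_derivative f (at x) b"

text \<open>Only meant for open \<open>U\<close>: the derivatives are two-sided.\<close>

primrec Ck_on :: "nat \<Rightarrow> ('a::euclidean_space \<Rightarrow> real) \<Rightarrow> 'a set \<Rightarrow> bool" where
  "Ck_on 0 f U \<longleftrightarrow> continuous_on U f"
| "Ck_on (Suc k) f U \<longleftrightarrow>
     (\<forall>x\<in>U. f differentiable (at x)) \<and> (\<forall>b\<in>Basis. Ck_on k (partial b f) U)"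

definition smooth_on :: "('a::euclidean_space \<Rightarrow> real) \<Rightarrow> 'a set \<Rightarrow> bool" where
  "smooth_on f U \<longleftrightarrow> (\<forall>k. Ck_on k f U)"

text \<open>Near every boundary point \<open>p\<close> the domain is the intersection of finitely many smooth
  sublevel sets whose boundary hypersurfaces all pass through \<open>p\<close>. The common descent direction
  \<open>v\<close> makes the gradients at \<open>p\<close> nonzero and makes the tangent cone
  \<open>{w. \<forall>h\<in>H. h'(p) w \<le> 0}\<close> a convex polyhedral cone with nonempty interior: a half-space at a
  smooth point of the boundary, and a convex, non-cuspidal corner (or edge) elsewhere.\<close>

definition piecewise_smooth_convex_corners :: "'a::euclidean_space set \<Rightarrow> bool" where
  "piecewise_smooth_convex_corners \<Omega> \<longleftrightarrow>
     (\<forall>p\<in>frontier \<Omega>. \<exists>U H.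
        open U \<and> p \<in> U \<and> finite H \<and> H \<noteq> {} \<and>
        (\<forall>h\<in>H. smooth_on h U \<and> h p = 0) \<and>
        \<Omega> \<inter> U = {x\<in>U. \<forall>h\<in>H. h x < 0} \<and>
        (\<exists>v. \<forall>h\<in>H. frechet_derivative h (at p) v < 0))"

definition test_functions :: "'a::euclidean_space set \<Rightarrow> ('a \<Rightarrow> real) set" where
  "test_functions \<Omega> =
     {\<phi>. smooth_on \<phi> UNIV \<and> compact (closure {x. \<phi> x \<noteq> 0}) \<and> closure {x. \<phi> x \<noteq> 0} \<subseteq> \<Omega>}"

text \<open>\<open>v\<close> belongs to \<open>H\<^sup>1\<^sub>0(\<Omega>)\<close>, the closure of the test functions in the \<open>H\<^sup>1\<close> norm, and
  \<open>G\<close> is its weak gradient, given by its components along \<open>Basis\<close>.\<close>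

definition has_H10_gradient ::
    "'a::euclidean_space set \<Rightarrow> 'a l2 \<Rightarrow> ('a \<Rightarrow> 'a l2) \<Rightarrow> bool" where
  "has_H10_gradient \<Omega> v G \<longleftrightarrow>
     (\<exists>\<phi>. (\<forall>n. \<phi> n \<in> test_functions \<Omega>) \<and>
          (\<lambda>n. l2_of (\<phi> n)) \<longlonglongrightarrow> v \<and>
          (\<forall>b\<in>Basis. (\<lambda>n. l2_of (partial b (\<phi> n))) \<longlonglongrightarrow> G b))"

text \<open>\<open>v\<close> lies in the domain of the Dirichlet Laplacian \<open>A\<close> and \<open>A v = w\<close>, i.e.
  \<open>v \<in> H\<^sup>1\<^sub>0(\<Omega>)\<close>, \<open>w \<in> L\<^sup>2(\<Omega>)\<close> and \<open>(\<nabla>v, \<nabla>\<psi>) = - (w, \<psi>)\<close> for all test functions \<open>\<psi>\<close>.\<close>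

definition has_dirichlet_laplacian ::
    "'a::euclidean_space set \<Rightarrow> 'a l2 \<Rightarrow> 'a l2 \<Rightarrow> bool" where
  "has_dirichlet_laplacian \<Omega> v w \<longleftrightarrow>
     w \<in> L2 \<Omega> \<and>
     (\<exists>G. has_H10_gradient \<Omega> v G \<and>
          (\<forall>\<psi>\<in>test_functions \<Omega>.
             (\<Sum>b\<in>Basis. inner (G b) (l2_of (partial b \<psi>))) = - inner w (l2_of \<psi>)))"

definition conv :: "(real \<Rightarrow> real) \<Rightarrow> (real \<Rightarrow> 'b::real_normed_vector) \<Rightarrow> real \<Rightarrow> 'b" where
  "conv a u t = integral {0..t} (\<lambda>s. a (t - s) *\<^sub>R u s)"

text \<open>For \<open>t > 0\<close>. The convention \<open>0 powr x = 0\<close> makes the value at \<open>t = 0\<close> zero, also for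
  \<open>\<mu> = 1\<close>; this single point does not affect any convolution.\<close>

definition beta_kernel :: "real \<Rightarrow> real \<Rightarrow> real" where
  "beta_kernel \<mu> t = t powr (\<mu> - 1) / Gamma \<mu>"

definition vo_kernel :: "(real \<Rightarrow> real) \<Rightarrow> real \<Rightarrow> real" where
  "vo_kernel \<alpha> t = t powr (1 - \<alpha> t) / Gamma (2 - \<alpha> t)"

definition gen_identity :: "(real \<Rightarrow> real) \<Rightarrow> real \<Rightarrow> real" where
  "gen_identity \<alpha> t =
     (if t = 0 then 1 else conv (beta_kernel (\<alpha> 0 - 1)) (vo_kernel \<alpha>) t)"

text \<open>In \<open>conv (deriv (gen_identity \<alpha>))\<close> below, the value of \<open>deriv\<close> at the end points of
  \<open>[0, t]\<close> is irrelevant; at the interior points it depends on \<open>\<alpha>\<close> on \<open>[0, T]\<close> only.\<close>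

definition mild_rhs ::
    "(real \<Rightarrow> real) \<Rightarrow> (real \<Rightarrow> 'a::euclidean_space l2) \<Rightarrow> 'a l2 \<Rightarrow> 'a l2 \<Rightarrow>
     (real \<Rightarrow> 'a l2) \<Rightarrow> real \<Rightarrow> 'a l2" where
  "mild_rhs \<alpha> f u0 u1 u t =
     conv (beta_kernel (\<alpha> 0)) f t
     - conv (deriv (gen_identity \<alpha>)) (\<lambda>s. u s - u0) t
     + conv (beta_kernel 1) (gen_identity \<alpha>) t *\<^sub>R u1"

definition mild_solution ::
    "real \<Rightarrow> real \<Rightarrow> 'a::euclidean_space set \<Rightarrow> (real \<Rightarrow> real) \<Rightarrow> (real \<Rightarrow> 'a l2) \<Rightarrow>
     'a l2 \<Rightarrow> 'a l2 \<Rightarrow> (real \<Rightarrow> 'a l2) \<Rightarrow> bool" where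
  "mild_solution T \<kappa> \<Omega> \<alpha> f u0 u1 u \<longleftrightarrow>
     u \<in> C_L2 T \<Omega> \<and>
     (\<forall>t\<in>{0..T}. \<exists>w.
        has_dirichlet_laplacian \<Omega> (conv (beta_kernel (\<alpha> 0)) u t) w \<and>
        u t - u0 - \<kappa> *\<^sub>R w = mild_rhs \<alpha> f u0 u1 u t)"

end

theory Submission
  imports Defs
begin

text \<open>
  Let \<open>B\<close> be the inverse of the negative Dirichlet Laplacian on \<open>L\<^sup>2(\<Omega>)\<close>, obtained by minimizing the
  Dirichlet energy; no spectral decomposition is used. Applying \<open>B\<close>, the mild formulation becomes
  \<open>B (u - u0 - P\<^sub>u) + \<kappa> \<beta>\<^bsub>\<alpha>(0)\<^esub> * u = 0\<close>. Since \<open>g = \<beta>\<^bsub>\<alpha>(0)-1\<^esub> * k\<close>, deconvolution turns it into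
  \<open>B D + \<kappa> u = B f\<close> with \<open>k * v = \<beta>\<^sub>1 * D\<close> and \<open>u = u0 + t u1 + \<beta>\<^sub>1 * v\<close>.

  The kernel \<open>k\<close> is positive, tends to infinity at \<open>0\<close>, and \<open>k'\<close> is bounded above. Testing the equation
  with \<open>v\<close> therefore gives an energy inequality for \<open>\<langle>B v, v\<rangle>\<close> and \<open>\<parallel>u\<parallel>\<^sup>2\<close>: the part of \<open>k\<close> near \<open>0\<close>
  is so large that a Gronwall argument with a short delay closes. The resulting bound on \<open>\<parallel>u\<parallel>\<close> holds, with
  the same constant, for every positive operator in place of \<open>B\<close>; for \<open>B\<close> itself it yields uniqueness.

  For \<open>B + \<epsilon>\<close> the problem is a Volterra equation of the second kind, hence solvable. The uniform bound,
  together with \<open>(B (B + \<eta>)\<^sup>-\<^sup>1)\<^sup>2 x \<longlonglongrightarrow> x\<close>, makes these solutions a Cauchy sequence in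
  \<open>C([0,T]; L\<^sup>2(\<Omega>))\<close> as \<open>\<epsilon>\<close> tends to \<open>0\<close>, and their limit is the mild solution.
\<close>

section \<open>Convolution with weakly singular kernels\<close>

text \<open>The variable exponent may destroy monotonicity of \<open>k\<close>. What survives is the
  one-sided bound on \<open>k'\<close>: its leading term, a negative multiple of
  \<open>s powr (- \<alpha> 0)\<close>, outweighs the perturbation. The error this bound leaves
  contains the time integral of \<open><C v, v>\<close>, whereas the left side controls only its
  convolution with \<open>k\<close>; hence the delay in the Gronwall argument. The constant is the
  same for all operators because data \<open>G\<close> are measured by the least \<open>m\<close>
  with \<open><G, x> <= m * sqrt <C x, x>\<close>, and data \<open>B y\<close> have
  \<open>m <= sqrt K * norm y\<close> for every shift of \<open>B\<close>. Solutions for two shifts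
  differ by a datum \<open>(e m - e n) D\<close>, where only \<open>B D\<close> is bounded
  uniformly. Therefore the truncation is squared: one factor \<open>B\<close> turns \<open>D\<close>
  into \<open>B D\<close>, the other gives the datum the form \<open>B y\<close>. Convolutions are
  gauge integrals with values in a Banach space; Fubini is reached by pairing with vectors.\<close>

text \<open>Values lie in a Banach space without any countability assumption, so integrability is
  derived from the Cauchy criterion for gauge integrals: on a fine division the Riemann sums of
  \<open>f\<close> and \<open>g\<close> differ by at most \<open>e\<close> times a Riemann sum of
  \<open>h\<close>. The weight is needed because the approximation errors get multiplied by an
  unbounded kernel.\<close>

lemma integrable_weighted_approx:
  fixes f :: "'n::euclidean_space \<Rightarrow> 'b::banach" and h :: "'n \<Rightarrow> real"
  assumes approx: "\<And>e. e > 0 \<Longrightarrow> \<exists>g. g integrable_on cbox a b \<and> (\<forall>x\<in>cbox a b. norm (f x - g x) \<le> e * h x)"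
    and h: "h integrable_on cbox a b" "\<And>x. x \<in> cbox a b \<Longrightarrow> 0 \<le> h x"
  shows "f integrable_on cbox a b"
  unfolding integrable_Cauchy
proof (intro allI impI)
  fix e :: real assume e: "e > 0"
  define I where "I = integral (cbox a b) h"
  have I0: "I \<ge> 0" unfolding I_def by (rule integral_nonneg[OF h])
  \<comment> \<open>The gauge \<open>\<gamma>2\<close> keeps the Riemann sums of \<open>h\<close>
    below \<open>I + 1\<close>, so each of the two passages between \<open>f\<close> and
    \<open>g\<close> costs at most \<open>e / 4\<close>.\<close>
  define d where "d = e / (4 * (I + 1))"
  have d: "d > 0" using e I0 by (simp add: d_def)
  obtain g where g: "g integrable_on cbox a b" "\<And>x. x \<in> cbox a b \<Longrightarrow> norm (f x - g x) \<le> d * h x"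
    using approx[OF d] by blast
  obtain \<gamma>1 where \<gamma>1: "gauge \<gamma>1"
    "\<And>D1 D2. D1 tagged_division_of cbox a b \<and> \<gamma>1 fine D1 \<and> D2 tagged_division_of cbox a b \<and> \<gamma>1 fine D2 \<Longrightarrow>
      norm ((\<Sum>(x,K)\<in>D1. Henstock_Kurzweil_Integration.content K *\<^sub>R g x) - (\<Sum>(x,K)\<in>D2. Henstock_Kurzweil_Integration.content K *\<^sub>R g x)) < e / 2"
    using g(1) e unfolding integrable_Cauchy by (meson half_gt_zero)
  have "(h has_integral I) (cbox a b)" using h(1) by (simp add: I_def integrable_integral)
  then obtain \<gamma>2 where \<gamma>2: "gauge \<gamma>2"
    "\<And>D. D tagged_division_of cbox a b \<and> \<gamma>2 fine D \<Longrightarrow> norm ((\<Sum>(x,K)\<in>D. Henstock_Kurzweil_Integration.content K *\<^sub>R h x) - I) < 1"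
    unfolding has_integral by (meson zero_less_one)
  have close: "norm ((\<Sum>(x,K)\<in>D. Henstock_Kurzweil_Integration.content K *\<^sub>R f x) - (\<Sum>(x,K)\<in>D. Henstock_Kurzweil_Integration.content K *\<^sub>R g x)) \<le> e / 4"
    if D: "D tagged_division_of cbox a b" "\<gamma>2 fine D" for D
  proof -
    have "(\<Sum>(x,K)\<in>D. Henstock_Kurzweil_Integration.content K *\<^sub>R f x) - (\<Sum>(x,K)\<in>D. Henstock_Kurzweil_Integration.content K *\<^sub>R g x) = (\<Sum>(x,K)\<in>D. Henstock_Kurzweil_Integration.content K *\<^sub>R (f x - g x))"
      unfolding sum_subtractf[symmetric] by (rule sum.cong) (auto simp: algebra_simps)
    also have "norm \<dots> \<le> (\<Sum>(x,K)\<in>D. d * (Henstock_Kurzweil_Integration.content K *\<^sub>R h x))"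
    proof (rule sum_norm_le)
      fix p assume p: "p \<in> D"
      obtain x K where xK: "p = (x, K)" by force
      have "x \<in> cbox a b" using D(1) p unfolding xK by (meson tagged_division_ofD(2) tagged_division_ofD(3) subsetD)
      then have "Henstock_Kurzweil_Integration.content K * norm (f x - g x) \<le> Henstock_Kurzweil_Integration.content K * (d * h x)"
        by (intro mult_left_mono g(2)) auto
      then show "norm (case p of (x, K) \<Rightarrow> Henstock_Kurzweil_Integration.content K *\<^sub>R (f x - g x)) \<le> (case p of (x, K) \<Rightarrow> d * (Henstock_Kurzweil_Integration.content K *\<^sub>R h x))"
        by (simp add: xK scaleR_diff_right[symmetric] mult.left_commute)
    qed
    also have "\<dots> = d * (\<Sum>(x,K)\<in>D. Henstock_Kurzweil_Integration.content K *\<^sub>R h x)"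
      unfolding sum_distrib_left by (rule sum.cong) auto
    also have "\<dots> \<le> d * (I + 1)"
    proof (rule mult_left_mono)
      show "(\<Sum>(x,K)\<in>D. Henstock_Kurzweil_Integration.content K *\<^sub>R h x) \<le> I + 1"
        using \<gamma>2(2)[of D] D by (simp add: abs_less_iff)
    qed (use d in simp)
    also have "\<dots> = e / 4" using I0 by (simp add: d_def field_simps)
    finally show ?thesis .
  qed
  show "\<exists>\<gamma>. gauge \<gamma> \<and>
          (\<forall>D1 D2. D1 tagged_division_of cbox a b \<and> \<gamma> fine D1 \<and> D2 tagged_division_of cbox a b \<and> \<gamma> fine D2 \<longrightarrow>
            norm ((\<Sum>(x,K)\<in>D1. Henstock_Kurzweil_Integration.content K *\<^sub>R f x) - (\<Sum>(x,K)\<in>D2. Henstock_Kurzweil_Integration.content K *\<^sub>R f x)) < e)"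
  proof (intro exI[of _ "\<lambda>x. \<gamma>1 x \<inter> \<gamma>2 x"] conjI allI impI)
    show "gauge (\<lambda>x. \<gamma>1 x \<inter> \<gamma>2 x)" using \<gamma>1(1) \<gamma>2(1) by (rule gauge_Int)
    fix D1 D2 assume H: "D1 tagged_division_of cbox a b \<and> (\<lambda>x. \<gamma>1 x \<inter> \<gamma>2 x) fine D1 \<and> D2 tagged_division_of cbox a b \<and> (\<lambda>x. \<gamma>1 x \<inter> \<gamma>2 x) fine D2"
    then have F: "\<gamma>1 fine D1" "\<gamma>2 fine D1" "\<gamma>1 fine D2" "\<gamma>2 fine D2" by (auto simp: fine_Int)
    let ?s = "\<lambda>D f. (\<Sum>(x,K)\<in>D. Henstock_Kurzweil_Integration.content K *\<^sub>R f x)"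
    have 1: "norm (?s D1 f - ?s D1 g) \<le> e/4" using close H F by blast
    have 2: "norm (?s D2 f - ?s D2 g) \<le> e/4" using close H F by blast
    have 3: "norm (?s D1 g - ?s D2 g) < e/2" using \<gamma>1(2) H F by presburger
    have "norm (?s D1 f - ?s D2 f) = norm ((?s D1 f - ?s D1 g) - (?s D2 f - ?s D2 g) + (?s D1 g - ?s D2 g))" by (simp add: algebra_simps)
    also have "\<dots> \<le> norm ((?s D1 f - ?s D1 g) - (?s D2 f - ?s D2 g)) + norm (?s D1 g - ?s D2 g)" by (rule norm_triangle_ineq)
    also have "\<dots> \<le> norm (?s D1 f - ?s D1 g) + norm (?s D2 f - ?s D2 g) + norm (?s D1 g - ?s D2 g)"
      using norm_triangle_ineq4 by (intro add_right_mono)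
    also have "\<dots> < e" using 1 2 3 by linarith
    finally show "norm (?s D1 f - ?s D2 f) < e" .
  qed
qed

lemma absolutely_integrable_realD:
  fixes a :: "real \<Rightarrow> real"
  assumes "a absolutely_integrable_on S"
  shows "a integrable_on S" "(\<lambda>x. \<bar>a x\<bar>) integrable_on S"
  using assms by (auto simp: absolutely_integrable_on_def)

text \<open>Bolzano bisection builds \<open>a\<close> times a step function: locally
  \<open>u\<close> is replaced by the constant \<open>u x\<close>, with an error of at most
  \<open>e * |a s|\<close>, which is the weighted closeness of the previous criterion.\<close>

lemma integrable_scaleR_continuous:
  fixes u :: "real \<Rightarrow> 'b::banach"
  assumes a: "a absolutely_integrable_on {c..d}" and u: "continuous_on {c..d} u"
  shows "(\<lambda>s. a s *\<^sub>R u s) integrable_on {c..d}"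
proof (cases "c \<le> d")
  case True
  have ai: "a integrable_on {c..d}" "(\<lambda>x. \<bar>a x\<bar>) integrable_on {c..d}"
    using absolutely_integrable_realD[OF a] by auto
  have "(\<lambda>s. a s *\<^sub>R u s) integrable_on cbox c d"
  proof (rule integrable_weighted_approx[where h = "\<lambda>x. \<bar>a x\<bar>"])
    fix e :: real assume e: "e > 0"
    define P where "P = (\<lambda>x y. c \<le> x \<and> y \<le> d \<longrightarrow> (\<exists>g. g integrable_on {x..y} \<and> (\<forall>s\<in>{x..y}. norm (a s *\<^sub>R u s - g s) \<le> e * \<bar>a s\<bar>)))"
    have "P c d" using True
    proof (induct rule: Bolzano)
      case (trans x y z)
      show ?case unfolding P_def
      proof
        assume xz: "c \<le> x \<and> z \<le> d"
        obtain g1 where g1: "g1 integrable_on {x..y}" "\<forall>s\<in>{x..y}. norm (a s *\<^sub>R u s - g1 s) \<le> e * \<bar>a s\<bar>"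
          using trans xz unfolding P_def by force
        obtain g2 where g2: "g2 integrable_on {y..z}" "\<forall>s\<in>{y..z}. norm (a s *\<^sub>R u s - g2 s) \<le> e * \<bar>a s\<bar>"
          using trans xz unfolding P_def by force
        let ?g = "\<lambda>s. if s \<le> y then g1 s else g2 s"
        have "?g integrable_on {x..z}"
        proof (rule Henstock_Kurzweil_Integration.integrable_combine[where c = y])
          show "?g integrable_on {x..y}" using g1(1) by (rule integrable_eq) auto
          show "?g integrable_on {y..z}" by (rule integrable_spike_finite[OF _ _ g2(1), of "{y}"]) auto
        qed (use trans in auto)
        moreover have "\<forall>s\<in>{x..z}. norm (a s *\<^sub>R u s - ?g s) \<le> e * \<bar>a s\<bar>" using g1(2) g2(2) by auto
        ultimately show "\<exists>g. g integrable_on {x..z} \<and> (\<forall>s\<in>{x..z}. norm (a s *\<^sub>R u s - g s) \<le> e * \<bar>a s\<bar>)" by blast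
      qed
    next
      case (local x)
      obtain r where r: "r > 0" "\<And>s. s \<in> {c..d} \<Longrightarrow> dist s x < r \<Longrightarrow> dist (u s) (u x) < e"
        using u local e unfolding continuous_on_iff by (meson atLeastAtMost_iff)
      show ?case
      proof (intro exI[of _ r] conjI allI impI r(1))
        fix p q assume pq: "p \<le> x \<and> x \<le> q \<and> q - p < r"
        show "P p q" unfolding P_def
        proof
          assume cd: "c \<le> p \<and> q \<le> d"
          have "(\<lambda>s. a s *\<^sub>R u x) integrable_on {p..q}"
            using integrable_on_scaleR_left[OF integrable_on_subinterval[OF ai(1)], of p q] cd by auto
          moreover have "norm (a s *\<^sub>R u s - a s *\<^sub>R u x) \<le> e * \<bar>a s\<bar>" if "s \<in> {p..q}" for s
          proof -
            have "s \<in> {c..d}" "dist s x < r" using that pq cd by (auto simp: dist_real_def)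
            then have "norm (u s - u x) \<le> e" using r(2)[of s] by (simp add: dist_norm)
            then show ?thesis unfolding scaleR_diff_right[symmetric] norm_scaleR
              by (metis abs_ge_zero mult.commute mult_left_mono)
          qed
          ultimately show "\<exists>g. g integrable_on {p..q} \<and> (\<forall>s\<in>{p..q}. norm (a s *\<^sub>R u s - g s) \<le> e * \<bar>a s\<bar>)" by blast
        qed
      qed
    qed
    then show "\<exists>g. g integrable_on cbox c d \<and> (\<forall>x\<in>cbox c d. norm (a x *\<^sub>R u x - g x) \<le> e * \<bar>a x\<bar>)"
      unfolding P_def by simp
  qed (use ai in auto)
  then show ?thesis by simp
qed auto

section \<open>Reflection, linearity, bounds and continuity of convolutions\<close>

lemma has_integral_reflect_shift:
  fixes f :: "real \<Rightarrow> 'b::banach"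
  assumes "(f has_integral I) {a..b}"
  shows "((\<lambda>s. f (t - s)) has_integral I) {t-b..t-a}"
proof -
  have "(\<lambda>x. (1 / (-1)) *\<^sub>R x + - ((1 / (-1)) *\<^sub>R t)) ` cbox a b = {t-b..t-a}"
  proof -
    have "x \<in> (\<lambda>x. t - x) ` cbox a b" if "x \<in> {t-b..t-a}" for x
      using that by (intro image_eqI[of _ _ "t - x"]) auto
    then show ?thesis by auto
  qed
  then show ?thesis
    using has_integral_affinity[of f I a b "-1" t] assms by simp
qed

text \<open>No integrability is assumed: reflection preserves non-integrability, and then both sides
  are the default value \<open>0\<close>.\<close>

lemma integral_reflect_shift:
  fixes f :: "real \<Rightarrow> 'b::banach"
  shows "integral {0..t} (\<lambda>s. f (t - s)) = integral {0..t} f"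
proof (cases "f integrable_on {0..t}")
  case True
  then show ?thesis
    using has_integral_reflect_shift[of f "integral {0..t} f" 0 t t] by (auto simp: integrable_integral)
next
  case False
  moreover have "\<not> (\<lambda>s. f (t - s)) integrable_on {0..t}"
  proof
    assume "(\<lambda>s. f (t - s)) integrable_on {0..t}"
    then have "(\<lambda>s. f (t - (t - s))) integrable_on {t-t..t-0}"
      unfolding integrable_on_def using has_integral_reflect_shift[of "\<lambda>s. f (t - s)" _ 0 t t] by blast
    then show False using False by simp
  qed
  ultimately show ?thesis by (simp add: not_integrable_integral)
qed

lemma conv_commute:
  fixes u :: "real \<Rightarrow> 'b::banach"
  shows "conv a u t = integral {0..t} (\<lambda>s. a s *\<^sub>R u (t - s))"
  unfolding conv_def using integral_reflect_shift[of t "\<lambda>s. a s *\<^sub>R u (t - s)"] by simp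

lemma conv_commute_real: "conv a b t = conv b a (t::real)" for a b :: "real \<Rightarrow> real"
  by (subst conv_commute) (simp add: conv_def mult.commute)

text \<open>Singularities are allowed at both end points but nowhere inside. The class contains
  every \<open>beta_kernel \<mu>\<close> with \<open>\<mu> > 0\<close> and is stable under
  \<open>conv\<close> (\<open>kern_conv\<close>); interior continuity is what makes the product of
  two oppositely oriented singular kernels integrable.\<close>

definition kern :: "real \<Rightarrow> (real \<Rightarrow> real) \<Rightarrow> bool" where
  "kern T a \<longleftrightarrow> continuous_on {0<..<T} a \<and> a absolutely_integrable_on {0..T}"

lemma kern_subinterval: "kern T a \<Longrightarrow> t \<le> T \<Longrightarrow> kern t a"
  unfolding kern_def by (auto intro: continuous_on_subset absolutely_integrable_on_subinterval)

lemma kern_reflect: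
  assumes "kern T a" "t \<le> T"
  shows "(\<lambda>s. a (t - s)) absolutely_integrable_on {0..t}"
proof -
  have "a absolutely_integrable_on {0..t}" using kern_subinterval[OF assms] by (simp add: kern_def)
  then have "a integrable_on {0..t}" "(\<lambda>x. norm (a x)) integrable_on {0..t}"
    using absolutely_integrable_realD by auto
  then have "(\<lambda>s. a (t - s)) integrable_on {0..t}" "(\<lambda>s. norm (a (t - s))) integrable_on {0..t}"
    unfolding integrable_on_def
    using has_integral_reflect_shift[of a _ 0 t t] has_integral_reflect_shift[of "\<lambda>x. norm (a x)" _ 0 t t] by auto
  then show ?thesis by (simp add: absolutely_integrable_on_def)
qed

lemma conv_integrable:
  fixes u :: "real \<Rightarrow> 'b::banach"
  assumes "kern T a" "t \<le> T" "continuous_on {0..t} u"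
  shows "(\<lambda>s. a (t - s) *\<^sub>R u s) integrable_on {0..t}"
  using integrable_scaleR_continuous[OF kern_reflect[OF assms(1,2)] assms(3)] .

lemma conv_integrable':
  fixes u :: "real \<Rightarrow> 'b::banach"
  assumes "kern T a" "t \<le> T" "continuous_on {0..t} u"
  shows "(\<lambda>s. a s *\<^sub>R u (t - s)) integrable_on {0..t}"
proof (rule integrable_scaleR_continuous)
  show "a absolutely_integrable_on {0..t}" using kern_subinterval[OF assms(1,2)] by (simp add: kern_def)
  show "continuous_on {0..t} (\<lambda>s. u (t - s))"
    by (rule continuous_on_compose2[OF assms(3)]) (auto intro!: continuous_intros)
qed

lemma conv_0 [simp]: "conv a u 0 = 0"
  by (simp add: conv_def)

lemma conv_cong: "(\<And>s. 0 \<le> s \<Longrightarrow> s \<le> t \<Longrightarrow> u s = w s) \<Longrightarrow> conv a u t = conv a w t"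
  unfolding conv_def by (rule integral_cong) auto

lemma conv_cong_left:
  assumes "\<And>s. 0 < s \<Longrightarrow> s < t \<Longrightarrow> a s = b s"
  shows "conv a u t = conv b u t"
  unfolding conv_def by (rule integral_spike[of "{0,t}"]) (use assms in auto)

lemma conv_cong_interior:
  assumes "\<And>s. 0 < s \<Longrightarrow> s < t \<Longrightarrow> u s = w s"
  shows "conv a u t = conv a w t"
  unfolding conv_def by (rule integral_spike[of "{0,t}"]) (use assms in auto)

lemma conv_add:
  fixes u w :: "real \<Rightarrow> 'b::banach"
  assumes "kern T a" "t \<le> T" "continuous_on {0..t} u" "continuous_on {0..t} w"
  shows "conv a (\<lambda>s. u s + w s) t = conv a u t + conv a w t"
  unfolding conv_def using conv_integrable[OF assms(1,2,3)] conv_integrable[OF assms(1,2,4)]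
  by (simp add: scaleR_add_right integral_add)

lemma conv_diff:
  fixes u w :: "real \<Rightarrow> 'b::banach"
  assumes "kern T a" "t \<le> T" "continuous_on {0..t} u" "continuous_on {0..t} w"
  shows "conv a (\<lambda>s. u s - w s) t = conv a u t - conv a w t"
  unfolding conv_def using conv_integrable[OF assms(1,2,3)] conv_integrable[OF assms(1,2,4)]
  by (simp add: scaleR_diff_right integral_diff)

lemma conv_linear:
  fixes u :: "real \<Rightarrow> 'b::banach"
  assumes "kern T a" "t \<le> T" "continuous_on {0..t} u" "bounded_linear L"
  shows "conv a (\<lambda>s. L (u s)) t = L (conv a u t)"
proof -
  interpret L: bounded_linear L by fact
  show ?thesis unfolding conv_def
    using integral_linear[OF conv_integrable[OF assms(1-3)] assms(4)] by (simp add: o_def L.scaleR)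
qed

lemma conv_scaleR:
  fixes u :: "real \<Rightarrow> 'b::banach"
  shows "conv a (\<lambda>s. c *\<^sub>R u s) t = c *\<^sub>R conv a u t"
  unfolding conv_def using integral_cmul[of "{0..t}" c "\<lambda>s. a (t - s) *\<^sub>R u s"] by (metis (no_types, lifting) ext scaleR_left_commute)

lemma conv_add_left:
  fixes u :: "real \<Rightarrow> 'b::banach"
  assumes "kern T a" "kern T b" "t \<le> T" "continuous_on {0..t} u"
  shows "conv (\<lambda>s. a s + b s) u t = conv a u t + conv b u t"
  unfolding conv_def using conv_integrable[OF assms(1,3,4)] conv_integrable[OF assms(2,3,4)]
  by (simp add: scaleR_add_left integral_add)

lemma kern_L1_mono:
  assumes "kern T a" "t \<le> T"
  shows "integral {0..t} (\<lambda>s. \<bar>a s\<bar>) \<le> integral {0..T} (\<lambda>s. \<bar>a s\<bar>)"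
proof (cases "0 \<le> t")
  case True
  have "(\<lambda>s. \<bar>a s\<bar>) integrable_on {0..T}" "(\<lambda>s. \<bar>a s\<bar>) integrable_on {0..t}"
    using assms kern_subinterval[OF assms] by (auto intro!: absolutely_integrable_realD(2) simp: kern_def)
  then show ?thesis using assms by (intro integral_subset_le) auto
next
  case False
  then show ?thesis using assms by (simp add: kern_def absolutely_integrable_on_def integral_nonneg)
qed

lemma norm_conv_le:
  fixes u :: "real \<Rightarrow> 'b::banach"
  assumes "kern T a" "t \<le> T" "continuous_on {0..t} u" "\<And>s. 0 \<le> s \<Longrightarrow> s \<le> t \<Longrightarrow> norm (u s) \<le> U" "0 \<le> t"
  shows "norm (conv a u t) \<le> integral {0..T} (\<lambda>s. \<bar>a s\<bar>) * U"
proof -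
  have U: "0 \<le> U" using assms(4)[of 0] assms(5) norm_ge_zero order_trans by blast
  have i: "(\<lambda>s. \<bar>a s\<bar>) integrable_on {0..t}"
    by (metis absolutely_integrable_realD(2) assms(1,2) kern_def kern_subinterval)
  have "norm (conv a u t) \<le> integral {0..t} (\<lambda>s. \<bar>a s\<bar> * U)"
    unfolding conv_commute
  proof (rule Henstock_Kurzweil_Integration.integral_norm_bound_integral[OF conv_integrable'[OF assms(1-3)]])
    show "(\<lambda>s. \<bar>a s\<bar> * U) integrable_on {0..t}" using integrable_on_mult_left[OF i] by simp
    show "norm (a x *\<^sub>R u (t - x)) \<le> \<bar>a x\<bar> * U" if "x \<in> {0..t}" for x
      using assms(4)[of "t - x"] that by (auto intro!: mult_left_mono)
  qed
  also have "\<dots> = integral {0..t} (\<lambda>s. \<bar>a s\<bar>) * U" by simp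
  also have "\<dots> \<le> integral {0..T} (\<lambda>s. \<bar>a s\<bar>) * U"
    by (rule mult_right_mono[OF kern_L1_mono[OF assms(1,2)] U])
  finally show ?thesis .
qed

text \<open>Extending \<open>u\<close> by constants to \<open>w\<close> fixes the domain of
  integration to \<open>{0..T}\<close>: for \<open>s > t\<close> the factor \<open>w (t - s)\<close>
  equals \<open>u 0\<close>, and this contribution is subtracted again. Uniform continuity of
  \<open>w\<close> and the L1 norm of \<open>a\<close> then give continuity in
  \<open>t\<close>.\<close>

lemma conv_continuous:
  fixes u :: "real \<Rightarrow> 'b::banach"
  assumes a: "kern T a" and u: "continuous_on {0..T} u"
  shows "continuous_on {0..T} (conv a u)"
proof (cases "0 \<le> T")
  case T: True
  define w where "w = (\<lambda>x. u (max 0 (min T x)))"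
  have wc: "continuous_on UNIV w" unfolding w_def
    by (rule continuous_on_compose2[OF u]) (use T in \<open>auto intro!: continuous_intros\<close>)
  have aT: "a absolutely_integrable_on {0..T}" using a by (simp add: kern_def)
  have ai: "a integrable_on {0..T}" and absi: "(\<lambda>s. \<bar>a s\<bar>) integrable_on {0..T}"
    using absolutely_integrable_realD[OF aT] by auto
  have wi: "(\<lambda>s. a s *\<^sub>R w (t - s)) integrable_on {0..T}" for t
    by (intro integrable_scaleR_continuous aT continuous_on_compose2[OF wc]) (auto intro!: continuous_intros)
  have eq: "conv a u t = integral {0..T} (\<lambda>s. a s *\<^sub>R w (t - s)) - (integral {0..T} a - integral {0..t} a) *\<^sub>R u 0"
    if t: "t \<in> {0..T}" for t
  proof -
    have "integral {0..T} (\<lambda>s. a s *\<^sub>R w (t - s)) = integral {0..t} (\<lambda>s. a s *\<^sub>R w (t - s)) + integral {t..T} (\<lambda>s. a s *\<^sub>R w (t - s))"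
      using t by (intro Henstock_Kurzweil_Integration.integral_combine[symmetric] wi) auto
    also have "integral {0..t} (\<lambda>s. a s *\<^sub>R w (t - s)) = conv a u t"
      unfolding conv_commute using t by (intro integral_cong) (auto simp: w_def)
    also have "integral {t..T} (\<lambda>s. a s *\<^sub>R w (t - s)) = integral {t..T} (\<lambda>s. a s *\<^sub>R u 0)"
      using t by (intro integral_cong) (auto simp: w_def)
    also have "\<dots> = integral {t..T} a *\<^sub>R u 0"
      by (intro integral_unique has_integral_scaleR_left integrable_integral integrable_on_subinterval[OF ai]) (use t in auto)
    also have "integral {t..T} a = integral {0..T} a - integral {0..t} a"
      using t Henstock_Kurzweil_Integration.integral_combine[of 0 t T a] ai by auto
    finally show ?thesis by simp
  qed
  have c1: "continuous_on {0..T} (\<lambda>t. integral {0..T} (\<lambda>s. a s *\<^sub>R w (t - s)))"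
  proof (rule continuous_onI)
    fix x e assume x: "x \<in> {0..T}" and e: "(e::real) > 0"
    define A where "A = integral {0..T} (\<lambda>s. \<bar>a s\<bar>)"
    have A: "A \<ge> 0" unfolding A_def by (intro integral_nonneg absi) auto
    have uc: "uniformly_continuous_on {-T..T} w"
      by (rule compact_uniformly_continuous) (auto intro: continuous_on_subset[OF wc])
    have e': "e / (A + 1) > 0" using e A by simp
    then obtain d where d: "d > 0" "\<And>x x'. x \<in> {-T..T} \<Longrightarrow> x' \<in> {-T..T} \<Longrightarrow> dist x' x < d \<Longrightarrow> dist (w x') (w x) < e / (A + 1)"
      using uc unfolding uniformly_continuous_on_def by (metis (no_types, lifting))
    show "\<exists>d>0. \<forall>x'\<in>{0..T}. dist x' x < d \<longrightarrow> dist (integral {0..T} (\<lambda>s. a s *\<^sub>R w (x' - s))) (integral {0..T} (\<lambda>s. a s *\<^sub>R w (x - s))) \<le> e"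
    proof (intro exI[of _ d] conjI ballI impI d(1))
      fix y assume y: "y \<in> {0..T}" "dist y x < d"
      have "dist (integral {0..T} (\<lambda>s. a s *\<^sub>R w (y - s))) (integral {0..T} (\<lambda>s. a s *\<^sub>R w (x - s))) = norm (integral {0..T} (\<lambda>s. a s *\<^sub>R w (y - s) - a s *\<^sub>R w (x - s)))"
        unfolding dist_norm by (simp add: integral_diff[OF wi wi])
      also have "\<dots> \<le> integral {0..T} (\<lambda>s. \<bar>a s\<bar> * (e / (A + 1)))"
      proof (rule Henstock_Kurzweil_Integration.integral_norm_bound_integral)
        show "(\<lambda>s. a s *\<^sub>R w (y - s) - a s *\<^sub>R w (x - s)) integrable_on {0..T}" by (intro integrable_diff wi)
        show "(\<lambda>s. \<bar>a s\<bar> * (e / (A + 1))) integrable_on {0..T}" using integrable_on_mult_left[OF absi] by metis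
        show "norm (a s *\<^sub>R w (y - s) - a s *\<^sub>R w (x - s)) \<le> \<bar>a s\<bar> * (e / (A + 1))" if "s \<in> {0..T}" for s
        proof -
          have "dist (w (y - s)) (w (x - s)) < e / (A + 1)"
            using that x y by (intro d(2)) (auto simp: dist_norm)
          then show ?thesis unfolding scaleR_diff_right[symmetric] norm_scaleR
            by (intro mult_left_mono) (auto simp: dist_norm)
        qed
      qed
      also have "\<dots> = A * (e / (A + 1))" by (simp add: A_def)
      also have "\<dots> \<le> e" using A e by (simp add: field_simps)
      finally show "dist (integral {0..T} (\<lambda>s. a s *\<^sub>R w (y - s))) (integral {0..T} (\<lambda>s. a s *\<^sub>R w (x - s))) \<le> e" .
    qed
  qed
  have "continuous_on {0..T} (\<lambda>t. integral {0..T} (\<lambda>s. a s *\<^sub>R w (t - s)) - (integral {0..T} a - integral {0..t} a) *\<^sub>R u 0)"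
    by (intro continuous_intros c1 indefinite_integral_continuous_1 ai)
  then show ?thesis by (rule continuous_on_eq) (simp add: eq)
qed auto

lemma kern_continuous:
  assumes "continuous_on {0..T} w" shows "kern T w"
  unfolding kern_def using assms absolutely_integrable_continuous_real[OF assms] continuous_on_subset[OF assms, of "{0<..<T}"]
  by fastforce

section \<open>Convolution of two singular kernels and associativity\<close>

lemma absolutely_integrable_mult_continuous:
  fixes a c :: "real \<Rightarrow> real"
  assumes "a absolutely_integrable_on {x..y}" "continuous_on {x..y} c"
  shows "(\<lambda>s. a s * c s) absolutely_integrable_on {x..y}"
proof -
  have 1: "(\<lambda>s. a s * c s) integrable_on {x..y}" using integrable_scaleR_continuous[OF assms] by simp
  have "(\<lambda>x. \<bar>a x\<bar>) absolutely_integrable_on {x..y}" using absolutely_integrable_norm[OF assms(1)] by (simp add: o_def)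
  from integrable_scaleR_continuous[OF this continuous_on_rabs[OF assms(2)]]
  have "(\<lambda>s. norm (a s * c s)) integrable_on {x..y}" by (simp add: abs_mult)
  with 1 show ?thesis unfolding absolutely_integrable_on_def by simp
qed

text \<open>The singularities sit at opposite ends: on \<open>{0..t/2}\<close> the reflected factor
  is continuous (here \<open>t < T\<close> matters), and the other half follows by reflection with
  the roles exchanged.\<close>

lemma kern_product_integrable:
  assumes a: "kern T a" and b: "kern T b" and t: "0 < t" "t < T"
  shows "(\<lambda>s. a (t - s) * b s) absolutely_integrable_on {0..t}"
proof -
  have first: "(\<lambda>s. p (t - s) * q s) absolutely_integrable_on {0..t/2}" if "kern T p" "kern T q" for p q
  proof -
    have "q absolutely_integrable_on {0..t/2}" using kern_subinterval[OF that(2), of "t/2"] t by (simp add: kern_def)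
    moreover have "continuous_on {0..t/2} (\<lambda>s. p (t - s))"
      by (rule continuous_on_compose2[of "{0<..<T}" p]) (use that(1) t in \<open>auto simp: kern_def intro!: continuous_intros\<close>)
    ultimately have "(\<lambda>s. q s * p (t - s)) absolutely_integrable_on {0..t/2}" by (rule absolutely_integrable_mult_continuous)
    then show ?thesis by (simp add: mult.commute)
  qed
  have second: "(\<lambda>s. a (t - s) * b s) absolutely_integrable_on {t/2..t}"
  proof -
    have f: "(\<lambda>s. b (t - s) * a s) absolutely_integrable_on {0..t/2}" by (rule first[OF b a])
    then have "(\<lambda>s. b (t - (t - s)) * a (t - s)) integrable_on {t - t/2..t - 0}"
      "(\<lambda>s. norm (b (t - (t - s)) * a (t - s))) integrable_on {t - t/2..t - 0}"
      unfolding absolutely_integrable_on_def integrable_on_def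
      using has_integral_reflect_shift[of "\<lambda>s. b (t - s) * a s" _ 0 "t/2" t]
        has_integral_reflect_shift[of "\<lambda>s. norm (b (t - s) * a s)" _ 0 "t/2" t] by blast+
    then show ?thesis by (simp add: absolutely_integrable_on_def mult.commute)
  qed
  have "{0..t} = {0..t/2} \<union> {t/2..t}" using t by auto
  then show ?thesis using absolutely_integrable_Un[OF first[OF a b] second] by simp
qed

text \<open>Bridge from gauge integrals on \<open>{0..t}\<close> to Lebesgue integrals on the line,
  where translation and Fubini are available. Cutting down to the open interval makes a kernel Borel
  measurable whatever its values at \<open>0\<close> and \<open>T\<close>.\<close>

definition zero_ext :: "real \<Rightarrow> (real \<Rightarrow> real) \<Rightarrow> real \<Rightarrow> real" where
  "zero_ext T a s = (if 0 < s \<and> s < T then a s else 0)"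

lemma zero_ext_measurable: "continuous_on {0<..<T} a \<Longrightarrow> zero_ext T a \<in> borel_measurable borel"
proof -
  assume "continuous_on {0<..<T} a"
  then have "(\<lambda>x. indicator {0<..<T} x *\<^sub>R a x) \<in> borel_measurable borel"
    by (intro borel_measurable_continuous_on_indicator) auto
  also have "(\<lambda>x. indicator {0<..<T} x *\<^sub>R a x) = zero_ext T a" by (auto simp: zero_ext_def fun_eq_iff)
  finally show ?thesis .
qed

lemma zero_ext_lborel:
  assumes "kern T a" shows "integrable lborel (zero_ext T a)"
proof -
  have "set_integrable lebesgue {0<..<T} a"
    using assms unfolding kern_def by (auto intro: set_integrable_subset)
  then have "integrable lebesgue (zero_ext T a)"
    unfolding set_integrable_def by (rule back_subst[of "integrable lebesgue"]) (auto simp: zero_ext_def fun_eq_iff)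
  moreover have "zero_ext T a \<in> borel_measurable lborel" using zero_ext_measurable assms by (simp add: kern_def)
  ultimately show ?thesis using integrable_completion[of "zero_ext T a" lborel] by simp
qed

text \<open>Outside \<open>{0<..<t}\<close> one of the two factors is zero, so the integral over the
  line reduces to the one defining \<open>conv\<close>, up to the end points.\<close>

lemma conv_lborel:
  assumes a: "kern T a" and b: "kern T b" and t: "0 \<le> t" "t \<le> T"
    and i: "(\<lambda>s. a (t - s) * b s) absolutely_integrable_on {0..t}"
  shows "integrable lborel (\<lambda>s. zero_ext T a (t - s) * zero_ext T b s)"
    and "conv a b t = (\<integral>s. zero_ext T a (t - s) * zero_ext T b s \<partial>lborel)"
proof -
  let ?g = "\<lambda>s. zero_ext T a (t - s) * zero_ext T b s"
  note [measurable] = zero_ext_measurable[of T a] zero_ext_measurable[of T b]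
  have ga: "zero_ext T a \<in> borel_measurable borel" "zero_ext T b \<in> borel_measurable borel"
    using a b by (auto simp: kern_def zero_ext_measurable)
  have "(\<lambda>s. t - s) \<in> borel_measurable borel" by simp
  from measurable_compose[OF this ga(1)] ga(2) have m: "?g \<in> borel_measurable lborel" by simp
  have "set_integrable lebesgue {0<..<t} (\<lambda>s. a (t - s) * b s)"
    using i by (rule set_integrable_subset) auto
  then have "integrable lebesgue ?g"
    unfolding set_integrable_def
    by (rule back_subst[of "integrable lebesgue"]) (use t in \<open>auto simp: zero_ext_def fun_eq_iff indicator_def\<close>)
  then show int: "integrable lborel ?g" using integrable_completion[OF m] by simp
  have "(?g has_integral (\<integral>s. ?g s \<partial>lborel)) UNIV" by (rule has_integral_integral_lborel[OF int])
  then have "((\<lambda>s. if s \<in> {0..t} then ?g s else 0) has_integral (\<integral>s. ?g s \<partial>lborel)) UNIV"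
    by (rule has_integral_eq[rotated]) (auto simp: zero_ext_def)
  then have "(?g has_integral (\<integral>s. ?g s \<partial>lborel)) {0..t}"
    by (subst (asm) has_integral_restrict_UNIV)
  then have "((\<lambda>s. a (t - s) * b s) has_integral (\<integral>s. ?g s \<partial>lborel)) {0..t}"
    by (rule has_integral_spike_finite[of "{0,t}", rotated -1]) (use t in \<open>auto simp: zero_ext_def\<close>)
  then show "conv a b t = (\<integral>s. ?g s \<partial>lborel)" unfolding conv_def by (simp add: integral_unique)
qed

text \<open>Integrating the second variable first gives the L1 norm of \<open>B\<close>, independent
  of the first variable by translation invariance. This is the Tonelli argument behind Young's
  inequality.\<close>

lemma product_integrable:
  fixes A B :: "real \<Rightarrow> real"
  assumes A: "integrable lborel A" and B: "integrable lborel B"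
  shows "integrable (lborel \<Otimes>\<^sub>M lborel) (\<lambda>(s, r). A (t - s) * B (s - r))"
    and "integrable (lborel \<Otimes>\<^sub>M lborel) (\<lambda>(s, r). A s * B (r - s))"
proof -
  have [measurable]: "A \<in> borel_measurable borel" "B \<in> borel_measurable borel"
    using A B borel_measurable_integrable by auto
  have Br: "integrable lborel (\<lambda>r. B (s - r))" for s using lborel_integrable_real_affine[OF B, of "-1" s] by simp
  have Brs: "integrable lborel (\<lambda>r. B (r - s))" for s using lborel_integrable_real_affine[OF B, of 1 "-s"] by simp
  have Bn: "integrable lborel (\<lambda>s. norm (B s))" using B by simp
  have e1: "(\<integral>r. \<bar>B (s - r)\<bar> \<partial>lborel) = (\<integral>r. \<bar>B r\<bar> \<partial>lborel)" for s
    using lborel_integral_real_affine[of "-1" "\<lambda>r. \<bar>B r\<bar>" s] by simp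
  have e2: "(\<integral>r. \<bar>B (r - s)\<bar> \<partial>lborel) = (\<integral>r. \<bar>B r\<bar> \<partial>lborel)" for s
    using lborel_integral_real_affine[of 1 "\<lambda>r. \<bar>B r\<bar>" "-s"] by simp
  have Ar: "integrable lborel (\<lambda>r. A (t - r))" using lborel_integrable_real_affine[OF A, of "-1" t] by simp
  show "integrable (lborel \<Otimes>\<^sub>M lborel) (\<lambda>(s, r). A (t - s) * B (s - r))"
  proof (rule lborel_pair.Fubini_integrable)
    show "integrable lborel (\<lambda>x. \<integral>y. norm (case (x, y) of (s, r) \<Rightarrow> A (t - s) * B (s - r)) \<partial>lborel)"
      using Ar by (simp add: abs_mult e1)
    show "AE x in lborel. integrable lborel (\<lambda>y. case (x, y) of (s, r) \<Rightarrow> A (t - s) * B (s - r))"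
      using Br by simp
  qed measurable
  show "integrable (lborel \<Otimes>\<^sub>M lborel) (\<lambda>(s, r). A s * B (r - s))"
  proof (rule lborel_pair.Fubini_integrable)
    show "integrable lborel (\<lambda>x. \<integral>y. norm (case (x, y) of (s, r) \<Rightarrow> A s * B (r - s)) \<partial>lborel)"
      using A by (simp add: abs_mult e2)
    show "AE x in lborel. integrable lborel (\<lambda>y. case (x, y) of (s, r) \<Rightarrow> A s * B (r - s))"
      using Brs by simp
  qed measurable
qed

text \<open>The cutoff \<open>\<theta>\<close> splits each kernel into a part near \<open>0\<close>
  and a part continuous on \<open>{0..T'}\<close>. For \<open>r > 4 * d\<close> the near-near
  convolution vanishes, since two arguments below \<open>2 * d\<close> cannot add up to
  \<open>r\<close>; every remaining term has a continuous factor and falls under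
  \<open>conv_continuous\<close>.\<close>

lemma conv_kern_continuous_at:
  assumes a: "kern T a" and b: "kern T b" and t: "0 < t" "t < T"
  shows "continuous (at t) (conv a b)"
proof -
  define d where "d = t / 8"
  \<comment> \<open>Kernels are continuous only on the open interval, so continuity up to a right
    end point needs one smaller than \<open>T\<close>.\<close>
  define T' where "T' = (t + T) / 2"
  define \<theta> where "\<theta> = (\<lambda>s::real. max 0 (min 1 (2 - s / d)))"
  have d: "d > 0" "4 * d < t" "t < T'" "T' < T" using t by (auto simp: d_def T'_def)
  have \<theta>c: "continuous_on S \<theta>" for S unfolding \<theta>_def using d by (intro continuous_intros) auto
  have \<theta>0: "\<theta> s = 0" if "s \<ge> 2 * d" for s
    using that d by (auto simp: \<theta>_def max_def min_def field_simps)
  have \<theta>1: "\<theta> s = 1" if "s \<le> d" for s using that d by (auto simp: \<theta>_def max_def min_def field_simps)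
  have near: "kern T' (\<lambda>s. p s * \<theta> s)" if "kern T p" for p
    using kern_subinterval[OF that, of T'] d \<theta>c unfolding kern_def
    by (auto intro!: absolutely_integrable_mult_continuous continuous_intros)
  have far: "continuous_on {0..T'} (\<lambda>s. p s * (1 - \<theta> s))" if "kern T p" for p
  proof -
    have "continuous_on ({0..d} \<union> {d..T'}) (\<lambda>s. p s * (1 - \<theta> s))"
    proof (rule continuous_on_closed_Un)
      show "continuous_on {0..d} (\<lambda>s. p s * (1 - \<theta> s))"
        by (rule continuous_on_eq[of _ "\<lambda>_. 0"]) (auto simp: \<theta>1)
      have "continuous_on {d..T'} p"
        using that d unfolding kern_def by (auto elim!: continuous_on_subset)
      then show "continuous_on {d..T'} (\<lambda>s. p s * (1 - \<theta> s))" by (intro continuous_intros \<theta>c)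
    qed auto
    moreover have "{0..d} \<union> {d..T'} = {0..T'}" using d by auto
    ultimately show ?thesis by simp
  qed
  have a': "kern T' a" and b': "kern T' b" using a b kern_subinterval d by auto
  have split: "conv p q r = conv p (\<lambda>s. q s * \<theta> s) r + conv p (\<lambda>s. q s * (1 - \<theta> s)) r"
    if pq: "kern T' p" "kern T q" and r: "0 < r" "r < T'" for p q r
  proof -
    have "(\<lambda>s. p (r - s) * (q s * \<theta> s)) absolutely_integrable_on {0..r}"
      "(\<lambda>s. p (r - s) * (q s * (1 - \<theta> s))) absolutely_integrable_on {0..r}"
      using kern_product_integrable[OF pq(1) near[OF pq(2)] r]
        kern_product_integrable[OF pq(1) kern_continuous[OF far[OF pq(2)]] r] by auto
    then show ?thesis unfolding conv_def
      by (subst integral_add[symmetric]) (auto simp: absolutely_integrable_on_def algebra_simps)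
  qed
  let ?h = "\<lambda>r. conv (\<lambda>s. b s * \<theta> s) (\<lambda>s. a s * (1 - \<theta> s)) r + conv a (\<lambda>s. b s * (1 - \<theta> s)) r"
  have eq: "conv a b r = ?h r" if r: "4 * d < r" "r < T'" for r
  proof -
    have r0: "0 < r" using r d by simp
    have "conv a b r = conv a (\<lambda>s. b s * \<theta> s) r + conv a (\<lambda>s. b s * (1 - \<theta> s)) r"
      by (rule split[OF a' b r0 r(2)])
    also have "conv a (\<lambda>s. b s * \<theta> s) r = conv (\<lambda>s. b s * \<theta> s) a r" by (rule conv_commute_real)
    also have "\<dots> = conv (\<lambda>s. b s * \<theta> s) (\<lambda>s. a s * \<theta> s) r + conv (\<lambda>s. b s * \<theta> s) (\<lambda>s. a s * (1 - \<theta> s)) r"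
      by (rule split[OF near[OF b] a r0 r(2)])
    also have "conv (\<lambda>s. b s * \<theta> s) (\<lambda>s. a s * \<theta> s) r = 0"
    proof -
      have "\<theta> (r - s) * \<theta> s = 0" for s
        using \<theta>0[of s] \<theta>0[of "r - s"] r by (cases "s \<ge> 2 * d") auto
      then have "(b (r - s) * \<theta> (r - s)) *\<^sub>R (a s * \<theta> s) = 0" for s
        by (metis (no_types, lifting) mult.assoc mult.left_commute mult_zero_right real_scaleR_def)
      then show ?thesis unfolding conv_def by (metis (no_types, lifting) Henstock_Kurzweil_Integration.integral_cong integral_0)
    qed
    finally show ?thesis by simp
  qed
  have hc: "continuous_on {0..T'} ?h"
    by (intro continuous_intros conv_continuous near[OF b] far[OF a] far[OF b] a')
  have "continuous_on {4*d<..<T'} (conv a b)"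
    by (rule continuous_on_eq[OF continuous_on_subset[OF hc]]) (use d eq in auto)
  then show ?thesis using d by (simp add: continuous_on_eq_continuous_at)
qed

text \<open>Fubini makes the convolution of the zero extensions integrable on the line, and on
  \<open>{0<..<T}\<close> it coincides with \<open>conv a b\<close>.\<close>

lemma kern_conv:
  assumes a: "kern T a" and b: "kern T b"
  shows "kern T (conv a b)"
proof -
  note ia = zero_ext_lborel[OF a] and ib = zero_ext_lborel[OF b]
  have "integrable lborel (\<lambda>r. \<integral>s. zero_ext T b s * zero_ext T a (r - s) \<partial>lborel)"
    using lborel_pair.integrable_snd[OF product_integrable(2)[OF ib ia]] .
  then have i: "integrable lborel (\<lambda>r. \<integral>s. zero_ext T a (r - s) * zero_ext T b s \<partial>lborel)"
    by (simp add: mult.commute)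
  then have "set_integrable lborel {0<..<T} (\<lambda>r. \<integral>s. zero_ext T a (r - s) * zero_ext T b s \<partial>lborel)"
    unfolding set_integrable_def by (rule integrable_mult_indicator[rotated]) auto
  then have "set_integrable lborel {0<..<T} (conv a b)"
    by (rule back_subst) (auto simp: set_integrable_def indicator_def intro!: Bochner_Integration.integrable_cong
        conv_lborel(2)[OF a b _ _ kern_product_integrable[OF a b], symmetric])
  then have "set_integrable lebesgue {0<..<T} (conv a b)"
    unfolding set_integrable_def using integrable_completion borel_measurable_integrable by blast
  then have "conv a b absolutely_integrable_on {0..T}"
    by (metis \<open>conv a b absolutely_integrable_on {0<..<T}\<close> absolutely_integrable_on_Icc_iff_Ioo)
  moreover have "continuous_on {0<..<T} (conv a b)"
    by (intro continuous_at_imp_continuous_on ballI conv_kern_continuous_at[OF a b]) auto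
  ultimately show ?thesis by (simp add: kern_def)
qed

text \<open>Fubini for \<open>a (t - s) * b (s - r) * w r\<close>. Boundedness of \<open>w\<close>
  reduces the joint integrability to that of the first two factors.\<close>

lemma conv_assoc_real:
  fixes w :: "real \<Rightarrow> real"
  assumes a: "kern T a" and b: "kern T b" and w: "continuous_on {0..T} w" and t: "0 \<le> t" "t \<le> T"
  shows "conv a (conv b w) t = conv (conv a b) w t"
proof -
  let ?a = "zero_ext T a" and ?b = "zero_ext T b" and ?w = "zero_ext T w"
  have kw: "kern T w" by (rule kern_continuous[OF w])
  have bwc: "continuous_on {0..T} (conv b w)" by (rule conv_continuous[OF b w])
  have kbw: "kern T (conv b w)" by (rule kern_continuous[OF bwc])
  have kab: "kern T (conv a b)" by (rule kern_conv[OF a b])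
  have prodc: "(\<lambda>s. p (r - s) * q s) absolutely_integrable_on {0..r}" if "kern T p" "continuous_on {0..T} q" "r \<le> T" for p q r
    using absolutely_integrable_mult_continuous[OF kern_reflect[OF that(1,3)] continuous_on_subset[OF that(2)]] that(3) by auto
  note ma = borel_measurable_integrable[OF zero_ext_lborel[OF a]] and mb = borel_measurable_integrable[OF zero_ext_lborel[OF b]]
    and mw = borel_measurable_integrable[OF zero_ext_lborel[OF kw]]
  have [measurable]: "?a \<in> borel_measurable borel" "?b \<in> borel_measurable borel" "?w \<in> borel_measurable borel"
    using ma mb mw by auto
  obtain W where W: "\<And>s. s \<in> {0..T} \<Longrightarrow> \<bar>w s\<bar> \<le> W"
    using compact_imp_bounded[OF compact_continuous_image[OF w]] unfolding bounded_iff by fastforce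
  have W': "\<bar>?w s\<bar> \<le> \<bar>W\<bar>" for s using W[of s] by (auto simp: zero_ext_def)
  have big: "integrable (lborel \<Otimes>\<^sub>M lborel) (\<lambda>(s, r). ?a (t - s) * ?b (s - r) * ?w r)"
  proof (rule Bochner_Integration.integrable_bound)
    show "integrable (lborel \<Otimes>\<^sub>M lborel) (\<lambda>p. \<bar>W\<bar> * (case p of (s, r) \<Rightarrow> ?a (t - s) * ?b (s - r)))"
      using product_integrable(1)[OF zero_ext_lborel[OF a] zero_ext_lborel[OF b], of t] by (rule integrable_mult_right)
    show "AE p in lborel \<Otimes>\<^sub>M lborel. norm (case p of (s, r) \<Rightarrow> ?a (t - s) * ?b (s - r) * ?w r) \<le> norm (\<bar>W\<bar> * (case p of (s, r) \<Rightarrow> ?a (t - s) * ?b (s - r)))"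
      by (rule AE_I2) (auto simp: abs_mult mult.commute[of "\<bar>W\<bar>"] intro!: mult_left_mono W')
  qed measurable
  have "conv a (conv b w) t = (\<integral>s. ?a (t - s) * zero_ext T (conv b w) s \<partial>lborel)"
    by (rule conv_lborel(2)[OF a kbw t prodc[OF a bwc t(2)]])
  also have "\<dots> = (\<integral>s. (\<integral>r. ?a (t - s) * ?b (s - r) * ?w r \<partial>lborel) \<partial>lborel)"
  proof (rule Bochner_Integration.integral_cong)
    fix s :: real
    show "?a (t - s) * zero_ext T (conv b w) s = (\<integral>r. ?a (t - s) * ?b (s - r) * ?w r \<partial>lborel)"
    proof (cases "0 < s \<and> s < T")
      case True
      then have "zero_ext T (conv b w) s = (\<integral>r. ?b (s - r) * ?w r \<partial>lborel)"
        using conv_lborel(2)[OF b kw _ _ prodc[OF b w]] by (simp add: zero_ext_def)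
      then show ?thesis by (simp add: mult.assoc)
    next
      case False
      then have "?a (t - s) * ?b (s - r) * ?w r = 0" for r using t by (auto simp: zero_ext_def)
      then have "(\<integral>r. ?a (t - s) * ?b (s - r) * ?w r \<partial>lborel) = 0" by (simp only: Bochner_Integration.integral_zero)
      moreover have "zero_ext T (conv b w) s = 0" using False by (auto simp: zero_ext_def)
      ultimately show ?thesis by simp
    qed
  qed simp
  also have "\<dots> = (\<integral>r. (\<integral>s. ?a (t - s) * ?b (s - r) * ?w r \<partial>lborel) \<partial>lborel)"
    by (rule lborel_pair.Fubini_integral[OF big, symmetric])
  also have "\<dots> = (\<integral>r. zero_ext T (conv a b) (t - r) * ?w r \<partial>lborel)"
  proof (rule Bochner_Integration.integral_cong)
    fix r :: real
    have "(\<integral>s. ?a (t - s) * ?b (s - r) \<partial>lborel) = (\<integral>s. ?a ((t - r) - s) * ?b s \<partial>lborel)"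
      using lborel_integral_real_affine[of 1 "\<lambda>s. ?a (t - s) * ?b (s - r)" r] by (simp add: algebra_simps)
    moreover have "(\<integral>s. ?a ((t - r) - s) * ?b s \<partial>lborel) * ?w r = zero_ext T (conv a b) (t - r) * ?w r"
    proof (cases "0 < t - r \<and> t - r < T")
      case True
      then show ?thesis using conv_lborel(2)[OF a b _ _ kern_product_integrable[OF a b]] by (simp add: zero_ext_def)
    next
      case False
      show ?thesis
      proof (cases "0 < r \<and> r < T")
        case True
        then have "?a ((t - r) - s) * ?b s = 0" for s using False t by (auto simp: zero_ext_def)
        then have "(\<integral>s. ?a ((t - r) - s) * ?b s \<partial>lborel) = 0" by (simp only: Bochner_Integration.integral_zero)
        moreover have "zero_ext T (conv a b) (t - r) = 0" using False by (auto simp: zero_ext_def)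
        ultimately show ?thesis by simp
      qed (auto simp: zero_ext_def)
    qed
    ultimately show "(\<integral>s. ?a (t - s) * ?b (s - r) * ?w r \<partial>lborel) = zero_ext T (conv a b) (t - r) * ?w r" by simp
  qed simp
  also have "\<dots> = conv (conv a b) w t"
    by (rule conv_lborel(2)[OF kab kw t prodc[OF kab w t(2)], symmetric])
  finally show ?thesis .
qed

text \<open>Pairing with every vector \<open>x\<close> reduces the claim to scalar functions; this
  is where the inner product is required.\<close>

lemma conv_assoc:
  fixes u :: "real \<Rightarrow> 'b::{real_inner,banach}"
  assumes a: "kern T a" and b: "kern T b" and u: "continuous_on {0..T} u" and t: "0 \<le> t" "t \<le> T"
  shows "conv a (conv b u) t = conv (conv a b) u t"
proof -
  have u': "continuous_on {0..s} u" if "s \<le> T" for s using that by (auto intro: continuous_on_subset[OF u])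
  have bu: "continuous_on {0..s} (conv b u)" if "s \<le> T" for s
    using that by (auto intro: continuous_on_subset[OF conv_continuous[OF b u]])
  have "inner x (conv a (conv b u) t) = inner x (conv (conv a b) u t)" for x
  proof -
    have L: "bounded_linear (\<lambda>y. inner x y)" by (rule bounded_linear_inner_right)
    have "inner x (conv a (conv b u) t) = conv a (\<lambda>s. inner x (conv b u s)) t"
      using conv_linear[OF a t(2) bu[OF t(2)] L] by simp
    also have "\<dots> = conv a (conv b (\<lambda>s. inner x (u s))) t"
      by (rule conv_cong) (use t in \<open>auto simp: conv_linear[OF b _ u' L]\<close>)
    also have "\<dots> = conv (conv a b) (\<lambda>s. inner x (u s)) t"
      by (intro conv_assoc_real[OF a b _ t] continuous_intros u)
    also have "\<dots> = inner x (conv (conv a b) u t)"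
      by (rule conv_linear[OF kern_conv[OF a b] t(2) u'[OF t(2)] L])
    finally show ?thesis .
  qed
  then show ?thesis by (metis vector_eq_ldot)
qed

lemma conv_left_commute:
  fixes u :: "real \<Rightarrow> 'b::{real_inner,banach}"
  assumes a: "kern T a" and b: "kern T b" and u: "continuous_on {0..T} u" and t: "0 \<le> t" "t \<le> T"
  shows "conv a (conv b u) t = conv b (conv a u) t"
proof -
  have "conv a b = conv b a" by (rule ext) (rule conv_commute_real)
  then show ?thesis using conv_assoc[OF a b u t] conv_assoc[OF b a u t] by simp
qed

subsection \<open>The kernels \<open>\<beta>\<^sub>\<mu>\<close>\<close>

lemma kern_beta:
  assumes "\<mu> > 0" shows "kern T (beta_kernel \<mu>)"
proof -
  have "continuous_on {0<..<T} (beta_kernel \<mu>)"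
    unfolding beta_kernel_def using Gamma_real_pos[OF assms] by (intro continuous_intros) auto
  moreover have "beta_kernel \<mu> absolutely_integrable_on {0..T}"
  proof (cases "0 \<le> T")
    case True
    have "(\<lambda>x. x powr (\<mu> - 1)) integrable_on {0..T}" using True assms by (intro integrable_on_powr_from_0) auto
    then have "beta_kernel \<mu> integrable_on {0..T}"
      unfolding beta_kernel_def using integrable_on_divide by blast
    then show ?thesis
      by (rule nonnegative_absolutely_integrable_1) (use Gamma_real_pos[OF assms] in \<open>auto simp: beta_kernel_def\<close>)
  qed auto
  ultimately show ?thesis by (simp add: kern_def)
qed

lemma has_integral_stretch:
  fixes f :: "real \<Rightarrow> real"
  assumes "(f has_integral I) {0..1}" "t > 0"
  shows "((\<lambda>s. f (s / t)) has_integral t * I) {0..t}"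
proof -
  have "(\<lambda>x. (1 / (1/t)) *\<^sub>R x + - ((1 / (1/t)) *\<^sub>R 0)) ` cbox 0 1 = {0..t}"
    using assms(2) by (simp add: cbox_interval image_mult_atLeastAtMost)
  then show ?thesis
    using has_integral_affinity[of f I 0 1 "1/t" 0] assms by (simp add: cbox_interval)
qed

text \<open>The substitution \<open>s = t * x\<close> turns the integral into the Beta function,
  whose Gamma quotient cancels both normalizations.\<close>

lemma conv_beta:
  assumes \<mu>: "\<mu> > 0" and \<nu>: "\<nu> > 0" and t: "t > 0"
  shows "conv (beta_kernel \<mu>) (beta_kernel \<nu>) t = beta_kernel (\<mu> + \<nu>) t"
proof -
  have "((\<lambda>s. (s/t) powr (\<nu> - 1) * (1 - s/t) powr (\<mu> - 1)) has_integral t * Beta \<nu> \<mu>) {0..t}"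
    by (rule has_integral_stretch[OF has_integral_Beta_real[OF \<nu> \<mu>] t])
  then have "((\<lambda>s. (t powr (\<mu> + \<nu> - 2) / (Gamma \<mu> * Gamma \<nu>)) * ((s/t) powr (\<nu> - 1) * (1 - s/t) powr (\<mu> - 1))) has_integral
     (t powr (\<mu> + \<nu> - 2) / (Gamma \<mu> * Gamma \<nu>)) * (t * Beta \<nu> \<mu>)) {0..t}"
    by (rule has_integral_mult_right)
  then have "((\<lambda>s. beta_kernel \<mu> (t - s) *\<^sub>R beta_kernel \<nu> s) has_integral
     (t powr (\<mu> + \<nu> - 2) / (Gamma \<mu> * Gamma \<nu>)) * (t * Beta \<nu> \<mu>)) {0..t}"
  proof (rule has_integral_eq[rotated])
    fix s assume s: "s \<in> {0..t}"
    have 1: "s powr (\<nu> - 1) = t powr (\<nu> - 1) * (s/t) powr (\<nu> - 1)"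
      using s t by (subst powr_mult[symmetric]) auto
    have ts: "t - s = t * (1 - s/t)" using t by (simp add: right_diff_distrib)
    have 2: "(t - s) powr (\<mu> - 1) = t powr (\<mu> - 1) * (1 - s/t) powr (\<mu> - 1)"
      using s t by (subst ts, subst powr_mult) auto
    have 3: "t powr (\<mu> + \<nu> - 2) = t powr (\<mu> - 1) * t powr (\<nu> - 1)"
      by (simp add: powr_add[symmetric])
    show "t powr (\<mu> + \<nu> - 2) / (Gamma \<mu> * Gamma \<nu>) * ((s / t) powr (\<nu> - 1) * (1 - s / t) powr (\<mu> - 1)) = beta_kernel \<mu> (t - s) *\<^sub>R beta_kernel \<nu> s"
      unfolding beta_kernel_def 1 2 3 by simp
  qed
  then have "conv (beta_kernel \<mu>) (beta_kernel \<nu>) t = (t powr (\<mu> + \<nu> - 2) / (Gamma \<mu> * Gamma \<nu>)) * (t * Beta \<nu> \<mu>)"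
    unfolding conv_def by (rule integral_unique)
  also have "t powr (\<mu> + \<nu> - 2) * t = t powr (\<mu> + \<nu> - 1)"
    using t powr_add[of t "\<mu> + \<nu> - 2" 1] by simp
  then have "(t powr (\<mu> + \<nu> - 2) / (Gamma \<mu> * Gamma \<nu>)) * (t * Beta \<nu> \<mu>) = beta_kernel (\<mu> + \<nu>) t"
    using Gamma_real_pos[OF \<mu>] Gamma_real_pos[OF \<nu>] by (simp add: Beta_def beta_kernel_def field_simps)
  finally show ?thesis .
qed

lemma conv_beta_beta:
  fixes u :: "real \<Rightarrow> 'b::{real_inner,banach}"
  assumes "\<mu> > 0" "\<nu> > 0" "continuous_on {0..T} u" "0 \<le> t" "t \<le> T"
  shows "conv (beta_kernel \<mu>) (conv (beta_kernel \<nu>) u) t = conv (beta_kernel (\<mu> + \<nu>)) u t"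
  using conv_assoc[OF kern_beta kern_beta assms(3-5), of \<mu> \<nu>] assms(1,2)
  by (simp add: conv_cong_left[of t "conv (beta_kernel \<mu>) (beta_kernel \<nu>)" "beta_kernel (\<mu> + \<nu>)"] conv_beta)

lemma conv_beta1:
  fixes u :: "real \<Rightarrow> 'b::banach"
  shows "conv (beta_kernel 1) u t = integral {0..t} u"
proof -
  have "conv (beta_kernel 1) u t = conv (\<lambda>_. 1) u t"
    by (rule conv_cong_left) (auto simp: beta_kernel_def)
  then show ?thesis by (simp add: conv_def)
qed

text \<open>Convolution with \<open>beta_kernel 1\<close> is the running integral, so
  differentiation recovers the functions.\<close>

lemma conv_beta1_inject:
  fixes u w :: "real \<Rightarrow> 'b::banach"
  assumes u: "continuous_on {0..T} u" and w: "continuous_on {0..T} w"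
    and eq: "\<And>t. 0 \<le> t \<Longrightarrow> t \<le> T \<Longrightarrow> conv (beta_kernel 1) u t = conv (beta_kernel 1) w t"
    and T: "T > 0" and t: "0 \<le> t" "t \<le> T"
  shows "u t = w t"
proof -
  have t': "t \<in> {0..T}" using t by simp
  have "((\<lambda>x. integral {0..x} u) has_vector_derivative u t) (at t within {0..T})"
    by (rule integral_has_vector_derivative[OF u t'])
  moreover have "((\<lambda>x. integral {0..x} u) has_vector_derivative w t) (at t within {0..T})"
    by (rule has_vector_derivative_transform[OF t' _ integral_has_vector_derivative[OF w t']])
      (use eq in \<open>auto simp: conv_beta1\<close>)
  ultimately show ?thesis using vector_derivative_unique_within_closed_interval[of 0 T t] T t' by (simp add: cbox_interval)
qed

text \<open>Abel inversion: a further convolution with \<open>beta_kernel (1 - \<gamma>)\<close>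
  completes the order to one.\<close>

lemma conv_beta_inject:
  fixes u w :: "real \<Rightarrow> 'b::{real_inner,banach}"
  assumes u: "continuous_on {0..T} u" and w: "continuous_on {0..T} w" and g: "0 < \<gamma>" "\<gamma> < 1"
    and eq: "\<And>t. 0 \<le> t \<Longrightarrow> t \<le> T \<Longrightarrow> conv (beta_kernel \<gamma>) u t = conv (beta_kernel \<gamma>) w t"
    and T: "T > 0" and t: "0 \<le> t" "t \<le> T"
  shows "u t = w t"
proof (rule conv_beta1_inject[OF u w _ T t])
  fix t assume t: "0 \<le> t" "t \<le> T"
  have "conv (beta_kernel (1 - \<gamma>)) (conv (beta_kernel \<gamma>) u) t = conv (beta_kernel (1 - \<gamma>)) (conv (beta_kernel \<gamma>) w) t"
    by (rule conv_cong) (use eq t in auto)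
  then show "conv (beta_kernel 1) u t = conv (beta_kernel 1) w t"
    using conv_beta_beta[OF _ _ u t, of "1 - \<gamma>" \<gamma>] conv_beta_beta[OF _ _ w t, of "1 - \<gamma>" \<gamma>] g by simp
qed

section \<open>Volterra equations\<close>

lemma kern_exp_weight:
  assumes "kern T a" shows "kern T (\<lambda>s. exp (- (c * s)) * a s)"
proof -
  have "(\<lambda>s. a s * exp (- (c * s))) absolutely_integrable_on {0..T}"
    by (rule absolutely_integrable_mult_continuous) (use assms in \<open>auto simp: kern_def intro!: continuous_intros\<close>)
  moreover have "continuous_on {0<..<T} (\<lambda>s. exp (- (c * s)) * a s)"
    using assms unfolding kern_def by (auto intro!: continuous_intros)
  ultimately show ?thesis by (simp add: kern_def mult.commute)
qed

text \<open>Dominated convergence with majorant \<open>|a|\<close>. The pointwise limit is zero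
  except at \<open>s = 0\<close>, where the weight equals one for every \<open>n\<close>.\<close>

lemma kern_exp_weight_tendsto_0:
  assumes "kern T a"
  shows "(\<lambda>n. integral {0..T} (\<lambda>s. \<bar>exp (- (real n * s)) * a s\<bar>)) \<longlonglongrightarrow> 0"
proof -
  let ?g = "\<lambda>s::real. if s = 0 then \<bar>a 0\<bar> else 0"
  have "(\<lambda>n. integral {0..T} (\<lambda>s. \<bar>exp (- (real n * s)) * a s\<bar>)) \<longlonglongrightarrow> integral {0..T} ?g"
  proof (rule dominated_convergence(2)[where h = "\<lambda>s. \<bar>a s\<bar>"])
    show "(\<lambda>s. \<bar>exp (- (real n * s)) * a s\<bar>) integrable_on {0..T}" for n
      using kern_exp_weight[OF assms] by (intro absolutely_integrable_realD) (simp add: kern_def)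
    show "(\<lambda>s. \<bar>a s\<bar>) integrable_on {0..T}"
      using assms by (intro absolutely_integrable_realD) (simp add: kern_def)
    show "norm \<bar>exp (- (real n * s)) * a s\<bar> \<le> \<bar>a s\<bar>" if "s \<in> {0..T}" for n s
      using that by (simp add: abs_mult mult_left_le_one_le)
    show "(\<lambda>n. \<bar>exp (- (real n * s)) * a s\<bar>) \<longlonglongrightarrow> ?g s" if "s \<in> {0..T}" for s
    proof (cases "s = 0")
      case False
      then have s: "s > 0" using that by simp
      have "(\<lambda>n. exp (- (real n * s))) \<longlonglongrightarrow> 0"
      proof -
        have "(\<lambda>n. exp (- s) ^ n) \<longlonglongrightarrow> 0" using s by (intro LIMSEQ_power_zero) auto
        then show ?thesis by (simp add: exp_of_nat_mult[symmetric])
      qed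
      then have "(\<lambda>n. \<bar>exp (- (real n * s)) * a s\<bar>) \<longlonglongrightarrow> \<bar>0 * a s\<bar>" by (intro tendsto_intros)
      then show ?thesis using False by simp
    qed simp
  qed
  moreover have "integral {0..T} ?g = 0"
    using integral_spike[of "{0}" "{0..T}" ?g "\<lambda>_. 0"] by simp
  ultimately show ?thesis by simp
qed

text \<open>Contraction for the weighted unknown \<open>w t = exp (- n t) v t\<close>: for large
  \<open>n\<close> the weighted L1 norms of both kernels are so small that the contraction factor is
  \<open>1/2\<close> on all of \<open>{0..T}\<close> at once. The operator \<open>L\<close> enters
  only through its bound \<open>K\<close>.\<close>

lemma volterra_exists:
  fixes F :: "real \<Rightarrow> 'b::banach"
  assumes a: "kern T a" and b: "kern T b" and L: "bounded_linear L" and F: "continuous_on {0..T} F" and T: "T > 0"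
  shows "\<exists>v. continuous_on {0..T} v \<and> (\<forall>t\<in>{0..T}. v t + conv a v t + L (conv b v t) = F t)"
proof -
  obtain K where K: "K \<ge> 0" "\<And>x. norm (L x) \<le> norm x * K" using bounded_linear.nonneg_bounded[OF L] by blast
  let ?w = "\<lambda>n c s. exp (- (real n * s)) * c s"
  let ?I = "\<lambda>n c. integral {0..T} (\<lambda>s. \<bar>?w n c s\<bar>)"
  have "(\<lambda>n. ?I n a + K * ?I n b) \<longlonglongrightarrow> 0 + K * 0"
    by (intro tendsto_intros kern_exp_weight_tendsto_0 a b)
  then have "eventually (\<lambda>n. ?I n a + K * ?I n b < 1/2) sequentially"
    by (rule order_tendstoD) simp
  then obtain n where n: "?I n a + K * ?I n b < 1/2" by (auto simp: eventually_sequentially)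
  let ?a = "?w n a" and ?b = "?w n b"
  have ka: "kern T ?a" and kb: "kern T ?b" using kern_exp_weight a b by auto
  define \<Phi> where "\<Phi> = (\<lambda>w t. exp (- (real n * t)) *\<^sub>R F t - conv ?a w t - L (conv ?b w t))"
  have \<Phi>c: "continuous_on {0..T} (\<Phi> w)" if "continuous_on {0..T} w" for w
    unfolding \<Phi>_def
    by (intro continuous_intros F conv_continuous ka kb that continuous_on_compose2[OF linear_continuous_on[OF L]]) auto
  \<comment> \<open>Freezing time outside \<open>{0..T}\<close> allows the fixed point to be sought
    among the bounded continuous functions on the whole line, a complete space.\<close>
  define cl where "cl = (\<lambda>t::real. max 0 (min T t))"
  have cl: "cl t \<in> {0..T}" "t \<in> {0..T} \<Longrightarrow> cl t = t" for t using T by (auto simp: cl_def)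
  define \<Psi> where "\<Psi> = (\<lambda>w. Bcontfun (\<lambda>t. \<Phi> (apply_bcontfun w) (cl t)))"
  have \<Psi>: "apply_bcontfun (\<Psi> w) t = \<Phi> (apply_bcontfun w) (cl t)" for w t
  proof -
    have c: "continuous_on {0..T} (\<Phi> (apply_bcontfun w))" by (rule \<Phi>c) simp
    have "continuous_on UNIV (\<lambda>t. \<Phi> (apply_bcontfun w) (cl t))"
      by (rule continuous_on_compose2[OF c]) (use cl(1) in \<open>auto simp: cl_def intro!: continuous_intros\<close>)
    moreover have "bounded (range (\<lambda>t. \<Phi> (apply_bcontfun w) (cl t)))"
      by (rule bounded_subset[OF compact_imp_bounded[OF compact_continuous_image[OF c compact_Icc]]]) (use cl(1) in auto)
    ultimately show ?thesis unfolding \<Psi>_def by (subst Bcontfun_inverse) (auto simp: bcontfun_def)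
  qed
  have "dist (\<Psi> w) (\<Psi> w') \<le> 1/2 * dist w w'" for w w'
  proof (rule dist_bound)
    fix t
    let ?d = "\<lambda>s. apply_bcontfun w s - apply_bcontfun w' s"
    have ct: "cl t \<le> T" "0 \<le> cl t" using cl(1)[of t] by auto
    have d: "norm (?d s) \<le> dist w w'" for s using dist_bounded[of w s w'] by (simp add: dist_norm)
    have cd: "continuous_on {0..cl t} ?d" by (intro continuous_intros) auto
    have c1: "continuous_on {0..cl t} (apply_bcontfun w)" "continuous_on {0..cl t} (apply_bcontfun w')" by auto
    have "apply_bcontfun (\<Psi> w) t - apply_bcontfun (\<Psi> w') t = - (conv ?a ?d (cl t) + L (conv ?b ?d (cl t)))"
      unfolding \<Psi> \<Phi>_def conv_diff[OF ka ct(1) c1] conv_diff[OF kb ct(1) c1] linear_diff[OF bounded_linear.linear[OF L]]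
      by simp
    then have "dist (apply_bcontfun (\<Psi> w) t) (apply_bcontfun (\<Psi> w') t) = norm (conv ?a ?d (cl t) + L (conv ?b ?d (cl t)))"
      by (simp only: dist_norm norm_minus_cancel)
    also have "\<dots> \<le> norm (conv ?a ?d (cl t)) + norm (conv ?b ?d (cl t)) * K"
      using norm_triangle_ineq K(2) by (meson add_left_mono order_trans)
    also have "\<dots> \<le> ?I n a * dist w w' + (?I n b * dist w w') * K"
      by (intro add_mono mult_right_mono norm_conv_le[OF ka ct(1) cd d ct(2)] norm_conv_le[OF kb ct(1) cd d ct(2)] K(1))
    also have "\<dots> = (?I n a + K * ?I n b) * dist w w'" by (simp add: algebra_simps)
    also have "\<dots> \<le> 1/2 * dist w w'" by (rule mult_right_mono) (use n in auto)
    finally show "dist (apply_bcontfun (\<Psi> w) t) (apply_bcontfun (\<Psi> w') t) \<le> 1/2 * dist w w'" .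
  qed
  then obtain w where w: "\<Psi> w = w" using banach_fix_type[of "1/2" \<Psi>] by auto
  define v where "v = (\<lambda>t. exp (real n * t) *\<^sub>R apply_bcontfun w t)"
  \<comment> \<open>The exponential is multiplicative and so passes through the convolution; undoing
    the weight therefore turns the fixed point into a solution of the original equation.\<close>
  have conv_v: "conv c v t = exp (real n * t) *\<^sub>R conv (?w n c) (apply_bcontfun w) t" for c t
  proof -
    have "exp (real n * t) *\<^sub>R conv (?w n c) (apply_bcontfun w) t = integral {0..t} (\<lambda>s. exp (real n * t) *\<^sub>R (?w n c (t - s) *\<^sub>R apply_bcontfun w s))"
      unfolding conv_def by (rule integral_cmul[symmetric])
    also have "\<dots> = conv c v t"
      unfolding conv_def v_def by (rule integral_cong) (simp add: exp_diff exp_minus algebra_simps)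
    finally show ?thesis ..
  qed
  show ?thesis
  proof (intro exI[of _ v] conjI ballI)
    show "continuous_on {0..T} v" unfolding v_def by (intro continuous_intros) auto
    fix t assume t: "t \<in> {0..T}"
    have "apply_bcontfun w t = \<Phi> (apply_bcontfun w) t" using \<Psi>[of w t] cl(2)[OF t] w by simp
    then have "exp (real n * t) *\<^sub>R apply_bcontfun w t = exp (real n * t) *\<^sub>R \<Phi> (apply_bcontfun w) t" by simp
    then have "v t = F t - exp (real n * t) *\<^sub>R conv ?a (apply_bcontfun w) t - exp (real n * t) *\<^sub>R L (conv ?b (apply_bcontfun w) t)"
      unfolding v_def \<Phi>_def by (simp add: algebra_simps exp_minus)
    then show "v t + conv a v t + L (conv b v t) = F t"
      unfolding conv_v by (simp add: linear_scale[OF bounded_linear.linear[OF L]])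
  qed
qed

section \<open>Positive symmetric operators and their resolvents\<close>

locale psd_operator =
  fixes C :: "'h::{real_inner,banach} \<Rightarrow> 'h"
  assumes bl: "bounded_linear C" and sym: "inner (C x) y = inner x (C y)" and psd: "0 \<le> inner (C x) x"
begin

sublocale C: bounded_linear C by (rule bl)

text \<open>Nonnegativity of the form at \<open>x + t y\<close> is a quadratic inequality in
  \<open>t\<close>. The form may be degenerate, hence the separate case \<open>r = 0\<close>, where
  an affine function bounded below must have slope zero.\<close>

lemma form_cauchy_schwarz: "\<bar>inner (C x) y\<bar> \<le> sqrt (inner (C x) x) * sqrt (inner (C y) y)"
proof -
  define p q r where "p = inner (C x) x" and "q = inner (C x) y" and "r = inner (C y) y"
  have quad: "0 \<le> p + 2 * t * q + t\<^sup>2 * r" for t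
  proof -
    have "inner (C (x + t *\<^sub>R y)) (x + t *\<^sub>R y) = p + 2 * t * q + t\<^sup>2 * r"
      using sym[of y x] by (simp add: C.add C.scaleR inner_add_left inner_add_right p_def q_def r_def power2_eq_square inner_commute algebra_simps)
    then show ?thesis using psd by metis
  qed
  have "q\<^sup>2 \<le> p * r"
  proof (cases "r = 0")
    case True
    have "q = 0"
    proof (rule ccontr)
      assume "q \<noteq> 0"
      \<comment> \<open>This value of \<open>t\<close> makes the affine expression equal to
        \<open>-1\<close>.\<close>
      then show False using quad[of "- (p + 1) / (2 * q)"] True by (simp add: field_simps)
    qed
    then show ?thesis using True by simp
  next
    case False
    then have r: "r > 0" using psd[of y] by (simp add: r_def)
    have "0 \<le> p - q\<^sup>2 / r" using quad[of "- q / r"] r by (simp add: field_simps power2_eq_square)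
    then show ?thesis using r by (simp add: field_simps)
  qed
  then have "sqrt (q\<^sup>2) \<le> sqrt (p * r)" by (rule real_sqrt_le_mono)
  then show ?thesis by (simp add: real_sqrt_mult p_def q_def r_def)
qed

lemma form_diff_le: "inner (C (x - y)) (x - y) \<le> 2 * inner (C x) x + 2 * inner (C y) y"
proof -
  have "inner (C (x - y)) (x - y) + inner (C (x + y)) (x + y) = 2 * inner (C x) x + 2 * inner (C y) y"
    by (simp add: C.add C.diff inner_add_left inner_add_right inner_diff_left inner_diff_right)
  then show ?thesis using psd[of "x + y"] by linarith
qed

lemma shift_psd:
  assumes "\<epsilon> \<ge> 0" shows "psd_operator (\<lambda>x. C x + \<epsilon> *\<^sub>R x)"
proof (rule psd_operator.intro)
  show "bounded_linear (\<lambda>x. C x + \<epsilon> *\<^sub>R x)" by (intro bounded_linear_add bl bounded_linear_scaleR_right)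
  show "inner (C x + \<epsilon> *\<^sub>R x) y = inner x (C y + \<epsilon> *\<^sub>R y)" for x y
    by (simp add: inner_add_left inner_add_right sym)
  show "0 \<le> inner (C x + \<epsilon> *\<^sub>R x) x" for x using psd[of x] assms by (simp add: inner_add_left)
qed

text \<open>Lax-Milgram by Richardson iteration: the shifted operator \<open>D\<close> is coercive
  with constant \<open>\<epsilon>\<close> and bounded by \<open>M\<close>, so
  \<open>x - \<tau> (D x - y)\<close> is a contraction, and its fixed point solves the
  equation.\<close>

lemma shift_surj:
  assumes \<epsilon>: "\<epsilon> > 0" shows "\<exists>x. C x + \<epsilon> *\<^sub>R x = y"
proof -
  obtain K where K: "K \<ge> 0" "\<And>x. norm (C x) \<le> norm x * K" using C.nonneg_bounded by blast
  define M where "M = K + \<epsilon>"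
  have M: "M > 0" "\<epsilon> \<le> M" using K \<epsilon> by (auto simp: M_def)
  define D where "D = (\<lambda>x. C x + \<epsilon> *\<^sub>R x)"
  have D: "norm (D x) \<le> M * norm x" for x
    unfolding D_def M_def using norm_triangle_ineq[of "C x" "\<epsilon> *\<^sub>R x"] K(2)[of x] \<epsilon> by (simp add: algebra_simps)
  \<comment> \<open>This step length minimizes
    \<open>1 - 2 * \<tau> * \<epsilon> + \<tau>^2 * M^2\<close>; the minimum is
    \<open>c^2\<close>.\<close>
  define \<tau> where "\<tau> = \<epsilon> / M\<^sup>2"
  define c where "c = sqrt (1 - \<epsilon>\<^sup>2 / M\<^sup>2)"
  have c: "0 \<le> c" "c < 1" "c\<^sup>2 = 1 - \<epsilon>\<^sup>2 / M\<^sup>2"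
  proof -
    have "0 < \<epsilon>\<^sup>2 / M\<^sup>2" "\<epsilon>\<^sup>2 / M\<^sup>2 \<le> 1" using \<epsilon> M by (auto simp: power_mono)
    then show "0 \<le> c" "c < 1" "c\<^sup>2 = 1 - \<epsilon>\<^sup>2 / M\<^sup>2" by (auto simp: c_def)
  qed
  have contr: "norm (z - \<tau> *\<^sub>R D z) \<le> c * norm z" for z
  proof (rule power2_le_imp_le)
    have Dz: "inner z (D z) \<ge> \<epsilon> * (norm z)\<^sup>2"
      using psd[of z] by (simp add: D_def inner_add_right power2_norm_eq_inner inner_commute)
    have "(norm (z - \<tau> *\<^sub>R D z))\<^sup>2 = (norm z)\<^sup>2 - 2 * \<tau> * inner z (D z) + \<tau>\<^sup>2 * (norm (D z))\<^sup>2"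
      unfolding power2_norm_eq_inner by (simp add: inner_diff_left inner_diff_right inner_commute power2_eq_square algebra_simps)
    also have "\<dots> \<le> (norm z)\<^sup>2 - 2 * \<tau> * (\<epsilon> * (norm z)\<^sup>2) + \<tau>\<^sup>2 * (M * norm z)\<^sup>2"
      by (intro add_mono diff_mono mult_left_mono power_mono D order_refl Dz) (use \<epsilon> M in \<open>auto simp: \<tau>_def\<close>)
    also have "\<dots> = c\<^sup>2 * (norm z)\<^sup>2"
      using M unfolding c(3) by (simp add: \<tau>_def field_simps power2_eq_square)
    finally show "(norm (z - \<tau> *\<^sub>R D z))\<^sup>2 \<le> (c * norm z)\<^sup>2" by (simp add: power_mult_distrib)
  qed (use c in auto)
  have "dist (x - \<tau> *\<^sub>R (D x - y)) (x' - \<tau> *\<^sub>R (D x' - y)) \<le> c * dist x x'" for x x'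
    using contr[of "x - x'"] by (simp add: dist_norm D_def C.diff algebra_simps)
  then obtain x where "x - \<tau> *\<^sub>R (D x - y) = x"
    using banach_fix_type[OF c(1,2), of "\<lambda>x. x - \<tau> *\<^sub>R (D x - y)"] by blast
  moreover have "\<tau> \<noteq> 0" using \<epsilon> M by (simp add: \<tau>_def)
  ultimately have "D x = y" by simp
  then show ?thesis unfolding D_def by blast
qed

text \<open>The cross term \<open>2 * \<epsilon> * <C x, x>\<close> of the squared norm is
  nonnegative, so each summand alone is bounded by the whole. The second bound does not deteriorate
  as \<open>\<epsilon>\<close> tends to zero.\<close>

lemma shift_norm_ge:
  assumes "\<epsilon> > 0" shows "\<epsilon> * norm x \<le> norm (C x + \<epsilon> *\<^sub>R x)" "norm (C x) \<le> norm (C x + \<epsilon> *\<^sub>R x)"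
proof -
  have e: "(norm (C x + \<epsilon> *\<^sub>R x))\<^sup>2 = (norm (C x))\<^sup>2 + 2 * \<epsilon> * inner (C x) x + (\<epsilon> * norm x)\<^sup>2"
    unfolding power_mult_distrib power2_norm_eq_inner by (simp add: inner_add_left inner_add_right inner_commute power2_eq_square algebra_simps)
  have "0 \<le> 2 * \<epsilon> * inner (C x) x" using psd[of x] assms by simp
  then have "(\<epsilon> * norm x)\<^sup>2 \<le> (norm (C x + \<epsilon> *\<^sub>R x))\<^sup>2" "(norm (C x))\<^sup>2 \<le> (norm (C x + \<epsilon> *\<^sub>R x))\<^sup>2"
    unfolding e by auto
  then show "\<epsilon> * norm x \<le> norm (C x + \<epsilon> *\<^sub>R x)" "norm (C x) \<le> norm (C x + \<epsilon> *\<^sub>R x)"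
    by (auto intro: power2_le_imp_le)
qed

definition resolvent :: "real \<Rightarrow> 'h \<Rightarrow> 'h" where
  "resolvent \<epsilon> y = (SOME x. C x + \<epsilon> *\<^sub>R x = y)"

lemma resolvent_eq: "\<epsilon> > 0 \<Longrightarrow> C (resolvent \<epsilon> y) + \<epsilon> *\<^sub>R resolvent \<epsilon> y = y"
  unfolding resolvent_def using shift_surj by (rule someI_ex)

lemma resolvent_unique: "\<epsilon> > 0 \<Longrightarrow> C x + \<epsilon> *\<^sub>R x = y \<Longrightarrow> resolvent \<epsilon> y = x"
proof -
  assume \<epsilon>: "\<epsilon> > 0" and x: "C x + \<epsilon> *\<^sub>R x = y"
  have "C (resolvent \<epsilon> y - x) + \<epsilon> *\<^sub>R (resolvent \<epsilon> y - x) = 0"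
    using resolvent_eq[OF \<epsilon>, of y] x by (simp add: C.diff algebra_simps)
  then show ?thesis using shift_norm_ge(1)[OF \<epsilon>, of "resolvent \<epsilon> y - x"] \<epsilon> by (simp add: mult_le_0_iff)
qed

lemma resolvent_norm_le: "\<epsilon> > 0 \<Longrightarrow> norm (resolvent \<epsilon> y) \<le> norm y / \<epsilon>"
  using shift_norm_ge(1)[of \<epsilon> "resolvent \<epsilon> y"] by (simp add: resolvent_eq field_simps)

lemma C_resolvent_norm_le: "\<epsilon> > 0 \<Longrightarrow> norm (C (resolvent \<epsilon> y)) \<le> norm y"
  using shift_norm_ge(2)[of \<epsilon> "resolvent \<epsilon> y"] by (simp add: resolvent_eq)

lemma bounded_linear_resolvent: "\<epsilon> > 0 \<Longrightarrow> bounded_linear (resolvent \<epsilon>)"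
proof -
  assume \<epsilon>: "\<epsilon> > 0"
  show ?thesis
  proof (rule bounded_linear_intro)
    show "resolvent \<epsilon> (x + y) = resolvent \<epsilon> x + resolvent \<epsilon> y" for x y
    proof (rule resolvent_unique[OF \<epsilon>])
      have "C (resolvent \<epsilon> x + resolvent \<epsilon> y) + \<epsilon> *\<^sub>R (resolvent \<epsilon> x + resolvent \<epsilon> y)
          = (C (resolvent \<epsilon> x) + \<epsilon> *\<^sub>R resolvent \<epsilon> x) + (C (resolvent \<epsilon> y) + \<epsilon> *\<^sub>R resolvent \<epsilon> y)"
        by (simp add: C.add algebra_simps)
      then show "C (resolvent \<epsilon> x + resolvent \<epsilon> y) + \<epsilon> *\<^sub>R (resolvent \<epsilon> x + resolvent \<epsilon> y) = x + y"
        by (simp only: resolvent_eq[OF \<epsilon>])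
    qed
    show "resolvent \<epsilon> (r *\<^sub>R x) = r *\<^sub>R resolvent \<epsilon> x" for r x
    proof (rule resolvent_unique[OF \<epsilon>])
      have "C (r *\<^sub>R resolvent \<epsilon> x) + \<epsilon> *\<^sub>R (r *\<^sub>R resolvent \<epsilon> x) = r *\<^sub>R (C (resolvent \<epsilon> x) + \<epsilon> *\<^sub>R resolvent \<epsilon> x)"
        by (simp add: C.scaleR algebra_simps)
      then show "C (r *\<^sub>R resolvent \<epsilon> x) + \<epsilon> *\<^sub>R (r *\<^sub>R resolvent \<epsilon> x) = r *\<^sub>R x"
        by (simp only: resolvent_eq[OF \<epsilon>])
    qed
    show "norm (resolvent \<epsilon> x) \<le> norm x * (1 / \<epsilon>)" for x using resolvent_norm_le[OF \<epsilon>] by simp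
  qed
qed

lemma resolvent_C_commute: "\<epsilon> > 0 \<Longrightarrow> resolvent \<epsilon> (C x) = C (resolvent \<epsilon> x)"
proof (rule resolvent_unique)
  assume \<epsilon>: "\<epsilon> > 0"
  have "C (C (resolvent \<epsilon> x)) + \<epsilon> *\<^sub>R C (resolvent \<epsilon> x) = C (C (resolvent \<epsilon> x) + \<epsilon> *\<^sub>R resolvent \<epsilon> x)"
    by (simp add: C.add C.scaleR)
  then show "C (C (resolvent \<epsilon> x)) + \<epsilon> *\<^sub>R C (resolvent \<epsilon> x) = C x" by (simp only: resolvent_eq[OF \<epsilon>])
qed

text \<open>The vectors \<open>\<eta> (C + \<eta>)\<^sup>-\<^sup>1 x\<close> have norms decreasing with \<open>\<eta>\<close> and
  \<open>\<bar>z\<^sub>\<eta> - z\<^sub>\<mu>\<bar>\<^sup>2 \<le> \<bar>z\<^sub>\<eta>\<bar>\<^sup>2 - \<bar>z\<^sub>\<mu>\<bar>\<^sup>2\<close> for \<open>\<mu> \<le> \<eta>\<close>, so they converge, and the limit lies in the kernel of \<open>C\<close>.\<close>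

lemma resolvent_tendsto:
  assumes inj: "\<And>z. z \<in> S \<Longrightarrow> C z = 0 \<Longrightarrow> z = 0" and S: "subspace S" "closed S" "range C \<subseteq> S" and x: "x \<in> S"
  shows "(\<lambda>n. C (resolvent (1 / real (Suc n)) x)) \<longlonglongrightarrow> x"
proof -
  define e where "e = (\<lambda>n. 1 / real (Suc n))"
  have e: "e n > 0" for n by (simp add: e_def)
  define z where "z = (\<lambda>n. e n *\<^sub>R resolvent (e n) x)"
  have zx: "C (resolvent (e n) x) = x - z n" for n
    using resolvent_eq[OF e, of n x] by (simp add: z_def algebra_simps)
  have mono: "(norm (z m))\<^sup>2 + (norm (z n - z m))\<^sup>2 \<le> (norm (z n))\<^sup>2" if "n \<le> m" for n m
  proof -
    have enm: "e m \<le> e n" using that by (simp add: e_def frac_le)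
    \<comment> \<open>The shifted operators commute, so one vector carries both resolvents: they are
      \<open>C + e n\<close> and \<open>C + e m\<close> applied to \<open>q\<close>. Hence
      \<open>z n - z m\<close> and \<open>z m\<close> are explicit in \<open>C q\<close> and
      \<open>q\<close>, and their inner product is visibly nonnegative.\<close>
    define q where "q = resolvent (e n) (resolvent (e m) x)"
    have rm: "resolvent (e m) x = C q + e n *\<^sub>R q" unfolding q_def using resolvent_eq[OF e] by simp
    have rn: "resolvent (e n) x = C q + e m *\<^sub>R q"
    proof (rule resolvent_unique[OF e])
      have "C (C q + e m *\<^sub>R q) + e n *\<^sub>R (C q + e m *\<^sub>R q) = C (C q + e n *\<^sub>R q) + e m *\<^sub>R (C q + e n *\<^sub>R q)"
        by (simp add: C.add C.scaleR algebra_simps)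
      also have "\<dots> = x" unfolding rm[symmetric] by (rule resolvent_eq[OF e])
      finally show "C (C q + e m *\<^sub>R q) + e n *\<^sub>R (C q + e m *\<^sub>R q) = x" .
    qed
    have d: "z n - z m = (e n - e m) *\<^sub>R C q" unfolding z_def rm rn by (simp add: algebra_simps)
    have "inner (z n - z m) (z m) = (e n - e m) * e m * (inner (C q) (C q) + e n * inner (C q) q)"
      unfolding d z_def rm by (metis ab_semigroup_mult_class.mult_ac(1) d inner_right_distrib inner_scaleR_left inner_scaleR_right rm z_def)
    moreover have "\<dots> \<ge> 0" using enm e[of m] e[of n] psd[of q] by (intro mult_nonneg_nonneg add_nonneg_nonneg) auto
    moreover have "(norm (z n))\<^sup>2 = (norm (z m))\<^sup>2 + 2 * inner (z n - z m) (z m) + (norm (z n - z m))\<^sup>2"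
      by (simp add: power2_norm_eq_inner inner_diff_left inner_diff_right inner_commute)
    ultimately show ?thesis by linarith
  qed
  have dec: "decseq (\<lambda>n. (norm (z n))\<^sup>2)"
  proof (rule decseq_SucI)
    show "(norm (z (Suc n)))\<^sup>2 \<le> (norm (z n))\<^sup>2" for n
      using mono[of n "Suc n"] zero_le_power2[of "norm (z n - z (Suc n))"] by linarith
  qed
  then obtain l where l: "(\<lambda>n. (norm (z n))\<^sup>2) \<longlonglongrightarrow> l"
    using decseq_convergent[of "\<lambda>n. (norm (z n))\<^sup>2" 0] by auto
  have "Cauchy z"
  proof (rule metric_CauchyI)
    fix r :: real assume r: "r > 0"
    have "Cauchy (\<lambda>n. (norm (z n))\<^sup>2)" using l by (rule LIMSEQ_imp_Cauchy)
    then obtain N where N: "\<And>m n. m \<ge> N \<Longrightarrow> n \<ge> N \<Longrightarrow> dist ((norm (z m))\<^sup>2) ((norm (z n))\<^sup>2) < r\<^sup>2"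
      using metric_CauchyD r by (metis zero_less_power)
    have *: "norm (z n - z m) < r" if "n \<ge> N" "m \<ge> n" for n m
    proof -
      have "(norm (z n - z m))\<^sup>2 \<le> (norm (z n))\<^sup>2 - (norm (z m))\<^sup>2" using mono[OF that(2)] by linarith
      also have "\<dots> < r\<^sup>2" using N[of n m] that by (simp add: dist_real_def abs_less_iff)
      finally show ?thesis using r by (simp add: power_less_imp_less_base)
    qed
    show "\<exists>M. \<forall>m\<ge>M. \<forall>n\<ge>M. dist (z m) (z n) < r"
      by (intro exI[of _ N] allI impI) (metis * dist_norm linear norm_minus_commute)
  qed
  then obtain z0 where z0: "z \<longlonglongrightarrow> z0" using Cauchy_convergent_iff convergent_def by blast
  have "z n \<in> S" for n
  proof -
    have "z n = x - C (resolvent (e n) x)" using zx by simp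
    then show ?thesis using S x by (metis range_subsetD subspace_diff)
  qed
  then have z0S: "z0 \<in> S" using S(2) z0 closed_sequentially by blast
  have "C z0 = 0"
  proof (rule LIMSEQ_unique)
    show "(\<lambda>n. C (z n)) \<longlonglongrightarrow> C z0" by (rule C.tendsto[OF z0])
    have "(\<lambda>n. e n *\<^sub>R (x - z n)) \<longlonglongrightarrow> 0 *\<^sub>R (x - z0)"
      unfolding e_def by (intro tendsto_intros z0 LIMSEQ_Suc[OF lim_1_over_n])
    moreover have "C (z n) = e n *\<^sub>R (x - z n)" for n unfolding zx[symmetric] z_def by (simp add: C.scaleR z_def zx)
    ultimately show "(\<lambda>n. C (z n)) \<longlonglongrightarrow> 0" by simp
  qed
  then have "z0 = 0" using inj z0S by blast
  then have "(\<lambda>n. x - z n) \<longlonglongrightarrow> x - 0" using z0 by (intro tendsto_intros) simp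
  then have "(\<lambda>n. C (resolvent (e n) x)) \<longlonglongrightarrow> x" by (simp add: zx)
  then show ?thesis by (simp only: e_def)
qed

end

section \<open>The energy inequality\<close>

text \<open>Monotonicity of \<open>k\<close> is replaced by the one-sided bound
  \<open>k'_le\<close>, which lets \<open>k'\<close> tend to minus infinity. The bound
  \<open>k_le\<close> limits the singularity to order \<open>1 / s\<close> and thereby kills a
  boundary term in the integration by parts; \<open>k_blowup\<close> supplies the large factor used
  up by the delayed Gronwall argument.\<close>

locale memory_kernel =
  fixes T M c :: real and k k' :: "real \<Rightarrow> real"
  assumes T_pos: "T > 0" and kern_k: "kern T k"
    and k_pos: "0 < s \<Longrightarrow> s < T \<Longrightarrow> 0 < k s"
    and k_deriv: "0 < s \<Longrightarrow> s < T \<Longrightarrow> (k has_real_derivative k' s) (at s)"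
    and k'_le: "0 < s \<Longrightarrow> s < T \<Longrightarrow> k' s \<le> M" and M_nonneg: "0 \<le> M"
    and k_le: "0 < s \<Longrightarrow> s < T \<Longrightarrow> s * k s \<le> c"
    and k_blowup: "\<exists>\<delta>>0. \<forall>s. 0 < s \<and> s < \<delta> \<and> s < T \<longrightarrow> K \<le> k s"

lemma conv_nonneg:
  assumes "kern T k" "\<And>s. 0 < s \<Longrightarrow> s < T \<Longrightarrow> 0 \<le> k s" "t \<le> T" "continuous_on {0..t} w" "\<And>s. 0 \<le> s \<Longrightarrow> s \<le> t \<Longrightarrow> 0 \<le> (w s :: real)"
  shows "0 \<le> conv k w t"
proof -
  \<comment> \<open>The sign of \<open>k\<close> is known on the open interval only; with
    \<open>|k|\<close> the integrand is nonnegative at the end points as well.\<close>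
  have "conv k w t = conv (\<lambda>s. \<bar>k s\<bar>) w t"
    by (rule conv_cong_left) (use assms in auto)
  moreover have "0 \<le> conv (\<lambda>s. \<bar>k s\<bar>) w t"
    unfolding conv_def
  proof (rule integral_nonneg)
    have "kern T (\<lambda>s. \<bar>k s\<bar>)"
    proof -
      have "k absolutely_integrable_on {0..T}" using assms(1) by (simp add: kern_def)
      from absolutely_integrable_norm[OF this] have "(\<lambda>s. \<bar>k s\<bar>) absolutely_integrable_on {0..T}" by (simp add: o_def)
      then show ?thesis using assms(1) unfolding kern_def by (auto intro!: continuous_intros)
    qed
    then show "(\<lambda>s. \<bar>k (t - s)\<bar> *\<^sub>R w s) integrable_on {0..t}" by (rule conv_integrable) (use assms in auto)
  qed (use assms in auto)
  ultimately show ?thesis by simp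
qed

lemma (in psd_operator) form_has_derivative:
  assumes p: "(p has_vector_derivative p') (at s within S)"
  shows "((\<lambda>s. inner (C (p s - z)) (p s - z)) has_real_derivative 2 * inner (C (p s - z)) p') (at s within S)"
proof -
  have d: "((\<lambda>s. p s - z) has_vector_derivative p') (at s within S)"
    using has_vector_derivative_diff[OF p has_vector_derivative_const[of z]] by simp
  have "((\<lambda>s. C (p s - z)) has_vector_derivative C p') (at s within S)"
    by (rule C.has_vector_derivative[OF d])
  from bounded_bilinear.has_vector_derivative[OF bounded_bilinear_inner this d]
  have "((\<lambda>s. inner (C (p s - z)) (p s - z)) has_vector_derivative inner (C (p s - z)) p' + inner (C p') (p s - z)) (at s within S)" .
  moreover have "inner (C p') (p s - z) = inner (C (p s - z)) p'" using sym by (metis inner_commute)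
  ultimately show ?thesis by (simp add: has_real_derivative_iff_has_vector_derivative)
qed

lemma (in psd_operator) continuous_form:
  "continuous_on S f \<Longrightarrow> continuous_on S g \<Longrightarrow> continuous_on S (\<lambda>s. inner (C (f s)) (g s))"
  by (intro continuous_on_inner continuous_on_compose2[OF linear_continuous_on[OF bl]]) auto

context memory_kernel begin

text \<open>For a quadratic form, \<open>k * p'\<close> tested with \<open>p\<close> dominates \<open>k\<close> convolved with half the derivative of
  the form, up to the part of \<open>k\<close> that fails to be decreasing: integrate
  \<open>k(t - s) \<langle>C(p(t) - p(s)), p'(s)\<rangle>\<close> by parts.\<close>

lemma convolution_form_pointwise:
  fixes C :: "'h::{real_inner,banach} \<Rightarrow> 'h"
  assumes C: "psd_operator C" and p': "continuous_on {0..T} p'" and p: "\<And>s. s \<in> {0..T} \<Longrightarrow> p s = integral {0..s} p'"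
    and t: "0 < t" "t < T"
  shows "inner (C (p t)) (conv k p' t) \<ge> conv k (\<lambda>s. inner (C (p s)) (p' s)) t
     - M * (T * inner (C (p t)) (p t) + integral {0..t} (\<lambda>s. inner (C (p s)) (p s)))"
proof -
  interpret psd_operator C by fact
  have dp: "(p has_vector_derivative p' s) (at s within {0..T})" if "s \<in> {0..T}" for s
    by (rule has_vector_derivative_transform[OF that _ integral_has_vector_derivative[OF p' that]]) (simp add: p)
  have pc: "continuous_on {0..T} p"
    using dp has_vector_derivative_continuous continuous_on_eq_continuous_within by blast
  \<comment> \<open>Half the form at \<open>p s - p t\<close>. It vanishes to second order at
    \<open>s = t\<close>, exactly where \<open>k (t - s)\<close> is singular, and its derivative is
    \<open>r\<close>.\<close>
  define q where "q = (\<lambda>s. inner (C (p s - p t)) (p s - p t) / 2)"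
  define r where "r = (\<lambda>s. inner (C (p s - p t)) (p' s))"
  have sub: "{0..t} \<subseteq> {0..T}" using t by auto
  note pct = continuous_on_subset[OF pc sub] and p't = continuous_on_subset[OF p' sub]
  have rc: "continuous_on {0..t} r" unfolding r_def by (intro continuous_form continuous_intros pct p't)
  have qc: "continuous_on {0..t} q" unfolding q_def by (intro continuous_form continuous_intros pct) auto
  have q0: "0 \<le> q s" for s using psd by (simp add: q_def)
  have qi: "q integrable_on {0..x}" if "x \<le> t" for x
    by (rule integrable_continuous_real, rule continuous_on_subset[OF qc]) (use that in auto)
  have dq: "(q has_real_derivative r s) (at s within {0..T})" if "s \<in> {0..T}" for s
    unfolding q_def r_def using DERIV_cdivide[OF form_has_derivative[OF dp[OF that], of "p t"], of 2] by simp
  have tT: "t \<le> T" using t by simp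
  define H where "H = (\<lambda>s. k (t - s) * r s)"
  have Hi: "H integrable_on {0..t}" unfolding H_def using conv_integrable[OF kern_k tT rc] by simp
  obtain P where P: "\<And>s. s \<in> {0..T} \<Longrightarrow> norm (p' s) \<le> P" "P > 0"
    using compact_imp_bounded[OF compact_continuous_image[OF p' compact_Icc]] unfolding bounded_pos by blast
  obtain K where K: "K > 0" "\<And>x. norm (C x) \<le> norm x * K" using C.pos_bounded by blast
  have lip: "norm (p s - p t) \<le> P * (t - s)" if "s \<in> {0..t}" for s
  proof -
    have "integral {0..t} p' = integral {0..s} p' + integral {s..t} p'"
      using that p't by (intro Henstock_Kurzweil_Integration.integral_combine[symmetric] integrable_continuous_real) auto
    then have "p t - p s = integral {s..t} p'" using that t p by simp
    moreover have "norm (integral {s..t} p') \<le> P * (t - s)"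
      by (rule integral_bound) (use that t in \<open>auto intro!: P continuous_on_subset[OF p't]\<close>)
    ultimately show ?thesis by (metis \<open>p t - p s = integral {s..t} p'\<close> \<open>norm (integral {s..t} p') \<le> P * (t - s)\<close> norm_minus_commute)
  qed
  have qle: "q s \<le> K * P\<^sup>2 * (t - s)\<^sup>2" if "s \<in> {0..t}" for s
  proof -
    have "inner (C (p s - p t)) (p s - p t) \<le> norm (C (p s - p t)) * norm (p s - p t)" by (rule norm_cauchy_schwarz)
    also have "\<dots> \<le> (norm (p s - p t) * K) * norm (p s - p t)" by (intro mult_right_mono K) auto
    also have "\<dots> = K * (norm (p s - p t))\<^sup>2" by (simp add: power2_eq_square)
    also have "\<dots> \<le> K * (P * (t - s))\<^sup>2" using K by (intro mult_left_mono power_mono lip that) auto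
    finally have "q s \<le> K * (P * (t - s))\<^sup>2 / 2" by (simp add: q_def)
    also have "\<dots> \<le> K * (P * (t - s))\<^sup>2" using K by simp
    finally show ?thesis by (simp add: power_mult_distrib)
  qed
  \<comment> \<open>The integration by parts stops at \<open>x < t\<close>. Its boundary term at
    \<open>x\<close> is of order \<open>t - x\<close> by \<open>qle\<close> and \<open>k_le\<close>,
    and the one at \<open>0\<close> has the favourable sign; afterwards \<open>x\<close> tends to
    \<open>t\<close> by continuity.\<close>
  have step: "K * P\<^sup>2 * c * (t - x) - integral {0..x} H \<ge> - M * integral {0..t} q" if x: "x \<in> {0..<t}" for x
  proof -
    have d: "((\<lambda>s. k (t - s) * q s) has_vector_derivative (- k' (t - s) * q s + k (t - s) * r s)) (at s within {0..x})"
      if s: "s \<in> {0..x}" for s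
    proof -
      have 1: "(k has_real_derivative k' (t - s)) (at (t - s))" using s x t by (intro k_deriv) auto
      have 2: "((\<lambda>s. t - s) has_real_derivative -1) (at s within {0..x})" by (auto intro!: derivative_eq_intros)
      have "((\<lambda>s. k (t - s)) has_real_derivative k' (t - s) * (-1)) (at s within {0..x})"
        by (rule DERIV_chain2[OF 1 2])
      moreover have "(q has_real_derivative r s) (at s within {0..x})"
        by (rule DERIV_subset[OF dq]) (use s x t in auto)
      ultimately have "((\<lambda>s. k (t - s) * q s) has_real_derivative (k' (t - s) * (-1)) * q s + r s * k (t - s)) (at s within {0..x})"
        by (rule DERIV_mult)
      then show ?thesis by (simp add: has_real_derivative_iff_has_vector_derivative[symmetric] mult.commute)
    qed
    have I1: "((\<lambda>s. - k' (t - s) * q s + k (t - s) * r s) has_integral (k (t - x) * q x - k (t - 0) * q 0)) {0..x}"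
      by (rule fundamental_theorem_of_calculus[of 0 x "\<lambda>s. k (t - s) * q s"]) (use x d in auto)
    have I2: "(H has_integral integral {0..x} H) {0..x}"
      by (intro integrable_integral integrable_on_subinterval[OF Hi]) (use x in auto)
    have I3: "((\<lambda>s. M * q s) has_integral M * integral {0..x} q) {0..x}"
      by (intro has_integral_mult_right integrable_integral qi) (use x in auto)
    have I4: "((\<lambda>s. (- k' (t - s) * q s + k (t - s) * r s) - H s + M * q s) has_integral
        (k (t - x) * q x - k (t - 0) * q 0) - integral {0..x} H + M * integral {0..x} q) {0..x}"
      by (intro has_integral_add has_integral_diff I1 I2 I3)
    have "0 \<le> (k (t - x) * q x - k (t - 0) * q 0) - integral {0..x} H + M * integral {0..x} q"
    proof (rule has_integral_nonneg[OF I4])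
      fix s assume "s \<in> {0..x}"
      then have "k' (t - s) \<le> M" using x t by (intro k'_le) auto
      then show "0 \<le> (- k' (t - s) * q s + k (t - s) * r s) - H s + M * q s"
        using mult_right_mono[OF _ q0[of s], of "k' (t - s)" M] by (simp add: H_def)
    qed
    moreover have "k (t - x) * q x \<le> K * P\<^sup>2 * c * (t - x)"
    proof -
      have "k (t - x) * q x \<le> k (t - x) * (K * P\<^sup>2 * (t - x)\<^sup>2)"
        using k_pos[of "t - x"] x t by (intro mult_left_mono qle) auto
      also have "\<dots> = (K * P\<^sup>2 * (t - x)) * ((t - x) * k (t - x))" by (simp add: power2_eq_square)
      also have "\<dots> \<le> (K * P\<^sup>2 * (t - x)) * c" using K x t by (intro mult_left_mono k_le) auto
      finally show ?thesis by (simp add: algebra_simps)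
    qed
    moreover have "0 \<le> k (t - 0) * q 0" using k_pos[of t] t q0[of 0] by simp
    moreover have "M * integral {0..x} q \<le> M * integral {0..t} q"
      by (intro mult_left_mono M_nonneg integral_subset_le qi) (use x q0 in auto)
    ultimately show ?thesis by linarith
  qed
  have Z: "continuous_on {0..t} (\<lambda>x. K * P\<^sup>2 * c * (t - x) - integral {0..x} H)"
    by (intro continuous_intros indefinite_integral_continuous_1 Hi)
  have cl: "closure {0..<t} = {0..t}" using t by simp
  have "K * P\<^sup>2 * c * (t - t) - integral {0..t} H \<ge> - M * integral {0..t} q"
  proof (rule continuous_ge_on_closure[of "{0..<t}" "\<lambda>x. K * P\<^sup>2 * c * (t - x) - integral {0..x} H"])
    show "continuous_on (closure {0..<t}) (\<lambda>x. K * P\<^sup>2 * c * (t - x) - integral {0..x} H)" using Z by (simp only: cl)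
    show "t \<in> closure {0..<t}" using t by (simp add: cl)
  qed (rule step)
  then have A: "integral {0..t} H \<le> M * integral {0..t} q" by simp
  have B: "integral {0..t} H = conv k (\<lambda>s. inner (C (p s)) (p' s)) t - inner (C (p t)) (conv k p' t)"
  proof -
    have c1: "continuous_on {0..t} (\<lambda>s. inner (C (p s)) (p' s))" by (intro continuous_form pct p't)
    have c2: "continuous_on {0..t} (\<lambda>s. inner (C (p t)) (p' s))" by (intro continuous_intros p't)
    have "integral {0..t} H = conv k (\<lambda>s. inner (C (p s)) (p' s) - inner (C (p t)) (p' s)) t"
      by (simp add: H_def r_def conv_def C.diff inner_diff_left)
    also have "\<dots> = conv k (\<lambda>s. inner (C (p s)) (p' s)) t - conv k (\<lambda>s. inner (C (p t)) (p' s)) t"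
      by (rule conv_diff[OF kern_k tT c1 c2])
    also have "conv k (\<lambda>s. inner (C (p t)) (p' s)) t = inner (C (p t)) (conv k p' t)"
      by (rule conv_linear[OF kern_k tT p't bounded_linear_inner_right])
    finally show ?thesis .
  qed
  have \<rho>i: "(\<lambda>s. inner (C (p s)) (p s)) integrable_on {0..t}"
    by (intro integrable_continuous_real continuous_form pct)
  have "integral {0..t} q \<le> integral {0..t} (\<lambda>s. inner (C (p t)) (p t) + inner (C (p s)) (p s))"
  proof (rule integral_le)
    show "q s \<le> inner (C (p t)) (p t) + inner (C (p s)) (p s)" for s
      using form_diff_le[of "p s" "p t"] by (simp add: q_def)
  qed (use qi \<rho>i in \<open>auto intro!: integrable_add\<close>)
  also have "\<dots> = t * inner (C (p t)) (p t) + integral {0..t} (\<lambda>s. inner (C (p s)) (p s))"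
    using t by (subst integral_add) (auto simp: \<rho>i)
  also have "\<dots> \<le> T * inner (C (p t)) (p t) + integral {0..t} (\<lambda>s. inner (C (p s)) (p s))"
    using t psd by (intro add_right_mono mult_right_mono) auto
  finally have "M * integral {0..t} q \<le> M * (T * inner (C (p t)) (p t) + integral {0..t} (\<lambda>s. inner (C (p s)) (p s)))"
    by (rule mult_left_mono[OF _ M_nonneg])
  with A B show ?thesis by linarith
qed

text \<open>The pointwise inequality is integrated over \<open>{0..t}\<close>. Here
  \<open><C p, p'>\<close> is half the derivative of the form, which vanishes at \<open>0\<close>;
  as convolutions commute, integrating its convolution with \<open>k\<close> leaves \<open>k\<close>
  convolved with half the form. Each of the two remainders is at most \<open>M * T\<close> times the
  integral of the form.\<close>

lemma convolution_form_lower: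
  fixes C :: "'h::{real_inner,banach} \<Rightarrow> 'h"
  assumes C: "psd_operator C" and p': "continuous_on {0..T} p'" and p: "\<And>s. s \<in> {0..T} \<Longrightarrow> p s = integral {0..s} p'"
    and t: "0 \<le> t" "t \<le> T"
  shows "integral {0..t} (\<lambda>s. inner (C (p s)) (conv k p' s)) \<ge> conv k (\<lambda>s. inner (C (p s)) (p s)) t / 2
     - 2 * M * T * integral {0..t} (\<lambda>s. inner (C (p s)) (p s))"
proof -
  interpret psd_operator C by fact
  have dp: "(p has_vector_derivative p' s) (at s within {0..T})" if "s \<in> {0..T}" for s
    by (rule has_vector_derivative_transform[OF that _ integral_has_vector_derivative[OF p' that]]) (simp add: p)
  have pc: "continuous_on {0..T} p"
    using dp has_vector_derivative_continuous continuous_on_eq_continuous_within by blast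
  define \<rho> where "\<rho> = (\<lambda>s. inner (C (p s)) (p s))"
  define \<sigma> where "\<sigma> = (\<lambda>s. inner (C (p s)) (p' s))"
  define R where "R = (\<lambda>s. integral {0..s} \<rho>)"
  have \<rho>c: "continuous_on {0..T} \<rho>" unfolding \<rho>_def by (intro continuous_form pc)
  have \<sigma>c: "continuous_on {0..T} \<sigma>" unfolding \<sigma>_def by (intro continuous_form pc p')
  have \<rho>0: "0 \<le> \<rho> s" for s unfolding \<rho>_def by (rule psd)
  have sub: "{0..s} \<subseteq> {0..T}" if "s \<le> T" for s using that by auto
  have \<rho>i: "\<rho> integrable_on {0..s}" if "s \<le> T" for s
    by (rule integrable_continuous_real[OF continuous_on_subset[OF \<rho>c sub[OF that]]])
  have kp: "continuous_on {0..T} (conv k p')" by (rule conv_continuous[OF kern_k p'])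
  have k\<sigma>: "continuous_on {0..T} (conv k \<sigma>)" by (rule conv_continuous[OF kern_k \<sigma>c])
  have Rc: "continuous_on {0..T} R" unfolding R_def by (rule indefinite_integral_continuous_1[OF \<rho>i]) simp
  let ?f = "\<lambda>s. inner (C (p s)) (conv k p' s) - conv k \<sigma> s + M * (T * \<rho> s + R s)"
  have fc: "continuous_on {0..T} ?f"
    by (intro continuous_intros continuous_form pc kp k\<sigma> Rc \<rho>c)
  have f0: "0 \<le> ?f s" if "s \<in> {0..T}" for s
  proof (rule continuous_ge_on_closure[of "{0<..<T}" ?f])
    show "continuous_on (closure {0<..<T}) ?f" using fc T_pos by simp
    show "s \<in> closure {0<..<T}" using that T_pos by simp
    show "0 \<le> ?f x" if "x \<in> {0<..<T}" for x
      using convolution_form_pointwise[OF C p' p, of x] that unfolding \<rho>_def \<sigma>_def R_def by simp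
  qed
  have \<sigma>\<rho>: "integral {0..s} \<sigma> = \<rho> s / 2" if "s \<in> {0..T}" for s
  proof -
    have "(\<sigma> has_integral (\<rho> s / 2 - \<rho> 0 / 2)) {0..s}"
    proof (rule fundamental_theorem_of_calculus[of 0 s "\<lambda>s. \<rho> s / 2"])
      fix x assume x: "x \<in> {0..s}"
      have "x \<in> {0..T}" using x that by auto
      from has_vector_derivative_within_subset[OF dp[OF this]] x that
      have "(p has_vector_derivative p' x) (at x within {0..s})" by auto
      from DERIV_cdivide[OF form_has_derivative[OF this, of 0], of 2]
      show "((\<lambda>s. \<rho> s / 2) has_vector_derivative \<sigma> x) (at x within {0..s})"
        by (simp add: \<rho>_def \<sigma>_def has_real_derivative_iff_has_vector_derivative)
    qed (use that in auto)
    moreover have "\<rho> 0 = 0" using p[of 0] T_pos by (simp add: \<rho>_def C.zero)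
    ultimately show ?thesis by (simp add: integral_unique)
  qed
  have k\<sigma>_int: "integral {0..t} (conv k \<sigma>) = conv k \<rho> t / 2"
  proof -
    have "integral {0..t} (conv k \<sigma>) = conv (beta_kernel 1) (conv k \<sigma>) t" by (simp add: conv_beta1)
    also have "\<dots> = conv k (conv (beta_kernel 1) \<sigma>) t"
      by (rule conv_left_commute[OF kern_beta kern_k \<sigma>c t]) simp
    also have "\<dots> = conv k (\<lambda>s. (1/2) *\<^sub>R \<rho> s) t"
      by (rule conv_cong) (use t in \<open>simp add: conv_beta1 \<sigma>\<rho>\<close>)
    finally show ?thesis by (simp only: conv_scaleR) simp
  qed
  have i1: "(\<lambda>s. inner (C (p s)) (conv k p' s)) integrable_on {0..t}"
    by (intro integrable_continuous_real continuous_on_subset[OF _ sub[OF t(2)]] continuous_form pc kp)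
  have i2: "conv k \<sigma> integrable_on {0..t}"
    by (intro integrable_continuous_real continuous_on_subset[OF _ sub[OF t(2)]] k\<sigma>)
  have i3: "R integrable_on {0..t}"
    by (intro integrable_continuous_real continuous_on_subset[OF _ sub[OF t(2)]] Rc)
  have "0 \<le> integral {0..t} ?f"
    by (rule integral_nonneg) (use f0 t in \<open>auto intro!: integrable_add integrable_diff i1 i2 i3 \<rho>i integrable_on_mult_right\<close>)
  also have "\<dots> = integral {0..t} (\<lambda>s. inner (C (p s)) (conv k p' s)) - integral {0..t} (conv k \<sigma>) + M * (T * R t + integral {0..t} R)"
    using i1 i2 i3 \<rho>i[OF t(2)]
    by (simp add: integral_add integral_diff integrable_add integrable_diff integrable_on_mult_right R_def)
  finally have 1: "0 \<le> integral {0..t} (\<lambda>s. inner (C (p s)) (conv k p' s)) - conv k \<rho> t / 2 + M * (T * R t + integral {0..t} R)"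
    by (simp add: k\<sigma>_int)
  have "integral {0..t} R \<le> integral {0..t} (\<lambda>_. R t)"
  proof (rule integral_le[OF i3])
    show "R s \<le> R t" if "s \<in> {0..t}" for s
      unfolding R_def by (rule integral_subset_le) (use that t \<rho>0 \<rho>i in auto)
  qed auto
  also have "\<dots> \<le> T * R t"
  proof -
    have "0 \<le> R t" unfolding R_def by (rule integral_nonneg) (use \<rho>i t \<rho>0 in auto)
    then show ?thesis using t by (simp add: mult_right_mono)
  qed
  finally have "M * (T * R t + integral {0..t} R) \<le> M * (T * R t + T * R t)" by (intro mult_left_mono M_nonneg) simp
  with 1 have "conv k \<rho> t / 2 - 2 * M * T * R t \<le> integral {0..t} (\<lambda>s. inner (C (p s)) (conv k p' s))"
    by (simp add: algebra_simps)
  then show ?thesis by (simp only: R_def \<rho>_def)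
qed

end

subsection \<open>Mollification in time\<close>

text \<open>The Yosida approximation of the identity for \<open>d/dt\<close> with zero initial
  value: \<open>p = conv (mollifier n) v\<close> solves \<open>p' = n (v - p)\<close>,
  \<open>p 0 = 0\<close>. Being a causal convolution it commutes with all the others, and it makes a
  continuous \<open>v\<close> continuously differentiable.\<close>

definition mollifier :: "nat \<Rightarrow> real \<Rightarrow> real" where
  "mollifier n s = real n * exp (- (real n * s))"

lemma kern_mollifier: "kern T (mollifier n)"
  unfolding mollifier_def by (intro kern_continuous continuous_intros)

lemma integral_mollifier:
  assumes "0 \<le> t" shows "(mollifier n has_integral 1 - exp (- (real n * t))) {0..t}"
proof -
  have "(mollifier n has_integral - exp (- (real n * t)) - - exp (- (real n * 0))) {0..t}"
    by (rule fundamental_theorem_of_calculus[OF assms])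
      (auto simp: mollifier_def has_real_derivative_iff_has_vector_derivative[symmetric] intro!: derivative_eq_intros)
  then show ?thesis by simp
qed

lemma norm_mollify_le:
  fixes v :: "real \<Rightarrow> 'b::banach"
  assumes v: "continuous_on {0..t} v" and V: "\<And>s. 0 \<le> s \<Longrightarrow> s \<le> t \<Longrightarrow> norm (v s) \<le> V" and t: "0 \<le> t"
  shows "norm (conv (mollifier n) v t) \<le> V"
proof -
  have "norm (conv (mollifier n) v t) \<le> integral {0..t} (\<lambda>s. \<bar>mollifier n s\<bar>) * V"
    by (rule norm_conv_le[OF kern_mollifier order_refl v V t])
  also have "integral {0..t} (\<lambda>s. \<bar>mollifier n s\<bar>) = 1 - exp (- (real n * t))"
  proof -
    have "(\<lambda>s. \<bar>mollifier n s\<bar>) = mollifier n" by (auto simp: mollifier_def)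
    then show ?thesis using integral_mollifier[OF t, of n] by (simp add: integral_unique)
  qed
  also have "(1 - exp (- (real n * t))) * V \<le> 1 * V"
    using V[of 0] t norm_ge_zero order_trans by (metis eq_diff_eq exp_ge_zero le_add_same_cancel1 le_numeral_extra(3) mult_right_mono)
  finally show ?thesis by simp
qed

lemma mollify_tendsto:
  fixes v :: "real \<Rightarrow> 'b::banach"
  assumes v: "continuous_on {0..t} v" and t: "0 < t"
  shows "(\<lambda>n. conv (mollifier n) v t) \<longlonglongrightarrow> v t"
proof -
  let ?w = "\<lambda>s. v s - v t"
  have wc: "continuous_on {0..t} ?w" by (intro continuous_intros v)
  obtain W where W: "W > 0" "\<And>s. s \<in> {0..t} \<Longrightarrow> norm (?w s) \<le> W"
    using compact_imp_bounded[OF compact_continuous_image[OF wc compact_Icc]] unfolding bounded_pos by auto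
  have lim0: "(\<lambda>n. conv (mollifier n) ?w t) \<longlonglongrightarrow> 0"
  proof (rule LIMSEQ_I)
    fix e :: real assume e: "e > 0"
    obtain d where d: "d > 0" "\<And>s. s \<in> {0..t} \<Longrightarrow> dist s t < d \<Longrightarrow> dist (v s) (v t) < e / 2"
      using v t e unfolding continuous_on_iff by (metis atLeastAtMost_iff half_gt_zero less_imp_le order_refl)
    \<comment> \<open>One affine bound serves both ranges: continuity of \<open>v\<close> controls
      \<open>s < d\<close>, and beyond \<open>d\<close> the factor \<open>s / d\<close> is at least
      one. Against the mollifier the linear part contributes a first moment of at most
      \<open>1 / n\<close>.\<close>
    have wle: "norm (?w (t - s)) \<le> e / 2 + W / d * s" if s: "s \<in> {0..t}" for s
    proof (cases "s < d")
      case True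
      then have "norm (?w (t - s)) \<le> e / 2" using d(2)[of "t - s"] s by (simp add: dist_norm)
      moreover have "0 \<le> W / d * s" using W d s by simp
      ultimately show ?thesis by linarith
    next
      case False
      then have "W * 1 \<le> W * (s / d)" using W d by (intro mult_left_mono) auto
      moreover have "norm (?w (t - s)) \<le> W" using s by (intro W) auto
      ultimately show ?thesis using e by simp
    qed
    have bound: "norm (conv (mollifier n) ?w t) \<le> e / 2 + W / d / real n" if n: "n > 0" for n
    proof -
      have I1: "((\<lambda>s. mollifier n s * s) has_integral (- (t + 1 / real n) * exp (- (real n * t)) - - (0 + 1 / real n) * exp (- (real n * 0)))) {0..t}"
        by (rule fundamental_theorem_of_calculus)
          (use t n in \<open>auto simp: mollifier_def has_real_derivative_iff_has_vector_derivative[symmetric] field_simps intro!: derivative_eq_intros\<close>)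
      have I2: "((\<lambda>s. (e/2) * mollifier n s + (W / d) * (mollifier n s * s)) has_integral
        (e/2) * (1 - exp (- (real n * t))) + (W / d) * (- (t + 1 / real n) * exp (- (real n * t)) - - (0 + 1 / real n) * exp (- (real n * 0)))) {0..t}"
        by (intro has_integral_add has_integral_mult_right I1 integral_mollifier) (use t in auto)
      have "norm (conv (mollifier n) ?w t) \<le> integral {0..t} (\<lambda>s. (e/2) * mollifier n s + (W / d) * (mollifier n s * s))"
        unfolding conv_commute
      proof (rule Henstock_Kurzweil_Integration.integral_norm_bound_integral)
        show "(\<lambda>s. mollifier n s *\<^sub>R ?w (t - s)) integrable_on {0..t}"
          by (rule conv_integrable'[OF kern_mollifier order_refl wc])
        show "(\<lambda>s. (e/2) * mollifier n s + (W / d) * (mollifier n s * s)) integrable_on {0..t}" using I2 by blast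
        show "norm (mollifier n s *\<^sub>R ?w (t - s)) \<le> (e/2) * mollifier n s + (W / d) * (mollifier n s * s)" if "s \<in> {0..t}" for s
        proof -
          have m: "mollifier n s \<ge> 0" by (simp add: mollifier_def)
          then have "norm (mollifier n s *\<^sub>R ?w (t - s)) \<le> mollifier n s * (e / 2 + W / d * s)"
            using mult_left_mono[OF wle[OF that] m] by simp
          then show ?thesis by (simp add: algebra_simps)
        qed
      qed
      also have "\<dots> = (e/2) * (1 - exp (- (real n * t))) + (W / d) * (- (t + 1 / real n) * exp (- (real n * t)) - - (0 + 1 / real n) * exp (- (real n * 0)))"
        using I2 by (rule integral_unique)
      also have "\<dots> \<le> (e/2) * 1 + (W / d) * (1 / real n)"
      proof (intro add_mono mult_left_mono)
        show "- (t + 1 / real n) * exp (- (real n * t)) - - (0 + 1 / real n) * exp (- (real n * 0)) \<le> 1 / real n"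
        proof -
          have "0 \<le> (t + 1 / real n) * exp (- (real n * t))" using t by (intro mult_nonneg_nonneg) auto
          then show ?thesis by (simp add: algebra_simps)
        qed
      qed (use e W d in auto)
      finally show ?thesis by simp
    qed
    obtain N :: nat where N: "real N > 2 * (W / d) / e" using reals_Archimedean2 by blast
    have N0: "real N > 0"
      using N W d e by (meson divide_pos_pos less_trans mult_pos_pos zero_less_numeral)
    have "norm (conv (mollifier n) ?w t - 0) < e" if "n \<ge> N" for n
    proof -
      have n: "real n \<ge> real N" "n > 0" using that N0 by auto
      have "2 * (W / d) / e < real n" using N n by linarith
      then have "2 * (W / d) < real n * e" using pos_divide_less_eq[OF e] by metis
      then have "W / d < e / 2 * real n" by (simp add: mult.commute)
      moreover have "0 < real n" using n by simp
      ultimately have "W / d / real n < e / 2" using pos_divide_less_eq by metis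
      with bound[OF n(2)] have "norm (conv (mollifier n) ?w t) < e" by linarith
      then show ?thesis by simp
    qed
    then show "\<exists>no. \<forall>n\<ge>no. norm (conv (mollifier n) ?w t - 0) < e" by blast
  qed
  have "conv (mollifier n) v t = conv (mollifier n) ?w t + (1 - exp (- (real n * t))) *\<^sub>R v t" for n
  proof -
    have "conv (mollifier n) (\<lambda>s. v t) t = (1 - exp (- (real n * t))) *\<^sub>R v t"
      unfolding conv_commute by (intro integral_unique has_integral_scaleR_left integral_mollifier) (use t in auto)
    moreover have "conv (mollifier n) ?w t = conv (mollifier n) v t - conv (mollifier n) (\<lambda>s. v t) t"
      by (rule conv_diff[OF kern_mollifier order_refl v]) auto
    ultimately show ?thesis by simp
  qed
  moreover have "(\<lambda>n. conv (mollifier n) ?w t + (1 - exp (- (real n * t))) *\<^sub>R v t) \<longlonglongrightarrow> 0 + (1 - 0) *\<^sub>R v t"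
  proof (intro tendsto_intros lim0)
    have "(\<lambda>n. exp (- t) ^ n) \<longlonglongrightarrow> 0" using t by (intro LIMSEQ_power_zero) auto
    then show "(\<lambda>n. exp (- (real n * t))) \<longlonglongrightarrow> 0" by (simp add: exp_of_nat_mult[symmetric])
  qed
  ultimately show ?thesis by simp
qed

lemma conv_scale_left:
  fixes u :: "real \<Rightarrow> 'b::banach"
  shows "conv (\<lambda>s. c * a s) u t = c *\<^sub>R conv a u t"
  unfolding conv_def using integral_cmul[of "{0..t}" c "\<lambda>s. a (t - s) *\<^sub>R u s"] by simp

text \<open>Integral form of \<open>p' = n (v - p)\<close>. It is the kernel identity
  \<open>n = n exp (- n s) + n (1 - exp (- n s))\<close> convolved with \<open>v\<close>, so nothing
  has to be differentiated.\<close>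

lemma mollify_integral:
  fixes v :: "real \<Rightarrow> 'h::{real_inner,banach}"
  assumes v: "continuous_on {0..T} v" and t: "0 \<le> t" "t \<le> T"
  shows "conv (mollifier n) v t = integral {0..t} (\<lambda>s. real n *\<^sub>R (v s - conv (mollifier n) v s))"
proof -
  let ?E = "mollifier n" and ?b = "beta_kernel 1"
  have kb: "kern T ?b" by (rule kern_beta) simp
  have kE: "kern T ?E" by (rule kern_mollifier)
  have kbE: "kern T (conv ?b ?E)" by (rule kern_conv[OF kb kE])
  have vt: "continuous_on {0..t} v" using v t by (auto intro: continuous_on_subset)
  have Evt: "continuous_on {0..t} (conv ?E v)" using conv_continuous[OF kE v] t by (auto intro: continuous_on_subset)
  have kn: "kern T (\<lambda>s. real n * conv ?b ?E s)"
    using kbE unfolding kern_def by (auto intro!: continuous_intros)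
  have "real n *\<^sub>R conv ?b v t = conv (\<lambda>s. real n * ?b s) v t" by (simp add: conv_scale_left)
  also have "\<dots> = conv (\<lambda>s. ?E s + real n * conv ?b ?E s) v t"
  proof (rule conv_cong_left)
    fix s :: real assume s: "0 < s"
    have c: "conv ?b ?E s = 1 - exp (- (real n * s))"
      using integral_mollifier[of s n] s by (simp add: conv_beta1 integral_unique)
    show "real n * ?b s = ?E s + real n * conv ?b ?E s"
      using s c by (simp add: beta_kernel_def mollifier_def right_diff_distrib)
  qed
  also have "\<dots> = conv ?E v t + real n *\<^sub>R conv (conv ?b ?E) v t"
    using conv_add_left[OF kE kn t(2) vt] by (simp add: conv_scale_left)
  also have "conv (conv ?b ?E) v t = conv ?b (conv ?E v) t" by (rule conv_assoc[OF kb kE v t, symmetric])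
  finally have "conv ?E v t = real n *\<^sub>R conv ?b v t - real n *\<^sub>R conv ?b (conv ?E v) t" by simp
  also have "\<dots> = real n *\<^sub>R conv ?b (\<lambda>s. v s - conv ?E v s) t"
    using conv_diff[OF kb t(2) vt Evt] by (simp add: scaleR_diff_right)
  also have "\<dots> = conv ?b (\<lambda>s. real n *\<^sub>R (v s - conv ?E v s)) t" by (simp only: conv_scaleR)
  finally show ?thesis by (simp add: conv_beta1)
qed

section \<open>The energy estimate for continuous velocities\<close>

lemma integral_nonneg_spike:
  fixes f :: "real \<Rightarrow> real"
  assumes "f integrable_on S" "finite F" "\<And>x. x \<in> S - F \<Longrightarrow> 0 \<le> f x"
  shows "0 \<le> integral S f"
proof -
  let ?g = "\<lambda>x. if x \<in> F then 0 else f x"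
  have "integral S f = integral S ?g"
    by (rule integral_spike[of F]) (use assms(2) in auto)
  moreover have "?g integrable_on S" by (rule integrable_spike_finite[OF assms(2) _ assms(1)]) auto
  then have "0 \<le> integral S ?g" by (rule integral_nonneg) (use assms(3) in auto)
  ultimately show ?thesis by simp
qed

lemma bounded_on_interval:
  fixes v :: "real \<Rightarrow> 'b::real_normed_vector"
  assumes "continuous_on {0..T} v"
  obtains V where "V > 0" "\<And>s. s \<in> {0..T} \<Longrightarrow> norm (v s) \<le> V"
  using compact_imp_bounded[OF compact_continuous_image[OF assms compact_Icc]] unfolding bounded_pos by auto

text \<open>The number \<open>m\<close> counts the delays needed to walk from \<open>t\<close> back
  to \<open>0\<close>; clamping at \<open>0\<close> covers a last, shorter step.\<close>

lemma delay_gronwall: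
  fixes S :: "real \<Rightarrow> real" and X :: real
  assumes S0: "S 0 \<le> 0" and \<delta>: "\<delta> > 0" and X: "X \<ge> 0"
    and step: "\<And>t. 0 \<le> t \<Longrightarrow> t \<le> T \<Longrightarrow> S t \<le> 2 * S (max 0 (t - \<delta>)) + X"
    and t: "0 \<le> t" "t \<le> T" "t \<le> real m * \<delta>"
  shows "S t \<le> 2 ^ m * X"
proof -
  \<comment> \<open>The factor \<open>2 ^ m - 1\<close> is the exact solution of the recursion
    \<open>x' = 2 x + 1\<close> started at zero, hence the invariant carried by the
    induction.\<close>
  have "S t \<le> (2 ^ m - 1) * X" using t
  proof (induction m arbitrary: t)
    case 0
    then show ?case using S0 by simp
  next
    case (Suc m)
    have "S (max 0 (t - \<delta>)) \<le> (2 ^ m - 1) * X"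
      by (rule Suc.IH) (use Suc.prems \<delta> in \<open>auto simp: algebra_simps\<close>)
    then show ?case using step[of t] Suc.prems by (simp add: algebra_simps)
  qed
  also have "\<dots> \<le> 2 ^ m * X" using X by (intro mult_right_mono) auto
  finally show ?thesis .
qed

context memory_kernel begin

text \<open>Extends \<open>convolution_form_lower\<close> to a velocity that is only continuous. The
  point is that \<open>k\<close> convolved with the derivative of the mollified \<open>v\<close> is
  the mollified \<open>D\<close>: both have the same running integral. Bounded convergence then
  removes the mollifier; \<open>v 0 = 0\<close> gives convergence at time zero, where every
  mollification vanishes.\<close>

lemma energy_lower:
  fixes C :: "'h::{real_inner,banach} \<Rightarrow> 'h"
  assumes C: "psd_operator C" and v: "continuous_on {0..T} v" and D: "continuous_on {0..T} D" and v0: "v 0 = 0"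
    and kv: "\<And>t. t \<in> {0..T} \<Longrightarrow> conv k v t = integral {0..t} D" and t: "0 \<le> t" "t \<le> T"
  shows "integral {0..t} (\<lambda>s. inner (C (v s)) (D s)) \<ge> conv k (\<lambda>s. inner (C (v s)) (v s)) t / 2
     - 2 * M * T * integral {0..t} (\<lambda>s. inner (C (v s)) (v s))"
proof -
  interpret psd_operator C by fact
  let ?E = "mollifier" and ?b = "beta_kernel 1"
  have kE: "kern T (?E n)" for n by (rule kern_mollifier)
  have kb: "kern T ?b" by (rule kern_beta) simp
  define p where "p = (\<lambda>n. conv (?E n) v)"
  define p' where "p' = (\<lambda>n s. real n *\<^sub>R (v s - p n s))"
  define q where "q = (\<lambda>n. conv (?E n) D)"
  have sub: "{0..t} \<subseteq> {0..T}" using t by auto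
  have pc: "continuous_on {0..T} (p n)" for n unfolding p_def by (rule conv_continuous[OF kE v])
  have qc: "continuous_on {0..T} (q n)" for n unfolding q_def by (rule conv_continuous[OF kE D])
  have p'c: "continuous_on {0..T} (p' n)" for n unfolding p'_def by (intro continuous_intros v pc)
  have pint: "p n s = integral {0..s} (p' n)" if "s \<in> {0..T}" for n s
    using mollify_integral[OF v, of s n] that by (simp add: p_def p'_def)
  have kp': "conv k (p' n) s = q n s" if s: "s \<in> {0..T}" for n s
  proof (rule conv_beta1_inject[OF conv_continuous[OF kern_k p'c] qc _ T_pos])
    fix r assume r: "0 \<le> r" "r \<le> T"
    have "conv ?b (conv k (p' n)) r = conv k (conv ?b (p' n)) r" by (rule conv_left_commute[OF kb kern_k p'c r])
    also have "\<dots> = conv k (conv (?E n) v) r"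
      by (rule conv_cong) (use r pint in \<open>auto simp: conv_beta1 p_def\<close>)
    also have "\<dots> = conv (?E n) (conv k v) r" by (rule conv_left_commute[OF kern_k kE v r])
    also have "\<dots> = conv (?E n) (conv ?b D) r"
      by (rule conv_cong) (use r kv in \<open>auto simp: conv_beta1\<close>)
    also have "\<dots> = conv ?b (q n) r" unfolding q_def by (rule conv_left_commute[OF kE kb D r])
    finally show "conv ?b (conv k (p' n)) r = conv ?b (q n) r" .
  qed (use s in auto)
  obtain V where V: "V > 0" "\<And>s. s \<in> {0..T} \<Longrightarrow> norm (v s) \<le> V" using bounded_on_interval[OF v] by blast
  obtain W where W: "W > 0" "\<And>s. s \<in> {0..T} \<Longrightarrow> norm (D s) \<le> W" using bounded_on_interval[OF D] by blast
  obtain K where K: "K > 0" "\<And>x. norm (C x) \<le> norm x * K" using C.pos_bounded by blast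
  have pV: "norm (p n s) \<le> V" if "s \<in> {0..T}" for n s
    unfolding p_def by (rule norm_mollify_le) (use that V in \<open>auto intro: continuous_on_subset[OF v]\<close>)
  have qW: "norm (q n s) \<le> W" if "s \<in> {0..T}" for n s
    unfolding q_def by (rule norm_mollify_le) (use that W in \<open>auto intro: continuous_on_subset[OF D]\<close>)
  have form_le: "\<bar>inner (C x) y\<bar> \<le> V * K * Y" if "norm x \<le> V" "norm y \<le> Y" for x y Y
  proof -
    have "\<bar>inner (C x) y\<bar> \<le> norm (C x) * norm y" by (rule Cauchy_Schwarz_ineq2)
    also have "\<dots> \<le> (V * K) * Y"
    proof (rule mult_mono)
      show "norm (C x) \<le> V * K" using K(2)[of x] mult_right_mono[OF that(1), of K] K(1) by linarith
    qed (use that V K in auto)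
    finally show ?thesis .
  qed
  have plim: "(\<lambda>n. p n s) \<longlonglongrightarrow> v s" if "s \<in> {0..T}" for s
  proof (cases "s = 0")
    case True
    then show ?thesis using v0 by (simp add: p_def)
  next
    case False
    then show ?thesis unfolding p_def
      by (intro mollify_tendsto) (use that in \<open>auto intro: continuous_on_subset[OF v]\<close>)
  qed
  have Clim: "(\<lambda>n. C (p n s)) \<longlonglongrightarrow> C (v s)" if "s \<in> {0..T}" for s
    by (rule C.tendsto[OF plim[OF that]])
  have qlim: "(\<lambda>n. inner (C (p n s)) (q n s)) \<longlonglongrightarrow> inner (C (v s)) (D s)" if s: "s \<in> {0..T}" for s
  proof (cases "s = 0")
    case True
    then show ?thesis using v0 by (simp add: p_def q_def C.zero)
  next
    case False
    have "(\<lambda>n. q n s) \<longlonglongrightarrow> D s" unfolding q_def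
      by (rule mollify_tendsto) (use s False in \<open>auto intro: continuous_on_subset[OF D]\<close>)
    then show ?thesis by (rule tendsto_inner[OF Clim[OF s]])
  qed
  have \<rho>lim: "(\<lambda>n. inner (C (p n s)) (p n s)) \<longlonglongrightarrow> inner (C (v s)) (v s)" if "s \<in> {0..T}" for s
    by (rule tendsto_inner[OF Clim[OF that] plim[OF that]])
  have L1: "(\<lambda>n. integral {0..t} (\<lambda>s. inner (C (p n s)) (q n s))) \<longlonglongrightarrow> integral {0..t} (\<lambda>s. inner (C (v s)) (D s))"
  proof (rule dominated_convergence(2)[where h = "\<lambda>_. V * K * W"])
    show "(\<lambda>s. inner (C (p n s)) (q n s)) integrable_on {0..t}" for n
      by (intro integrable_continuous_real continuous_form continuous_on_subset[OF pc sub] continuous_on_subset[OF qc sub])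
    show "norm (inner (C (p n s)) (q n s)) \<le> V * K * W" if "s \<in> {0..t}" for n s
      using that t by (auto intro!: form_le pV qW)
    show "(\<lambda>n. inner (C (p n s)) (q n s)) \<longlonglongrightarrow> inner (C (v s)) (D s)" if "s \<in> {0..t}" for s
      using that t by (intro qlim) auto
  qed auto
  have \<rho>i: "continuous_on {0..t} (\<lambda>s. inner (C (p n s)) (p n s))" for n
    by (intro continuous_form continuous_on_subset[OF pc sub])
  have L2: "(\<lambda>n. integral {0..t} (\<lambda>s. inner (C (p n s)) (p n s))) \<longlonglongrightarrow> integral {0..t} (\<lambda>s. inner (C (v s)) (v s))"
  proof (rule dominated_convergence(2)[where h = "\<lambda>_. V * K * V"])
    show "(\<lambda>s. inner (C (p n s)) (p n s)) integrable_on {0..t}" for n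
      by (rule integrable_continuous_real[OF \<rho>i])
    show "norm (inner (C (p n s)) (p n s)) \<le> V * K * V" if "s \<in> {0..t}" for n s
      using that t by (auto intro!: form_le pV)
    show "(\<lambda>n. inner (C (p n s)) (p n s)) \<longlonglongrightarrow> inner (C (v s)) (v s)" if "s \<in> {0..t}" for s
      using that t by (intro \<rho>lim) auto
  qed auto
  have L3: "(\<lambda>n. conv k (\<lambda>s. inner (C (p n s)) (p n s)) t) \<longlonglongrightarrow> conv k (\<lambda>s. inner (C (v s)) (v s)) t"
    unfolding conv_def
  proof (rule dominated_convergence(2)[where h = "\<lambda>s. \<bar>k (t - s)\<bar> * (V * K * V)"])
    show "(\<lambda>s. k (t - s) *\<^sub>R inner (C (p n s)) (p n s)) integrable_on {0..t}" for n
      by (rule conv_integrable[OF kern_k t(2) \<rho>i])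
    have "(\<lambda>s. \<bar>k (t - s)\<bar>) integrable_on {0..t}"
      by (rule absolutely_integrable_realD(2)[OF kern_reflect[OF kern_k t(2)]])
    then show "(\<lambda>s. \<bar>k (t - s)\<bar> * (V * K * V)) integrable_on {0..t}" using integrable_on_mult_left by blast
    show "norm (k (t - s) *\<^sub>R inner (C (p n s)) (p n s)) \<le> \<bar>k (t - s)\<bar> * (V * K * V)" if "s \<in> {0..t}" for n s
      using that t form_le[OF pV[of s n] pV[of s n]] by (auto simp: abs_mult intro!: mult_left_mono)
    show "(\<lambda>n. k (t - s) *\<^sub>R inner (C (p n s)) (p n s)) \<longlonglongrightarrow> k (t - s) *\<^sub>R inner (C (v s)) (v s)" if "s \<in> {0..t}" for s
      using that t by (intro tendsto_scaleR tendsto_const \<rho>lim) auto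
  qed
  have ineq: "conv k (\<lambda>s. inner (C (p n s)) (p n s)) t / 2 - 2 * M * T * integral {0..t} (\<lambda>s. inner (C (p n s)) (p n s))
      \<le> integral {0..t} (\<lambda>s. inner (C (p n s)) (q n s))" for n
  proof -
    have "integral {0..t} (\<lambda>s. inner (C (p n s)) (conv k (p' n) s)) = integral {0..t} (\<lambda>s. inner (C (p n s)) (q n s))"
      by (rule integral_cong) (use t in \<open>simp add: kp'\<close>)
    then show ?thesis using convolution_form_lower[OF C p'c pint t, of n] by simp
  qed
  have lim: "(\<lambda>n. conv k (\<lambda>s. inner (C (p n s)) (p n s)) t / 2 - 2 * M * T * integral {0..t} (\<lambda>s. inner (C (p n s)) (p n s)))
     \<longlonglongrightarrow> conv k (\<lambda>s. inner (C (v s)) (v s)) t / 2 - 2 * M * T * integral {0..t} (\<lambda>s. inner (C (v s)) (v s))"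
    by (intro tendsto_intros L2 L3) simp
  show ?thesis by (rule LIMSEQ_le[OF lim L1]) (use ineq in blast)
qed

text \<open>The differential form \<open>C D + \<kappa> u = G\<close>, \<open>D = k * u''\<close> of the evolution equation, written with \<open>v = u' - u1\<close>.\<close>

definition evolution ::
  "real \<Rightarrow> ('h::{real_inner,banach} \<Rightarrow> 'h) \<Rightarrow> (real \<Rightarrow> 'h) \<Rightarrow> 'h \<Rightarrow> 'h \<Rightarrow> (real \<Rightarrow> 'h) \<Rightarrow> (real \<Rightarrow> 'h) \<Rightarrow> (real \<Rightarrow> 'h) \<Rightarrow> bool" where
  "evolution \<kappa> C G u0 u1 u v D \<longleftrightarrow> continuous_on {0..T} v \<and> continuous_on {0..T} D \<and> v 0 = 0 \<and>
     (\<forall>t\<in>{0..T}. conv k v t = integral {0..t} D \<and> u t = u0 + t *\<^sub>R u1 + integral {0..t} v \<and> C (D t) + \<kappa> *\<^sub>R u t = G t)"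

text \<open>The equation is tested with \<open>v\<close> and integrated. Since
  \<open>v = u' - u1\<close>, the term with \<open>u\<close> is the derivative of half the squared
  norm minus a product with \<open>u1\<close>, and \<open>energy_lower\<close> takes care of
  \<open>D\<close>. As the data are measured against the square root of the form, no norm of
  \<open>C\<close> enters the constants.\<close>

lemma energy_inequality:
  fixes C :: "'h::{real_inner,banach} \<Rightarrow> 'h"
  assumes C: "psd_operator C" and ev: "evolution \<kappa> C G u0 u1 u v D" and \<kappa>: "\<kappa> > 0"
    and G: "\<And>t x. t \<in> {0..T} \<Longrightarrow> inner (G t) x \<le> m * sqrt (inner (C x) x)"
    and t: "t \<in> {0..T}"
  shows "\<kappa> * (norm (u t))\<^sup>2 + conv k (\<lambda>s. inner (C (v s)) (v s)) t
     \<le> (\<kappa> + \<kappa> * T + T) * (m\<^sup>2 + (norm u0)\<^sup>2 + (norm u1)\<^sup>2)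
       + (1 + 4 * M * T) * integral {0..t} (\<lambda>s. inner (C (v s)) (v s) + \<kappa> * (norm (u s))\<^sup>2)"
proof -
  interpret psd_operator C by fact
  have I: "psd_operator (\<lambda>x::'h. x)" by (rule psd_operator.intro[OF bounded_linear_ident]) auto
  have v: "continuous_on {0..T} v" and D: "continuous_on {0..T} D" and v0: "v 0 = 0"
    and kv: "\<And>t. t \<in> {0..T} \<Longrightarrow> conv k v t = integral {0..t} D"
    and u: "\<And>t. t \<in> {0..T} \<Longrightarrow> u t = u0 + t *\<^sub>R u1 + integral {0..t} v"
    and eq: "\<And>t. t \<in> {0..T} \<Longrightarrow> C (D t) + \<kappa> *\<^sub>R u t = G t"
    using ev unfolding evolution_def by blast+
  have t': "0 \<le> t" "t \<le> T" and sub: "{0..t} \<subseteq> {0..T}" using t by auto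
  have du: "(u has_vector_derivative u1 + v s) (at s within {0..T})" if "s \<in> {0..T}" for s
  proof -
    have du': "((\<lambda>s. u0 + s *\<^sub>R u1 + integral {0..s} v) has_vector_derivative u1 + v s) (at s within {0..T})"
      by (rule has_vector_derivative_add[OF _ integral_has_vector_derivative[OF v that]]) (auto intro!: derivative_eq_intros)
    show ?thesis by (rule has_vector_derivative_transform[OF that _ du']) (simp add: u)
  qed
  have uc: "continuous_on {0..T} u"
    using du has_vector_derivative_continuous continuous_on_eq_continuous_within by blast
  define \<rho> where "\<rho> = (\<lambda>s. inner (C (v s)) (v s))"
  have \<rho>c: "continuous_on {0..T} \<rho>" unfolding \<rho>_def by (intro continuous_form v)
  have \<rho>0: "0 \<le> \<rho> s" for s unfolding \<rho>_def by (rule psd)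
  note ut = continuous_on_subset[OF uc sub] and vt = continuous_on_subset[OF v sub] and Dt = continuous_on_subset[OF D sub]
    and \<rho>t = continuous_on_subset[OF \<rho>c sub]
  have \<rho>i: "\<rho> integrable_on {0..t}" by (rule integrable_continuous_real[OF \<rho>t])
  have nui: "(\<lambda>s. (norm (u s))\<^sup>2) integrable_on {0..t}"
    by (intro integrable_continuous_real continuous_intros ut)
  have uvi: "(\<lambda>s. inner (u s) (v s)) integrable_on {0..t}" by (intro integrable_continuous_real continuous_intros ut vt)
  have uu1i: "(\<lambda>s. inner (u s) u1) integrable_on {0..t}" by (intro integrable_continuous_real continuous_intros ut)
  have CvD: "(\<lambda>s. inner (C (v s)) (D s)) integrable_on {0..t}" by (intro integrable_continuous_real continuous_form vt Dt)
  have "((\<lambda>s. inner (u s) (u1 + v s)) has_integral ((norm (u t))\<^sup>2 / 2 - (norm (u 0))\<^sup>2 / 2)) {0..t}"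
  proof (rule fundamental_theorem_of_calculus[OF t'(1), of "\<lambda>s. (norm (u s))\<^sup>2 / 2"])
    fix s assume s: "s \<in> {0..t}"
    have "(u has_vector_derivative u1 + v s) (at s within {0..t})"
      by (rule has_vector_derivative_within_subset[OF du]) (use s t in auto)
    from DERIV_cdivide[OF psd_operator.form_has_derivative[OF I this, of 0], of 2]
    show "((\<lambda>s. (norm (u s))\<^sup>2 / 2) has_vector_derivative inner (u s) (u1 + v s)) (at s within {0..t})"
      unfolding power2_norm_eq_inner has_real_derivative_iff_has_vector_derivative by simp
  qed
  moreover have "u 0 = u0" using u[of 0] less_imp_le[OF T_pos] by simp
  ultimately have E1: "integral {0..t} (\<lambda>s. inner (u s) u1) + integral {0..t} (\<lambda>s. inner (u s) (v s)) = (norm (u t))\<^sup>2 / 2 - (norm u0)\<^sup>2 / 2"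
    using integral_add[OF uu1i uvi] by (simp add: inner_add_right integral_unique)
  have E2: "\<kappa> * integral {0..t} (\<lambda>s. inner (u s) u1) \<le> integral {0..t} (\<lambda>s. \<kappa> * (norm (u s))\<^sup>2) / 2 + \<kappa> * T * (norm u1)\<^sup>2 / 2"
  proof -
    have "integral {0..t} (\<lambda>s. inner (u s) u1) \<le> integral {0..t} (\<lambda>s. (norm (u s))\<^sup>2 / 2 + (norm u1)\<^sup>2 / 2)"
    proof (rule integral_le[OF uu1i])
      show "(\<lambda>s. (norm (u s))\<^sup>2 / 2 + (norm u1)\<^sup>2 / 2) integrable_on {0..t}" by (intro integrable_continuous_real continuous_intros ut) auto
      show "inner (u s) u1 \<le> (norm (u s))\<^sup>2 / 2 + (norm u1)\<^sup>2 / 2" for s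
        using norm_cauchy_schwarz[of "u s" u1] sum_squares_bound[of "norm (u s)" "norm u1"] by linarith
    qed
    also have "\<dots> = integral {0..t} (\<lambda>s. (norm (u s))\<^sup>2) / 2 + t * (norm u1)\<^sup>2 / 2"
      using t' nui by (subst integral_add) (auto intro!: integrable_on_divide)
    also have "\<dots> \<le> integral {0..t} (\<lambda>s. (norm (u s))\<^sup>2) / 2 + T * (norm u1)\<^sup>2 / 2"
      using t' by (intro add_left_mono divide_right_mono mult_right_mono) auto
    finally have "\<kappa> * integral {0..t} (\<lambda>s. inner (u s) u1) \<le> \<kappa> * (integral {0..t} (\<lambda>s. (norm (u s))\<^sup>2) / 2 + T * (norm u1)\<^sup>2 / 2)"
      using \<kappa> by (intro mult_left_mono) auto
    then show ?thesis by (simp add: algebra_simps)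
  qed
  have E3: "integral {0..t} (\<lambda>s. inner (C (v s)) (D s)) + \<kappa> * integral {0..t} (\<lambda>s. inner (u s) (v s)) \<le> integral {0..t} \<rho> / 2 + T * m\<^sup>2 / 2"
  proof -
    have "integral {0..t} (\<lambda>s. inner (C (v s)) (D s)) + \<kappa> * integral {0..t} (\<lambda>s. inner (u s) (v s))
       = integral {0..t} (\<lambda>s. inner (C (v s)) (D s) + \<kappa> * inner (u s) (v s))"
      by (subst integral_add) (auto intro!: integrable_on_mult_right CvD uvi)
    also have "\<dots> \<le> integral {0..t} (\<lambda>s. \<rho> s / 2 + m\<^sup>2 / 2)"
    proof (rule integral_le)
      show "(\<lambda>s. inner (C (v s)) (D s) + \<kappa> * inner (u s) (v s)) integrable_on {0..t}"
        by (intro integrable_add integrable_on_mult_right CvD uvi)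
      show "(\<lambda>s. \<rho> s / 2 + m\<^sup>2 / 2) integrable_on {0..t}" by (intro integrable_continuous_real continuous_intros \<rho>t) auto
      show "inner (C (v s)) (D s) + \<kappa> * inner (u s) (v s) \<le> \<rho> s / 2 + m\<^sup>2 / 2" if "s \<in> {0..t}" for s
      proof -
        have sT: "s \<in> {0..T}" using that t by auto
        have "inner (C (v s)) (D s) + \<kappa> * inner (u s) (v s) = inner (G s) (v s)"
          unfolding eq[OF sT, symmetric] using sym[of "v s" "D s"] by (metis inner_commute inner_left_distrib inner_scaleR_left)
        also have "\<dots> \<le> m * sqrt (\<rho> s)" unfolding \<rho>_def by (rule G[OF sT])
        also have "\<dots> \<le> (m\<^sup>2 + (sqrt (\<rho> s))\<^sup>2) / 2" using sum_squares_bound[of m "sqrt (\<rho> s)"] by simp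
        finally show ?thesis using \<rho>0[of s] by (simp add: add_divide_distrib)
      qed
    qed
    also have "\<dots> = integral {0..t} \<rho> / 2 + t * m\<^sup>2 / 2"
      using t' \<rho>i by (subst integral_add) (auto intro!: integrable_on_divide)
    also have "\<dots> \<le> integral {0..t} \<rho> / 2 + T * m\<^sup>2 / 2"
      using t' by (intro add_left_mono divide_right_mono mult_right_mono) auto
    finally show ?thesis .
  qed
  have E4: "conv k \<rho> t / 2 - 2 * M * T * integral {0..t} \<rho> \<le> integral {0..t} (\<lambda>s. inner (C (v s)) (D s))"
    unfolding \<rho>_def by (rule energy_lower[OF C v D v0 kv t'])
  have E1': "\<kappa> * integral {0..t} (\<lambda>s. inner (u s) u1) + \<kappa> * integral {0..t} (\<lambda>s. inner (u s) (v s)) = \<kappa> * (norm (u t))\<^sup>2 / 2 - \<kappa> * (norm u0)\<^sup>2 / 2"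
    using arg_cong[OF E1, of "\<lambda>x. \<kappa> * x"] by (simp add: algebra_simps)
  have main: "\<kappa> * (norm (u t))\<^sup>2 + conv k \<rho> t \<le> (\<kappa> * (norm u0)\<^sup>2 + \<kappa> * T * (norm u1)\<^sup>2 + T * m\<^sup>2)
      + (integral {0..t} \<rho> + 4 * M * T * integral {0..t} \<rho>) + integral {0..t} (\<lambda>s. \<kappa> * (norm (u s))\<^sup>2)"
    using E1' E2 E3 E4 by argo
  have b1: "\<kappa> * (norm u0)\<^sup>2 + \<kappa> * T * (norm u1)\<^sup>2 + T * m\<^sup>2 \<le> (\<kappa> + \<kappa> * T + T) * (m\<^sup>2 + (norm u0)\<^sup>2 + (norm u1)\<^sup>2)"
  proof -
    have "\<kappa> * (norm u0)\<^sup>2 \<le> (\<kappa> + \<kappa> * T + T) * (norm u0)\<^sup>2" "\<kappa> * T * (norm u1)\<^sup>2 \<le> (\<kappa> + \<kappa> * T + T) * (norm u1)\<^sup>2" "T * m\<^sup>2 \<le> (\<kappa> + \<kappa> * T + T) * m\<^sup>2"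
      using \<kappa> T_pos by (auto intro!: mult_right_mono)
    then show ?thesis by (simp add: distrib_left)
  qed
  have i0: "0 \<le> integral {0..t} (\<lambda>s. \<kappa> * (norm (u s))\<^sup>2)"
    by (rule integral_nonneg) (use \<kappa> nui in \<open>auto intro!: integrable_on_mult_right\<close>)
  have "integral {0..t} (\<lambda>s. \<rho> s + \<kappa> * (norm (u s))\<^sup>2) = integral {0..t} \<rho> + integral {0..t} (\<lambda>s. \<kappa> * (norm (u s))\<^sup>2)"
    by (rule integral_add[OF \<rho>i integrable_on_mult_right[OF nui]])
  then have b2: "(integral {0..t} \<rho> + 4 * M * T * integral {0..t} \<rho>) + integral {0..t} (\<lambda>s. \<kappa> * (norm (u s))\<^sup>2)
     \<le> (1 + 4 * M * T) * integral {0..t} (\<lambda>s. \<rho> s + \<kappa> * (norm (u s))\<^sup>2)"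
    using mult_nonneg_nonneg[OF _ i0, of "4 * M * T"] M_nonneg T_pos by (simp add: algebra_simps)
  show ?thesis using main b1 b2 unfolding \<rho>_def by linarith
qed

text \<open>Plain Gronwall does not apply, since the left side controls \<open><C v, v>\<close> only
  through its convolution with \<open>k\<close>. On the last time interval of length
  \<open>\<delta>\<close>, however, \<open>k (t - s)\<close> is at least \<open>4 * c1\<close>, and
  that piece of the integral can be absorbed. The delay, the number \<open>n\<close> of delays and
  \<open>Q\<close> are fixed before the operator is chosen.\<close>

lemma energy_estimate:
  assumes \<kappa>: "\<kappa> > 0"
  obtains Q where "Q > 0" "\<And>(C :: 'h::{real_inner,banach} \<Rightarrow> 'h) G u0 u1 u v D m t. psd_operator C \<Longrightarrow>
     evolution \<kappa> C G u0 u1 u v D \<Longrightarrow> 0 \<le> m \<Longrightarrow>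
     (\<And>t x. t \<in> {0..T} \<Longrightarrow> inner (G t) x \<le> m * sqrt (inner (C x) x)) \<Longrightarrow> t \<in> {0..T} \<Longrightarrow>
     norm (u t) \<le> Q * (m + norm u0 + norm u1)"
proof -
  define c1 where "c1 = 1 + 4 * M * T"
  define A where "A = \<kappa> + \<kappa> * T + T"
  have c1: "c1 \<ge> 1" using M_nonneg T_pos by (simp add: c1_def)
  have A: "A > 0" using \<kappa> T_pos by (simp add: A_def add_pos_pos)
  obtain d where d: "d > 0" "\<And>s. 0 < s \<Longrightarrow> s < d \<Longrightarrow> s < T \<Longrightarrow> 4 * c1 \<le> k s" using k_blowup[of "4 * c1"] by blast
  \<comment> \<open>With this delay both parts of the integral over the last interval are at most
    \<open>Y / (4 * c1)\<close>. Their sum contains exactly \<open>S t / 2\<close>, which moves to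
    the left side and produces the factor \<open>2\<close> of \<open>delay_gronwall\<close>.\<close>
  define \<delta> where "\<delta> = min d (1 / (4 * c1))"
  have \<delta>: "\<delta> > 0" "\<delta> \<le> d" "\<delta> \<le> 1 / (4 * c1)" using d c1 by (auto simp: \<delta>_def)
  obtain n :: nat where n: "T / \<delta> < real n" using reals_Archimedean2 by blast
  then have n: "T \<le> real n * \<delta>" using \<delta> by (simp add: field_simps)
  define Q where "Q = sqrt ((A + 2 ^ n * A) / \<kappa>)"
  show thesis
  proof (rule that)
    show "Q > 0" using A \<kappa> by (simp add: Q_def add_pos_pos)
    fix C :: "'h \<Rightarrow> 'h" and G u0 u1 u v D m t
    assume C: "psd_operator C" and ev: "evolution \<kappa> C G u0 u1 u v D" and m: "0 \<le> m"
      and G: "\<And>t x. t \<in> {0..T} \<Longrightarrow> inner (G t) x \<le> m * sqrt (inner (C x) x)" and t: "t \<in> {0..T}"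
    interpret psd_operator C by fact
    define N where "N = m\<^sup>2 + (norm u0)\<^sup>2 + (norm u1)\<^sup>2"
    define \<rho> where "\<rho> = (\<lambda>s. inner (C (v s)) (v s))"
    define \<sigma> where "\<sigma> = (\<lambda>s. \<rho> s + \<kappa> * (norm (u s))\<^sup>2)"
    define S where "S = (\<lambda>t. integral {0..t} \<sigma>)"
    have E: "\<kappa> * (norm (u t))\<^sup>2 + conv k \<rho> t \<le> A * N + c1 * S t" if "t \<in> {0..T}" for t
      using energy_inequality[OF C ev \<kappa> G that] unfolding A_def N_def c1_def S_def \<sigma>_def \<rho>_def .
    have v: "continuous_on {0..T} v" using ev by (simp add: evolution_def)
    have uc: "continuous_on {0..T} u"
    proof (rule continuous_on_eq)
      show "continuous_on {0..T} (\<lambda>t. u0 + t *\<^sub>R u1 + integral {0..t} v)"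
        by (intro continuous_intros indefinite_integral_continuous_1 integrable_continuous_real v)
    qed (use ev in \<open>simp add: evolution_def\<close>)
    have \<rho>c: "continuous_on {0..T} \<rho>" unfolding \<rho>_def by (intro continuous_form v)
    have \<rho>0: "0 \<le> \<rho> s" for s unfolding \<rho>_def by (rule psd)
    have \<sigma>c: "continuous_on {0..T} \<sigma>" unfolding \<sigma>_def by (intro continuous_intros \<rho>c uc)
    have \<sigma>0: "0 \<le> \<sigma> s" for s using \<rho>0[of s] \<kappa> by (simp add: \<sigma>_def)
    have int: "f integrable_on {x..y}" if "continuous_on {0..T} f" "0 \<le> x" "y \<le> T" for f :: "real \<Rightarrow> real" and x y
      by (rule integrable_continuous_real[OF continuous_on_subset[OF that(1)]]) (use that in auto)
    have S_mono: "S x \<le> S y" if "0 \<le> x" "x \<le> y" "y \<le> T" for x y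
      unfolding S_def by (rule integral_subset_le) (use that \<sigma>0 int[OF \<sigma>c] in auto)
    have kr0: "0 \<le> conv k \<rho> s" if "s \<in> {0..T}" for s
      by (rule conv_nonneg[OF kern_k _ _ continuous_on_subset[OF \<rho>c]]) (use that k_pos \<rho>0 in \<open>auto intro: less_imp_le\<close>)
    have N0: "0 \<le> A * N" using A by (simp add: N_def)
    have step: "S t \<le> 2 * S (max 0 (t - \<delta>)) + A * N / c1" if t: "0 \<le> t" "t \<le> T" for t
    proof -
      define r where "r = max 0 (t - \<delta>)"
      have r: "0 \<le> r" "r \<le> t" "t - \<delta> \<le> r" using t \<delta> by (auto simp: r_def)
      define Y where "Y = A * N + c1 * S t"
      have kri: "(\<lambda>s. k (t - s) * \<rho> s) integrable_on {0..t}"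
        using conv_integrable[OF kern_k t(2) continuous_on_subset[OF \<rho>c]] t by simp
      have kri': "(\<lambda>s. k (t - s) * \<rho> s) integrable_on {x..y}" if "0 \<le> x" "y \<le> t" for x y
        by (rule integrable_on_subinterval[OF kri]) (use that in auto)
      have "integral {0..r} (\<lambda>s. k (t - s) * \<rho> s) + integral {r..t} (\<lambda>s. k (t - s) * \<rho> s) = conv k \<rho> t"
        unfolding conv_def using Henstock_Kurzweil_Integration.integral_combine[OF r(1,2) kri] by simp
      moreover have "0 \<le> integral {0..r} (\<lambda>s. k (t - s) * \<rho> s)"
        by (rule integral_nonneg_spike[of _ _ "{0,t}"])
          (use r t kri' \<rho>0 in \<open>auto intro!: mult_nonneg_nonneg less_imp_le[OF k_pos]\<close>)
      moreover have "0 \<le> integral {r..t} (\<lambda>s. k (t - s) * \<rho> s - 4 * c1 * \<rho> s)"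
      proof (rule integral_nonneg_spike[of _ _ "{r,t}"])
        show "(\<lambda>s. k (t - s) * \<rho> s - 4 * c1 * \<rho> s) integrable_on {r..t}"
          by (intro integrable_diff kri' integrable_on_mult_right int \<rho>c) (use r t in auto)
        fix s assume "s \<in> {r..t} - {r,t}"
        then have "4 * c1 \<le> k (t - s)" using r t \<delta> by (intro d(2)) auto
        then show "0 \<le> k (t - s) * \<rho> s - 4 * c1 * \<rho> s" using mult_right_mono[OF _ \<rho>0[of s]] by simp
      qed auto
      moreover have "integral {r..t} (\<lambda>s. k (t - s) * \<rho> s - 4 * c1 * \<rho> s) = integral {r..t} (\<lambda>s. k (t - s) * \<rho> s) - 4 * c1 * integral {r..t} \<rho>"
        by (subst integral_diff) (use r t in \<open>auto intro!: kri' integrable_on_mult_right int \<rho>c\<close>)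
      ultimately have "4 * c1 * integral {r..t} \<rho> \<le> conv k \<rho> t" by linarith
      also have "\<dots> \<le> Y"
      proof -
        have "0 \<le> \<kappa> * (norm (u t))\<^sup>2" using \<kappa> by simp
        then show ?thesis using E[of t] t unfolding Y_def by auto
      qed
      finally have I1: "integral {r..t} \<rho> \<le> Y / (4 * c1)" using c1 by (simp add: field_simps)
      have "integral {r..t} (\<lambda>s. \<kappa> * (norm (u s))\<^sup>2) \<le> integral {r..t} (\<lambda>_. Y)"
      proof (rule integral_le)
        show "(\<lambda>s. \<kappa> * (norm (u s))\<^sup>2) integrable_on {r..t}" by (intro int continuous_intros uc) (use r t in auto)
        fix s assume s: "s \<in> {r..t}"
        have "\<kappa> * (norm (u s))\<^sup>2 \<le> A * N + c1 * S s" using E[of s] kr0[of s] s r t by auto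
        also have "\<dots> \<le> Y" unfolding Y_def using S_mono[of s t] s r t c1 by (intro add_left_mono mult_left_mono) auto
        finally show "\<kappa> * (norm (u s))\<^sup>2 \<le> Y" .
      qed auto
      also have "\<dots> = (t - r) * Y" using r by simp
      also have "\<dots> \<le> (1 / (4 * c1)) * Y"
      proof (rule mult_right_mono)
        show "t - r \<le> 1 / (4 * c1)" using r \<delta> by linarith
        have "0 \<le> S t" unfolding S_def by (rule integral_nonneg) (use \<sigma>0 t int[OF \<sigma>c] in auto)
        then show "0 \<le> Y" unfolding Y_def using N0 c1 by simp
      qed
      finally have I2: "integral {r..t} (\<lambda>s. \<kappa> * (norm (u s))\<^sup>2) \<le> Y / (4 * c1)" by simp
      have "integral {r..t} \<sigma> = integral {r..t} \<rho> + integral {r..t} (\<lambda>s. \<kappa> * (norm (u s))\<^sup>2)"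
        unfolding \<sigma>_def by (rule integral_add) (use r t in \<open>auto intro!: int continuous_intros \<rho>c uc\<close>)
      moreover have "S t = S r + integral {r..t} \<sigma>"
        unfolding S_def using Henstock_Kurzweil_Integration.integral_combine[OF r(1,2) int[OF \<sigma>c]] t by simp
      ultimately have "S t \<le> S r + Y / (2 * c1)" using I1 I2 by simp
      also have "Y / (2 * c1) = A * N / (2 * c1) + S t / 2" using c1 by (simp add: Y_def field_simps)
      finally show ?thesis unfolding r_def by simp
    qed
    have "S t \<le> 2 ^ n * (A * N / c1)"
      by (rule delay_gronwall[of S \<delta> _ T]) (use t \<delta> n N0 c1 step in \<open>auto simp: S_def\<close>)
    then have "c1 * S t \<le> c1 * (2 ^ n * (A * N / c1))" using c1 by (intro mult_left_mono) auto
    then have "c1 * S t \<le> 2 ^ n * A * N" using c1 by simp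
    then have "\<kappa> * (norm (u t))\<^sup>2 \<le> (A + 2 ^ n * A) * N"
      using E[OF t] kr0[OF t] by (simp add: algebra_simps)
    then have "(norm (u t))\<^sup>2 \<le> Q\<^sup>2 * N" using \<kappa> A by (simp add: Q_def field_simps add_nonneg_nonneg)
    also have "\<dots> \<le> Q\<^sup>2 * (m + norm u0 + norm u1)\<^sup>2"
    proof (rule mult_left_mono)
      have "0 \<le> m * norm u0" "0 \<le> m * norm u1" "0 \<le> norm u0 * norm u1" using m by auto
      then show "N \<le> (m + norm u0 + norm u1)\<^sup>2" unfolding N_def by (simp add: power2_eq_square algebra_simps)
    qed simp
    finally have "(norm (u t))\<^sup>2 \<le> (Q * (m + norm u0 + norm u1))\<^sup>2" by (simp add: power_mult_distrib)
    then show "norm (u t) \<le> Q * (m + norm u0 + norm u1)"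
      by (rule power2_le_imp_le) (use m \<open>Q > 0\<close> in auto)
  qed
qed

end

section \<open>The abstract evolution equation\<close>

text \<open>In the application \<open>\<gamma>\<close> is \<open>\<alpha> 0 - 1\<close>,
  \<open>h\<close> is the derivative of \<open>g\<close>, and \<open>S\<close> is
  \<open>L2 \<Omega>\<close>. The operator \<open>B\<close> acts on the whole space, but its
  injectivity is available on the closed subspace \<open>S\<close> only.\<close>

locale diffusion_wave = memory_kernel T M c k k' + psd_operator B
  for T M c :: real and k k' :: "real \<Rightarrow> real" and B :: "'h::{real_inner,banach} \<Rightarrow> 'h" +
  fixes \<kappa> \<gamma> :: real and g h :: "real \<Rightarrow> real" and S :: "'h set"
  assumes \<kappa>: "\<kappa> > 0" and \<gamma>: "0 < \<gamma>" "\<gamma> < 1" and kern_h: "kern T h"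
    and g_conv: "0 < t \<Longrightarrow> t < T \<Longrightarrow> g t = conv (beta_kernel \<gamma>) k t"
    and g_int: "0 < t \<Longrightarrow> t < T \<Longrightarrow> g t = 1 + integral {0..t} h"
    and S: "subspace S" "closed S" "range B \<subseteq> S" and B_inj: "z \<in> S \<Longrightarrow> B z = 0 \<Longrightarrow> z = 0"
begin

abbreviation "\<beta> \<equiv> beta_kernel"

lemma kb: "kern T (\<beta> 1)" "kern T (\<beta> \<gamma>)" "kern T (\<beta> (1 + \<gamma>))"
  using \<gamma> by (auto intro!: kern_beta)

lemma cont_sub: "continuous_on {0..T} u \<Longrightarrow> t \<le> T \<Longrightarrow> continuous_on {0..t} u"
  by (rule continuous_on_subset) auto

lemma cont_conv_h: "continuous_on {0..T} (u :: real \<Rightarrow> 'z::banach) \<Longrightarrow> continuous_on {0..T} (conv h u)"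
  by (rule conv_continuous[OF kern_h])

lemma cont_conv_b1: "continuous_on {0..T} (u :: real \<Rightarrow> 'z::banach) \<Longrightarrow> continuous_on {0..T} (conv (\<beta> 1) u)"
  by (rule conv_continuous[OF kb(1)])

text \<open>The two descriptions of \<open>g\<close> are equated inside an associated convolution.
  This exchanges the memory kernel for the second-kind operator \<open>v + conv h v\<close> under a
  running integral, and is the bridge between the mild and the differential form.\<close>

lemma conv_\<gamma>_k:
  fixes v :: "real \<Rightarrow> 'h"
  assumes v: "continuous_on {0..T} v" and t: "0 \<le> t" "t \<le> T"
  shows "conv (\<beta> \<gamma>) (conv k v) t = conv (\<beta> 1) (\<lambda>s. v s + conv h v s) t"
proof -
  have kbh: "kern T (conv (\<beta> 1) h)" by (rule kern_conv[OF kb(1) kern_h])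
  have "conv (\<beta> \<gamma>) (conv k v) t = conv (conv (\<beta> \<gamma>) k) v t" by (rule conv_assoc[OF kb(2) kern_k v t])
  also have "\<dots> = conv (\<lambda>s. \<beta> 1 s + conv (\<beta> 1) h s) v t"
  proof (rule conv_cong_left)
    fix s assume s: "0 < s" "s < t"
    then show "conv (\<beta> \<gamma>) k s = \<beta> 1 s + conv (\<beta> 1) h s"
      using g_conv[of s] g_int[of s] t by (simp add: conv_beta1) (simp add: beta_kernel_def)
  qed
  also have "\<dots> = conv (\<beta> 1) v t + conv (conv (\<beta> 1) h) v t"
    by (rule conv_add_left[OF kb(1) kbh t(2) cont_sub[OF v t(2)]])
  also have "conv (conv (\<beta> 1) h) v t = conv (\<beta> 1) (conv h v) t"
    by (rule conv_assoc[OF kb(1) kern_h v t, symmetric])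
  also have "conv (\<beta> 1) v t + conv (\<beta> 1) (conv h v) t = conv (\<beta> 1) (\<lambda>s. v s + conv h v s) t"
    by (rule conv_add[OF kb(1) t(2) cont_sub[OF v t(2)] cont_sub[OF cont_conv_h[OF v] t(2)], symmetric])
  finally show ?thesis .
qed

text \<open>As \<open>g\<close> is one plus the running integral of \<open>h\<close>, the
  initial-velocity term is the linear motion \<open>t u1\<close> plus its convolution with
  \<open>h\<close>. This lets \<open>shift_data\<close> absorb \<open>u1\<close> into the
  unknown.\<close>

lemma conv_g:
  fixes x :: 'h
  assumes t: "0 \<le> t" "t \<le> T"
  shows "conv (\<beta> 1) g t *\<^sub>R x = t *\<^sub>R x + conv h (\<lambda>s. s *\<^sub>R x) t"
proof -
  have hi: "h integrable_on {0..T}" using kern_h absolutely_integrable_realD(1) unfolding kern_def by blast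
  have Hc: "continuous_on {0..T} (\<lambda>s. integral {0..s} h)" by (rule indefinite_integral_continuous_1[OF hi])
  have c1: "continuous_on {0..T} (\<lambda>s. 1::real)" by simp
  have h1: "conv h (\<lambda>_. 1) s = integral {0..s} h" for s by (simp add: conv_commute)
  have b1: "conv (\<beta> 1) (\<lambda>_. 1) s = s" if "0 \<le> s" for s :: real using that by (simp add: conv_beta1)
  have "conv (\<beta> 1) g t = conv (\<beta> 1) (\<lambda>s. 1 + conv h (\<lambda>_. 1) s) t"
    by (rule conv_cong_interior) (use g_int t in \<open>simp add: h1\<close>)
  also have "\<dots> = t + conv (\<beta> 1) (conv h (\<lambda>_. 1)) t"
    by (subst conv_add[OF kb(1) t(2)]) (use t Hc in \<open>auto simp: h1 b1 intro: cont_sub continuous_on_subset\<close>)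
  also have "conv (\<beta> 1) (conv h (\<lambda>_. 1::real)) t = conv h (conv (\<beta> 1) (\<lambda>_. 1)) t"
    by (rule conv_left_commute[OF kb(1) kern_h c1 t])
  also have "\<dots> = conv h (\<lambda>s. s) t" by (rule conv_cong) (simp add: b1)
  finally have "conv (\<beta> 1) g t *\<^sub>R x = t *\<^sub>R x + conv h (\<lambda>s. s) t *\<^sub>R x" by (simp add: scaleR_add_left)
  moreover have "conv h (\<lambda>s. s *\<^sub>R x) t = conv h (\<lambda>s. s) t *\<^sub>R x"
    by (rule conv_linear[OF kern_h t(2) _ bounded_linear_scaleR_left]) simp
  ultimately show ?thesis by simp
qed

text \<open>The mild equation with the Laplacian inverted: the argument of \<open>B\<close> stands
  for \<open>\<kappa>\<close> times the Laplacian of the convolved solution, and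
  \<open>1 + \<gamma>\<close> for \<open>\<alpha> 0\<close>.\<close>

definition mild :: "(real \<Rightarrow> 'h) \<Rightarrow> 'h \<Rightarrow> 'h \<Rightarrow> (real \<Rightarrow> 'h) \<Rightarrow> bool" where
  "mild f u0 u1 u \<longleftrightarrow> continuous_on {0..T} u \<and> (\<forall>t\<in>{0..T}.
     B (u t - u0 + conv h (\<lambda>s. u s - u0) t - conv (\<beta> 1) g t *\<^sub>R u1 - conv (\<beta> (1 + \<gamma>)) f t) + \<kappa> *\<^sub>R conv (\<beta> (1 + \<gamma>)) u t = 0)"

lemma shift_data:
  fixes u :: "real \<Rightarrow> 'h" and u0 u1 :: 'h
  assumes u: "continuous_on {0..T} u" and t: "0 \<le> t" "t \<le> T"
  defines "w \<equiv> \<lambda>s. u s - u0 - s *\<^sub>R u1"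
  shows "u t - u0 + conv h (\<lambda>s. u s - u0) t - conv (\<beta> 1) g t *\<^sub>R u1 = w t + conv h w t"
proof -
  have "conv h w t = conv h (\<lambda>s. u s - u0) t - conv h (\<lambda>s. s *\<^sub>R u1) t"
    unfolding w_def by (rule conv_diff[OF kern_h t(2)]) (auto intro!: continuous_intros cont_sub[OF u t(2)])
  then show ?thesis using conv_g[OF t, of u1] by (simp add: w_def)
qed

lemma evolution_eq: "evolution \<kappa> C G u0 u1 u v D \<Longrightarrow> t \<in> {0..T} \<Longrightarrow> C (D t) + \<kappa> *\<^sub>R u t = G t"
  unfolding evolution_def by blast

text \<open>Convolution with the kernel of order \<open>1 + \<gamma>\<close> turns \<open>D\<close>
  into \<open>w + conv h w\<close>, because \<open>w\<close> is the running integral of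
  \<open>v\<close>. In the resulting identity \<open>v\<close> and \<open>D\<close> have
  disappeared, so it survives a uniform limit of \<open>u\<close> alone.\<close>

lemma evolution_volterra:
  fixes C :: "'h \<Rightarrow> 'h" and u0 u1 :: 'h and u :: "real \<Rightarrow> 'h"
  assumes C: "bounded_linear C" and ev: "evolution \<kappa> C G u0 u1 u v D" and t: "0 \<le> t" "t \<le> T"
  defines "w \<equiv> \<lambda>s. u s - u0 - s *\<^sub>R u1"
  shows "C (w t + conv h w t) = conv (\<beta> (1 + \<gamma>)) (\<lambda>s. G s - \<kappa> *\<^sub>R u s) t"
proof -
  have v: "continuous_on {0..T} v" and D: "continuous_on {0..T} D" using ev by (auto simp: evolution_def)
  have wv: "w s = conv (\<beta> 1) v s" if "0 \<le> s" "s \<le> T" for s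
    using ev that by (simp add: evolution_def w_def conv_beta1)
  have "conv h w t = conv h (conv (\<beta> 1) v) t" by (rule conv_cong) (use wv t in auto)
  also have "\<dots> = conv (\<beta> 1) (conv h v) t" by (rule conv_left_commute[OF kern_h kb(1) v t])
  finally have "w t + conv h w t = conv (\<beta> 1) (\<lambda>s. v s + conv h v s) t"
    using wv t conv_add[OF kb(1) t(2) cont_sub[OF v t(2)] cont_sub[OF cont_conv_h[OF v] t(2)]] by simp
  also have "\<dots> = conv (\<beta> \<gamma>) (conv k v) t" by (rule conv_\<gamma>_k[OF v t, symmetric])
  also have "\<dots> = conv (\<beta> \<gamma>) (conv (\<beta> 1) D) t"
    by (rule conv_cong) (use ev t in \<open>auto simp: evolution_def conv_beta1\<close>)
  also have "\<dots> = conv (\<beta> (1 + \<gamma>)) D t"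
    using conv_beta_beta[OF \<gamma>(1) zero_less_one D t] by (simp add: add.commute)
  finally have "C (w t + conv h w t) = conv (\<beta> (1 + \<gamma>)) (\<lambda>s. C (D s)) t"
    using conv_linear[OF kb(3) t(2) cont_sub[OF D t(2)] C] by simp
  also have "\<dots> = conv (\<beta> (1 + \<gamma>)) (\<lambda>s. G s - \<kappa> *\<^sub>R u s) t"
  proof (rule conv_cong)
    fix s assume "0 \<le> s" "s \<le> t"
    then show "C (D s) = G s - \<kappa> *\<^sub>R u s" using evolution_eq[OF ev, of s] t by (simp add: eq_diff_eq)
  qed
  finally show ?thesis .
qed

lemma evolution_continuous:
  assumes "evolution \<kappa> C G u0 u1 u v D" shows "continuous_on {0..T} (u :: real \<Rightarrow> 'h)"
proof (rule continuous_on_eq)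
  show "continuous_on {0..T} (\<lambda>t. u0 + t *\<^sub>R u1 + integral {0..t} v)"
    using assms by (intro continuous_intros indefinite_integral_continuous_1 integrable_continuous_real) (simp add: evolution_def)
qed (use assms in \<open>simp add: evolution_def\<close>)

text \<open>The operators may differ: their mismatch on \<open>D'\<close> is counted among the data.
  Thus one estimate covers both the truncation of the data and the comparison of two regularization
  parameters.\<close>

lemma evolution_diff:
  fixes C C' :: "'h \<Rightarrow> 'h"
  assumes "evolution \<kappa> C G u0 u1 u v D" "evolution \<kappa> C' G' u0' u1' u' v' D'" "bounded_linear C"
  shows "evolution \<kappa> C (\<lambda>t. G t - G' t - (C (D' t) - C' (D' t))) (u0 - u0') (u1 - u1') (\<lambda>t. u t - u' t) (\<lambda>t. v t - v' t) (\<lambda>t. D t - D' t)"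
proof -
  interpret C: bounded_linear C by fact
  have c: "continuous_on {0..T} v" "continuous_on {0..T} v'" "continuous_on {0..T} D" "continuous_on {0..T} D'"
    using assms by (auto simp: evolution_def)
  show ?thesis unfolding evolution_def
  proof (intro conjI ballI)
    fix t assume t: "t \<in> {0..T}"
    then have t': "t \<le> T" by simp
    note ct = c[THEN cont_sub[OF _ t']]
    note i = ct[THEN integrable_continuous_real]
    show "conv k (\<lambda>t. v t - v' t) t = integral {0..t} (\<lambda>t. D t - D' t)"
      using assms t conv_diff[OF kern_k t' ct(1,2)] integral_diff[OF i(3,4)] by (simp add: evolution_def)
    show "u t - u' t = u0 - u0' + t *\<^sub>R (u1 - u1') + integral {0..t} (\<lambda>t. v t - v' t)"
      using assms t integral_diff[OF i(1,2)] by (simp add: evolution_def scaleR_diff_right)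
    have "G t = C (D t) + \<kappa> *\<^sub>R u t" "G' t = C' (D' t) + \<kappa> *\<^sub>R u' t"
      using evolution_eq[OF assms(1) t] evolution_eq[OF assms(2) t] by auto
    then show "C (D t - D' t) + \<kappa> *\<^sub>R (u t - u' t) = G t - G' t - (C (D' t) - C' (D' t))"
      by (auto simp: C.diff algebra_simps)
  qed (use assms c in \<open>auto simp: evolution_def intro!: continuous_intros\<close>)
qed

lemma evolution_apply:
  fixes C :: "'h \<Rightarrow> 'h"
  assumes ev: "evolution \<kappa> C G u0 u1 u v D" and L: "bounded_linear L" and comm: "\<And>x. L (C x) = C (L x)"
  shows "evolution \<kappa> C (\<lambda>t. L (G t)) (L u0) (L u1) (\<lambda>t. L (u t)) (\<lambda>t. L (v t)) (\<lambda>t. L (D t))"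
proof -
  interpret L: bounded_linear L by fact
  have c: "continuous_on {0..T} v" "continuous_on {0..T} D" using ev by (auto simp: evolution_def)
  have Lc: "continuous_on {0..T} (\<lambda>t. L (x t))" if "continuous_on {0..T} x" for x
    by (rule continuous_on_compose2[OF linear_continuous_on[OF L] that]) auto
  show ?thesis unfolding evolution_def
  proof (intro conjI ballI)
    fix t assume t: "t \<in> {0..T}"
    then have t': "t \<le> T" by simp
    note ct = c[THEN cont_sub[OF _ t']]
    have i: "integral {0..t} (\<lambda>s. L (x s)) = L (integral {0..t} x)" if "continuous_on {0..t} x" for x
      using integral_linear[OF integrable_continuous_real[OF that] L] by (simp add: o_def)
    show "conv k (\<lambda>t. L (v t)) t = integral {0..t} (\<lambda>t. L (D t))"
      using ev t conv_linear[OF kern_k t' ct(1) L] i[OF ct(2)] by (simp add: evolution_def)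
    show "L (u t) = L u0 + t *\<^sub>R L u1 + integral {0..t} (\<lambda>t. L (v t))"
      using ev t i[OF ct(1)] by (simp add: evolution_def L.add L.scaleR)
    show "C (L (D t)) + \<kappa> *\<^sub>R L (u t) = L (G t)"
      using ev t by (metis L.add L.scaleR comm evolution_def)
  qed (use ev c in \<open>auto simp: evolution_def L.zero intro!: Lc\<close>)
qed

text \<open>Replacing \<open>B\<close> by the invertible operator \<open>B + \<epsilon>\<close> turns the problem into a Volterra equation of the second kind.\<close>

lemma regularized_exists:
  assumes \<epsilon>: "\<epsilon> > 0" and f: "continuous_on {0..T} f"
  shows "\<exists>u v D. evolution \<kappa> (\<lambda>x. B x + \<epsilon> *\<^sub>R x) (\<lambda>t. B (f t)) u0 u1 u v D"
proof -
  let ?J = "resolvent \<epsilon>"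
  have J: "bounded_linear ?J" by (rule bounded_linear_resolvent[OF \<epsilon>])
  interpret J: bounded_linear ?J by (rule J)
  have L: "bounded_linear (\<lambda>x. \<kappa> *\<^sub>R ?J x)" by (rule bounded_linear_compose[OF bounded_linear_scaleR_right J])
  \<comment> \<open>Solving the equation for \<open>D\<close> gives
    \<open>D = J (B f - \<kappa> u)\<close>, and \<open>F0\<close> is the part without the unknown.
    Convolving with \<open>\<beta> \<gamma>\<close> turns the left side into
    \<open>v + conv h v\<close>, whence the Volterra equation for \<open>v\<close>.\<close>
  define F0 where "F0 = (\<lambda>s. ?J (B (f s) - \<kappa> *\<^sub>R (u0 + s *\<^sub>R u1)))"
  have F0: "continuous_on {0..T} F0"
    unfolding F0_def
    by (intro continuous_on_compose2[OF linear_continuous_on[OF J, of UNIV]] continuous_intros continuous_on_compose2[OF linear_continuous_on[OF bl, of UNIV]] f) auto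
  obtain v where v: "continuous_on {0..T} v"
    and eq: "\<And>t. t \<in> {0..T} \<Longrightarrow> v t + conv h v t + \<kappa> *\<^sub>R ?J (conv (\<beta> (1 + \<gamma>)) v t) = conv (\<beta> \<gamma>) F0 t"
    using volterra_exists[OF kern_h kb(3) L conv_continuous[OF kb(2) F0] T_pos] by blast
  define u where "u = (\<lambda>t. u0 + t *\<^sub>R u1 + conv (\<beta> 1) v t)"
  define D where "D = (\<lambda>t. F0 t - \<kappa> *\<^sub>R ?J (conv (\<beta> 1) v t))"
  have b1v: "continuous_on {0..T} (conv (\<beta> 1) v)" by (rule cont_conv_b1[OF v])
  have Jb1v: "continuous_on {0..T} (\<lambda>t. \<kappa> *\<^sub>R ?J (conv (\<beta> 1) v t))"
    by (rule continuous_on_compose2[OF linear_continuous_on[OF L] b1v]) auto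
  have Dc: "continuous_on {0..T} D" unfolding D_def by (intro continuous_intros F0 Jb1v)
  have \<gamma>D: "conv (\<beta> \<gamma>) D t = v t + conv h v t" if t: "t \<in> {0..T}" for t
  proof -
    have t': "0 \<le> t" "t \<le> T" using t by auto
    have "conv (\<beta> \<gamma>) D t = conv (\<beta> \<gamma>) F0 t - conv (\<beta> \<gamma>) (\<lambda>t. \<kappa> *\<^sub>R ?J (conv (\<beta> 1) v t)) t"
      unfolding D_def by (rule conv_diff[OF kb(2) t'(2) cont_sub[OF F0 t'(2)] cont_sub[OF Jb1v t'(2)]])
    also have "conv (\<beta> \<gamma>) (\<lambda>t. \<kappa> *\<^sub>R ?J (conv (\<beta> 1) v t)) t = \<kappa> *\<^sub>R ?J (conv (\<beta> \<gamma>) (conv (\<beta> 1) v) t)"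
      by (rule conv_linear[OF kb(2) t'(2) cont_sub[OF b1v t'(2)] L])
    also have "conv (\<beta> \<gamma>) (conv (\<beta> 1) v) t = conv (\<beta> (1 + \<gamma>)) v t"
      using conv_beta_beta[OF \<gamma>(1) zero_less_one v t'] by (simp add: add.commute)
    also have "conv (\<beta> \<gamma>) F0 t - \<kappa> *\<^sub>R ?J (conv (\<beta> (1 + \<gamma>)) v t) = v t + conv h v t"
      using eq[OF t] by (simp add: algebra_simps)
    finally show ?thesis .
  qed
  \<comment> \<open>The Volterra equation yields this only after convolution with
    \<open>\<beta> \<gamma>\<close>, which Abel inversion removes.\<close>
  have kv: "conv k v t = conv (\<beta> 1) D t" if t: "t \<in> {0..T}" for t
  proof (rule conv_beta_inject[OF conv_continuous[OF kern_k v] cont_conv_b1[OF Dc] \<gamma> _ T_pos])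
    fix s assume s: "0 \<le> s" "s \<le> T"
    have "conv (\<beta> \<gamma>) (conv k v) s = conv (\<beta> 1) (\<lambda>r. v r + conv h v r) s" by (rule conv_\<gamma>_k[OF v s])
    also have "\<dots> = conv (\<beta> 1) (conv (\<beta> \<gamma>) D) s" by (rule conv_cong) (use \<gamma>D s in auto)
    also have "\<dots> = conv (\<beta> \<gamma>) (conv (\<beta> 1) D) s" by (rule conv_left_commute[OF kb(1,2) Dc s])
    finally show "conv (\<beta> \<gamma>) (conv k v) s = conv (\<beta> \<gamma>) (conv (\<beta> 1) D) s" .
  qed (use t in auto)
  have "D t = ?J (B (f t) - \<kappa> *\<^sub>R u t)" for t
    by (simp add: D_def F0_def u_def J.diff J.add J.scaleR algebra_simps)
  then have "B (D t) + \<epsilon> *\<^sub>R D t + \<kappa> *\<^sub>R u t = B (f t)" for t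
    using resolvent_eq[OF \<epsilon>, of "B (f t) - \<kappa> *\<^sub>R u t"] by simp
  \<comment> \<open>Every convolution vanishes at time zero.\<close>
  moreover have "v 0 = 0" using eq[of 0] T_pos by (simp add: J.zero)
  ultimately have "evolution \<kappa> (\<lambda>x. B x + \<epsilon> *\<^sub>R x) (\<lambda>t. B (f t)) u0 u1 u v D"
    unfolding evolution_def using v Dc kv by (auto simp: u_def conv_beta1)
  then show ?thesis by blast
qed

text \<open>A mild solution need not be differentiable, so the energy estimate is applied to the
  twice integrated difference: \<open>U\<close> plays the role of \<open>u\<close>, its derivative
  \<open>v\<close> is the running integral of \<open>d\<close>, and \<open>D\<close> is
  \<open>conv k d\<close>. With zero data \<open>U\<close> vanishes, and cancelling two running
  integrals gives \<open>d = 0\<close>.\<close>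

lemma mild_unique:
  assumes u: "mild f u0 u1 u" and u': "mild f u0 u1 u'" and t: "t \<in> {0..T}"
  shows "u t = u' t"
proof -
  define d where "d = (\<lambda>s. u s - u' s)"
  have uc: "continuous_on {0..T} u" "continuous_on {0..T} u'" using u u' by (auto simp: mild_def)
  have dc: "continuous_on {0..T} d" unfolding d_def by (intro continuous_intros uc)
  have deq: "B (d s + conv h d s) = - \<kappa> *\<^sub>R conv (\<beta> (1 + \<gamma>)) d s" if s: "0 \<le> s" "s \<le> T" for s
  proof -
    note c = uc[THEN cont_sub[OF _ s(2)]]
    have hd: "conv h d s = conv h (\<lambda>s. u s - u0) s - conv h (\<lambda>s. u' s - u0) s"
      using conv_diff[OF kern_h s(2), of "\<lambda>s. u s - u0" "\<lambda>s. u' s - u0"] c by (simp add: d_def continuous_on_diff)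
    have bd: "conv (\<beta> (1 + \<gamma>)) d s = conv (\<beta> (1 + \<gamma>)) u s - conv (\<beta> (1 + \<gamma>)) u' s"
      unfolding d_def by (rule conv_diff[OF kb(3) s(2) c])
    have "B (u s - u0 + conv h (\<lambda>s. u s - u0) s - conv (\<beta> 1) g s *\<^sub>R u1 - conv (\<beta> (1 + \<gamma>)) f s) + \<kappa> *\<^sub>R conv (\<beta> (1 + \<gamma>)) u s = 0"
      "B (u' s - u0 + conv h (\<lambda>s. u' s - u0) s - conv (\<beta> 1) g s *\<^sub>R u1 - conv (\<beta> (1 + \<gamma>)) f s) + \<kappa> *\<^sub>R conv (\<beta> (1 + \<gamma>)) u' s = 0"
      using u u' s by (auto simp: mild_def)
    then show ?thesis unfolding hd bd by (simp add: d_def C.add C.diff algebra_simps)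
  qed
  define v where "v = conv (\<beta> 1) d"
  define D where "D = conv k d"
  define U where "U = conv (\<beta> 1) v"
  have vc: "continuous_on {0..T} v" unfolding v_def by (rule cont_conv_b1[OF dc])
  have Dc: "continuous_on {0..T} D" unfolding D_def by (rule conv_continuous[OF kern_k dc])
  have Uc: "continuous_on {0..T} U" unfolding U_def by (rule cont_conv_b1[OF vc])
  have BDc: "continuous_on {0..T} (\<lambda>s. B (D s))" by (rule continuous_on_compose2[OF linear_continuous_on[OF bl] Dc]) auto
  \<comment> \<open>Verified after convolution with \<open>\<beta> \<gamma>\<close>, where the
    deconvolution identity brings in the mild equation for the difference.\<close>
  have BD: "B (D s) = - \<kappa> *\<^sub>R U s" if s: "s \<in> {0..T}" for s
  proof (rule conv_beta_inject[OF BDc _ \<gamma> _ T_pos])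
    show "continuous_on {0..T} (\<lambda>s. - \<kappa> *\<^sub>R U s)" by (intro continuous_intros Uc)
    fix r assume r: "0 \<le> r" "r \<le> T"
    have "conv (\<beta> \<gamma>) (\<lambda>s. B (D s)) r = B (conv (\<beta> \<gamma>) (conv k d) r)"
      unfolding D_def[symmetric] by (rule conv_linear[OF kb(2) r(2) cont_sub[OF Dc r(2)] bl])
    also have "\<dots> = B (conv (\<beta> 1) (\<lambda>s. d s + conv h d s) r)" by (simp only: conv_\<gamma>_k[OF dc r])
    also have "\<dots> = conv (\<beta> 1) (\<lambda>s. B (d s + conv h d s)) r"
      by (rule conv_linear[OF kb(1) r(2) _ bl, symmetric]) (intro continuous_intros cont_sub[OF dc r(2)] cont_sub[OF cont_conv_h[OF dc] r(2)])
    also have "\<dots> = conv (\<beta> 1) (\<lambda>s. - \<kappa> *\<^sub>R conv (\<beta> (1 + \<gamma>)) d s) r" by (rule conv_cong) (use deq r in auto)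
    also have "\<dots> = - \<kappa> *\<^sub>R conv (\<beta> 1) (conv (\<beta> (1 + \<gamma>)) d) r" by (rule conv_scaleR)
    also have "conv (\<beta> 1) (conv (\<beta> (1 + \<gamma>)) d) r = conv (\<beta> 1) (conv (\<beta> \<gamma>) v) r"
      by (rule conv_cong) (use r conv_beta_beta[OF \<gamma>(1) zero_less_one dc] in \<open>auto simp: v_def add.commute\<close>)
    also have "\<dots> = conv (\<beta> \<gamma>) U r" unfolding U_def by (rule conv_left_commute[OF kb(1,2) vc r])
    finally show "conv (\<beta> \<gamma>) (\<lambda>s. B (D s)) r = conv (\<beta> \<gamma>) (\<lambda>s. - \<kappa> *\<^sub>R U s) r" by (simp only: conv_scaleR)
  qed (use s in auto)
  have ev: "evolution \<kappa> B (\<lambda>_. 0) 0 0 U v D"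
    unfolding evolution_def
  proof (intro conjI ballI vc Dc)
    show "v 0 = 0" by (simp add: v_def)
    fix s assume s: "s \<in> {0..T}"
    show "conv k v s = integral {0..s} D"
      unfolding conv_beta1[symmetric] v_def D_def by (rule conv_left_commute[OF kern_k kb(1) dc]) (use s in auto)
    show "U s = 0 + s *\<^sub>R 0 + integral {0..s} v" by (simp add: U_def conv_beta1)
    show "B (D s) + \<kappa> *\<^sub>R U s = 0" using BD[OF s] by simp
  qed
  obtain Q where Q: "\<And>(C :: 'h \<Rightarrow> 'h) G u0 u1 u v D m t. psd_operator C \<Longrightarrow> evolution \<kappa> C G u0 u1 u v D \<Longrightarrow> 0 \<le> m \<Longrightarrow>
     (\<And>t x. t \<in> {0..T} \<Longrightarrow> inner (G t) x \<le> m * sqrt (inner (C x) x)) \<Longrightarrow> t \<in> {0..T} \<Longrightarrow>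
     norm (u t) \<le> Q * (m + norm u0 + norm u1)"
    using energy_estimate[OF \<kappa>] by metis
  have U0: "U s = 0" if "s \<in> {0..T}" for s
    using Q[OF psd_operator_axioms ev order_refl _ that] by simp
  have z: "continuous_on {0..T} (\<lambda>_. 0::'h)" by simp
  have v0: "v s = 0" if "s \<in> {0..T}" for s
    using conv_beta1_inject[OF vc z _ T_pos, of s] U0 that unfolding U_def by (simp add: conv_beta1)
  have "d t = 0"
    using conv_beta1_inject[OF dc z _ T_pos, of t] v0 t unfolding v_def by (simp add: conv_beta1)
  then show ?thesis by (simp add: d_def)
qed

end

section \<open>Truncation and passage to the limit in the regularized problems\<close>

lemma norm_triangle3: "norm (a + b + c) \<le> norm a + norm b + norm (c :: 'b::real_normed_vector)"
  using norm_triangle_ineq[of "a + b" c] norm_triangle_ineq[of a b] by linarith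

lemma conv_uniform_limit:
  fixes u :: "nat \<Rightarrow> real \<Rightarrow> 'b::banach"
  assumes a: "kern T a" and u: "\<And>n. continuous_on {0..T} (u n)" and l: "uniform_limit {0..T} u l sequentially" and t: "t \<in> {0..T}"
  shows "(\<lambda>n. conv a (u n) t) \<longlonglongrightarrow> conv a l t"
proof (rule LIMSEQ_I)
  have lc: "continuous_on {0..T} l" by (rule uniform_limit_theorem[OF _ l]) (use u in auto)
  define I where "I = integral {0..T} (\<lambda>s. \<bar>a s\<bar>)"
  have I: "I \<ge> 0" unfolding I_def
    by (intro integral_nonneg absolutely_integrable_realD) (use a in \<open>auto simp: kern_def\<close>)
  fix e :: real assume e: "e > 0"
  then have "e / (I + 1) > 0" using I by simp
  then obtain N where N: "\<And>n s. n \<ge> N \<Longrightarrow> s \<in> {0..T} \<Longrightarrow> dist (u n s) (l s) < e / (I + 1)"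
    using l unfolding uniform_limit_iff eventually_sequentially by metis
  have "norm (conv a (u n) t - conv a l t) < e" if n: "n \<ge> N" for n
  proof -
    have tT: "t \<le> T" "0 \<le> t" using t by auto
    have c: "continuous_on {0..t} (u n)" "continuous_on {0..t} l" using t by (auto intro: continuous_on_subset[OF u] continuous_on_subset[OF lc])
    have "norm (conv a (\<lambda>s. u n s - l s) t) \<le> I * (e / (I + 1))"
      unfolding I_def
    proof (rule norm_conv_le[OF a tT(1) _ _ tT(2)])
      show "continuous_on {0..t} (\<lambda>s. u n s - l s)" by (intro continuous_intros c)
      show "norm (u n s - l s) \<le> e / (integral {0..T} (\<lambda>s. \<bar>a s\<bar>) + 1)" if "0 \<le> s" "s \<le> t" for s
        using N[OF n, of s] that t unfolding I_def dist_norm by auto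
    qed
    also have "\<dots> < e" using I e by (simp add: field_simps)
    finally show ?thesis using conv_diff[OF a tT(1) c] by simp
  qed
  then show "\<exists>no. \<forall>n\<ge>no. norm (conv a (u n) t - conv a l t) < e" by blast
qed

context diffusion_wave begin

text \<open>An approximate identity on \<open>S\<close>: of norm at most one, commuting with
  \<open>B\<close>, and with values in the range of \<open>B\<close>.\<close>

definition regularize :: "nat \<Rightarrow> 'h \<Rightarrow> 'h" where
  "regularize n x = B (resolvent (1 / real (Suc n)) x)"

lemma bounded_linear_regularize: "bounded_linear (regularize n)"
  unfolding regularize_def by (rule bounded_linear_compose[OF bl bounded_linear_resolvent]) simp

lemma norm_regularize_le: "norm (regularize n x) \<le> norm x"
  unfolding regularize_def by (rule C_resolvent_norm_le) simp

lemma regularize_in_S: "regularize n x \<in> S"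
  using S(3) by (auto simp: regularize_def)

lemma regularize_commute: "regularize n (B x) = B (regularize n x)"
  unfolding regularize_def by (simp add: resolvent_C_commute)

lemma regularize_twice_dist: "norm (x - regularize n (regularize n x)) \<le> 2 * norm (x - regularize n x)"
proof -
  interpret R: bounded_linear "regularize n" by (rule bounded_linear_regularize)
  have eq: "x - regularize n (regularize n x) = (x - regularize n x) + regularize n (x - regularize n x)"
    by (simp add: R.diff)
  have "norm (x - regularize n (regularize n x)) \<le> norm (x - regularize n x) + norm (regularize n (x - regularize n x))"
    unfolding eq by (rule norm_triangle_ineq)
  then show ?thesis using norm_regularize_le[of n "x - regularize n x"] by linarith
qed

text \<open>Strong convergence of operators of norm at most one is uniform on compact sets, here on
  the range of \<open>f\<close>: it suffices to treat a finite net.\<close>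

lemma regularize_twice_uniform:
  assumes f: "continuous_on {0..T} f" and fS: "\<And>t. t \<in> {0..T} \<Longrightarrow> f t \<in> S" and e: "e > 0"
  shows "\<forall>\<^sub>F n in sequentially. \<forall>t\<in>{0..T}. norm (f t - regularize n (regularize n (f t))) < e"
proof -
  have "seq_compact (f ` {0..T})" using compact_continuous_image[OF f compact_Icc] compact_eq_seq_compact_metric by blast
  \<comment> \<open>A single truncation costs three errors of \<open>e / 8\<close>; doubled by
    \<open>regularize_twice_dist\<close> they stay below \<open>e\<close>.\<close>
  from seq_compact_imp_totally_bounded[OF this, rule_format, of "e / 8"]
  obtain X where X: "finite X" "X \<subseteq> f ` {0..T}" "f ` {0..T} \<subseteq> (\<Union>x\<in>X. ball x (e / 8))"
    using e by auto
  have "\<forall>\<^sub>F n in sequentially. \<forall>x\<in>X. norm (x - regularize n x) < e / 8"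
  proof (rule eventually_ball_finite[OF X(1)], intro ballI)
    fix x assume "x \<in> X"
    then have "x \<in> S" using X(2) fS by auto
    then have "(\<lambda>n. regularize n x) \<longlonglongrightarrow> x"
      unfolding regularize_def using resolvent_tendsto[OF B_inj S] by blast
    then have "\<forall>\<^sub>F n in sequentially. dist (regularize n x) x < e / 8" by (rule tendstoD) (use e in simp)
    then show "\<forall>\<^sub>F n in sequentially. norm (x - regularize n x) < e / 8" by (simp add: dist_norm norm_minus_commute)
  qed
  then show ?thesis
  proof eventually_elim
    case (elim n)
    show ?case
    proof
      fix t assume "t \<in> {0..T}"
      then have "f t \<in> (\<Union>x\<in>X. ball x (e / 8))" using X(3) by blast
      then obtain x where x: "x \<in> X" "dist x (f t) < e / 8" by auto
      interpret R: bounded_linear "regularize n" by (rule bounded_linear_regularize)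
      have "f t - regularize n (f t) = (f t - x) + (x - regularize n x) + regularize n (x - f t)"
        by (simp add: R.diff)
      then have "norm (f t - regularize n (f t)) \<le> norm (f t - x) + norm (x - regularize n x) + norm (regularize n (x - f t))"
        by (simp only: norm_triangle3)
      also have "\<dots> < e / 8 + e / 8 + e / 8"
      proof -
        have "norm (x - regularize n x) < e / 8" using elim x(1) by blast
        moreover have "norm (x - f t) < e / 8" using x(2) by (simp add: dist_norm)
        moreover have "norm (f t - x) < e / 8" using x(2) by (simp add: dist_norm norm_minus_commute)
        ultimately show ?thesis using norm_regularize_le[of n "x - f t"] by linarith
      qed
      finally show "norm (f t - regularize n (regularize n (f t))) < e" using regularize_twice_dist[of "f t" n] e by linarith
    qed
  qed
qed

text \<open>Cauchy-Schwarz for the form of \<open>B\<close>, followed by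
  \<open>B <= B + \<epsilon>\<close>. Hence data \<open>B y\<close> are bounded in the norm dual to
  the form, uniformly in the shift.\<close>

lemma form_bound:
  assumes K: "\<And>x. norm (B x) \<le> norm x * K" "K \<ge> 0" and \<epsilon>: "\<epsilon> \<ge> 0" and y: "norm y \<le> Y"
  shows "inner (B y) x \<le> (sqrt K * Y) * sqrt (inner (B x + \<epsilon> *\<^sub>R x) x)"
proof -
  have "inner (B y) y \<le> norm (B y) * norm y" by (rule norm_cauchy_schwarz)
  also have "\<dots> \<le> (norm y * K) * norm y" by (intro mult_right_mono K) simp
  also have "\<dots> \<le> K * Y\<^sup>2" using mult_left_mono[OF power_mono[OF y norm_ge_zero, of 2] K(2)] by (simp add: power2_eq_square algebra_simps)
  finally have "sqrt (inner (B y) y) \<le> sqrt K * Y"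
    using order_trans[OF norm_ge_zero y] real_sqrt_le_mono[of "inner (B y) y" "K * Y\<^sup>2"] by (simp add: real_sqrt_mult)
  moreover have "sqrt (inner (B x) x) \<le> sqrt (inner (B x + \<epsilon> *\<^sub>R x) x)" using \<epsilon> by (simp add: inner_add_left)
  moreover have "inner (B y) x \<le> sqrt (inner (B y) y) * sqrt (inner (B x) x)" using form_cauchy_schwarz[of y x] by simp
  ultimately show ?thesis using psd by (smt (verit) mult_mono real_sqrt_ge_zero)
qed

text \<open>The Cauchy property comes from a three-term split with the squared truncation
  \<open>R j\<close>. The error \<open>u n - R j (u n)\<close> solves the same problem with small
  data and is small uniformly in \<open>n\<close>; for fixed \<open>j\<close> the difference of
  \<open>R j (u n)\<close> and \<open>R j (u m)\<close> is of order
  \<open>|e n - e m|\<close>.\<close>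

theorem well_posed:
  obtains Q where "Q > 0" "\<And>f u0 u1 F. continuous_on {0..T} f \<Longrightarrow> (\<And>t. t \<in> {0..T} \<Longrightarrow> f t \<in> S) \<Longrightarrow> u0 \<in> S \<Longrightarrow> u1 \<in> S \<Longrightarrow>
     (\<And>t. t \<in> {0..T} \<Longrightarrow> norm (f t) \<le> F) \<Longrightarrow>
     \<exists>u. mild f u0 u1 u \<and> (\<forall>t\<in>{0..T}. u t \<in> S \<and> norm (u t) \<le> Q * (F + norm u0 + norm u1))"
proof -
  obtain Q0 where Q0: "Q0 > 0" "\<And>(C :: 'h \<Rightarrow> 'h) G u0 u1 u v D m t. psd_operator C \<Longrightarrow> evolution \<kappa> C G u0 u1 u v D \<Longrightarrow> 0 \<le> m \<Longrightarrow>
     (\<And>t x. t \<in> {0..T} \<Longrightarrow> inner (G t) x \<le> m * sqrt (inner (C x) x)) \<Longrightarrow> t \<in> {0..T} \<Longrightarrow>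
     norm (u t) \<le> Q0 * (m + norm u0 + norm u1)"
    using energy_estimate[OF \<kappa>] by metis
  obtain K where K: "K > 0" "\<And>x. norm (B x) \<le> norm x * K" using C.pos_bounded by blast
  then have K0: "K \<ge> 0" by simp
  define e where "e = (\<lambda>n. 1 / real (Suc n))"
  have e: "e n > 0" "e n \<ge> 0" for n by (auto simp: e_def)
  have e_lim: "e \<longlonglongrightarrow> 0" unfolding e_def by (rule LIMSEQ_Suc[OF lim_1_over_n])
  define Cn where "Cn = (\<lambda>n x. B x + e n *\<^sub>R x)"
  have Cn: "psd_operator (Cn n)" for n unfolding Cn_def by (rule shift_psd[OF e(2)])
  have Cbl: "bounded_linear (Cn n)" for n using Cn psd_operator.bl by blast
  have fb: "inner (B y) x \<le> (sqrt K * Y) * sqrt (inner (Cn n x) x)" if "norm y \<le> Y" for n x y Y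
    unfolding Cn_def by (rule form_bound[OF K(2) K0 e(2) that])
  define Q where "Q = Q0 * (sqrt K + 1)"
  show thesis
  proof (rule that)
    show "Q > 0" using Q0 K by (simp add: Q_def add_nonneg_pos)
    fix f u0 u1 F
    assume f: "continuous_on {0..T} f" and fS: "\<And>t. t \<in> {0..T} \<Longrightarrow> f t \<in> S" and uS: "u0 \<in> S" "u1 \<in> S"
      and F: "\<And>t. t \<in> {0..T} \<Longrightarrow> norm (f t) \<le> F"
    have F0: "F \<ge> 0" using F[of 0] T_pos norm_ge_zero[of "f 0"] by (simp del: norm_ge_zero)
    have "\<forall>n. \<exists>p. evolution \<kappa> (Cn n) (\<lambda>t. B (f t)) u0 u1 (fst p) (fst (snd p)) (snd (snd p))"
      using regularized_exists[OF e(1) f] unfolding Cn_def by (metis fst_conv snd_conv)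
    then obtain p where p: "\<And>n. evolution \<kappa> (Cn n) (\<lambda>t. B (f t)) u0 u1 (fst (p n)) (fst (snd (p n))) (snd (snd (p n)))" by metis
    define u v D where "u = (\<lambda>n. fst (p n))" and "v = (\<lambda>n. fst (snd (p n)))" and "D = (\<lambda>n. snd (snd (p n)))"
    have ev: "evolution \<kappa> (Cn n) (\<lambda>t. B (f t)) u0 u1 (u n) (v n) (D n)" for n using p by (simp add: u_def v_def D_def)
    have uc: "continuous_on {0..T} (u n)" for n by (rule evolution_continuous[OF ev])
    define U where "U = Q0 * (sqrt K * F + norm u0 + norm u1)"
    have uU: "norm (u n t) \<le> U" if "t \<in> {0..T}" for n t
      unfolding U_def by (rule Q0(2)[OF Cn ev _ _ that]) (use K F0 in \<open>auto intro!: fb F\<close>)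
    define N where "N = F * K + \<kappa> * U"
    \<comment> \<open>No bound on \<open>D n\<close> uniform in \<open>n\<close> is at hand, but the
      resolvent bound controls \<open>B (D n)\<close> independently of the shift.\<close>
    have DN: "norm (B (D n t)) \<le> N" if t: "t \<in> {0..T}" for n t
    proof -
      have "B (D n t) + e n *\<^sub>R D n t + \<kappa> *\<^sub>R u n t = B (f t)" using evolution_eq[OF ev t] by (simp add: Cn_def)
      then have X: "B (D n t) + e n *\<^sub>R D n t = B (f t) - \<kappa> *\<^sub>R u n t" by (simp add: eq_diff_eq)
      have 1: "norm (B (D n t)) \<le> norm (B (f t) - \<kappa> *\<^sub>R u n t)"
        unfolding X[symmetric] by (rule shift_norm_ge(2)[OF e(1)])
      have 2: "norm (B (f t) - \<kappa> *\<^sub>R u n t) \<le> norm (B (f t)) + norm (\<kappa> *\<^sub>R u n t)" by (rule norm_triangle_ineq4)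
      have 3: "norm (B (f t)) \<le> F * K" using K(2)[of "f t"] mult_right_mono[OF F[OF t] K0] by linarith
      have 4: "norm (\<kappa> *\<^sub>R u n t) \<le> \<kappa> * U" using mult_left_mono[OF uU[OF t, of n], of \<kappa>] \<kappa> by simp
      show ?thesis unfolding N_def using 1 2 3 4 by linarith
    qed
    define R where "R = (\<lambda>j x. regularize j (regularize j x))"
    have Rbl: "bounded_linear (R j)" for j
      unfolding R_def by (rule bounded_linear_compose[OF bounded_linear_regularize bounded_linear_regularize])
    have Rcomm: "R j (Cn n x) = Cn n (R j x)" for j n x
    proof -
      interpret r: bounded_linear "regularize j" by (rule bounded_linear_regularize)
      show ?thesis by (simp add: R_def Cn_def r.add r.scaleR regularize_commute)
    qed
    have evR: "evolution \<kappa> (Cn n) (\<lambda>t. R j (B (f t))) (R j u0) (R j u1) (\<lambda>t. R j (u n t)) (\<lambda>t. R j (v n t)) (\<lambda>t. R j (D n t))" for j n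
      by (rule evolution_apply[OF ev Rbl]) (rule Rcomm)
    have RB: "R j (B x) = B (R j x)" for j x by (simp add: R_def regularize_commute)
    have approx: "\<exists>j. \<forall>n. \<forall>t\<in>{0..T}. norm (u n t - R j (u n t)) < r" if r: "r > 0" for r
    proof -
      \<comment> \<open>Chosen so that the energy bound with all three data errors at most
        \<open>d\<close> equals \<open>r / 2\<close>.\<close>
      define d where "d = r / (2 * Q0 * (sqrt K + 2))"
      have pos: "0 < 2 * Q0 * (sqrt K + 2)" using Q0(1) K by (intro mult_pos_pos add_nonneg_pos) auto
      have d1: "d > 0" unfolding d_def by (rule divide_pos_pos[OF r pos])
      have "2 * Q0 * (sqrt K + 2) * d = r" using less_imp_neq[OF pos] unfolding d_def by (metis nonzero_eq_divide_eq mult.commute)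
      moreover have "Q0 * (sqrt K * d + d + d) * 2 = 2 * Q0 * (sqrt K + 2) * d" by (simp add: algebra_simps)
      ultimately have d2: "Q0 * (sqrt K * d + d + d) = r / 2" by linarith
      note d = d1 d2
      have 1: "\<forall>\<^sub>F j in sequentially. \<forall>t\<in>{0..T}. norm (f t - R j (f t)) < d"
        unfolding R_def by (rule regularize_twice_uniform[OF f fS d(1)])
      have 2: "\<forall>\<^sub>F j in sequentially. \<forall>t\<in>{0..T}. norm (x - R j x) < d" if "x \<in> S" for x
        unfolding R_def by (rule regularize_twice_uniform[OF _ _ d(1)]) (use that in auto)
      have "\<forall>\<^sub>F j in sequentially. (\<forall>t\<in>{0..T}. norm (f t - R j (f t)) < d) \<and> (\<forall>t\<in>{0..T}. norm (u0 - R j u0) < d) \<and> (\<forall>t\<in>{0..T}. norm (u1 - R j u1) < d)"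
        by (intro eventually_conj 1 2 uS)
      from eventually_happens'[OF sequentially_bot this]
      obtain j where j: "\<forall>t\<in>{0..T}. norm (f t - R j (f t)) < d" "\<forall>t\<in>{0..T}. norm (u0 - R j u0) < d" "\<forall>t\<in>{0..T}. norm (u1 - R j u1) < d"
        by blast
      have z: "0 \<in> {0..T}" using T_pos by simp
      note j = bspec[OF j(1)] bspec[OF j(2) z] bspec[OF j(3) z]
      interpret Rj: bounded_linear "R j" by (rule Rbl)
      have "norm (u n t - R j (u n t)) < r" if t: "t \<in> {0..T}" for n t
      proof -
        have evd: "evolution \<kappa> (Cn n) (\<lambda>t. B (f t) - R j (B (f t)) - (Cn n (R j (D n t)) - Cn n (R j (D n t)))) (u0 - R j u0) (u1 - R j u1)
           (\<lambda>t. u n t - R j (u n t)) (\<lambda>t. v n t - R j (v n t)) (\<lambda>t. D n t - R j (D n t))"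
          by (rule evolution_diff[OF ev evR Cbl])
        have "norm (u n t - R j (u n t)) \<le> Q0 * (sqrt K * d + norm (u0 - R j u0) + norm (u1 - R j u1))"
        proof (rule Q0(2)[OF Cn evd _ _ t])
          fix t x assume "t \<in> {0..T}"
          then have "norm (f t - R j (f t)) \<le> d" using j(1) less_imp_le by blast
          from fb[OF this, of x n]
          show "inner (B (f t) - R j (B (f t)) - (Cn n (R j (D n t)) - Cn n (R j (D n t)))) x \<le> sqrt K * d * sqrt (inner (Cn n x) x)"
            by (simp add: RB C.diff)
        qed (use d K in auto)
        also have "\<dots> \<le> Q0 * (sqrt K * d + d + d)"
        proof (rule mult_left_mono)
          show "sqrt K * d + norm (u0 - R j u0) + norm (u1 - R j u1) \<le> sqrt K * d + d + d" using j(2,3) by linarith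
        qed (use Q0(1) in simp)
        also have "\<dots> < r" using d r by simp
        finally show ?thesis .
      qed
      then show ?thesis by blast
    qed
    \<comment> \<open>The operator mismatch is \<open>(e m - e n) R j (D m)\<close>. Of the two
      factors \<open>B\<close> in the truncation, one gives this datum the form \<open>B y\<close>
      and the other meets \<open>D m\<close>, where the uniform bound is known. The price
      \<open>1 / (e j)^2\<close> is harmless for fixed \<open>j\<close>.\<close>
    have smooth: "norm (R j (u n t) - R j (u m t)) \<le> Q0 * (sqrt K * (\<bar>e n - e m\<bar> * (N / (e j * e j))))" if t: "t \<in> {0..T}" for j n m t
    proof -
      interpret Rj: bounded_linear "R j" by (rule Rbl)
      let ?J = "resolvent (e j)"
      have Rz: "R j x = B (?J (?J (B x)))" for x
      proof -
        have "1 / real (Suc j) = e j" by (simp add: e_def)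
        then show ?thesis unfolding R_def regularize_def by (simp only: resolvent_C_commute[OF e(1)])
      qed
      have z: "norm (?J (?J (B (D m t)))) \<le> N / (e j * e j)" if t: "t \<in> {0..T}" for t
      proof -
        have "norm (?J (?J (B (D m t)))) \<le> norm (?J (B (D m t))) / e j" by (rule resolvent_norm_le[OF e(1)])
        also have "\<dots> \<le> (norm (B (D m t)) / e j) / e j" by (intro divide_right_mono resolvent_norm_le e)
        also have "\<dots> \<le> (N / e j) / e j" by (intro divide_right_mono DN t e)
        finally show ?thesis by simp
      qed
      have evd: "evolution \<kappa> (Cn n) (\<lambda>t. R j (B (f t)) - R j (B (f t)) - (Cn n (R j (D m t)) - Cn m (R j (D m t)))) (R j u0 - R j u0) (R j u1 - R j u1)
           (\<lambda>t. R j (u n t) - R j (u m t)) (\<lambda>t. R j (v n t) - R j (v m t)) (\<lambda>t. R j (D n t) - R j (D m t))"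
        by (rule evolution_diff[OF evR evR Cbl])
      have "norm (R j (u n t) - R j (u m t)) \<le> Q0 * (sqrt K * (\<bar>e n - e m\<bar> * (N / (e j * e j))) + norm (R j u0 - R j u0) + norm (R j u1 - R j u1))"
      proof (rule Q0(2)[OF Cn evd _ _ t])
        have "0 \<le> norm (B (D m t))" by simp
        then have "N \<ge> 0" using DN[OF t, of m] by linarith
        then show "0 \<le> sqrt K * (\<bar>e n - e m\<bar> * (N / (e j * e j)))" using K0 e by simp
        fix t x assume t: "t \<in> {0..T}"
        have "norm ((e m - e n) *\<^sub>R ?J (?J (B (D m t)))) \<le> \<bar>e n - e m\<bar> * (N / (e j * e j))"
          unfolding norm_scaleR by (subst abs_minus_commute) (intro mult_left_mono z t, simp)
        note b = fb[OF this, of x n]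
        have eq: "R j (B (f t)) - R j (B (f t)) - (Cn n (R j (D m t)) - Cn m (R j (D m t))) = B ((e m - e n) *\<^sub>R ?J (?J (B (D m t))))"
          unfolding Rz[of "D m t"] by (simp only: Cn_def C.scaleR) (simp add: algebra_simps)
        show "inner (R j (B (f t)) - R j (B (f t)) - (Cn n (R j (D m t)) - Cn m (R j (D m t)))) x
            \<le> sqrt K * (\<bar>e n - e m\<bar> * (N / (e j * e j))) * sqrt (inner (Cn n x) x)"
          unfolding eq by (rule b)
      qed
      then show ?thesis by simp
    qed
    have "uniformly_Cauchy_on {0..T} u"
      unfolding uniformly_Cauchy_on_def
    proof (intro allI impI)
      fix r :: real assume r: "r > 0"
      have "r / 4 > 0" using r by simp
      then obtain j where j: "\<And>n t. t \<in> {0..T} \<Longrightarrow> norm (u n t - R j (u n t)) < r / 4" using approx by blast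
      define c0 where "c0 = Q0 * (sqrt K * (\<bar>N\<bar> / (e j * e j))) + 1"
      have c0: "c0 > 0" unfolding c0_def using Q0(1) K0 e by (intro add_nonneg_pos mult_nonneg_nonneg divide_nonneg_nonneg) auto
      have "Cauchy e" using e_lim by (rule LIMSEQ_imp_Cauchy)
      then obtain M0 where M0: "\<And>m n. m \<ge> M0 \<Longrightarrow> n \<ge> M0 \<Longrightarrow> dist (e m) (e n) < r / 4 / c0"
        using metric_CauchyD[of e "r / 4 / c0"] r c0 by auto
      show "\<exists>M. \<forall>x\<in>{0..T}. \<forall>m\<ge>M. \<forall>n\<ge>M. dist (u m x) (u n x) < r"
      proof (intro exI[of _ M0] ballI allI impI)
        fix t m n assume t: "t \<in> {0..T}" and mn: "m \<ge> M0" "n \<ge> M0"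
        have "Q0 * (sqrt K * (\<bar>e m - e n\<bar> * (N / (e j * e j)))) \<le> Q0 * (sqrt K * (\<bar>e m - e n\<bar> * (\<bar>N\<bar> / (e j * e j))))"
          using Q0(1) K0 e by (intro mult_left_mono divide_right_mono) auto
        also have "\<dots> \<le> \<bar>e m - e n\<bar> * c0" by (simp add: c0_def algebra_simps)
        also have "\<dots> < r / 4" using M0[OF mn] c0 by (simp add: dist_real_def pos_less_divide_eq)
        finally have 1: "norm (R j (u m t) - R j (u n t)) < r / 4" using smooth[OF t, of j m n] by linarith
        have "u m t - u n t = (u m t - R j (u m t)) - (u n t - R j (u n t)) + (R j (u m t) - R j (u n t))" by simp
        then have "norm (u m t - u n t) \<le> norm (u m t - R j (u m t)) + norm (u n t - R j (u n t)) + norm (R j (u m t) - R j (u n t))"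
          using norm_triangle3[of "u m t - R j (u m t)" "- (u n t - R j (u n t))" "R j (u m t) - R j (u n t)"] by (simp add: norm_minus_commute)
        then show "dist (u m t) (u n t) < r" using j[OF t, of m] j[OF t, of n] 1 r by (simp add: dist_norm)
      qed
    qed
    then obtain l where l: "uniform_limit {0..T} u l sequentially"
      using Cauchy_uniformly_convergent unfolding uniformly_convergent_on_def by blast
    have lc: "continuous_on {0..T} l" by (rule uniform_limit_theorem[OF _ l]) (use uc in auto)
    have ptw: "(\<lambda>n. u n t) \<longlonglongrightarrow> l t" if "t \<in> {0..T}" for t by (rule tendsto_uniform_limitI[OF l that])
    \<comment> \<open>The vectors \<open>R j (u n t)\<close> lie in the range of \<open>B\<close>,
      hence in \<open>S\<close>, and come arbitrarily close to \<open>l t\<close>.\<close>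
    have lS: "l t \<in> S" if t: "t \<in> {0..T}" for t
    proof -
      have "l t \<in> closure S" unfolding closure_approachable
      proof (intro allI impI)
        fix r :: real assume r: "r > 0"
        have "r / 2 > 0" using r by simp
        then obtain j where j: "\<And>n. norm (u n t - R j (u n t)) < r / 2" using approx t by blast
        have "\<forall>\<^sub>F n in sequentially. dist (u n t) (l t) < r / 2" by (rule tendstoD[OF ptw[OF t]]) (use r in simp)
        then obtain n where "dist (u n t) (l t) < r / 2" by (auto simp: eventually_sequentially)
        then have "dist (R j (u n t)) (l t) < r"
          using j[of n] dist_triangle[of "R j (u n t)" "l t" "u n t"] by (simp add: dist_norm norm_minus_commute)
        moreover have "R j (u n t) \<in> S" by (simp add: R_def regularize_in_S)
        ultimately show "\<exists>y\<in>S. dist y (l t) < r" by blast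
      qed
      then show ?thesis using S(2) by (simp add: closure_closed)
    qed
    have lU: "norm (l t) \<le> Q * (F + norm u0 + norm u1)" if t: "t \<in> {0..T}" for t
    proof -
      have "norm (l t) \<le> U" by (rule LIMSEQ_le_const2[OF tendsto_norm[OF ptw[OF t]]]) (use uU t in blast)
      also have "\<dots> \<le> Q * (F + norm u0 + norm u1)"
      proof -
        have "sqrt K * F + norm u0 + norm u1 \<le> (sqrt K + 1) * (F + norm u0 + norm u1)"
          using K0 F0 by (simp add: algebra_simps)
        then show ?thesis unfolding U_def Q_def using mult_left_mono[of _ _ Q0] Q0(1) by (simp add: mult.assoc)
      qed
      finally show ?thesis .
    qed
    have "mild f u0 u1 l"
      unfolding mild_def
    proof (intro conjI ballI lc)
      fix t assume t: "t \<in> {0..T}"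
      then have t': "0 \<le> t" "t \<le> T" by auto
      define wn where "wn = (\<lambda>n s. u n s - u0 - s *\<^sub>R u1)"
      define w where "w = (\<lambda>s. l s - u0 - s *\<^sub>R u1)"
      have wl: "uniform_limit {0..T} wn w sequentially"
        using l by (simp add: uniform_limit_iff wn_def w_def dist_norm)
      have wnc: "continuous_on {0..T} (wn n)" for n unfolding wn_def by (intro continuous_intros uc)
      have Bf: "continuous_on {0..T} (\<lambda>s. B (f s))" by (rule continuous_on_compose2[OF linear_continuous_on[OF bl] f]) auto
      have gl: "uniform_limit {0..T} (\<lambda>n s. B (f s) - \<kappa> *\<^sub>R u n s) (\<lambda>s. B (f s) - \<kappa> *\<^sub>R l s) sequentially"
        unfolding uniform_limit_iff
      proof (intro allI impI)
        fix r :: real assume "r > 0"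
        then have "\<forall>\<^sub>F n in sequentially. \<forall>x\<in>{0..T}. dist (u n x) (l x) < r / \<kappa>"
          using l \<kappa> unfolding uniform_limit_iff by simp
        then show "\<forall>\<^sub>F n in sequentially. \<forall>x\<in>{0..T}. dist (B (f x) - \<kappa> *\<^sub>R u n x) (B (f x) - \<kappa> *\<^sub>R l x) < r"
        proof eventually_elim
          case (elim n)
          have "dist (B (f x) - \<kappa> *\<^sub>R u n x) (B (f x) - \<kappa> *\<^sub>R l x) = \<kappa> * dist (u n x) (l x)" for x
          proof -
            have "(B (f x) - \<kappa> *\<^sub>R u n x) - (B (f x) - \<kappa> *\<^sub>R l x) = - (\<kappa> *\<^sub>R (u n x - l x))" by (simp add: algebra_simps)
            then show ?thesis unfolding dist_norm using \<kappa> by (simp only: norm_minus_cancel norm_scaleR)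
          qed
          then show ?case using elim \<kappa> by (simp add: pos_less_divide_eq mult.commute)
        qed
      qed
      have X: "(\<lambda>n. wn n t + conv h (wn n) t) \<longlonglongrightarrow> w t + conv h w t"
        by (intro tendsto_add conv_uniform_limit[OF kern_h wnc wl t] tendsto_uniform_limitI[OF wl t])
      \<comment> \<open>The shift contributes \<open>e n\<close> times a convergent sequence and
        disappears in the limit.\<close>
      have "(\<lambda>n. Cn n (wn n t + conv h (wn n) t)) \<longlonglongrightarrow> B (w t + conv h w t) + 0 *\<^sub>R (w t + conv h w t)"
        unfolding Cn_def by (intro tendsto_add tendsto_scaleR C.tendsto X e_lim)
      moreover have "Cn n (wn n t + conv h (wn n) t) = conv (\<beta> (1 + \<gamma>)) (\<lambda>s. B (f s) - \<kappa> *\<^sub>R u n s) t" for n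
        unfolding wn_def by (rule evolution_volterra[OF Cbl ev t'])
      moreover have "(\<lambda>n. conv (\<beta> (1 + \<gamma>)) (\<lambda>s. B (f s) - \<kappa> *\<^sub>R u n s) t) \<longlonglongrightarrow> conv (\<beta> (1 + \<gamma>)) (\<lambda>s. B (f s) - \<kappa> *\<^sub>R l s) t"
        by (rule conv_uniform_limit[OF kb(3) _ gl t]) (intro continuous_intros Bf uc)
      ultimately have "B (w t + conv h w t) = conv (\<beta> (1 + \<gamma>)) (\<lambda>s. B (f s) - \<kappa> *\<^sub>R l s) t"
        using LIMSEQ_unique by fastforce
      also have "\<dots> = conv (\<beta> (1 + \<gamma>)) (\<lambda>s. B (f s)) t - conv (\<beta> (1 + \<gamma>)) (\<lambda>s. \<kappa> *\<^sub>R l s) t"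
        by (rule conv_diff[OF kb(3) t'(2)]) (intro continuous_intros cont_sub[OF Bf t'(2)] cont_sub[OF lc t'(2)])+
      also have "conv (\<beta> (1 + \<gamma>)) (\<lambda>s. B (f s)) t = B (conv (\<beta> (1 + \<gamma>)) f t)"
        by (rule conv_linear[OF kb(3) t'(2) cont_sub[OF f t'(2)] bl])
      also have "conv (\<beta> (1 + \<gamma>)) (\<lambda>s. \<kappa> *\<^sub>R l s) t = \<kappa> *\<^sub>R conv (\<beta> (1 + \<gamma>)) l t" by (rule conv_scaleR)
      finally show "B (l t - u0 + conv h (\<lambda>s. l s - u0) t - conv (\<beta> 1) g t *\<^sub>R u1 - conv (\<beta> (1 + \<gamma>)) f t) + \<kappa> *\<^sub>R conv (\<beta> (1 + \<gamma>)) l t = 0"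
        unfolding shift_data[OF lc t'] by (simp add: C.diff w_def)
    qed
    with lS lU show "\<exists>u. mild f u0 u1 u \<and> (\<forall>t\<in>{0..T}. u t \<in> S \<and> norm (u t) \<le> Q * (F + norm u0 + norm u1))" by blast
  qed
qed

end

section \<open>The variable-order kernel\<close>

lemma continuous_on_Icc_from_Ioc:
  fixes f :: "real \<Rightarrow> 'b::topological_space"
  assumes f: "continuous_on {a<..b} f" and lim: "(f \<longlongrightarrow> f a) (at_right a)" and "a < b"
  shows "continuous_on {a..b} f"
  unfolding continuous_on_def
proof
  fix x assume x: "x \<in> {a..b}"
  show "(f \<longlongrightarrow> f x) (at x within {a..b})"
  proof (cases "x = a")
    case True
    then show ?thesis using lim \<open>a < b\<close> by (simp add: at_within_Icc_at_right)
  next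
    case False
    then have xa: "a < x" using x by simp
    have "at x within {a..b} = at x within {a<..b}"
      by (rule at_within_nhd[of x "{a<..}"]) (use xa in auto)
    then show ?thesis using f xa x unfolding continuous_on_def by auto
  qed
qed

lemma kern_cong:
  assumes "\<And>s. 0 < s \<Longrightarrow> s < T \<Longrightarrow> a s = b s" and "kern T a"
  shows "kern T b"
proof -
  have "continuous_on {0<..<T} b" using assms by (auto simp: kern_def intro: continuous_on_eq)
  moreover have "b absolutely_integrable_on {0<..<T}"
  proof -
    have "a absolutely_integrable_on {0<..<T}" using assms(2) by (simp add: kern_def absolutely_integrable_on_Icc_iff_Ioo)
    then show ?thesis by (rule absolutely_integrable_spike[of _ _ "{}"]) (use assms(1) in auto)
  qed
  ultimately show ?thesis by (simp add: kern_def absolutely_integrable_on_Icc_iff_Ioo)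
qed

lemma kern_add: "kern T a \<Longrightarrow> kern T b \<Longrightarrow> kern T (\<lambda>s. a s + b s)"
  unfolding kern_def using continuous_on_add by blast

lemma kern_integral_has_derivative:
  assumes "kern T h" "0 < t" "t < T"
  shows "((\<lambda>s. integral {0..s} h) has_real_derivative h t) (at t)"
proof -
  have i: "h integrable_on {0..T}" using assms absolutely_integrable_realD unfolding kern_def by blast
  have "isCont h t" using assms unfolding kern_def by (simp add: continuous_on_eq_continuous_at)
  then have "continuous (at t within ({0..T} - {})) h" by (rule continuous_at_imp_continuous_at_within)
  from integral_has_vector_derivative_continuous_at[OF i _ finite.emptyI this]
  have "((\<lambda>s. integral {0..s} h) has_vector_derivative h t) (at t within {0..T})" using assms by simp
  then show ?thesis
    using assms by (simp add: has_real_derivative_iff_has_vector_derivative at_within_Icc_at)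
qed

locale variable_order =
  fixes T L :: real and \<alpha> \<alpha>' :: "real \<Rightarrow> real"
  assumes T_pos: "T > 0"
    and \<alpha>_range: "t \<in> {0..T} \<Longrightarrow> 1 < \<alpha> t \<and> \<alpha> t < 2"
    and \<alpha>_deriv: "t \<in> {0..T} \<Longrightarrow> (\<alpha> has_real_derivative \<alpha>' t) (at t within {0..T})"
    and \<alpha>'_cont: "continuous_on {0..T} \<alpha>'"
    and \<alpha>'_le: "t \<in> {0..T} \<Longrightarrow> \<bar>\<alpha>' t\<bar> \<le> L"
begin

text \<open>Chosen for \<open>(1 - \<alpha> 0) + (1 - \<sigma>) = \<sigma>\<close> and
  \<open>2 * (\<sigma> - 1) = - \<alpha> 0\<close>. By the first, logarithms may be paid for with
  \<open>t powr (- \<sigma>)\<close> and the remainder of the kernel still vanishes at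
  \<open>0\<close>; by the second, the leading term of the derivative of the kernel is, up to a
  factor, the square of the bound on the derivative of the remainder.\<close>

definition "\<sigma> = 1 - \<alpha> 0 / 2"

lemma \<alpha>0: "1 < \<alpha> 0" "\<alpha> 0 < 2" and \<sigma>: "0 < \<sigma>" "\<sigma> < 1"
  using \<alpha>_range[of 0] T_pos by (auto simp: \<sigma>_def)

lemma L_nonneg: "L \<ge> 0" using \<alpha>'_le[of 0] T_pos by auto

lemma \<alpha>_cont: "continuous_on {0..T} \<alpha>"
  by (rule DERIV_continuous_on[OF \<alpha>_deriv])

lemma \<alpha>_lipschitz: "t \<in> {0..T} \<Longrightarrow> \<bar>\<alpha> 0 - \<alpha> t\<bar> \<le> L * t"
  using field_differentiable_bound[OF convex_real_interval(5) \<alpha>_deriv, of L 0 t] \<alpha>'_le T_pos by auto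

lemma ln_le_powr: "\<exists>K\<ge>0. \<forall>t. 0 < t \<and> t \<le> T \<longrightarrow> 1 \<le> K * t powr (- \<sigma>) \<and> \<bar>ln t\<bar> \<le> K * t powr (- \<sigma>)"
\<comment> \<open>The summand \<open>1 / \<sigma>\<close> bounds the logarithm for
  \<open>t <= 1\<close>, \<open>T powr \<sigma>\<close> covers the constant \<open>1\<close>, and
  \<open>T * T powr \<sigma>\<close> covers \<open>ln t <= T\<close> for
  \<open>t > 1\<close>.\<close>
proof (intro exI[of _ "1 / \<sigma> + (1 + T) * T powr \<sigma>"] conjI allI impI)
  show "0 \<le> 1 / \<sigma> + (1 + T) * T powr \<sigma>" using \<sigma> T_pos by simp
  fix t assume "0 < t \<and> t \<le> T"
  then have t: "0 < t" "t \<le> T" by auto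
  have p: "T powr \<sigma> * t powr (- \<sigma>) \<ge> 1"
  proof -
    have "t powr \<sigma> \<le> T powr \<sigma>" using t \<sigma> by (intro powr_mono2) auto
    then have "t powr \<sigma> * t powr (- \<sigma>) \<le> T powr \<sigma> * t powr (- \<sigma>)" by (intro mult_right_mono) auto
    then show ?thesis using t by (simp add: powr_add[symmetric])
  qed
  have eq: "(1 / \<sigma> + (1 + T) * T powr \<sigma>) * t powr (- \<sigma>) = t powr (- \<sigma>) / \<sigma> + T powr \<sigma> * t powr (- \<sigma>) + T * (T powr \<sigma> * t powr (- \<sigma>))"
    by (simp add: algebra_simps)
  have n: "0 \<le> t powr (- \<sigma>) / \<sigma>" "T * (T powr \<sigma> * t powr (- \<sigma>)) \<ge> T * 1" using \<sigma> T_pos p by (auto simp del: mult_1_right intro!: mult_left_mono)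
  show "1 \<le> (1 / \<sigma> + (1 + T) * T powr \<sigma>) * t powr (- \<sigma>)" unfolding eq using p n T_pos by linarith
  show "\<bar>ln t\<bar> \<le> (1 / \<sigma> + (1 + T) * T powr \<sigma>) * t powr (- \<sigma>)"
  proof (cases "t \<le> 1")
    case True
    have "ln (1 / t) \<le> (1 / t) powr \<sigma> / \<sigma>" by (rule ln_powr_bound) (use True t \<sigma> in auto)
    moreover have "(1 / t) powr \<sigma> = t powr (- \<sigma>)" using t by (simp add: powr_divide powr_minus_divide)
    ultimately have "ln (1 / t) \<le> t powr (- \<sigma>) / \<sigma>" by simp
    moreover have "\<bar>ln t\<bar> = ln (1 / t)" using True t by (simp add: ln_div)
    ultimately show ?thesis unfolding eq using p n T_pos by linarith
  next
    case False
    then have "\<bar>ln t\<bar> \<le> T" using t ln_le_minus_one[of t] by simp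
    then show ?thesis unfolding eq using p n T_pos by linarith
  qed
qed

lemma t_ln_le: "0 < t \<Longrightarrow> t \<le> T \<Longrightarrow> t * \<bar>ln t\<bar> \<le> 1 + T * T"
proof -
  assume t: "0 < t" "t \<le> T"
  show ?thesis
  proof (cases "t \<le> 1")
    case True
    have "ln (1 / t) \<le> 1 / t - 1" using t by (intro ln_le_minus_one) auto
    then have "\<bar>ln t\<bar> \<le> 1 / t" using True t by (simp add: ln_div)
    then have "t * \<bar>ln t\<bar> \<le> t * (1 / t)" using t by (intro mult_left_mono) auto
    moreover have "0 \<le> T * T" by simp
    ultimately show ?thesis using t by (smt (verit) nonzero_mult_div_cancel_left times_divide_eq_right)
  next
    case False
    then have "\<bar>ln t\<bar> \<le> T" using t ln_le_minus_one[of t] by simp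
    then have "t * \<bar>ln t\<bar> \<le> T * T" using t by (intro mult_mono) auto
    then show ?thesis by simp
  qed
qed

text \<open>The kernel is \<open>t\<^bsup>1 - \<alpha>(0)\<^esup> q(t)\<close>, where \<open>q\<close> is continuous and \<open>q'\<close> is logarithmic at \<open>0\<close>.\<close>

definition q :: "real \<Rightarrow> real" where
  "q t = (if t \<le> 0 then rGamma (2 - \<alpha> 0) else t powr (\<alpha> 0 - \<alpha> t) * rGamma (2 - \<alpha> t))"

definition q' :: "real \<Rightarrow> real" where
  "q' t = t powr (\<alpha> 0 - \<alpha> t) * ((- \<alpha>' t) * ln t + (\<alpha> 0 - \<alpha> t) / t) * rGamma (2 - \<alpha> t)
     + t powr (\<alpha> 0 - \<alpha> t) * (rGamma (2 - \<alpha> t) * Digamma (2 - \<alpha> t) * \<alpha>' t)"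

lemma not_nonpos: "t \<in> {0..T} \<Longrightarrow> 2 - \<alpha> t \<notin> \<int>\<^sub>\<le>\<^sub>0"
  using \<alpha>_range[of t] by (auto elim!: nonpos_Ints_cases)

lemma continuous_rGamma: "A \<subseteq> {0..T} \<Longrightarrow> continuous_on A (\<lambda>t. rGamma (2 - \<alpha> t))"
proof -
  assume A: "A \<subseteq> {0..T}"
  have "continuous_on UNIV (rGamma :: real \<Rightarrow> real)"
    by (intro continuous_at_imp_continuous_on ballI DERIV_isCont[OF has_field_derivative_rGamma])
  then show ?thesis
    by (rule continuous_on_compose2) (auto intro!: continuous_intros continuous_on_subset[OF \<alpha>_cont A])
qed

lemma continuous_Digamma: "A \<subseteq> {0..T} \<Longrightarrow> continuous_on A (\<lambda>t. Digamma (2 - \<alpha> t))"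
proof -
  assume A: "A \<subseteq> {0..T}"
  have "continuous_on {0<..} (Digamma :: real \<Rightarrow> real)"
    by (rule continuous_on_Polygamma) (auto elim!: nonpos_Ints_cases)
  then show ?thesis
    by (rule continuous_on_compose2) (use A \<alpha>_range in \<open>auto intro!: continuous_intros continuous_on_subset[OF \<alpha>_cont A]\<close>)
qed

lemma q_deriv:
  assumes t: "0 < t" "t < T" shows "(q has_real_derivative q' t) (at t)"
proof -
  have \<alpha>: "(\<alpha> has_real_derivative \<alpha>' t) (at t)"
    using \<alpha>_deriv[of t] t by (simp add: at_within_Icc_at)
  have d: "((\<lambda>s. \<alpha> 0 - \<alpha> s) has_real_derivative - \<alpha>' t) (at t)" "((\<lambda>s. 2 - \<alpha> s) has_real_derivative - \<alpha>' t) (at t)"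
    using \<alpha> by (auto intro!: derivative_eq_intros)
  have G: "((\<lambda>s. rGamma (2 - \<alpha> s)) has_real_derivative (- rGamma (2 - \<alpha> t) * Digamma (2 - \<alpha> t)) * (- \<alpha>' t)) (at t)"
    by (rule DERIV_chain2[OF has_field_derivative_rGamma_no_nonpos_int[OF not_nonpos] d(2)]) (use t in auto)
  have P: "((\<lambda>s. s powr (\<alpha> 0 - \<alpha> s)) has_real_derivative t powr (\<alpha> 0 - \<alpha> t) * ((- \<alpha>' t) * ln t + 1 * (\<alpha> 0 - \<alpha> t) / t)) (at t)"
    by (rule DERIV_powr[OF DERIV_ident t(1) d(1)])
  have "((\<lambda>s. s powr (\<alpha> 0 - \<alpha> s) * rGamma (2 - \<alpha> s)) has_real_derivative q' t) (at t)"
    using DERIV_mult[OF P G] by (simp add: q'_def algebra_simps)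
  then show ?thesis
    by (rule has_field_derivative_transform_within_open[of _ _ _ "{0<..}"]) (use t in \<open>auto simp: q_def\<close>)
qed

lemma q'_cont: "continuous_on {0<..<T} q'"
proof -
  have [continuous_intros]: "continuous_on {0<..<T} \<alpha>" "continuous_on {0<..<T} \<alpha>'"
    using \<alpha>_cont \<alpha>'_cont by (auto elim!: continuous_on_subset)
  show ?thesis unfolding q'_def
    by (intro continuous_intros continuous_rGamma continuous_Digamma) auto
qed

text \<open>The Lipschitz bound makes the exponent of order \<open>t\<close>, and
  \<open>t * |ln t|\<close> is bounded, so the power is the exponential of a quantity bounded
  above.\<close>

lemma powr_bound: "\<exists>E\<ge>0. \<forall>t. 0 < t \<and> t \<le> T \<longrightarrow> t powr (\<alpha> 0 - \<alpha> t) \<le> E"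
proof (intro exI[of _ "exp (L * (1 + T * T))"] conjI allI impI)
  fix t assume "0 < t \<and> t \<le> T"
  then have t: "0 < t" "t \<le> T" by auto
  have "(\<alpha> 0 - \<alpha> t) * ln t \<le> \<bar>\<alpha> 0 - \<alpha> t\<bar> * \<bar>ln t\<bar>" by (metis abs_ge_self abs_mult)
  also have "\<dots> \<le> (L * t) * \<bar>ln t\<bar>" using \<alpha>_lipschitz[of t] t by (intro mult_right_mono) auto
  also have "\<dots> \<le> L * (1 + T * T)" using t_ln_le[OF t] L_nonneg by (simp add: mult.assoc mult_left_mono)
  finally show "t powr (\<alpha> 0 - \<alpha> t) \<le> exp (L * (1 + T * T))" using t by (simp add: powr_def)
qed simp

text \<open>Differentiating the exponent produces a logarithm and a bounded difference quotient; all
  remaining factors are bounded.\<close>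

lemma q'_bound: "\<exists>K\<ge>0. \<forall>t. 0 < t \<and> t < T \<longrightarrow> \<bar>q' t\<bar> \<le> K * t powr (- \<sigma>)"
proof -
  obtain E where E: "E \<ge> 0" "\<And>t. 0 < t \<Longrightarrow> t \<le> T \<Longrightarrow> t powr (\<alpha> 0 - \<alpha> t) \<le> E" using powr_bound by auto
  obtain K where K: "K \<ge> 0" "\<And>t. 0 < t \<Longrightarrow> t \<le> T \<Longrightarrow> 1 \<le> K * t powr (- \<sigma>)" "\<And>t. 0 < t \<Longrightarrow> t \<le> T \<Longrightarrow> \<bar>ln t\<bar> \<le> K * t powr (- \<sigma>)"
    using ln_le_powr by auto
  have c: "continuous_on {0..T} (\<lambda>t. rGamma (2 - \<alpha> t))" "continuous_on {0..T} (\<lambda>t. rGamma (2 - \<alpha> t) * Digamma (2 - \<alpha> t) * \<alpha>' t)"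
    by (auto intro!: continuous_intros continuous_rGamma continuous_Digamma \<alpha>'_cont)
  obtain P0 where P0: "P0 > 0" "\<And>s. s \<in> {0..T} \<Longrightarrow> norm (rGamma (2 - \<alpha> s)) \<le> P0" using bounded_on_interval[OF c(1)] by blast
  obtain P1 where P1: "P1 > 0" "\<And>s. s \<in> {0..T} \<Longrightarrow> norm (rGamma (2 - \<alpha> s) * Digamma (2 - \<alpha> s) * \<alpha>' s) \<le> P1" using bounded_on_interval[OF c(2)] by blast
  show ?thesis
  proof (intro exI[of _ "E * (2 * L * K) * P0 + E * (P1 * K)"] conjI allI impI)
    show "0 \<le> E * (2 * L * K) * P0 + E * (P1 * K)" using E K P0 P1 L_nonneg by simp
    fix t assume "0 < t \<and> t < T"
    then have t: "0 < t" "t \<le> T" "t \<in> {0..T}" by auto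
    define y where "y = t powr (- \<sigma>)"
    have 1: "\<bar>(- \<alpha>' t) * ln t + (\<alpha> 0 - \<alpha> t) / t\<bar> \<le> 2 * L * K * y"
    proof -
      have "\<bar>(- \<alpha>' t) * ln t\<bar> \<le> L * (K * y)" unfolding abs_mult y_def using \<alpha>'_le[OF t(3)] K(3)[OF t(1,2)] L_nonneg by (intro mult_mono) auto
      moreover have "\<bar>(\<alpha> 0 - \<alpha> t) / t\<bar> \<le> L * (K * y)"
      proof -
        have "\<bar>(\<alpha> 0 - \<alpha> t) / t\<bar> \<le> L" using \<alpha>_lipschitz[OF t(3)] t by (simp add: abs_divide pos_divide_le_eq)
        also have "L * 1 \<le> L * (K * y)" unfolding y_def using K(2)[OF t(1,2)] L_nonneg by (intro mult_left_mono) auto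
        finally show ?thesis by simp
      qed
      ultimately show ?thesis by linarith
    qed
    have 2: "\<bar>rGamma (2 - \<alpha> t) * Digamma (2 - \<alpha> t) * \<alpha>' t\<bar> \<le> P1 * (K * y)"
    proof -
      have "P1 * 1 \<le> P1 * (K * y)" unfolding y_def using K(2)[OF t(1,2)] P1 by (intro mult_left_mono) auto
      then show ?thesis using P1(2)[OF t(3)] by simp
    qed
    have "\<bar>q' t\<bar> \<le> \<bar>t powr (\<alpha> 0 - \<alpha> t)\<bar> * \<bar>(- \<alpha>' t) * ln t + (\<alpha> 0 - \<alpha> t) / t\<bar> * \<bar>rGamma (2 - \<alpha> t)\<bar>
        + \<bar>t powr (\<alpha> 0 - \<alpha> t)\<bar> * \<bar>rGamma (2 - \<alpha> t) * Digamma (2 - \<alpha> t) * \<alpha>' t\<bar>"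
      unfolding q'_def abs_mult[symmetric] by (rule abs_triangle_ineq)
    also have "\<dots> \<le> E * (2 * L * K * y) * P0 + E * (P1 * (K * y))"
      using E(1) E(2)[OF t(1,2)] P0(2)[OF t(3)] K(1) P1(1) L_nonneg 1 2
      by (intro add_mono mult_mono) (auto simp: y_def)
    finally show "\<bar>q' t\<bar> \<le> (E * (2 * L * K) * P0 + E * (P1 * K)) * t powr (- \<sigma>)" by (simp add: y_def algebra_simps)
  qed
qed

lemma powr_tendsto_0: "p > 0 \<Longrightarrow> ((\<lambda>t::real. t powr p) \<longlongrightarrow> 0) (at_right 0)"
proof -
  assume p: "p > 0"
  have "continuous_on {0..1::real} (\<lambda>t. t powr p)" by (rule continuous_on_powr') (use p in \<open>auto intro: continuous_intros\<close>)
  then have "((\<lambda>t. t powr p) \<longlongrightarrow> 0 powr p) (at 0 within {0..1::real})" unfolding continuous_on_def by (metis atLeastAtMost_iff order_refl zero_le_one)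
  then show ?thesis by (simp add: at_within_Icc_at_right)
qed

lemma eventually_Ioc: "\<forall>\<^sub>F t in at_right 0. 0 < t \<and> t \<le> T"
  using T_pos unfolding eventually_at_right_field by (intro exI[of _ T]) auto

lemma q_cont: "continuous_on {0..T} q"
proof (rule continuous_on_Icc_from_Ioc)
  have [continuous_intros]: "continuous_on {0<..T} \<alpha>" using \<alpha>_cont by (auto elim!: continuous_on_subset)
  show "continuous_on {0<..T} q"
  proof (rule continuous_on_eq)
    show "continuous_on {0<..T} (\<lambda>t. t powr (\<alpha> 0 - \<alpha> t) * rGamma (2 - \<alpha> t))"
      by (intro continuous_intros continuous_rGamma) auto
  qed (simp add: q_def)
  obtain K where K: "K \<ge> 0" "\<And>t. 0 < t \<Longrightarrow> t \<le> T \<Longrightarrow> \<bar>ln t\<bar> \<le> K * t powr (- \<sigma>)" using ln_le_powr by auto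
  have "((\<lambda>t. (\<alpha> 0 - \<alpha> t) * ln t) \<longlongrightarrow> 0) (at_right 0)"
  proof (rule Lim_null_comparison)
    show "((\<lambda>t. L * K * t powr (1 - \<sigma>)) \<longlongrightarrow> 0) (at_right 0)"
      using tendsto_mult_left[OF powr_tendsto_0[of "1 - \<sigma>"], of "L * K"] \<sigma> by simp
    show "\<forall>\<^sub>F t in at_right 0. norm ((\<alpha> 0 - \<alpha> t) * ln t) \<le> L * K * t powr (1 - \<sigma>)"
      using eventually_Ioc
    proof eventually_elim
      case (elim t)
      have "norm ((\<alpha> 0 - \<alpha> t) * ln t) \<le> (L * t) * (K * t powr (- \<sigma>))"
        unfolding real_norm_def abs_mult by (intro mult_mono \<alpha>_lipschitz K(2)) (use elim L_nonneg in auto)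
      also have "\<dots> = L * K * (t powr 1 * t powr (- \<sigma>))" using elim by simp
      also have "t powr 1 * t powr (- \<sigma>) = t powr (1 - \<sigma>)" by (simp only: powr_add[symmetric]) simp
      finally show ?case .
    qed
  qed
  then have "((\<lambda>t. exp ((\<alpha> 0 - \<alpha> t) * ln t)) \<longlongrightarrow> 1) (at_right 0)" using tendsto_exp by fastforce
  moreover have "((\<lambda>t. rGamma (2 - \<alpha> t)) \<longlongrightarrow> rGamma (2 - \<alpha> 0)) (at_right 0)"
  proof -
    have "continuous_on {0..T} (\<lambda>t. rGamma (2 - \<alpha> t))" by (rule continuous_rGamma) simp
    then have "((\<lambda>t. rGamma (2 - \<alpha> t)) \<longlongrightarrow> rGamma (2 - \<alpha> 0)) (at 0 within {0..T})"
      using T_pos unfolding continuous_on_def by auto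
    then show ?thesis using T_pos by (simp add: at_within_Icc_at_right)
  qed
  ultimately have "((\<lambda>t. exp ((\<alpha> 0 - \<alpha> t) * ln t) * rGamma (2 - \<alpha> t)) \<longlongrightarrow> 1 * rGamma (2 - \<alpha> 0)) (at_right 0)"
    by (rule tendsto_mult)
  moreover have "\<forall>\<^sub>F t in at_right 0. exp ((\<alpha> 0 - \<alpha> t) * ln t) * rGamma (2 - \<alpha> t) = q t"
    using eventually_Ioc by eventually_elim (simp add: q_def powr_def)
  ultimately show "(q \<longlongrightarrow> q 0) (at_right 0)"
    using tendsto_cong using q_def[of "0"] by fastforce
qed (rule T_pos)

text \<open>The possibly unbounded \<open>q'\<close> is integrated by monotonicity:
  \<open>z * q t - c * t powr (1 - \<sigma>)\<close> decreases for \<open>z = 1\<close> and for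
  \<open>z = -1\<close>.\<close>

lemma q_diff_bound: "\<exists>K\<ge>0. \<forall>t\<in>{0..T}. \<bar>q t - q 0\<bar> \<le> K * t powr (1 - \<sigma>)"
proof -
  obtain K where K: "K \<ge> 0" "\<And>t. 0 < t \<Longrightarrow> t < T \<Longrightarrow> \<bar>q' t\<bar> \<le> K * t powr (- \<sigma>)" using q'_bound by blast
  define c where "c = K / (1 - \<sigma>)"
  have pc: "continuous_on {0..t} (\<lambda>t. c * t powr (1 - \<sigma>))" for t
    by (intro continuous_intros continuous_on_powr') (use \<sigma> in auto)
  have pd: "((\<lambda>t. c * t powr (1 - \<sigma>)) has_real_derivative K * t powr (- \<sigma>)) (at t)" if "t > 0" for t
    using DERIV_cmult[OF has_real_derivative_powr[OF that, of "1 - \<sigma>"], of c] \<sigma> by (simp add: c_def)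
  have mono: "z * (q t - q 0) \<le> c * t powr (1 - \<sigma>)" if t: "t \<in> {0..T}" and z: "\<bar>z\<bar> = 1" for z t
  proof -
    have "z * q t - c * t powr (1 - \<sigma>) \<le> z * q 0 - c * 0 powr (1 - \<sigma>)"
    proof (rule DERIV_nonpos_imp_decreasing_open[of 0 t "\<lambda>t. z * q t - c * t powr (1 - \<sigma>)"])
      show "continuous_on {0..t} (\<lambda>t. z * q t - c * t powr (1 - \<sigma>))"
        using t by (intro continuous_intros pc continuous_on_subset[OF q_cont]) auto
      fix x assume x: "0 < x" "x < t"
      then have xT: "x < T" using t by simp
      have "((\<lambda>t. z * q t - c * t powr (1 - \<sigma>)) has_real_derivative z * q' x - K * x powr (- \<sigma>)) (at x)"
        by (intro DERIV_diff DERIV_cmult q_deriv pd x xT)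
      moreover have "z * q' x - K * x powr (- \<sigma>) \<le> 0"
        using K(2)[OF x(1) xT] z abs_ge_self[of "z * q' x"] by (simp add: abs_mult)
      ultimately show "\<exists>y. ((\<lambda>t. z * q t - c * t powr (1 - \<sigma>)) has_real_derivative y) (at x) \<and> y \<le> 0" by blast
    qed (use t in auto)
    then show ?thesis by (simp add: right_diff_distrib)
  qed
  show ?thesis
  proof (intro exI[of _ c] conjI ballI)
    show "0 \<le> c" using K \<sigma> by (simp add: c_def)
    show "\<bar>q t - q 0\<bar> \<le> c * t powr (1 - \<sigma>)" if "t \<in> {0..T}" for t
      using mono[OF that, of 1] mono[OF that, of "-1"] by simp
  qed
qed

text \<open>The kernel minus its leading power \<open>beta_kernel (2 - \<alpha> 0)\<close>. The
  remainder vanishes at \<open>0\<close> and has an integrable derivative, whereas the derivative of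
  the leading power is not integrable.\<close>

definition r :: "real \<Rightarrow> real" where "r t = t powr (1 - \<alpha> 0) * (q t - q 0)"
definition r' :: "real \<Rightarrow> real" where
  "r' t = (1 - \<alpha> 0) * t powr (- \<alpha> 0) * (q t - q 0) + t powr (1 - \<alpha> 0) * q' t"

lemma q0: "q 0 > 0" "q 0 = rGamma (2 - \<alpha> 0)"
  using \<alpha>0 by (auto simp: q_def rGamma_inverse_Gamma)

lemma vo_kernel_split: "t > 0 \<Longrightarrow> vo_kernel \<alpha> t = q 0 * t powr (1 - \<alpha> 0) + r t"
  "t > 0 \<Longrightarrow> vo_kernel \<alpha> t = beta_kernel (2 - \<alpha> 0) t + r t"
proof -
  assume t: "t > 0"
  have "t powr (1 - \<alpha> t) = t powr (1 - \<alpha> 0) * t powr (\<alpha> 0 - \<alpha> t)" by (simp add: powr_add[symmetric])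
  then show 1: "vo_kernel \<alpha> t = q 0 * t powr (1 - \<alpha> 0) + r t"
    using t by (simp add: vo_kernel_def r_def q_def rGamma_inverse_Gamma field_simps)
  then show "vo_kernel \<alpha> t = beta_kernel (2 - \<alpha> 0) t + r t"
    by (simp add: beta_kernel_def q0(2) rGamma_inverse_Gamma field_simps)
qed

lemma r_bound: "\<exists>K\<ge>0. \<forall>t\<in>{0..T}. \<bar>r t\<bar> \<le> K * t powr \<sigma>"
proof -
  obtain K where K: "K \<ge> 0" "\<And>t. t \<in> {0..T} \<Longrightarrow> \<bar>q t - q 0\<bar> \<le> K * t powr (1 - \<sigma>)" using q_diff_bound by blast
  have "\<bar>r t\<bar> \<le> K * t powr \<sigma>" if "t \<in> {0..T}" for t
  proof -
    have "\<bar>r t\<bar> \<le> t powr (1 - \<alpha> 0) * (K * t powr (1 - \<sigma>))"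
      unfolding r_def abs_mult using K(2)[OF that] by (simp add: mult_left_mono)
    also have "\<dots> = K * (t powr ((1 - \<alpha> 0) + (1 - \<sigma>)))" by (metis mult.left_commute powr_add)
    also have "(1 - \<alpha> 0) + (1 - \<sigma>) = \<sigma>" by (simp add: \<sigma>_def)
    finally show ?thesis .
  qed
  with K(1) show ?thesis by blast
qed

lemma r'_bound: "\<exists>K\<ge>0. \<forall>t. 0 < t \<and> t < T \<longrightarrow> \<bar>r' t\<bar> \<le> K * t powr (\<sigma> - 1)"
proof -
  obtain K where K: "K \<ge> 0" "\<And>t. t \<in> {0..T} \<Longrightarrow> \<bar>q t - q 0\<bar> \<le> K * t powr (1 - \<sigma>)" using q_diff_bound by blast
  obtain K' where K': "K' \<ge> 0" "\<And>t. 0 < t \<Longrightarrow> t < T \<Longrightarrow> \<bar>q' t\<bar> \<le> K' * t powr (- \<sigma>)" using q'_bound by blast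
  show ?thesis
  proof (intro exI[of _ "(\<alpha> 0 - 1) * K + K'"] conjI allI impI)
    show "0 \<le> (\<alpha> 0 - 1) * K + K'" using K K' \<alpha>0 by simp
    fix t assume t: "0 < t \<and> t < T"
    have "\<bar>r' t\<bar> \<le> (\<alpha> 0 - 1) * t powr (- \<alpha> 0) * \<bar>q t - q 0\<bar> + t powr (1 - \<alpha> 0) * \<bar>q' t\<bar>"
      unfolding r'_def using abs_triangle_ineq[of "(1 - \<alpha> 0) * t powr (- \<alpha> 0) * (q t - q 0)" "t powr (1 - \<alpha> 0) * q' t"] \<alpha>0
      by (simp add: abs_mult)
    also have "\<dots> \<le> (\<alpha> 0 - 1) * t powr (- \<alpha> 0) * (K * t powr (1 - \<sigma>)) + t powr (1 - \<alpha> 0) * (K' * t powr (- \<sigma>))"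
      using t \<alpha>0 by (intro add_mono mult_left_mono K K') auto
    also have "\<dots> = (\<alpha> 0 - 1) * K * t powr (- \<alpha> 0 + (1 - \<sigma>)) + K' * t powr ((1 - \<alpha> 0) + (- \<sigma>))"
      by (simp only: powr_add) (simp add: mult_ac)
    also have "- \<alpha> 0 + (1 - \<sigma>) = \<sigma> - 1" by (simp add: \<sigma>_def)
    also have "(1 - \<alpha> 0) + (- \<sigma>) = \<sigma> - 1" by (simp add: \<sigma>_def)
    finally show "\<bar>r' t\<bar> \<le> ((\<alpha> 0 - 1) * K + K') * t powr (\<sigma> - 1)" by (simp add: algebra_simps)
  qed
qed

lemma r_cont: "continuous_on {0..T} r"
proof (rule continuous_on_Icc_from_Ioc)
  show "continuous_on {0<..T} r" unfolding r_def
    by (intro continuous_intros continuous_on_subset[OF q_cont]) auto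
  obtain K where K: "K \<ge> 0" "\<And>t. t \<in> {0..T} \<Longrightarrow> \<bar>r t\<bar> \<le> K * t powr \<sigma>" using r_bound by blast
  have "(r \<longlongrightarrow> 0) (at_right 0)"
  proof (rule Lim_null_comparison)
    show "((\<lambda>t. K * t powr \<sigma>) \<longlongrightarrow> 0) (at_right 0)" using tendsto_mult_left[OF powr_tendsto_0[OF \<sigma>(1)], of K] by simp
    show "\<forall>\<^sub>F t in at_right 0. norm (r t) \<le> K * t powr \<sigma>" using eventually_Ioc by eventually_elim (use K in auto)
  qed
  then show "(r \<longlongrightarrow> r 0) (at_right 0)" by (simp add: r_def)
qed (rule T_pos)

lemma r_deriv: "0 < t \<Longrightarrow> t < T \<Longrightarrow> (r has_real_derivative r' t) (at t)"
proof -
  assume t: "0 < t" "t < T"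
  have "((\<lambda>t. t powr (1 - \<alpha> 0) * (q t - q 0)) has_real_derivative
     ((1 - \<alpha> 0) * t powr (1 - \<alpha> 0 - 1)) * (q t - q 0) + (q' t - 0) * t powr (1 - \<alpha> 0)) (at t)"
    by (intro DERIV_mult DERIV_diff DERIV_const has_real_derivative_powr q_deriv t)
  then show ?thesis by (simp add: r_def[abs_def] r'_def mult.commute)
qed

lemma kern_r': "kern T r'"
proof -
  have c: "continuous_on {0<..<T} r'" unfolding r'_def
    by (intro continuous_intros q'_cont continuous_on_subset[OF q_cont]) auto
  obtain K where K: "K \<ge> 0" "\<And>t. 0 < t \<Longrightarrow> t < T \<Longrightarrow> \<bar>r' t\<bar> \<le> K * t powr (\<sigma> - 1)" using r'_bound by blast
  have "r' absolutely_integrable_on {0<..<T}"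
  proof (rule measurable_bounded_by_integrable_imp_absolutely_integrable)
    show "r' \<in> borel_measurable (lebesgue_on {0<..<T})" by (rule continuous_imp_measurable_on_sets_lebesgue[OF c]) auto
    have "(\<lambda>t. K * t powr (\<sigma> - 1)) integrable_on {0..T}"
      by (intro integrable_on_mult_right integrable_on_powr_from_0) (use \<sigma> T_pos in auto)
    then show "(\<lambda>t. K * t powr (\<sigma> - 1)) integrable_on {0<..<T}" by (simp add: integrable_on_Icc_iff_Ioo)
  qed (use K in auto)
  with c show ?thesis by (simp add: kern_def absolutely_integrable_on_Icc_iff_Ioo)
qed

lemma r_integral: "t \<in> {0..T} \<Longrightarrow> r t = integral {0..t} r'"
proof -
  assume t: "t \<in> {0..T}"
  have "(r' has_integral (r t - r 0)) {0..t}"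
    by (rule fundamental_theorem_of_calculus_interior)
      (use t r_deriv in \<open>auto simp: has_real_derivative_iff_has_vector_derivative[symmetric] intro: continuous_on_subset[OF r_cont]\<close>)
  then show ?thesis by (simp add: integral_unique r_def)
qed

lemma kern_vo_kernel: "kern T (vo_kernel \<alpha>)"
proof (rule kern_cong)
  show "kern T (\<lambda>t. beta_kernel (2 - \<alpha> 0) t + r t)"
    by (intro kern_add kern_beta kern_continuous r_cont) (use \<alpha>0 in auto)
qed (simp add: vo_kernel_split(2))

text \<open>This is the derivative of the generalized identity: the leading power convolves with
  \<open>beta_kernel (\<alpha> 0 - 1)\<close> to the constant \<open>1\<close>, and the remainder is
  the running integral of \<open>r'\<close>. In this form a singularity at \<open>0\<close> is
  covered by \<open>kern_conv\<close>.\<close>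

definition h :: "real \<Rightarrow> real" where "h = conv (beta_kernel (\<alpha> 0 - 1)) r'"

lemma kern_h: "kern T h"
  unfolding h_def by (intro kern_conv kern_beta kern_r') (use \<alpha>0 in auto)

lemma gen_identity_conv: "t \<noteq> 0 \<Longrightarrow> gen_identity \<alpha> t = conv (beta_kernel (\<alpha> 0 - 1)) (vo_kernel \<alpha>) t"
  by (simp add: gen_identity_def)

lemma gen_identity_integral:
  assumes t: "0 < t" "t < T" shows "gen_identity \<alpha> t = 1 + integral {0..t} h"
proof -
  let ?b = "beta_kernel (\<alpha> 0 - 1)"
  have kb: "kern T ?b" and kb2: "kern T (beta_kernel (2 - \<alpha> 0))" using \<alpha>0 by (auto intro!: kern_beta)
  have kr: "kern T r" by (rule kern_continuous[OF r_cont])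
  have t': "0 \<le> t" "t \<le> T" using t by auto
  have "gen_identity \<alpha> t = conv ?b (vo_kernel \<alpha>) t" using t by (intro gen_identity_conv) simp
  also have "\<dots> = conv ?b (\<lambda>s. beta_kernel (2 - \<alpha> 0) s + r s) t"
    by (meson conv_cong_interior vo_kernel_split(2))
  also have "\<dots> = conv ?b (beta_kernel (2 - \<alpha> 0)) t + conv ?b r t"
    unfolding conv_def using kern_product_integrable[OF kb kb2 t] kern_product_integrable[OF kb kr t]
    by (subst integral_add[symmetric]) (auto simp: absolutely_integrable_on_def algebra_simps)
  also have "conv ?b (beta_kernel (2 - \<alpha> 0)) t = 1"
    using conv_beta[of "\<alpha> 0 - 1" "2 - \<alpha> 0" t] \<alpha>0 t by (simp add: beta_kernel_def)
  also have "conv ?b r t = conv ?b (conv r' (\<lambda>_. 1)) t"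
    by (rule conv_cong) (use t in \<open>simp add: conv_commute r_integral\<close>)
  also have "\<dots> = conv h (\<lambda>_. 1) t" unfolding h_def by (rule conv_assoc[OF kb kern_r' _ t']) simp
  finally show ?thesis by (simp add: conv_commute)
qed

lemma gen_identity_deriv:
  assumes t: "0 < t" "t < T" shows "deriv (gen_identity \<alpha>) t = h t"
proof -
  have "((\<lambda>s. 1 + integral {0..s} h) has_real_derivative 0 + h t) (at t)"
    by (intro DERIV_add DERIV_const kern_integral_has_derivative[OF kern_h] t)
  then have "(gen_identity \<alpha> has_real_derivative 0 + h t) (at t)"
    by (rule has_field_derivative_transform_within_open[of _ _ _ "{0<..<T}"]) (use t gen_identity_integral in auto)
  then show ?thesis by (simp add: DERIV_imp_deriv)
qed

text \<open>With \<open>y = s powr (\<sigma> - 1)\<close> the derivative of the kernel is at most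
  \<open>- p * y^2 + K' * y\<close>, and completing the square gives the upper bound
  \<open>K'^2 / (4 * p)\<close>.\<close>

lemma memory_kernel_vo_kernel: "\<exists>M c k'. memory_kernel T M c (vo_kernel \<alpha>) k'"
proof -
  obtain K where K: "K \<ge> 0" "\<And>t. t \<in> {0..T} \<Longrightarrow> \<bar>r t\<bar> \<le> K * t powr \<sigma>" using r_bound by blast
  obtain K' where K': "K' \<ge> 0" "\<And>t. 0 < t \<Longrightarrow> t < T \<Longrightarrow> \<bar>r' t\<bar> \<le> K' * t powr (\<sigma> - 1)" using r'_bound by blast
  define p where "p = (\<alpha> 0 - 1) * q 0"
  have p: "p > 0" using \<alpha>0 q0 by (simp add: p_def)
  have "memory_kernel T (K'\<^sup>2 / (4 * p)) (q 0 * T powr (2 - \<alpha> 0) + T * (K * T powr \<sigma>)) (vo_kernel \<alpha>)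
     (\<lambda>t. q 0 * ((1 - \<alpha> 0) * t powr (1 - \<alpha> 0 - 1)) + r' t)"
  proof
    show "0 < T" by (rule T_pos)
    show "kern T (vo_kernel \<alpha>)" by (rule kern_vo_kernel)
    show "0 \<le> K'\<^sup>2 / (4 * p)" using p by simp
    fix s assume s: "0 < s" "s < T"
    show "0 < vo_kernel \<alpha> s" using s \<alpha>_range[of s] by (simp add: vo_kernel_def)
    have "((\<lambda>t. q 0 * t powr (1 - \<alpha> 0) + r t) has_real_derivative q 0 * ((1 - \<alpha> 0) * s powr (1 - \<alpha> 0 - 1)) + r' s) (at s)"
      by (intro DERIV_add DERIV_cmult has_real_derivative_powr r_deriv s)
    then show "(vo_kernel \<alpha> has_real_derivative q 0 * ((1 - \<alpha> 0) * s powr (1 - \<alpha> 0 - 1)) + r' s) (at s)"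
      by (rule has_field_derivative_transform_within_open[of _ _ _ "{0<..}"]) (use s in \<open>auto simp: vo_kernel_split(1)\<close>)
    show "q 0 * ((1 - \<alpha> 0) * s powr (1 - \<alpha> 0 - 1)) + r' s \<le> K'\<^sup>2 / (4 * p)"
    proof -
      define y where "y = s powr (\<sigma> - 1)"
      have y2: "s powr (1 - \<alpha> 0 - 1) = y\<^sup>2" unfolding y_def power2_eq_square powr_add[symmetric] by (simp add: \<sigma>_def)
      have "q 0 * ((1 - \<alpha> 0) * s powr (1 - \<alpha> 0 - 1)) = - p * y\<^sup>2" unfolding y2 p_def by (simp add: algebra_simps)
      moreover have "r' s \<le> K' * y" using K'(2)[OF s] unfolding y_def by simp
      moreover have "- p * y\<^sup>2 + K' * y \<le> K'\<^sup>2 / (4 * p)"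
      proof -
        have "0 \<le> p * (y - K' / (2 * p))\<^sup>2" using p by simp
        also have "p * (y - K' / (2 * p))\<^sup>2 = p * y\<^sup>2 - K' * y + K'\<^sup>2 / (4 * p)"
          using p by (simp add: power2_eq_square field_simps)
        finally show ?thesis by simp
      qed
      ultimately show ?thesis by linarith
    qed
    show "s * vo_kernel \<alpha> s \<le> q 0 * T powr (2 - \<alpha> 0) + T * (K * T powr \<sigma>)"
    proof -
      have "s * vo_kernel \<alpha> s = q 0 * (s powr 1 * s powr (1 - \<alpha> 0)) + s * r s"
        using s by (simp add: vo_kernel_split(1) algebra_simps)
      also have "s powr 1 * s powr (1 - \<alpha> 0) = s powr (2 - \<alpha> 0)" by (simp only: powr_add[symmetric]) simp
      also have "q 0 * s powr (2 - \<alpha> 0) \<le> q 0 * T powr (2 - \<alpha> 0)"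
        using q0 s \<alpha>0 by (intro mult_left_mono powr_mono2) auto
      also have "s * r s \<le> T * (K * T powr \<sigma>)"
      proof -
        have "r s \<le> K * s powr \<sigma>" using K(2)[of s] s by auto
        also have "\<dots> \<le> K * T powr \<sigma>" using s \<sigma> K(1) by (intro mult_left_mono powr_mono2) auto
        finally have "s * r s \<le> s * (K * T powr \<sigma>)" using s by (intro mult_left_mono) auto
        also have "\<dots> \<le> T * (K * T powr \<sigma>)" using s K(1) by (intro mult_right_mono) auto
        finally show ?thesis .
      qed
      finally show ?thesis by simp
    qed
  next
    fix Y
    \<comment> \<open>Below \<open>\<delta>\<close> the leading term is at least
      \<open>q 0 * Z\<close>, which exceeds \<open>|Y|\<close> by more than the bound
      \<open>K * T powr \<sigma>\<close> of the remainder.\<close>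
    define Z where "Z = (\<bar>Y\<bar> + K * T powr \<sigma> + 1) / q 0"
    have Z: "Z > 0" unfolding Z_def using q0 K(1) by (intro divide_pos_pos add_nonneg_pos add_nonneg_nonneg) auto
    define \<delta> where "\<delta> = Z powr (1 / (1 - \<alpha> 0))"
    show "\<exists>\<delta>>0. \<forall>s. 0 < s \<and> s < \<delta> \<and> s < T \<longrightarrow> Y \<le> vo_kernel \<alpha> s"
    proof (intro exI[of _ \<delta>] conjI allI impI)
      show "\<delta> > 0" using Z by (simp add: \<delta>_def)
      fix s assume s: "0 < s \<and> s < \<delta> \<and> s < T"
      have "\<delta> powr (1 - \<alpha> 0) = Z" using Z \<alpha>0 by (simp add: \<delta>_def powr_powr)
      moreover have "\<delta> powr (1 - \<alpha> 0) \<le> s powr (1 - \<alpha> 0)" using s \<alpha>0 by (intro powr_mono2') auto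
      ultimately have "q 0 * Z \<le> q 0 * s powr (1 - \<alpha> 0)" using q0 by (intro mult_left_mono) auto
      moreover have "q 0 * Z = \<bar>Y\<bar> + K * T powr \<sigma> + 1" using q0 by (simp add: Z_def)
      moreover have "- (K * T powr \<sigma>) \<le> r s"
      proof -
        have "K * s powr \<sigma> \<le> K * T powr \<sigma>" using s \<sigma> K(1) by (intro mult_left_mono powr_mono2) auto
        then show ?thesis using K(2)[of s] s by auto
      qed
      ultimately show "Y \<le> vo_kernel \<alpha> s" using s by (simp add: vo_kernel_split(1))
    qed
  qed
  then show ?thesis by blast
qed

lemma kern_deriv_gen_identity: "kern T (deriv (gen_identity \<alpha>))"
  by (rule kern_cong[OF _ kern_h]) (simp add: gen_identity_deriv)

lemma gen_identity_integral_deriv: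
  assumes t: "0 < t" "t < T" shows "gen_identity \<alpha> t = 1 + integral {0..t} (deriv (gen_identity \<alpha>))"
proof -
  have "integral {0..t} (deriv (gen_identity \<alpha>)) = integral {0..t} h"
    by (rule integral_spike[of "{0, t}"]) (use t gen_identity_deriv in auto)
  then show ?thesis using gen_identity_integral[OF t] by simp
qed

end

section \<open>Completeness of \<open>L\<^sup>2\<close>\<close>

lemma l2_rep:
  obtains f where "sq_integrable f" "v = l2_of f"
  using Quotient_rep_reflp[OF Quotient_l2, of v] Quotient_abs_rep[OF Quotient_l2, of v] l2_rel_refl_iff by metis

lemma l2_of_diff: "sq_integrable f \<Longrightarrow> sq_integrable g \<Longrightarrow> l2_of f - l2_of g = l2_of (\<lambda>x. f x - g x)"
  by (simp add: minus_l2.abs_eq l2_rel_refl_iff)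

lemma l2_of_add: "sq_integrable f \<Longrightarrow> sq_integrable g \<Longrightarrow> l2_of f + l2_of g = l2_of (\<lambda>x. f x + g x)"
  by (simp add: plus_l2.abs_eq l2_rel_refl_iff)

lemma l2_of_scaleR: "sq_integrable f \<Longrightarrow> c *\<^sub>R l2_of f = l2_of (\<lambda>x. c * f x)"
  by (simp add: scaleR_l2.abs_eq l2_rel_refl_iff)

lemma l2_of_eq_iff: "sq_integrable f \<Longrightarrow> sq_integrable g \<Longrightarrow> l2_of f = l2_of g \<longleftrightarrow> (AE x in lebesgue. f x = g x)"
  using Quotient_rel[OF Quotient_l2, of f g] by (auto simp: l2_rel_def)

lemma l2_of_eq_0_iff: "sq_integrable f \<Longrightarrow> l2_of f = 0 \<longleftrightarrow> (AE x in lebesgue. f x = 0)"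
  unfolding zero_l2_def by (rule l2_of_eq_iff) (auto simp: sq_integrable_zero)

lemma norm_l2_of_power2: "sq_integrable f \<Longrightarrow> (norm (l2_of f))\<^sup>2 = integral\<^sup>L lebesgue (\<lambda>x. (f x)\<^sup>2)"
  by (simp add: norm_l2_of)

lemma nn_integral_sq:
  "sq_integrable f \<Longrightarrow> (\<integral>\<^sup>+ x. ennreal ((f x)\<^sup>2) \<partial>lebesgue) = ennreal ((norm (l2_of f))\<^sup>2)"
  by (simp add: norm_l2_of_power2 nn_integral_eq_integral sq_integrable_def)

text \<open>The terms are eventually below one, which is the geometric bound
  \<open>|d n| <= (1 / sqrt 2) ^ n\<close>.\<close>

lemma summable_of_weighted_squares:
  fixes d :: "nat \<Rightarrow> real"
  assumes "summable (\<lambda>n. 2 ^ n * (d n)\<^sup>2)" shows "summable d"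
proof -
  let ?s = "1 / sqrt 2 :: real"
  have s: "?s ^ n * sqrt (2 ^ n) = 1" "0 < ?s ^ n" for n by (auto simp: real_sqrt_power power_divide)
  have "(\<lambda>n. 2 ^ n * (d n)\<^sup>2) \<longlonglongrightarrow> 0" by (rule summable_LIMSEQ_zero[OF assms])
  then obtain N where N: "\<And>n. n \<ge> N \<Longrightarrow> \<bar>2 ^ n * (d n)\<^sup>2\<bar> < 1"
    using LIMSEQ_D[of _ 0 1] by force
  show ?thesis
  proof (rule summable_comparison_test[of _ "\<lambda>n. ?s ^ n"])
    have "norm (d n) \<le> ?s ^ n" if "n \<ge> N" for n
    proof -
      have "sqrt (2 ^ n * (d n)\<^sup>2) \<le> sqrt 1" using N[OF that] by (intro real_sqrt_le_mono) auto
      then have "sqrt (2 ^ n) * \<bar>d n\<bar> \<le> 1" by (simp add: real_sqrt_mult)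
      then have "?s ^ n * (sqrt (2 ^ n) * \<bar>d n\<bar>) \<le> ?s ^ n * 1" by (rule mult_left_mono) simp
      then show ?thesis using s(1)[of n] by (simp add: mult.assoc[symmetric])
    qed
    then show "\<exists>N. \<forall>n\<ge>N. norm (d n) \<le> ?s ^ n" by blast
    show "summable (\<lambda>n. ?s ^ n)" by (rule summable_geometric) simp
  qed
qed

text \<open>Riesz-Fischer. Along a fast subsequence the squared steps have integrals at most
  \<open>4^-n\<close>, so weights \<open>2^n\<close> are affordable: the weighted squares have an
  integrable sum, and the steps are summable almost everywhere. Fatou's lemma turns the pointwise
  limit into a limit in norm.\<close>

lemma l2_Cauchy_convergent:
  fixes X :: "nat \<Rightarrow> 'a::euclidean_space l2"
  assumes X: "Cauchy X" shows "convergent X"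
proof -
  have "\<exists>N. \<forall>m\<ge>N. \<forall>n\<ge>N. norm (X m - X n) < (1/2) ^ j" for j :: nat
    using X unfolding Cauchy_def dist_norm by (meson half_gt_zero_iff zero_less_one zero_less_power zero_less_divide_1_iff zero_less_numeral)
  then obtain N where N: "\<And>j m n. m \<ge> N j \<Longrightarrow> n \<ge> N j \<Longrightarrow> norm (X m - X n) < (1/2) ^ j" by metis
  \<comment> \<open>Summing all thresholds keeps the index above \<open>N j\<close>; the added
    \<open>j\<close> makes it strictly increasing.\<close>
  define r where "r = (\<lambda>j. (\<Sum>i\<le>j. N i) + j)"
  have r: "strict_mono r" unfolding r_def by (rule strict_mono_Suc_iff[THEN iffD2]) auto
  have rN: "N j \<le> r j" for j unfolding r_def by (meson atMost_iff finite_atMost le_add1 member_le_sum order_refl order_trans zero_le)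
  have Xr: "norm (X (r i) - X (r j)) < (1/2) ^ j" if "i \<ge> j" for i j
    using rN[of j] strict_mono_less_eq[OF r, of j i] that by (intro N) auto
  have "\<forall>n. \<exists>f. sq_integrable f \<and> X (r n) = l2_of f" using l2_rep by metis
  then obtain f where f: "\<And>n. sq_integrable (f n)" "\<And>n. X (r n) = l2_of (f n)" by metis
  have fm [measurable]: "f n \<in> borel_measurable lebesgue" for n using f(1) by (simp add: sq_integrable_def)
  define d where "d = (\<lambda>n x. f (Suc n) x - f n x)"
  have d: "sq_integrable (d n)" "norm (l2_of (d n)) < (1/2) ^ n" for n
    using f Xr[of n "Suc n"] by (auto simp: d_def l2_of_diff[symmetric] intro: sq_integrable_diff)
  have dm [measurable]: "d n \<in> borel_measurable lebesgue" for n using d(1) by (simp add: sq_integrable_def)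
  have bound: "(\<integral>\<^sup>+ x. ennreal (2 ^ n * (d n x)\<^sup>2) \<partial>lebesgue) \<le> ennreal ((1/2) ^ n)" for n
  proof -
    have "(\<integral>\<^sup>+ x. ennreal (2 ^ n * (d n x)\<^sup>2) \<partial>lebesgue) = ennreal (2 ^ n) * ennreal ((norm (l2_of (d n)))\<^sup>2)"
      by (simp add: ennreal_mult nn_integral_cmult nn_integral_sq[OF d(1)])
    also have "\<dots> = ennreal (2 ^ n * (norm (l2_of (d n)))\<^sup>2)" by (simp add: ennreal_mult)
    also have "\<dots> \<le> ennreal (2 ^ n * ((1/2) ^ n)\<^sup>2)"
      using d(2)[of n] by (intro ennreal_leI mult_left_mono power_mono) auto
    also have "2 ^ n * ((1/2) ^ n)\<^sup>2 = ((1/2) ^ n :: real)" by (simp add: power2_eq_square power_divide)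
    finally show ?thesis .
  qed
  have "(\<integral>\<^sup>+ x. (\<Sum>n. ennreal (2 ^ n * (d n x)\<^sup>2)) \<partial>lebesgue) = (\<Sum>n. \<integral>\<^sup>+ x. ennreal (2 ^ n * (d n x)\<^sup>2) \<partial>lebesgue)"
    by (rule nn_integral_suminf) simp
  also have "\<dots> \<le> (\<Sum>n. ennreal ((1/2) ^ n))" by (rule suminf_le) (auto simp: bound)
  also have "\<dots> = ennreal (\<Sum>n. (1/2) ^ n)" by (rule suminf_ennreal2) (auto intro: summable_geometric)
  also have "\<dots> < \<infinity>" by simp
  finally have "AE x in lebesgue. (\<Sum>n. ennreal (2 ^ n * (d n x)\<^sup>2)) \<noteq> \<infinity>"
    by (intro nn_integral_PInf_AE) auto
  then have AE1: "AE x in lebesgue. summable (\<lambda>n. d n x)"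
  proof eventually_elim
    case (elim x)
    have "summable (\<lambda>n. 2 ^ n * (d n x)\<^sup>2)"
      by (rule summable_suminf_not_top) (use elim in \<open>auto simp: infinity_ennreal_def\<close>)
    then show ?case by (rule summable_of_weighted_squares)
  qed
  define F where "F = (\<lambda>x. lim (\<lambda>n. f n x))"
  have Fm [measurable]: "F \<in> borel_measurable lebesgue" unfolding F_def by measurable
  have AE2: "AE x in lebesgue. (\<lambda>n. f n x) \<longlonglongrightarrow> F x"
    using AE1
  proof eventually_elim
    case (elim x)
    have "(\<Sum>i<n. d i x) = f n x - f 0 x" for n using sum_lessThan_telescope[of "\<lambda>i. f i x" n] by (simp add: d_def)
    then have "convergent (\<lambda>n. f n x - f 0 x)" using elim by (simp add: summable_iff_convergent)
    then have "convergent (\<lambda>n. f n x)" using convergent_add_const_right_iff[of "\<lambda>n. f n x" "- f 0 x"] by simp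
    then show ?case unfolding F_def by (rule convergent_LIMSEQ_iff[THEN iffD1])
  qed
  have fatou: "(\<integral>\<^sup>+ x. ennreal ((F x - f m x)\<^sup>2) \<partial>lebesgue) \<le> ennreal (((1/2) ^ m)\<^sup>2)" for m
  proof -
    have "(\<integral>\<^sup>+ x. ennreal ((F x - f m x)\<^sup>2) \<partial>lebesgue) = (\<integral>\<^sup>+ x. liminf (\<lambda>n. ennreal ((f n x - f m x)\<^sup>2)) \<partial>lebesgue)"
    proof (rule nn_integral_cong_AE)
      show "AE x in lebesgue. ennreal ((F x - f m x)\<^sup>2) = liminf (\<lambda>n. ennreal ((f n x - f m x)\<^sup>2))"
        using AE2
      proof eventually_elim
        case (elim x)
        then have "(\<lambda>n. ennreal ((f n x - f m x)\<^sup>2)) \<longlonglongrightarrow> ennreal ((F x - f m x)\<^sup>2)"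
          by (intro tendsto_intros)
        from lim_imp_Liminf[OF _ this] show ?case by simp
      qed
    qed
    also have "\<dots> \<le> liminf (\<lambda>n. \<integral>\<^sup>+ x. ennreal ((f n x - f m x)\<^sup>2) \<partial>lebesgue)"
      by (rule nn_integral_liminf) simp
    also have "\<dots> \<le> ennreal (((1/2) ^ m)\<^sup>2)"
    proof (rule Liminf_le)
      have "(\<integral>\<^sup>+ x. ennreal ((f n x - f m x)\<^sup>2) \<partial>lebesgue) \<le> ennreal (((1/2) ^ m)\<^sup>2)" if "n \<ge> m" for n
      proof -
        have "sq_integrable (\<lambda>x. f n x - f m x)" by (intro sq_integrable_diff f)
        then have "(\<integral>\<^sup>+ x. ennreal ((f n x - f m x)\<^sup>2) \<partial>lebesgue) = ennreal ((norm (X (r n) - X (r m)))\<^sup>2)"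
          by (simp add: nn_integral_sq f l2_of_diff)
        also have "\<dots> \<le> ennreal (((1/2) ^ m)\<^sup>2)" using Xr[OF that] by (intro ennreal_leI power_mono) auto
        finally show ?thesis .
      qed
      then show "\<forall>\<^sub>F n in sequentially. (\<integral>\<^sup>+ x. ennreal ((f n x - f m x)\<^sup>2) \<partial>lebesgue) \<le> ennreal (((1/2) ^ m)\<^sup>2)"
        by (auto simp: eventually_sequentially)
    qed simp
    finally show ?thesis .
  qed
  have FD: "sq_integrable (\<lambda>x. F x - f m x)" for m
    unfolding sq_integrable_def
  proof
    show "integrable lebesgue (\<lambda>x. (F x - f m x)\<^sup>2)"
      using fatou[of m] by (intro integrableI_nonneg) (auto intro: le_less_trans)
  qed simp
  have Fs: "sq_integrable F" using sq_integrable_add[OF FD[of 0] f(1)[of 0]] by simp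
  have "norm (l2_of F - X (r m)) \<le> (1/2) ^ m" for m
  proof -
    have "ennreal ((norm (l2_of F - X (r m)))\<^sup>2) \<le> ennreal (((1/2) ^ m)\<^sup>2)"
      using fatou[of m] nn_integral_sq[OF FD[of m]] by (simp add: f l2_of_diff Fs)
    then have "(norm (l2_of F - X (r m)))\<^sup>2 \<le> ((1/2) ^ m)\<^sup>2" by (subst (asm) ennreal_le_iff) simp_all
    then show ?thesis by (rule power2_le_imp_le) simp
  qed
  then have "\<forall>m. norm (X (r m) - l2_of F) \<le> (1/2) ^ m" by (simp add: norm_minus_commute)
  then have "(\<lambda>m. X (r m) - l2_of F) \<longlonglongrightarrow> 0"
    by (intro Lim_null_comparison[OF _ LIMSEQ_power_zero[of "1/2::real"]]) auto
  then have "(X \<circ> r) \<longlonglongrightarrow> l2_of F" by (simp add: LIM_zero_iff o_def)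
  then show ?thesis using Cauchy_converges_subseq[OF X r] convergentI by blast
qed

instance l2 :: (euclidean_space) banach
  by standard (rule l2_Cauchy_convergent)

section \<open>The subspace \<open>L\<^sup>2(\<Omega>)\<close>\<close>

lemma vanishes_outside_l2_of:
  "sq_integrable f \<Longrightarrow> vanishes_outside \<Omega> (l2_of f) \<longleftrightarrow> (AE x in lebesgue. x \<notin> \<Omega> \<longrightarrow> f x = 0)"
  by (simp add: vanishes_outside.abs_eq l2_rel_refl_iff)

lemma L2_orthogonal:
  assumes "v \<in> L2 \<Omega>" "w \<in> L2 (- \<Omega>)" shows "inner v w = 0"
proof -
  obtain f g where f: "sq_integrable f" "v = l2_of f" and g: "sq_integrable g" "w = l2_of g" using l2_rep by metis
  have "AE x in lebesgue. x \<notin> \<Omega> \<longrightarrow> f x = 0" "AE x in lebesgue. x \<notin> - \<Omega> \<longrightarrow> g x = 0"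
    using assms f g by (auto simp: L2_def vanishes_outside_l2_of)
  then have "AE x in lebesgue. f x * g x = 0" by eventually_elim auto
  then have "integral\<^sup>L lebesgue (\<lambda>x. f x * g x) = 0" by (rule integral_eq_zero_AE)
  then show ?thesis using f g by (simp add: inner_l2_of)
qed

text \<open>Through inner products, closedness, linearity and stability under convolution become
  immediate. For the nontrivial inclusion \<open>v\<close> is tested with its own restriction to the
  complement.\<close>

lemma L2_eq_orthogonal_complement:
  assumes "\<Omega> \<in> sets lebesgue"
  shows "L2 \<Omega> = {v. \<forall>w\<in>L2 (- \<Omega>). inner v w = 0}"
proof (intro equalityI subsetI)
  fix v assume v: "v \<in> {v. \<forall>w\<in>L2 (- \<Omega>). inner v w = 0}"
  obtain f where f: "sq_integrable f" "v = l2_of f" using l2_rep by metis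
  define g where "g = (\<lambda>x. indicator (- \<Omega>) x * f x)"
  have C: "- \<Omega> \<in> sets lebesgue" using assms by (simp add: Compl_in_sets_lebesgue)
  have [measurable]: "f \<in> borel_measurable lebesgue" using f by (simp add: sq_integrable_def)
  have gm: "g \<in> borel_measurable lebesgue" unfolding g_def using C by measurable
  have g: "sq_integrable g"
    unfolding sq_integrable_def
  proof (intro conjI gm)
    show "integrable lebesgue (\<lambda>x. (g x)\<^sup>2)"
    proof (rule Bochner_Integration.integrable_bound)
      show "integrable lebesgue (\<lambda>x. (f x)\<^sup>2)" using f by (simp add: sq_integrable_def)
    qed (use gm in \<open>auto simp: g_def indicator_def\<close>)
  qed
  have "l2_of g \<in> L2 (- \<Omega>)" unfolding L2_def mem_Collect_eq vanishes_outside_l2_of[OF g] by (auto simp: g_def)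
  then have "inner v (l2_of g) = 0" using v by blast
  then have "integral\<^sup>L lebesgue (\<lambda>x. f x * g x) = 0" using inner_l2_of[OF f(1) g] f(2) by simp
  moreover have "f x * g x = (g x)\<^sup>2" for x by (cases "x \<in> \<Omega>") (simp_all add: g_def power2_eq_square)
  ultimately have "integral\<^sup>L lebesgue (\<lambda>x. (g x)\<^sup>2) = 0" by simp
  then have "AE x in lebesgue. (g x)\<^sup>2 = 0"
    using g by (subst (asm) integral_nonneg_eq_0_iff_AE) (auto simp: sq_integrable_def)
  then have "AE x in lebesgue. x \<notin> \<Omega> \<longrightarrow> f x = 0" by eventually_elim (auto simp: g_def)
  then show "v \<in> L2 \<Omega>" using f by (simp add: L2_def vanishes_outside_l2_of)
qed (use L2_orthogonal in blast)

lemma closed_L2: "\<Omega> \<in> sets lebesgue \<Longrightarrow> closed (L2 \<Omega>)"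
proof -
  assume "\<Omega> \<in> sets lebesgue"
  then have "L2 \<Omega> = (\<Inter>w\<in>L2 (- \<Omega>). {v. inner v w = 0})" by (auto simp: L2_eq_orthogonal_complement)
  moreover have "closed {v. inner v w = 0}" for w :: "'a l2"
    by (intro closed_Collect_eq continuous_intros)
  ultimately show ?thesis by auto
qed

lemma subspace_L2: "\<Omega> \<in> sets lebesgue \<Longrightarrow> subspace (L2 \<Omega>)"
  by (simp add: L2_eq_orthogonal_complement subspace_def inner_add_left)

lemma conv_in_L2:
  assumes "\<Omega> \<in> sets lebesgue" "kern T a" "t \<le> T" "continuous_on {0..t} u" "\<And>s. 0 \<le> s \<Longrightarrow> s \<le> t \<Longrightarrow> u s \<in> L2 \<Omega>"
  shows "conv a u t \<in> L2 \<Omega>"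
  unfolding L2_eq_orthogonal_complement[OF assms(1)]
proof safe
  fix w assume w: "w \<in> L2 (- \<Omega>)"
  have "inner (conv a u t) w = conv a (\<lambda>s. inner (u s) w) t"
    by (rule conv_linear[OF assms(2-4) bounded_linear_inner_left, symmetric])
  also have "\<dots> = conv a (\<lambda>s. 0) t" by (rule conv_cong) (use assms(5) w L2_orthogonal in auto)
  finally show "inner (conv a u t) w = 0" by (simp add: conv_def)
qed

section \<open>Test functions\<close>

lemma partial_eq: "(f has_derivative f') (at x) \<Longrightarrow> partial b f x = f' b"
  unfolding partial_def by (simp add: frechet_derivative_at[symmetric])

lemma differentiable_has_partial: "f differentiable (at x) \<Longrightarrow> (f has_derivative frechet_derivative f (at x)) (at x)"
  using frechet_derivative_works by blast

lemma partial_add_scale: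
  assumes "f differentiable (at x)" "g differentiable (at x)"
  shows "partial b (\<lambda>x. f x + c * g x) x = partial b f x + c * partial b g x"
proof -
  have "((\<lambda>x. f x + c * g x) has_derivative (\<lambda>h. frechet_derivative f (at x) h + c * frechet_derivative g (at x) h)) (at x)"
    by (intro has_derivative_add has_derivative_mult_right differentiable_has_partial assms)
  then show ?thesis by (simp add: partial_eq) (simp add: partial_def)
qed

lemma Ck_on_add_scale: "Ck_on k f UNIV \<Longrightarrow> Ck_on k g UNIV \<Longrightarrow> Ck_on k (\<lambda>x. f x + c * g x) UNIV"
proof (induction k arbitrary: f g)
  case 0
  then show ?case by (auto intro!: continuous_intros)
next
  case (Suc k)
  have d: "f differentiable (at x)" "g differentiable (at x)" for x using Suc.prems by auto
  then have "partial b (\<lambda>x. f x + c * g x) = (\<lambda>x. partial b f x + c * partial b g x)" for b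
    by (intro ext partial_add_scale)
  moreover have "(\<lambda>x. f x + c * g x) differentiable (at x)" for x
    using d[of x] by (auto intro!: differentiable_add differentiable_mult)
  ultimately show ?case using Suc by auto
qed

lemma smooth_onD:
  assumes "smooth_on f UNIV"
  shows "f differentiable (at x)" "continuous_on UNIV f" "b \<in> Basis \<Longrightarrow> continuous_on UNIV (partial b f)"
proof -
  have "Ck_on 0 f UNIV" "Ck_on (Suc 0) f UNIV" using assms unfolding smooth_on_def by blast+
  then show "f differentiable (at x)" "continuous_on UNIV f" "b \<in> Basis \<Longrightarrow> continuous_on UNIV (partial b f)" by auto
qed

lemma test_functionsE:
  assumes "\<phi> \<in> test_functions \<Omega>"
  obtains K where "compact K" "K \<subseteq> \<Omega>" "\<And>x. x \<notin> K \<Longrightarrow> \<phi> x = 0" "\<And>x b. x \<notin> K \<Longrightarrow> partial b \<phi> x = 0"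
proof (rule that[of "closure {x. \<phi> x \<noteq> 0}"])
  show "compact (closure {x. \<phi> x \<noteq> 0})" "closure {x. \<phi> x \<noteq> 0} \<subseteq> \<Omega>" using assms by (auto simp: test_functions_def)
  have z: "\<phi> x = 0" if "x \<notin> closure {x. \<phi> x \<noteq> 0}" for x using that closure_subset[of "{x. \<phi> x \<noteq> 0}"] by auto
  then show "\<phi> x = 0" if "x \<notin> closure {x. \<phi> x \<noteq> 0}" for x using that .
  show "partial b \<phi> x = 0" if "x \<notin> closure {x. \<phi> x \<noteq> 0}" for x b
  proof -
    have "(\<phi> has_derivative (\<lambda>_. 0)) (at x)"
    proof (rule has_derivative_transform_within_open[OF has_derivative_const[of 0] open_Compl[OF closed_closure[of "{x. \<phi> x \<noteq> 0}"]]])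
      show "x \<in> - closure {x. \<phi> x \<noteq> 0}" using that by simp
      show "0 = \<phi> y" if "y \<in> - closure {x. \<phi> x \<noteq> 0}" for y using z[of y] that by simp
    qed
    then show ?thesis by (rule partial_eq)
  qed
qed

lemma test_functions_smooth: "\<phi> \<in> test_functions \<Omega> \<Longrightarrow> smooth_on \<phi> UNIV"
  by (simp add: test_functions_def)

lemma test_functions_add_scale:
  assumes "\<phi> \<in> test_functions \<Omega>" "\<psi> \<in> test_functions \<Omega>"
  shows "(\<lambda>x. \<phi> x + c * \<psi> x) \<in> test_functions \<Omega>"
proof -
  have "closure {x. \<phi> x + c * \<psi> x \<noteq> 0} \<subseteq> closure {x. \<phi> x \<noteq> 0} \<union> closure {x. \<psi> x \<noteq> 0}"
    unfolding closure_Un[symmetric] by (rule closure_mono) auto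
  moreover from this have "compact (closure {x. \<phi> x + c * \<psi> x \<noteq> 0})"
    using assms compact_Un unfolding test_functions_def
    by (metis (mono_tags, lifting) closed_Int_compact closed_closure inf.orderE inf_commute mem_Collect_eq)
  ultimately show ?thesis using assms Ck_on_add_scale unfolding test_functions_def smooth_on_def by blast
qed

lemma compact_support_integrable:
  fixes f :: "'a::euclidean_space \<Rightarrow> real"
  assumes f: "continuous_on UNIV f" and K: "compact K" "\<And>x. x \<notin> K \<Longrightarrow> f x = 0"
  shows "integrable lborel f"
proof -
  have "integrable lborel (\<lambda>x. indicator K x *\<^sub>R f x)"
    by (rule borel_integrable_compact[OF K(1) continuous_on_subset[OF f]]) simp
  moreover have "(\<lambda>x. indicator K x *\<^sub>R f x) = f" using K(2) by (auto simp: indicator_def fun_eq_iff)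
  ultimately show ?thesis by simp
qed

lemma lebesgue_borel:
  fixes f :: "'a::euclidean_space \<Rightarrow> real"
  assumes "f \<in> borel_measurable borel"
  shows "f \<in> borel_measurable lebesgue" "integral\<^sup>L lebesgue f = integral\<^sup>L lborel f" "integrable lebesgue f = integrable lborel f"
proof -
  have m: "f \<in> borel_measurable lborel" using assms by simp
  show "f \<in> borel_measurable lebesgue" using m by (rule measurable_completion)
  show "integral\<^sup>L lebesgue f = integral\<^sup>L lborel f" by (rule integral_completion[OF m])
  show "integrable lebesgue f = integrable lborel f" by (rule integrable_completion[OF m])
qed

lemma compact_support_sq_integrable:
  fixes f :: "'a::euclidean_space \<Rightarrow> real"
  assumes f: "continuous_on UNIV f" and K: "compact K" "\<And>x. x \<notin> K \<Longrightarrow> f x = 0"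
  shows "sq_integrable f"
proof -
  have m: "f \<in> borel_measurable borel" by (rule borel_measurable_continuous_onI[OF f])
  have c: "continuous_on UNIV (\<lambda>x. (f x)\<^sup>2)" by (intro continuous_intros f)
  have "integrable lborel (\<lambda>x. (f x)\<^sup>2)"
    by (rule compact_support_integrable[OF c K(1)]) (use K in auto)
  then show ?thesis using m lebesgue_borel(1)[OF m] lebesgue_borel(3)[OF borel_measurable_continuous_onI[OF c]]
    by (simp add: sq_integrable_def)
qed

lemma sq_integrable_indicator:
  assumes "A \<in> sets borel" "bounded A" shows "sq_integrable (indicator A)"
proof -
  have m: "(indicator A :: 'a \<Rightarrow> real) \<in> borel_measurable borel" using assms by simp
  have "integrable lborel (indicator A :: 'a \<Rightarrow> real)"
    using assms emeasure_bounded_finite[of A] by (intro integrable_real_indicator) auto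
  moreover have "(\<lambda>x. (indicator A x)\<^sup>2) = (indicator A :: 'a \<Rightarrow> real)" by (auto simp: indicator_def)
  ultimately show ?thesis using lebesgue_borel(1,3)[OF m] by (simp add: sq_integrable_def)
qed

lemma test_functions_sq_integrable:
  assumes "\<phi> \<in> test_functions \<Omega>"
  shows "sq_integrable \<phi>" "b \<in> Basis \<Longrightarrow> sq_integrable (partial b \<phi>)"
proof -
  obtain K where K: "compact K" "\<And>x. x \<notin> K \<Longrightarrow> \<phi> x = 0" "\<And>x b. x \<notin> K \<Longrightarrow> partial b \<phi> x = 0"
    using test_functionsE[OF assms] by metis
  note s = smooth_onD[OF test_functions_smooth[OF assms]]
  show "sq_integrable \<phi>" by (rule compact_support_sq_integrable[OF s(2) K(1,2)])
  show "sq_integrable (partial b \<phi>)" if "b \<in> Basis" by (rule compact_support_sq_integrable[OF s(3)[OF that] K(1,3)])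
qed

section \<open>Integration by parts and the Poincare inequality\<close>

lemma integral_translation:
  fixes f :: "'a::euclidean_space \<Rightarrow> real"
  assumes [measurable]: "f \<in> borel_measurable borel"
  shows "(\<integral>x. f (x + c) \<partial>lborel) = (\<integral>x. f x \<partial>lborel)"
proof -
  have "(\<integral>x. f x \<partial>lborel) = (\<integral>x. f x \<partial>distr lborel borel ((+) c))" by (simp add: lborel_distr_plus)
  also have "\<dots> = (\<integral>x. f (c + x) \<partial>lborel)" by (rule integral_distr) auto
  finally show ?thesis by (simp add: add.commute)
qed

text \<open>The difference quotients of \<open>f\<close> integrate to zero by translation invariance.\<close>

lemma integral_partial_eq_0:
  fixes f :: "'a::euclidean_space \<Rightarrow> real"
  assumes f: "\<And>x. f differentiable (at x)" and p: "continuous_on UNIV (partial b f)"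
    and K: "compact K" "\<And>x. x \<notin> K \<Longrightarrow> f x = 0" "\<And>x. x \<notin> K \<Longrightarrow> partial b f x = 0"
  shows "integral\<^sup>L lborel (partial b f) = 0"
proof -
  have fc: "continuous_on UNIV f" using f by (intro continuous_at_imp_continuous_on) (auto intro: differentiable_imp_continuous_within)
  have fm [measurable]: "f \<in> borel_measurable borel" by (rule borel_measurable_continuous_onI[OF fc])
  have pm [measurable]: "partial b f \<in> borel_measurable borel" by (rule borel_measurable_continuous_onI[OF p])
  obtain M where M: "M \<ge> 0" "\<And>x. \<bar>partial b f x\<bar> \<le> M"
  proof -
    obtain M where "M > 0" "\<forall>y\<in>partial b f ` K. norm y \<le> M"
      using compact_imp_bounded[OF compact_continuous_image[OF continuous_on_subset[OF p] K(1)]] unfolding bounded_pos by auto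
    then show ?thesis using that[of M] K(3) by (metis abs_zero imageI less_imp_le real_norm_def)
  qed
  have dir: "((\<lambda>t. f (x + t *\<^sub>R b)) has_real_derivative partial b f (x + t *\<^sub>R b)) (at t)" for x t
  proof -
    have 1: "((\<lambda>t. x + t *\<^sub>R b) has_derivative (\<lambda>h. h *\<^sub>R b)) (at t)" by (auto intro!: derivative_eq_intros)
    have 2: "(f has_derivative frechet_derivative f (at (x + t *\<^sub>R b))) (at (x + t *\<^sub>R b))" by (rule differentiable_has_partial[OF f])
    have "((\<lambda>t. f (x + t *\<^sub>R b)) has_derivative (\<lambda>h. frechet_derivative f (at (x + t *\<^sub>R b)) (h *\<^sub>R b))) (at t)"
      by (rule has_derivative_compose[OF 1 2])
    moreover have "frechet_derivative f (at (x + t *\<^sub>R b)) (h *\<^sub>R b) = partial b f (x + t *\<^sub>R b) * h" for h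
      using linear_scale[OF has_derivative_linear[OF 2]] by (simp add: partial_def)
    ultimately show ?thesis by (simp add: has_field_derivative_def)
  qed
  define e where "e = (\<lambda>n. 1 / real (Suc n))"
  have e: "0 < e n" "e n \<le> 1" for n by (auto simp: e_def)
  define s where "s = (\<lambda>n x. (f (x + e n *\<^sub>R b) - f x) / e n)"
  \<comment> \<open>The union of the translates of \<open>K\<close> by \<open>- t b\<close> with
    \<open>0 <= t <= 1\<close>. Outside it every difference quotient vanishes, so \<open>M\<close>
    times its indicator is a majorant.\<close>
  define K' where "K' = (\<lambda>z. fst z - snd z *\<^sub>R b) ` (K \<times> {0..1::real})"
  have K': "compact K'" unfolding K'_def
    by (intro compact_continuous_image compact_Times K compact_Icc continuous_intros)
  have K'm [measurable]: "K' \<in> sets borel" using K' by (simp add: borel_compact)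
  have lim: "(\<lambda>n. s n x) \<longlonglongrightarrow> partial b f x" for x
  proof -
    have "((\<lambda>h. (f (x + h *\<^sub>R b) - f x) / h) \<longlongrightarrow> partial b f x) (at 0)"
      using dir[of x 0] by (simp add: DERIV_def)
    moreover have "filterlim e (at 0) sequentially"
      unfolding filterlim_at using e(1) LIMSEQ_Suc[OF lim_1_over_n] by (auto simp: e_def less_imp_neq[symmetric])
    ultimately show ?thesis unfolding s_def by (rule filterlim_compose)
  qed
  have bound: "\<bar>s n x\<bar> \<le> M * indicator K' x" for n x
  proof (cases "x \<in> K'")
    case True
    have "norm (f (x + e n *\<^sub>R b) - f (x + 0 *\<^sub>R b)) \<le> M * norm (e n - 0)"
      by (rule field_differentiable_bound[of UNIV "\<lambda>t. f (x + t *\<^sub>R b)" "\<lambda>t. partial b f (x + t *\<^sub>R b)"])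
        (use dir M in auto)
    then show ?thesis using True e[of n] by (simp add: s_def pos_divide_le_eq)
  next
    case False
    have "x + t *\<^sub>R b \<notin> K" if "0 \<le> t" "t \<le> 1" for t
    proof
      assume "x + t *\<^sub>R b \<in> K"
      then have "x \<in> K'" unfolding K'_def using that by (intro image_eqI[of _ _ "(x + t *\<^sub>R b, t)"]) auto
      with False show False by simp
    qed
    from K(2)[OF this[of 0]] K(2)[OF this[of "e n"]] show ?thesis using e[of n] False by (simp add: s_def)
  qed
  have fi: "integrable lborel f" by (rule compact_support_integrable[OF fc K(1,2)])
  have fti: "integrable lborel (\<lambda>x. f (x + c))" for c
  proof -
    have "continuous_on UNIV (\<lambda>x. f (x + c))" by (intro continuous_on_compose2[OF fc] continuous_intros) auto
    moreover have "compact ((\<lambda>x. x - c) ` K)" by (intro compact_continuous_image K continuous_intros)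
    ultimately show ?thesis
    proof (rule compact_support_integrable)
      show "f (x + c) = 0" if "x \<notin> (\<lambda>x. x - c) ` K" for x
      proof (rule K(2))
        show "x + c \<notin> K" using that by (metis add_diff_cancel_right' imageI)
      qed
    qed
  qed
  have "integral\<^sup>L lborel (s n) = 0" for n
    unfolding s_def using integral_translation[OF fm, of "e n *\<^sub>R b"] fi fti[of "e n *\<^sub>R b"] by simp
  moreover have "(\<lambda>n. integral\<^sup>L lborel (s n)) \<longlonglongrightarrow> integral\<^sup>L lborel (partial b f)"
  proof (rule integral_dominated_convergence[where w = "\<lambda>x. M * indicator K' x"])
    show "integrable lborel (\<lambda>x. M * indicator K' x :: real)"
      using K' emeasure_compact_finite[of K'] by (intro integrable_mult_right) auto
    show "s n \<in> borel_measurable lborel" for n unfolding s_def by measurable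
  qed (use lim bound in auto)
  ultimately have "(\<lambda>n. 0::real) \<longlonglongrightarrow> integral\<^sup>L lborel (partial b f)" by simp
  then show ?thesis using LIMSEQ_unique tendsto_const by blast
qed

text \<open>The derivative along \<open>b\<close> of \<open>(x . b) * \<phi>^2\<close> integrates to
  zero. With \<open>p\<close> the partial derivative,
  \<open>2 (x . b) \<phi> p >= - \<phi>^2 / 2 - 2 R^2 p^2\<close> on \<open>\<Omega>\<close>, which
  leaves half of the squared norm of \<open>\<phi>\<close> to be compared with that of
  \<open>p\<close>.\<close>

lemma poincare_test_function:
  assumes \<phi>: "\<phi> \<in> test_functions \<Omega>" and b: "b \<in> Basis" and R: "\<And>x. x \<in> \<Omega> \<Longrightarrow> \<bar>inner x b\<bar> \<le> R"
  shows "(norm (l2_of \<phi>))\<^sup>2 \<le> 4 * R\<^sup>2 * (norm (l2_of (partial b \<phi>)))\<^sup>2"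
proof -
  obtain K where K: "compact K" "K \<subseteq> \<Omega>" "\<And>x. x \<notin> K \<Longrightarrow> \<phi> x = 0" "\<And>x b. x \<notin> K \<Longrightarrow> partial b \<phi> x = 0"
    using test_functionsE[OF \<phi>] by metis
  note s = smooth_onD[OF test_functions_smooth[OF \<phi>]]
  let ?p = "partial b \<phi>"
  let ?f = "\<lambda>x. inner x b * (\<phi> x)\<^sup>2"
  have d: "(?f has_derivative (\<lambda>h. inner x b * (2 * \<phi> x * frechet_derivative \<phi> (at x) h) + inner h b * (\<phi> x)\<^sup>2)) (at x)" for x
    using differentiable_has_partial[OF s(1)[of x]] by (auto intro!: derivative_eq_intros simp: algebra_simps)
  have pf: "partial b ?f = (\<lambda>x. (\<phi> x)\<^sup>2 + 2 * inner x b * \<phi> x * ?p x)"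
    using partial_eq[OF d, of b] b by (intro ext) (simp add: partial_def inner_Basis algebra_simps)
  have pc: "continuous_on UNIV (partial b ?f)" unfolding pf by (intro continuous_intros s(2) s(3)[OF b])
  have "integral\<^sup>L lborel (partial b ?f) = 0"
  proof (rule integral_partial_eq_0[OF _ pc K(1)])
    show "?f differentiable (at x)" for x using d differentiable_def by blast
  qed (use K in \<open>auto simp: pf\<close>)
  then have zero: "integral\<^sup>L lebesgue (\<lambda>x. (\<phi> x)\<^sup>2 + 2 * inner x b * \<phi> x * ?p x) = 0"
    using lebesgue_borel(2)[OF borel_measurable_continuous_onI[OF pc]] by (simp add: pf)
  have i0: "integrable lebesgue (\<lambda>x. (\<phi> x)\<^sup>2 + 2 * inner x b * \<phi> x * ?p x)"
    using compact_support_integrable[OF pc K(1)] K lebesgue_borel(3)[OF borel_measurable_continuous_onI[OF pc]] by (simp add: pf)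
  note sq = test_functions_sq_integrable[OF \<phi>]
  have i1: "integrable lebesgue (\<lambda>x. (\<phi> x)\<^sup>2)" "integrable lebesgue (\<lambda>x. (?p x)\<^sup>2)"
    using sq(1) sq(2)[OF b] by (auto simp: sq_integrable_def)
  have "integral\<^sup>L lebesgue (\<lambda>x. (\<phi> x)\<^sup>2 / 2 - 2 * R\<^sup>2 * (?p x)\<^sup>2) \<le> integral\<^sup>L lebesgue (\<lambda>x. (\<phi> x)\<^sup>2 + 2 * inner x b * \<phi> x * ?p x)"
  proof (rule integral_mono[OF _ i0])
    show "integrable lebesgue (\<lambda>x. (\<phi> x)\<^sup>2 / 2 - 2 * R\<^sup>2 * (?p x)\<^sup>2)" using i1 by simp
    fix x
    show "(\<phi> x)\<^sup>2 / 2 - 2 * R\<^sup>2 * (?p x)\<^sup>2 \<le> (\<phi> x)\<^sup>2 + 2 * inner x b * \<phi> x * ?p x"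
    proof (cases "x \<in> \<Omega>")
      case True
      have "(inner x b)\<^sup>2 \<le> R\<^sup>2" using R[OF True] by (metis abs_ge_zero power2_abs power_mono)
      then have "(inner x b)\<^sup>2 * (?p x)\<^sup>2 \<le> R\<^sup>2 * (?p x)\<^sup>2" by (rule mult_right_mono) simp
      moreover have "0 \<le> (\<phi> x + 2 * inner x b * ?p x)\<^sup>2" by simp
      then have "0 \<le> (\<phi> x)\<^sup>2 + 4 * inner x b * \<phi> x * ?p x + 4 * ((inner x b)\<^sup>2 * (?p x)\<^sup>2)"
        by (simp add: power2_eq_square algebra_simps)
      ultimately show ?thesis by linarith
    next
      case False
      then show ?thesis using K by (metis (no_types, lifting) add.commute diff_0 div_0 le_minus_iff minus_zero mult_zero_left mult_zero_right order_refl subsetD zero_power2 add_0 mult_cancel_right1)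
    qed
  qed
  also have "\<dots> = 0" by (rule zero)
  also have "integral\<^sup>L lebesgue (\<lambda>x. (\<phi> x)\<^sup>2 / 2 - 2 * R\<^sup>2 * (?p x)\<^sup>2) = (norm (l2_of \<phi>))\<^sup>2 / 2 - 2 * R\<^sup>2 * (norm (l2_of ?p))\<^sup>2"
    using i1 by (simp add: norm_l2_of_power2 sq b)
  finally show ?thesis by simp
qed

section \<open>Density of test functions\<close>

text \<open>The functions \<open>x\<^sup>-\<^sup>k e\<^bsup>-1/x\<^esup>\<close> are closed under differentiation up to linear combinations.\<close>

definition flat :: "nat \<Rightarrow> real \<Rightarrow> real" where
  "flat k x = (if 0 < x then exp (- (1 / x)) / x ^ k else 0)"

lemma flat_tendsto_0: "(flat k \<longlongrightarrow> 0) (at_right 0)"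
proof -
  have "((\<lambda>x. (inverse x) ^ k / exp (inverse x)) \<longlongrightarrow> 0) (at_right (0::real))"
    by (rule filterlim_compose[OF tendsto_power_div_exp_0 filterlim_inverse_at_top_right])
  moreover have "\<forall>\<^sub>F x in at_right 0. (inverse x) ^ k / exp (inverse x) = flat k x"
    unfolding eventually_at_right_field
    by (intro exI[of _ 1]) (auto simp: flat_def exp_minus field_simps power_inverse)
  ultimately show ?thesis by (rule Lim_transform_eventually)
qed

text \<open>At the gluing point the right difference quotient of \<open>flat k\<close> is
  \<open>flat (k + 1)\<close> itself, which tends to zero.\<close>

lemma flat_deriv: "(flat k has_real_derivative (flat (k + 2) x - real k * flat (k + 1) x)) (at x)"
proof (cases x "0 :: real" rule: linorder_cases)
  case less
  have "((\<lambda>_. 0) has_real_derivative 0) (at x)" by simp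
  then have "(flat k has_real_derivative 0) (at x)"
    by (rule has_field_derivative_transform_within_open[of _ _ _ "{..<0}"]) (use less in \<open>auto simp: flat_def\<close>)
  then show ?thesis using less by (simp add: flat_def)
next
  case greater
  have e: "((\<lambda>x. exp (- (1 / x))) has_real_derivative exp (- (1 / x)) * (1 / x\<^sup>2)) (at x)"
    using greater by (auto intro!: derivative_eq_intros simp: power2_eq_square)
  have pw: "real k * x ^ (k - Suc 0) = real k * x ^ k / x" using greater by (cases k) auto
  have "((\<lambda>x. exp (- (1 / x)) / x ^ k) has_real_derivative
     (exp (- (1 / x)) * (1 / x\<^sup>2) * x ^ k - exp (- (1 / x)) * (real k * x ^ (k - Suc 0))) / (x ^ k * x ^ k)) (at x)"
    by (rule DERIV_divide[OF e DERIV_pow]) (use greater in simp)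
  moreover have "(exp (- (1 / x)) * (1 / x\<^sup>2) * x ^ k - exp (- (1 / x)) * (real k * x ^ (k - Suc 0))) / (x ^ k * x ^ k)
      = flat (k + 2) x - real k * flat (k + 1) x"
    unfolding pw using greater by (simp add: flat_def field_simps power2_eq_square)
  ultimately have "((\<lambda>x. exp (- (1 / x)) / x ^ k) has_real_derivative (flat (k + 2) x - real k * flat (k + 1) x)) (at x)" by simp
  then show ?thesis
    by (rule has_field_derivative_transform_within_open[of _ _ _ "{0<..}"]) (use greater in \<open>auto simp: flat_def\<close>)
next
  case equal
  have "((\<lambda>h. (flat k (0 + h) - flat k 0) / h) \<longlongrightarrow> 0) (at 0)"
  proof (rule filterlim_split_at)
    have "\<forall>\<^sub>F h in at_left 0. 0 = (flat k (0 + h) - flat k 0) / h"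
      unfolding eventually_at_left_field by (intro exI[of _ "-1"]) (auto simp: flat_def)
    then show "((\<lambda>h. (flat k (0 + h) - flat k 0) / h) \<longlongrightarrow> 0) (at_left 0)" by (rule Lim_transform_eventually[OF tendsto_const])
    have "\<forall>\<^sub>F h in at_right 0. flat (k + 1) h = (flat k (0 + h) - flat k 0) / h"
      unfolding eventually_at_right_field by (intro exI[of _ 1]) (auto simp: flat_def)
    then show "((\<lambda>h. (flat k (0 + h) - flat k 0) / h) \<longlongrightarrow> 0) (at_right 0)" by (rule Lim_transform_eventually[OF flat_tendsto_0])
  qed
  then show ?thesis using equal by (simp add: DERIV_def flat_def)
qed

text \<open>A linear class closed under differentiation, so that one derivative lemma settles
  smoothness of every order.\<close>

inductive bump_like :: "real \<Rightarrow> real \<Rightarrow> real \<Rightarrow> (real \<Rightarrow> real) \<Rightarrow> bool" for n p q where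
  zero: "bump_like n p q (\<lambda>_. 0)"
| prod: "bump_like n p q (\<lambda>t. flat i (n * (t - p)) * flat j (n * (q - t)))"
| lin: "bump_like n p q f \<Longrightarrow> bump_like n p q g \<Longrightarrow> bump_like n p q (\<lambda>t. c * f t + g t)"

lemma bump_like_deriv: "bump_like n p q f \<Longrightarrow> \<exists>g. bump_like n p q g \<and> (\<forall>t. (f has_real_derivative g t) (at t))"
proof (induction rule: bump_like.induct)
  case zero
  show ?case by (intro exI[of _ "\<lambda>_. 0"]) (auto intro: bump_like.zero)
next
  case (prod i j)
  let ?P = "\<lambda>i j t. flat i (n * (t - p)) * flat j (n * (q - t))"
  let ?g = "\<lambda>t. n * ?P (i + 2) j t + (- (n * real i) * ?P (i + 1) j t + (- n * ?P i (j + 2) t + ((n * real j) * ?P i (j + 1) t + 0)))"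
  have d: "((\<lambda>t. flat i (n * (t - p))) has_real_derivative (flat (i + 2) (n * (t - p)) - real i * flat (i + 1) (n * (t - p))) * n) (at t)" for t
    by (rule DERIV_chain2[OF flat_deriv]) (auto intro!: derivative_eq_intros)
  have d': "((\<lambda>t. flat j (n * (q - t))) has_real_derivative (flat (j + 2) (n * (q - t)) - real j * flat (j + 1) (n * (q - t))) * (- n)) (at t)" for t
    by (rule DERIV_chain2[OF flat_deriv]) (auto intro!: derivative_eq_intros)
  have "(?P i j has_real_derivative ?g t) (at t)" for t
    using DERIV_mult[OF d[of t] d'[of t]] by (rule back_subst[of "\<lambda>D. (_ has_real_derivative D) _"]) (simp add: algebra_simps)
  moreover have "bump_like n p q ?g" by (intro bump_like.lin bump_like.prod bump_like.zero)
  ultimately show ?case by blast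
next
  case (lin f g c)
  then obtain f' g' where "bump_like n p q f'" "bump_like n p q g'" "\<And>t. (f has_real_derivative f' t) (at t)" "\<And>t. (g has_real_derivative g' t) (at t)"
    by auto
  then show ?case by (intro exI[of _ "\<lambda>t. c * f' t + g' t"]) (auto intro!: bump_like.lin derivative_eq_intros)
qed

text \<open>A partial derivative replaces a single factor by another member of the class; hence the
  induction ranges over all families \<open>h\<close>.\<close>

lemma Ck_on_prod:
  fixes h :: "'a::euclidean_space \<Rightarrow> real \<Rightarrow> real" and p q :: 'a
  assumes "\<And>b. b \<in> Basis \<Longrightarrow> bump_like n (inner p b) (inner q b) (h b)"
  shows "Ck_on k (\<lambda>x. \<Prod>b\<in>Basis. h b (inner x b)) UNIV"
  using assms
proof (induction k arbitrary: h)
  case 0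
  have "continuous_on UNIV (h b)" if "b \<in> Basis" for b
    using bump_like_deriv[OF 0[OF that]] DERIV_isCont by (metis continuous_at_imp_continuous_on)
  then have "continuous_on UNIV (\<lambda>x. h b (inner x b))" if "b \<in> Basis" for b
    by (rule continuous_on_compose2[of UNIV "h b"]) (use that in \<open>auto intro!: continuous_intros\<close>)
  then have "continuous_on UNIV (\<lambda>x. \<Prod>b\<in>Basis. h b (inner x b))"
    by (rule continuous_on_prod)
  then show ?case by simp
next
  case (Suc k)
  have "\<forall>b\<in>Basis. \<exists>g. bump_like n (inner p b) (inner q b) g \<and> (\<forall>t. (h b has_real_derivative g t) (at t))"
    using bump_like_deriv Suc.prems by blast
  then obtain g where g: "\<And>b. b \<in> Basis \<Longrightarrow> bump_like n (inner p b) (inner q b) (g b)"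
    "\<And>b t. b \<in> Basis \<Longrightarrow> (h b has_real_derivative g b t) (at t)" by metis
  let ?F = "\<lambda>x. \<Prod>b\<in>Basis. h b (inner x b)"
  have d: "(?F has_derivative (\<lambda>y. \<Sum>b\<in>Basis. (g b (inner x b) * inner y b) * (\<Prod>j\<in>Basis - {b}. h j (inner x j)))) (at x)" for x
  proof (rule has_derivative_prod)
    fix b :: 'a assume b: "b \<in> Basis"
    have "((\<lambda>x. inner x b) has_derivative (\<lambda>y. inner y b)) (at x)" by (auto intro!: derivative_eq_intros)
    from has_derivative_compose[OF this g(2)[OF b, unfolded has_field_derivative_def]]
    show "((\<lambda>x. h b (inner x b)) has_derivative (\<lambda>y. g b (inner x b) * inner y b)) (at x)" .
  qed
  have pd: "partial c ?F = (\<lambda>x. \<Prod>b\<in>Basis. (h(c := g c)) b (inner x b))" if c: "c \<in> Basis" for c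
  proof
    fix x
    have "partial c ?F x = (\<Sum>b\<in>Basis. (g b (inner x b) * inner c b) * (\<Prod>j\<in>Basis - {b}. h j (inner x j)))"
      by (rule partial_eq[OF d])
    also have "\<dots> = (\<Sum>b\<in>Basis. if b = c then g c (inner x c) * (\<Prod>j\<in>Basis - {c}. h j (inner x j)) else 0)"
      by (rule sum.cong) (use c in \<open>auto simp: inner_Basis\<close>)
    also have "\<dots> = g c (inner x c) * (\<Prod>j\<in>Basis - {c}. h j (inner x j))" using c by simp
    also have "(\<Prod>j\<in>Basis - {c}. h j (inner x j)) = (\<Prod>j\<in>Basis - {c}. (h(c := g c)) j (inner x j))"
      by (rule prod.cong) auto
    also have "g c (inner x c) * \<dots> = (\<Prod>b\<in>Basis. (h(c := g c)) b (inner x b))"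
      using c by (subst prod.remove[of _ c]) auto
    finally show "partial c ?F x = (\<Prod>b\<in>Basis. (h(c := g c)) b (inner x b))" .
  qed
  have "Ck_on k (partial c ?F) UNIV" if c: "c \<in> Basis" for c
    unfolding pd[OF c] by (rule Suc.IH) (use Suc.prems g(1) c in \<open>auto simp: fun_upd_def\<close>)
  moreover have "?F differentiable (at x)" for x using d[of x] unfolding differentiable_def by blast
  ultimately show ?case by simp
qed

text \<open>The scaling by \<open>Suc n\<close> sharpens the flanks without changing the support:
  inside the open box each factor has the form \<open>exp (- 1 / (s * Suc n))\<close> and tends to
  one.\<close>

definition box_bump :: "'a::euclidean_space \<Rightarrow> 'a \<Rightarrow> nat \<Rightarrow> 'a \<Rightarrow> real" where
  "box_bump p q n x = (\<Prod>b\<in>Basis. flat 0 (real (Suc n) * (inner x b - inner p b)) * flat 0 (real (Suc n) * (inner q b - inner x b)))"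

lemma flat_0_bounds: "0 \<le> flat 0 x" "flat 0 x \<le> 1"
  by (auto simp: flat_def)

lemma box_bump_outside: "x \<notin> box p q \<Longrightarrow> box_bump p q n x = 0"
proof -
  assume "x \<notin> box p q"
  then obtain b where "b \<in> Basis" "inner x b \<le> inner p b \<or> inner q b \<le> inner x b" by (auto simp: mem_box not_less)
  then have "flat 0 (real (Suc n) * (inner x b - inner p b)) * flat 0 (real (Suc n) * (inner q b - inner x b)) = 0"
    by (auto simp: flat_def zero_less_mult_iff)
  then show ?thesis unfolding box_bump_def using \<open>b \<in> Basis\<close> by (meson finite_Basis prod_zero)
qed

lemma box_bump_bounds: "0 \<le> box_bump p q n x" "box_bump p q n x \<le> 1"
  unfolding box_bump_def by (auto intro!: prod_nonneg prod_le_1 mult_nonneg_nonneg mult_le_one flat_0_bounds)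

lemma box_bump_test:
  assumes "cbox p q \<subseteq> \<Omega>" shows "box_bump p q n \<in> test_functions \<Omega>"
proof -
  have "smooth_on (box_bump p q n) UNIV"
    unfolding smooth_on_def box_bump_def by (intro allI Ck_on_prod[of "real (Suc n)" p q] bump_like.prod)
  moreover have "closure {x. box_bump p q n x \<noteq> 0} \<subseteq> cbox p q"
    by (rule closure_minimal) (use box_bump_outside box_subset_cbox in blast)+
  moreover from this have "compact (closure {x. box_bump p q n x \<noteq> 0})"
    by (meson bounded_cbox bounded_subset closed_closure compact_eq_bounded_closed)
  ultimately show ?thesis using assms by (auto simp: test_functions_def)
qed

lemma box_bump_tendsto: "(\<lambda>n. box_bump p q n x) \<longlonglongrightarrow> indicator (box p q) x"
proof (cases "x \<in> box p q")
  case True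
  have "(\<lambda>n. flat 0 (real (Suc n) * s)) \<longlonglongrightarrow> 1" if "s > 0" for s
  proof -
    have "(\<lambda>n. exp (- (1 / s * (1 / real (Suc n))))) \<longlonglongrightarrow> exp (- (1 / s * 0))"
      by (intro tendsto_intros LIMSEQ_Suc[OF lim_1_over_n])
    moreover have "flat 0 (real (Suc n) * s) = exp (- (1 / s * (1 / real (Suc n))))" for n
      using that by (simp add: flat_def mult.commute)
    ultimately show ?thesis by simp
  qed
  then have "(\<lambda>n. box_bump p q n x) \<longlonglongrightarrow> (\<Prod>b\<in>(Basis::'a set). 1 * 1)"
    unfolding box_bump_def using True by (intro tendsto_prod tendsto_mult) (auto simp: mem_box)
  then show ?thesis using True by simp
next
  case False
  then show ?thesis by (simp add: box_bump_outside)
qed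

text \<open>Boxes form a generator stable under intersection, so the vanishing integrals extend to
  all Borel sets; the complement step needs the integral over the whole space, obtained from growing
  boxes. Testing on the sets where \<open>f\<close> and \<open>- f\<close> are positive
  concludes.\<close>

lemma AE_zero_of_box_integrals:
  fixes f :: "'a::euclidean_space \<Rightarrow> real"
  assumes f: "integrable lborel f" and z: "\<And>p q. (\<integral>x. indicator (box p q) x * f x \<partial>lborel) = 0"
  shows "AE x in lborel. f x = 0"
proof -
  have [measurable]: "f \<in> borel_measurable borel" using f by auto
  have si: "set_integrable lborel A f" if "A \<in> sets borel" for A
    using that integrable_mult_indicator[OF _ f, of A] by (simp add: set_integrable_def)
  have total: "integral\<^sup>L lborel f = 0"
  proof -
    let ?b = "\<lambda>n. box (- (real n *\<^sub>R One)) (real n *\<^sub>R One) :: 'a set"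
    have "(\<lambda>n. \<integral>x. indicator (?b n) x * f x \<partial>lborel) \<longlonglongrightarrow> integral\<^sup>L lborel f"
    proof (rule integral_dominated_convergence[where w = "\<lambda>x. \<bar>f x\<bar>"])
      show "AE x in lborel. (\<lambda>n. indicator (?b n) x * f x) \<longlonglongrightarrow> f x"
      proof (rule AE_I2)
        fix x :: 'a
        obtain N :: nat where N: "norm x < real N" using reals_Archimedean2 by blast
        have "x \<in> ?b n" if "n \<ge> N" for n
          unfolding mem_box
        proof
          fix i :: 'a assume i: "i \<in> Basis"
          have "\<bar>inner x i\<bar> < real n" using Basis_le_norm[OF i, of x] N that by linarith
          then show "inner (- (real n *\<^sub>R One)) i < inner x i \<and> inner x i < inner (real n *\<^sub>R One) i"
            using i by (auto simp: abs_less_iff)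
        qed
        then have "\<forall>\<^sub>F n in sequentially. indicator (?b n) x * f x = f x"
          unfolding eventually_sequentially by (intro exI[of _ N]) auto
        then show "(\<lambda>n. indicator (?b n) x * f x) \<longlonglongrightarrow> f x" by (rule tendsto_eventually)
      qed
    qed (use f in \<open>auto simp: indicator_def\<close>)
    then show ?thesis using LIMSEQ_unique[OF _ tendsto_const] by (simp add: z)
  qed
  have G: "A \<in> sigma_sets UNIV (range (\<lambda>(a, b). box a b :: 'a set)) \<Longrightarrow> A \<in> sets borel" for A
    unfolding borel_eq_box by simp
  have main: "(LINT x:A|lborel. f x) = 0" if A: "A \<in> sets borel" for A
  proof -
    have "Int_stable (range (\<lambda>(a, b). box a b :: 'a set))"
      unfolding Int_stable_def by (auto simp: box_Int_box)
    moreover have "range (\<lambda>(a, b). box a b :: 'a set) \<subseteq> Pow UNIV" by simp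
    moreover have "A \<in> sigma_sets UNIV (range (\<lambda>(a, b). box a b :: 'a set))" using A unfolding borel_eq_box by simp
    ultimately show ?thesis
    proof (induct rule: sigma_sets_induct_disjoint[consumes 3])
      case (basic B)
      then show ?case using z by (auto simp: set_lebesgue_integral_def)
    next
      case empty
      then show ?case by (simp add: set_lebesgue_integral_def)
    next
      case (compl B)
      have B: "B \<in> sets borel" using compl(1) G by blast
      have "integral\<^sup>L lborel f = (LINT x:B|lborel. f x) + (LINT x:UNIV - B|lborel. f x)"
        using set_integral_Un[of B "UNIV - B" lborel f] si B by (auto simp: set_lebesgue_integral_def)
      then show ?case using compl(2) total by simp
    next
      case (union B)
      have B: "B i \<in> sets borel" for i using union(2) G by blast
      have "(LINT x:(\<Union>i. B i)|lborel. f x) = (\<Sum>i. (LINT x:B i|lborel. f x))"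
        by (rule lebesgue_integral_countable_add) (use B si union(1) in \<open>auto simp: disjoint_family_on_def\<close>)
      then show ?case using union(3) by simp
    qed
  qed
  have "AE x in lborel. max 0 (s * f x) = 0" if "s = 1 \<or> s = -1" for s
  proof -
    let ?A = "{x. 0 < s * f x}"
    have A: "?A \<in> sets borel" by measurable
    have "integral\<^sup>L lborel (\<lambda>x. max 0 (s * f x)) = integral\<^sup>L lborel (\<lambda>x. s * (indicator ?A x *\<^sub>R f x))"
      by (rule Bochner_Integration.integral_cong) (auto simp: indicator_def)
    also have "\<dots> = 0" using main[OF A] by (simp add: set_lebesgue_integral_def)
    finally show ?thesis using f by (subst (asm) integral_nonneg_eq_0_iff_AE) auto
  qed
  from this[of 1] this[of "-1"] have "AE x in lborel. max 0 (1 * f x) = 0" "AE x in lborel. max 0 (-1 * f x) = 0" by auto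
  then show ?thesis by eventually_elim (auto simp: max_def split: if_splits)
qed

text \<open>Box bumps carry the orthogonality over to indicators of boxes with closure in
  \<open>\<Omega>\<close>, and \<open>\<Omega>\<close> is a countable union of closed boxes. A Borel
  representative \<open>y0\<close> brings the question to \<open>lborel\<close>; outside
  \<open>\<Omega>\<close> membership in \<open>L2 \<Omega>\<close> suffices.\<close>

lemma test_functions_total:
  fixes z :: "'a::euclidean_space l2"
  assumes \<Omega>: "open \<Omega>" and z: "z \<in> L2 \<Omega>" and orth: "\<And>\<psi>. \<psi> \<in> test_functions \<Omega> \<Longrightarrow> inner z (l2_of \<psi>) = 0"
  shows "z = 0"
proof -
  obtain y where y: "sq_integrable y" "z = l2_of y" using l2_rep by blast
  then obtain y0 where y0 [measurable]: "y0 \<in> borel_measurable lborel" and yy0: "AE x in lborel. y x = y0 x"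
    using completion_ex_borel_measurable_real[of y lborel] by (auto simp: sq_integrable_def)
  have yy0': "AE x in lebesgue. y x = y0 x" by (rule AE_completion[OF yy0])
  have y0sq: "sq_integrable y0"
  proof -
    have m: "y0 \<in> borel_measurable lebesgue" using y0 by (rule measurable_completion)
    have "integrable lebesgue (\<lambda>x. (y0 x)\<^sup>2)"
    proof (rule integrable_cong_AE_imp)
      show "integrable lebesgue (\<lambda>x. (y x)\<^sup>2)" using y by (simp add: sq_integrable_def)
      show "AE x in lebesgue. (y x)\<^sup>2 = (y0 x)\<^sup>2" using yy0' by eventually_elim simp
    qed (use m in simp)
    with m show ?thesis by (simp add: sq_integrable_def)
  qed
  have zy0: "z = l2_of y0" using y y0sq yy0' by (simp add: l2_of_eq_iff)
  have box0: "(\<integral>x. indicator (box p q) x * y0 x \<partial>lborel) = 0" if pq: "cbox p q \<subseteq> \<Omega>" for p q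
  proof -
    let ?c = "indicator (cbox p q) :: 'a \<Rightarrow> real"
    have csq: "sq_integrable ?c"
      by (rule sq_integrable_indicator) auto
    have ci: "integrable lborel (\<lambda>x. ?c x * y0 x)"
      using sq_integrable_mult[OF csq y0sq] lebesgue_borel(3)[of "\<lambda>x. ?c x * y0 x"] y0 by simp
    have bm [measurable]: "box_bump p q n \<in> borel_measurable borel" for n
      by (rule borel_measurable_continuous_onI[OF smooth_onD(2)[OF test_functions_smooth[OF box_bump_test[OF pq]]]])
    have "(\<lambda>n. \<integral>x. box_bump p q n x * y0 x \<partial>lborel) \<longlonglongrightarrow> (\<integral>x. indicator (box p q) x * y0 x \<partial>lborel)"
    proof (rule integral_dominated_convergence[where w = "\<lambda>x. \<bar>?c x * y0 x\<bar>"])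
      show "integrable lborel (\<lambda>x. \<bar>?c x * y0 x\<bar>)" using ci by (rule integrable_abs)
      show "AE x in lborel. (\<lambda>n. box_bump p q n x * y0 x) \<longlonglongrightarrow> indicator (box p q) x * y0 x"
        by (intro AE_I2 tendsto_mult box_bump_tendsto tendsto_const)
      show "AE x in lborel. norm (box_bump p q n x * y0 x) \<le> \<bar>?c x * y0 x\<bar>" for n
      proof (rule AE_I2)
        fix x
        have "\<bar>box_bump p q n x\<bar> \<le> ?c x"
          using box_bump_bounds[of p q n x] box_bump_outside[of x p q n] box_subset_cbox[of p q] by (cases "x \<in> box p q") auto
        then show "norm (box_bump p q n x * y0 x) \<le> \<bar>?c x * y0 x\<bar>" by (simp add: abs_mult mult_right_mono)
      qed
    qed auto
    moreover have "(\<integral>x. box_bump p q n x * y0 x \<partial>lborel) = 0" for n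
    proof -
      have "inner z (l2_of (box_bump p q n)) = 0" by (rule orth[OF box_bump_test[OF pq]])
      then have "integral\<^sup>L lebesgue (\<lambda>x. y0 x * box_bump p q n x) = 0"
        unfolding zy0 using inner_l2_of[OF y0sq test_functions_sq_integrable(1)[OF box_bump_test[OF pq]]] by simp
      then show ?thesis using lebesgue_borel(2)[of "\<lambda>x. y0 x * box_bump p q n x"] y0 by (simp add: mult.commute)
    qed
    ultimately show ?thesis using LIMSEQ_unique[OF _ tendsto_const] by simp
  qed
  have AEcbox: "AE x in lborel. x \<in> cbox a b \<longrightarrow> y0 x = 0" if ab: "cbox a b \<subseteq> \<Omega>" for a b
  proof -
    have csq: "sq_integrable (indicator (box a b) :: 'a \<Rightarrow> real)"
      by (rule sq_integrable_indicator) auto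
    have i: "integrable lborel (\<lambda>x. indicator (box a b) x * y0 x)"
      using sq_integrable_mult[OF csq y0sq] lebesgue_borel(3)[of "\<lambda>x. indicator (box a b) x * y0 x"] y0 by simp
    \<comment> \<open>Arbitrary boxes must be tested here; each meets \<open>box a b\<close> in a
      box whose closure, unless empty, lies in \<open>cbox a b\<close> and hence in
      \<open>\<Omega>\<close>.\<close>
    have "AE x in lborel. indicator (box a b) x * y0 x = 0"
    proof (rule AE_zero_of_box_integrals[OF i])
      fix p q
      obtain p' q' where pq': "box p q \<inter> box a b = box p' q'" using box_Int_box[of p q a b] by blast
      have eq: "indicator (box p q) x * (indicator (box a b) x * y0 x) = indicator (box p' q') x * y0 x" for x
        unfolding pq'[symmetric] by (simp add: indicator_def)
      show "(\<integral>x. indicator (box p q) x * (indicator (box a b) x * y0 x) \<partial>lborel) = 0"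
      proof (cases "box p' q' = {}")
        case True
        then show ?thesis unfolding eq by simp
      next
        case False
        then have "cbox p' q' = closure (box p' q')" by simp
        also have "\<dots> \<subseteq> cbox a b" by (rule closure_minimal) (use pq' box_subset_cbox[of a b] in auto)
        finally show ?thesis unfolding eq using box0 ab by blast
      qed
    qed
    moreover have "AE x in lborel. x \<notin> cbox a b - box a b"
      by (rule AE_not_in) (auto simp: emeasure_lborel_cbox_eq emeasure_lborel_box_eq null_sets_def emeasure_Diff box_subset_cbox)
    ultimately show ?thesis by eventually_elim (auto simp: indicator_def split: if_splits)
  qed
  obtain \<D> where \<D>: "countable \<D>" "\<And>X. X \<in> \<D> \<Longrightarrow> \<exists>a b. X = cbox a b" "\<Union>\<D> = \<Omega>"
    using open_countable_Union_open_cbox[OF \<Omega>] by metis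
  have "AE x in lborel. \<forall>X\<in>\<D>. x \<in> X \<longrightarrow> y0 x = 0"
  proof (rule AE_ball_countable[THEN iffD2, OF \<D>(1)], intro ballI)
    fix X assume X: "X \<in> \<D>"
    then obtain a b where "X = cbox a b" using \<D>(2) by blast
    then show "AE x in lborel. x \<in> X \<longrightarrow> y0 x = 0" using AEcbox \<D>(3) X by blast
  qed
  then have "AE x in lborel. x \<in> \<Omega> \<longrightarrow> y0 x = 0" by eventually_elim (use \<D>(3) in blast)
  then have 1: "AE x in lebesgue. x \<in> \<Omega> \<longrightarrow> y0 x = 0" by (rule AE_completion)
  have 2: "AE x in lebesgue. x \<notin> \<Omega> \<longrightarrow> y0 x = 0"
    using z zy0 y0sq by (simp add: L2_def vanishes_outside_l2_of)
  from 1 2 have "AE x in lebesgue. y0 x = 0" by eventually_elim blast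
  then show ?thesis using zy0 y0sq by (simp add: l2_of_eq_0_iff)
qed

section \<open>The Dirichlet Laplacian\<close>

text \<open>Dirichlet principle for \<open>J = E - 2 <x, u>\<close> on pairs of a function and its
  gradient. The infimum need not be attained in \<open>W\<close>, but a minimizing sequence is
  Cauchy in energy and satisfies the Euler-Lagrange equation in the limit.\<close>

lemma minimizing_sequence:
  fixes W :: "('v::real_inner \<times> ('i \<Rightarrow> 'v)) set"
  assumes I: "finite I" and W0: "W \<noteq> {}"
    and comb: "\<And>u F v G c. (u, F) \<in> W \<Longrightarrow> (v, G) \<in> W \<Longrightarrow> (u + c *\<^sub>R v, \<lambda>i. F i + c *\<^sub>R G i) \<in> W"
    and poincare: "\<And>u F. (u, F) \<in> W \<Longrightarrow> (norm u)\<^sup>2 \<le> K * (\<Sum>i\<in>I. (norm (F i))\<^sup>2)" and K: "K > 0"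
  obtains u F where "\<And>n. (u n, F n) \<in> W"
    "\<And>n m. (\<Sum>i\<in>I. (norm (F n i - F m i))\<^sup>2) \<le> 2 / real (Suc n) + 2 / real (Suc m)"
    "\<And>v G. (v, G) \<in> W \<Longrightarrow> (\<lambda>n. \<Sum>i\<in>I. inner (F n i) (G i)) \<longlonglongrightarrow> inner x v"
proof -
  define E where "E = (\<lambda>F :: 'i \<Rightarrow> 'v. \<Sum>i\<in>I. (norm (F i))\<^sup>2)"
  define a where "a = (\<lambda>F G :: 'i \<Rightarrow> 'v. \<Sum>i\<in>I. inner (F i) (G i))"
  define J where "J = (\<lambda>p. E (snd p) - 2 * inner x (fst p))"
  have E0: "E F \<ge> 0" for F unfolding E_def by (rule sum_nonneg) simp
  have expand: "J (u + c *\<^sub>R v, \<lambda>i. F i + c *\<^sub>R G i) = J (u, F) + 2 * c * (a F G - inner x v) + c\<^sup>2 * E G" for u F v G c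
  proof -
    have "E (\<lambda>i. F i + c *\<^sub>R G i) = (\<Sum>i\<in>I. (norm (F i))\<^sup>2 + 2 * c * inner (F i) (G i) + c\<^sup>2 * (norm (G i))\<^sup>2)"
      unfolding E_def power2_norm_eq_inner
      by (rule sum.cong) (simp_all add: inner_add_left inner_add_right inner_commute power2_eq_square algebra_simps)
    also have "\<dots> = E F + 2 * c * a F G + c\<^sup>2 * E G"
      by (simp add: E_def a_def sum.distrib sum_distrib_left)
    finally show ?thesis by (simp add: J_def inner_add_right algebra_simps)
  qed
  have lower: "- K * (norm x)\<^sup>2 \<le> J p" if p: "p \<in> W" for p
  proof -
    obtain u F where uF: "p = (u, F)" by force
    have "(norm u)\<^sup>2 / K \<le> E F" using poincare[of u F] p uF K by (simp add: E_def pos_divide_le_eq mult.commute)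
    moreover have "2 * inner x u \<le> K * (norm x)\<^sup>2 + (norm u)\<^sup>2 / K"
    proof -
      have "0 \<le> (K * norm x - norm u)\<^sup>2 / K" using K by simp
      also have "\<dots> = K * (norm x)\<^sup>2 + (norm u)\<^sup>2 / K - 2 * (norm x * norm u)" using K by (simp add: field_simps power2_eq_square)
      finally show ?thesis using norm_cauchy_schwarz[of x u] by linarith
    qed
    ultimately show ?thesis by (simp add: J_def uF)
  qed
  define m where "m = Inf (J ` W)"
  have bdd: "bdd_below (J ` W)" by (rule bdd_belowI2) (rule lower)
  have mJ: "m \<le> J p" if "p \<in> W" for p unfolding m_def using bdd that by (auto intro: cInf_lower)
  have "\<exists>p\<in>W. J p < m + 1 / real (Suc n)" for n
  proof -
    have "Inf (J ` W) < m + 1 / real (Suc n)" unfolding m_def[symmetric] by simp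
    then show ?thesis using cInf_less_iff[OF _ bdd] W0 by auto
  qed
  then obtain p where p: "\<And>n. p n \<in> W" "\<And>n. J (p n) < m + 1 / real (Suc n)" by metis
  define u where "u = (\<lambda>n. fst (p n))"
  define F where "F = (\<lambda>n. snd (p n))"
  have W: "(u n, F n) \<in> W" and J: "J (u n, F n) < m + 1 / real (Suc n)" for n using p by (auto simp: u_def F_def)
  show thesis
  proof (rule that[OF W])
    fix n k
    define d where "d = u n + (-1) *\<^sub>R u k"
    define D where "D = (\<lambda>i. F n i + (-1) *\<^sub>R F k i)"
    have dW: "(d, D) \<in> W" unfolding d_def D_def by (rule comb[OF W W])
    have q: "(u k + 1 *\<^sub>R d, \<lambda>i. F k i + 1 *\<^sub>R D i) = (u n, F n)" by (simp add: d_def D_def)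
    have 1: "J (u n, F n) = J (u k, F k) + 2 * (a (F k) D - inner x d) + E D"
      using expand[of "u k" 1 d "F k" D] unfolding q by simp
    \<comment> \<open>Comparison with the midpoint: \<open>J\<close> there is the mean of the two
      values minus \<open>E D / 4\<close>, yet still at least \<open>m\<close>.\<close>
    have "m \<le> J (u k + (1/2) *\<^sub>R d, \<lambda>i. F k i + (1/2) *\<^sub>R D i)" by (rule mJ[OF comb[OF W dW]])
    also have "\<dots> = J (u k, F k) + (a (F k) D - inner x d) + E D / 4"
      unfolding expand by (simp add: power2_eq_square)
    finally have "E D \<le> 2 * (1 / real (Suc n)) + 2 * (1 / real (Suc k))" using 1 J[of n] J[of k] by argo
    then have "E D \<le> 2 / real (Suc n) + 2 / real (Suc k)" by simp
    then show "(\<Sum>i\<in>I. (norm (F n i - F k i))\<^sup>2) \<le> 2 / real (Suc n) + 2 / real (Suc k)" by (simp add: E_def D_def)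
  next
    fix v G assume vG: "(v, G) \<in> W"
    define e where "e = E G + 1"
    have e: "e > 0" "E G \<le> e" using E0[of G] by (auto simp: e_def)
    have bound: "\<bar>a (F n) G - inner x v\<bar> \<le> sqrt (e * (1 / real (Suc n)))" for n
    proof -
      define \<delta> where "\<delta> = a (F n) G - inner x v"
      \<comment> \<open>The best multiple of \<open>G\<close>, with \<open>E G\<close> replaced by
        the positive upper bound \<open>e\<close>. The gain \<open>\<delta>^2 / e\<close> cannot
        exceed the distance of \<open>J (u n, F n)\<close> to the infimum.\<close>
      define c where "c = - \<delta> / e"
      have "m \<le> J (u n, F n) + 2 * c * \<delta> + c\<^sup>2 * E G"
        using mJ[OF comb[OF W vG]] unfolding expand \<delta>_def by simp
      moreover have "c\<^sup>2 * E G \<le> c\<^sup>2 * e" using e by (intro mult_left_mono) auto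
      moreover have "c\<^sup>2 * e = \<delta>\<^sup>2 / e" "2 * c * \<delta> = - 2 * (\<delta>\<^sup>2 / e)" using e by (simp_all add: c_def power2_eq_square)
      ultimately have "\<delta>\<^sup>2 / e \<le> 1 / real (Suc n)" using J[of n] by linarith
      then have "\<delta>\<^sup>2 \<le> e * (1 / real (Suc n))" using e by (simp add: pos_divide_le_eq mult.commute)
      then have "sqrt (\<delta>\<^sup>2) \<le> sqrt (e * (1 / real (Suc n)))" by (rule real_sqrt_le_mono)
      then show ?thesis by (simp add: \<delta>_def)
    qed
    have "(\<lambda>n. sqrt (e * (1 / real (Suc n)))) \<longlonglongrightarrow> sqrt (e * 0)"
      by (intro tendsto_intros LIMSEQ_Suc[OF lim_1_over_n])
    then have "(\<lambda>n. sqrt (e * (1 / real (Suc n)))) \<longlonglongrightarrow> 0" by simp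
    then have "(\<lambda>n. a (F n) G - inner x v) \<longlonglongrightarrow> 0"
      by (rule Lim_null_comparison[rotated]) (use bound in auto)
    then show "(\<lambda>n. \<Sum>i\<in>I. inner (F n i) (G i)) \<longlonglongrightarrow> inner x v" by (simp add: LIM_zero_iff a_def)
  qed
qed

lemma has_H10_gradient_add_scale:
  assumes "has_H10_gradient \<Omega> v G" "has_H10_gradient \<Omega> v' G'"
  shows "has_H10_gradient \<Omega> (v + c *\<^sub>R v') (\<lambda>b. G b + c *\<^sub>R G' b)"
proof -
  obtain \<phi> where \<phi>: "\<And>n. \<phi> n \<in> test_functions \<Omega>" "(\<lambda>n. l2_of (\<phi> n)) \<longlonglongrightarrow> v" "\<And>b. b \<in> Basis \<Longrightarrow> (\<lambda>n. l2_of (partial b (\<phi> n))) \<longlonglongrightarrow> G b"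
    using assms(1) unfolding has_H10_gradient_def by metis
  obtain \<phi>' where \<phi>': "\<And>n. \<phi>' n \<in> test_functions \<Omega>" "(\<lambda>n. l2_of (\<phi>' n)) \<longlonglongrightarrow> v'" "\<And>b. b \<in> Basis \<Longrightarrow> (\<lambda>n. l2_of (partial b (\<phi>' n))) \<longlonglongrightarrow> G' b"
    using assms(2) unfolding has_H10_gradient_def by metis
  show ?thesis unfolding has_H10_gradient_def
  proof (intro exI[of _ "\<lambda>n x. \<phi> n x + c * \<phi>' n x"] conjI allI ballI)
    show "(\<lambda>x. \<phi> n x + c * \<phi>' n x) \<in> test_functions \<Omega>" for n by (rule test_functions_add_scale[OF \<phi>(1) \<phi>'(1)])
    have "l2_of (\<lambda>x. \<phi> n x + c * \<phi>' n x) = l2_of (\<phi> n) + c *\<^sub>R l2_of (\<phi>' n)" for n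
      using test_functions_sq_integrable(1)[OF \<phi>(1)] test_functions_sq_integrable(1)[OF \<phi>'(1)]
      by (simp add: l2_of_add l2_of_scaleR sq_integrable_scale)
    then show "(\<lambda>n. l2_of (\<lambda>x. \<phi> n x + c * \<phi>' n x)) \<longlonglongrightarrow> v + c *\<^sub>R v'"
      by (simp only:) (intro tendsto_intros \<phi> \<phi>')
    fix b :: 'a assume b: "b \<in> Basis"
    have "l2_of (partial b (\<lambda>x. \<phi> n x + c * \<phi>' n x)) = l2_of (partial b (\<phi> n)) + c *\<^sub>R l2_of (partial b (\<phi>' n))" for n
    proof -
      have "partial b (\<lambda>x. \<phi> n x + c * \<phi>' n x) = (\<lambda>x. partial b (\<phi> n) x + c * partial b (\<phi>' n) x)"
        by (intro ext partial_add_scale smooth_onD(1)[OF test_functions_smooth[OF \<phi>(1)]] smooth_onD(1)[OF test_functions_smooth[OF \<phi>'(1)]])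
      then show ?thesis
        using test_functions_sq_integrable(2)[OF \<phi>(1) b] test_functions_sq_integrable(2)[OF \<phi>'(1) b]
        by (simp add: l2_of_add l2_of_scaleR sq_integrable_scale)
    qed
    then show "(\<lambda>n. l2_of (partial b (\<lambda>x. \<phi> n x + c * \<phi>' n x))) \<longlonglongrightarrow> G b + c *\<^sub>R G' b"
      by (simp only:) (intro tendsto_intros \<phi>(3)[OF b] \<phi>'(3)[OF b])
  qed
qed

lemma has_H10_gradient_test: "\<phi> \<in> test_functions \<Omega> \<Longrightarrow> has_H10_gradient \<Omega> (l2_of \<phi>) (\<lambda>b. l2_of (partial b \<phi>))"
  unfolding has_H10_gradient_def by (intro exI[of _ "\<lambda>_. \<phi>"]) auto

lemma zero_test_function: "(\<lambda>_. 0) \<in> test_functions \<Omega>"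
proof -
  have "Ck_on k (\<lambda>_::'a. 0) UNIV" for k
  proof (induction k)
    case (Suc k)
    have "partial b (\<lambda>_::'a. 0::real) = (\<lambda>_. 0)" for b :: 'a by (intro ext partial_eq) (rule has_derivative_const)
    then show ?case using Suc by simp
  qed simp
  then show ?thesis by (simp add: test_functions_def smooth_on_def)
qed

section \<open>The solution operator of the weak Dirichlet problem\<close>

locale dirichlet_problem =
  fixes \<Omega> :: "'a::euclidean_space set"
  assumes open_\<Omega>: "open \<Omega>" and bounded_\<Omega>: "bounded \<Omega>"
begin

lemma lebesgue_\<Omega>: "\<Omega> \<in> sets lebesgue"
  using open_\<Omega> by auto

lemma poincare:
  obtains K where "K > 0" "\<And>v G. has_H10_gradient \<Omega> v G \<Longrightarrow> (norm v)\<^sup>2 \<le> K * (\<Sum>b\<in>Basis. (norm (G b))\<^sup>2)"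
proof -
  obtain R where R: "R > 0" "\<And>x. x \<in> \<Omega> \<Longrightarrow> norm x \<le> R" using bounded_\<Omega> unfolding bounded_pos by auto
  obtain b :: 'a where b: "b \<in> Basis" using nonempty_Basis by blast
  have Rb: "\<bar>inner x b\<bar> \<le> R" if "x \<in> \<Omega>" for x using R(2)[OF that] Basis_le_norm[OF b, of x] by linarith
  show thesis
  proof (rule that)
    show "4 * R\<^sup>2 > 0" using R by simp
    fix v G assume "has_H10_gradient \<Omega> v G"
    then obtain \<phi> where \<phi>: "\<And>n. \<phi> n \<in> test_functions \<Omega>" "(\<lambda>n. l2_of (\<phi> n)) \<longlonglongrightarrow> v" "\<And>b. b \<in> Basis \<Longrightarrow> (\<lambda>n. l2_of (partial b (\<phi> n))) \<longlonglongrightarrow> G b"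
      unfolding has_H10_gradient_def by metis
    have "(norm v)\<^sup>2 \<le> 4 * R\<^sup>2 * (norm (G b))\<^sup>2"
    proof (rule LIMSEQ_le)
      show "(\<lambda>n. (norm (l2_of (\<phi> n)))\<^sup>2) \<longlonglongrightarrow> (norm v)\<^sup>2" by (intro tendsto_intros \<phi>)
      show "(\<lambda>n. 4 * R\<^sup>2 * (norm (l2_of (partial b (\<phi> n))))\<^sup>2) \<longlonglongrightarrow> 4 * R\<^sup>2 * (norm (G b))\<^sup>2" by (intro tendsto_intros \<phi> b)
    qed (use poincare_test_function[OF \<phi>(1) b Rb] in blast)
    also have "\<dots> \<le> 4 * R\<^sup>2 * (\<Sum>b\<in>Basis. (norm (G b))\<^sup>2)"
      using b by (intro mult_left_mono member_le_sum) auto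
    finally show "(norm v)\<^sup>2 \<le> 4 * R\<^sup>2 * (\<Sum>b\<in>Basis. (norm (G b))\<^sup>2)" .
  qed
qed

text \<open>The right side \<open>x\<close> of the Poisson equation may be any class on the whole
  space; it is seen only through its pairings with test functions in
  \<open>\<Omega>\<close>.\<close>

definition weak_solution :: "'a l2 \<Rightarrow> 'a l2 \<Rightarrow> ('a \<Rightarrow> 'a l2) \<Rightarrow> bool" where
  "weak_solution x v G \<longleftrightarrow> has_H10_gradient \<Omega> v G \<and>
     (\<forall>\<psi>\<in>test_functions \<Omega>. (\<Sum>b\<in>Basis. inner (G b) (l2_of (partial b \<psi>))) = inner x (l2_of \<psi>))"

text \<open>Both sides are continuous along the approximating test functions, so the weak identity
  extends to their H1 closure. This makes solutions admissible as test elements.\<close>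

lemma weak_solution_H10:
  assumes w: "weak_solution x v G" and H: "has_H10_gradient \<Omega> v' G'"
  shows "(\<Sum>b\<in>Basis. inner (G b) (G' b)) = inner x v'"
proof -
  obtain \<phi> where \<phi>: "\<And>n. \<phi> n \<in> test_functions \<Omega>" "(\<lambda>n. l2_of (\<phi> n)) \<longlonglongrightarrow> v'" "\<And>b. b \<in> Basis \<Longrightarrow> (\<lambda>n. l2_of (partial b (\<phi> n))) \<longlonglongrightarrow> G' b"
    using H unfolding has_H10_gradient_def by metis
  have "(\<lambda>n. \<Sum>b\<in>Basis. inner (G b) (l2_of (partial b (\<phi> n)))) \<longlonglongrightarrow> (\<Sum>b\<in>Basis. inner (G b) (G' b))"
    by (intro tendsto_sum tendsto_inner tendsto_const \<phi>)
  moreover have "(\<lambda>n. inner x (l2_of (\<phi> n))) \<longlonglongrightarrow> inner x v'" by (intro tendsto_inner tendsto_const \<phi>)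
  moreover have "(\<Sum>b\<in>Basis. inner (G b) (l2_of (partial b (\<phi> n)))) = inner x (l2_of (\<phi> n))" for n
    using w \<phi>(1) unfolding weak_solution_def by blast
  ultimately show ?thesis using LIMSEQ_unique by simp
qed

lemma weak_solution_add_scale:
  assumes "weak_solution x v G" "weak_solution y w H"
  shows "weak_solution (x + c *\<^sub>R y) (v + c *\<^sub>R w) (\<lambda>b. G b + c *\<^sub>R H b)"
  using assms has_H10_gradient_add_scale[of \<Omega> v G w H c] unfolding weak_solution_def
  by (auto simp: inner_add_left sum.distrib sum_distrib_left[symmetric])

lemma weak_solution_unique:
  assumes "weak_solution x v G" "weak_solution x v' G'"
  shows "v = v'"
proof -
  have d: "weak_solution (x + (-1) *\<^sub>R x) (v + (-1) *\<^sub>R v') (\<lambda>b. G b + (-1) *\<^sub>R G' b)"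
    by (rule weak_solution_add_scale[OF assms])
  then have H: "has_H10_gradient \<Omega> (v + (-1) *\<^sub>R v') (\<lambda>b. G b + (-1) *\<^sub>R G' b)" by (simp add: weak_solution_def)
  have "(\<Sum>b\<in>Basis. (norm (G b + (-1) *\<^sub>R G' b))\<^sup>2) = 0"
    using weak_solution_H10[OF d H] by (simp add: power2_norm_eq_inner)
  moreover obtain K where "\<And>v G. has_H10_gradient \<Omega> v G \<Longrightarrow> (norm v)\<^sup>2 \<le> K * (\<Sum>b\<in>Basis. (norm (G b))\<^sup>2)"
    using poincare by metis
  from this[OF H] have "(norm (v + (-1) *\<^sub>R v'))\<^sup>2 \<le> K * (\<Sum>b\<in>Basis. (norm (G b + (-1) *\<^sub>R G' b))\<^sup>2)" .
  ultimately show ?thesis by simp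
qed

text \<open>The minimizing sequence is Cauchy in each gradient component and, by Poincare, in the
  function itself; its limit lies in the H1 closure by construction.\<close>

lemma weak_solution_exists: "\<exists>v G. weak_solution x v G"
proof -
  obtain K where K: "K > 0" "\<And>v G. has_H10_gradient \<Omega> v G \<Longrightarrow> (norm v)\<^sup>2 \<le> K * (\<Sum>b\<in>Basis. (norm (G b))\<^sup>2)"
    using poincare by metis
  \<comment> \<open>Zero components off \<open>Basis\<close> make linear combinations of gradients
    literal equalities of functions.\<close>
  define gr where "gr = (\<lambda>\<phi> (b::'a). if b \<in> Basis then l2_of (partial b \<phi>) else 0)"
  define W where "W = (\<lambda>\<phi>. (l2_of \<phi>, gr \<phi>)) ` test_functions \<Omega>"
  have comb: "(u + c *\<^sub>R v, \<lambda>i. F i + c *\<^sub>R G i) \<in> W" if uF: "(u, F) \<in> W" and vG: "(v, G) \<in> W" for u F v G c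
  proof -
    obtain \<phi> \<psi> where \<phi>: "\<phi> \<in> test_functions \<Omega>" "u = l2_of \<phi>" "F = gr \<phi>" and \<psi>: "\<psi> \<in> test_functions \<Omega>" "v = l2_of \<psi>" "G = gr \<psi>"
      using uF vG unfolding W_def by auto
    have "u + c *\<^sub>R v = l2_of (\<lambda>x. \<phi> x + c * \<psi> x)"
      using \<phi>(2) \<psi>(2) test_functions_sq_integrable(1)[OF \<phi>(1)] test_functions_sq_integrable(1)[OF \<psi>(1)]
      by (simp add: l2_of_add l2_of_scaleR sq_integrable_scale)
    moreover have "(\<lambda>i. F i + c *\<^sub>R G i) = gr (\<lambda>x. \<phi> x + c * \<psi> x)"
    proof
      fix b
      have "partial b (\<lambda>x. \<phi> x + c * \<psi> x) = (\<lambda>x. partial b \<phi> x + c * partial b \<psi> x)"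
        by (intro ext partial_add_scale smooth_onD(1)[OF test_functions_smooth[OF \<phi>(1)]] smooth_onD(1)[OF test_functions_smooth[OF \<psi>(1)]])
      then show "F b + c *\<^sub>R G b = gr (\<lambda>x. \<phi> x + c * \<psi> x) b"
        using \<phi>(3) \<psi>(3) test_functions_sq_integrable(2)[OF \<phi>(1), of b] test_functions_sq_integrable(2)[OF \<psi>(1), of b]
        by (cases "b \<in> Basis") (simp_all add: gr_def l2_of_add l2_of_scaleR sq_integrable_scale)
    qed
    ultimately show ?thesis unfolding W_def using test_functions_add_scale[OF \<phi>(1) \<psi>(1)] by auto
  qed
  have PW: "(norm u)\<^sup>2 \<le> K * (\<Sum>b\<in>Basis. (norm (F b))\<^sup>2)" if "(u, F) \<in> W" for u F
    using that K(2)[OF has_H10_gradient_test] by (auto simp: W_def gr_def)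
  have W0: "W \<noteq> {}" using zero_test_function by (auto simp: W_def)
  obtain u F where uF: "\<And>n. (u n, F n) \<in> W"
    and E: "\<And>n m. (\<Sum>i\<in>Basis. (norm (F n i - F m i))\<^sup>2) \<le> 2 / real (Suc n) + 2 / real (Suc m)"
    and lim: "\<And>v G. (v, G) \<in> W \<Longrightarrow> (\<lambda>n. \<Sum>i\<in>Basis. inner (F n i) (G i)) \<longlonglongrightarrow> inner x v"
    by (rule minimizing_sequence[OF finite_Basis W0 comb PW K(1), of x]) blast+
  obtain \<phi> where \<phi>: "\<And>n. \<phi> n \<in> test_functions \<Omega>" "\<And>n. u n = l2_of (\<phi> n)" "\<And>n. F n = gr (\<phi> n)"
  proof -
    have "\<forall>n. \<exists>\<phi>. \<phi> \<in> test_functions \<Omega> \<and> u n = l2_of \<phi> \<and> F n = gr \<phi>" using uF unfolding W_def by blast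
    then show ?thesis using that by metis
  qed
  have cauchy: "Cauchy y" if y: "\<And>n m. (norm (y n - y m))\<^sup>2 \<le> C * (2 / real (Suc n) + 2 / real (Suc m))" and C: "C > 0" for y :: "nat \<Rightarrow> 'a l2" and C
  proof (rule metric_CauchyI)
    fix e :: real assume e: "e > 0"
    obtain N :: nat where N: "4 * C / e\<^sup>2 < real N" using reals_Archimedean2 by blast
    have "dist (y n) (y m) < e" if "n \<ge> N" "m \<ge> N" for n m
    proof -
      have "4 * C / e\<^sup>2 < real (Suc n)" "4 * C / e\<^sup>2 < real (Suc m)" using N that by auto
      then have "4 * C / real (Suc n) < e\<^sup>2" "4 * C / real (Suc m) < e\<^sup>2" using e by (simp_all add: field_simps)
      moreover have "C * (2 / a + 2 / b) < z" if "4 * C / a < z" "4 * C / b < z" "a > 0" "b > 0" for a b z :: real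
      proof -
        have eq: "C * (2 / a + 2 / b) = (4 * C / a + 4 * C / b) / 2" using that by (simp add: field_simps)
        have "(x + y) / 2 < z" if "x < z" "y < z" for x y :: real using that by simp
        from this[OF that(1,2)] show ?thesis unfolding eq .
      qed
      ultimately have "C * (2 / real (Suc n) + 2 / real (Suc m)) < e\<^sup>2" by (simp del: of_nat_Suc)
      then have "(norm (y n - y m))\<^sup>2 < e\<^sup>2" using y[of n m] by linarith
      then show ?thesis using e by (simp add: dist_norm power_less_imp_less_base)
    qed
    then show "\<exists>M. \<forall>m\<ge>M. \<forall>n\<ge>M. dist (y m) (y n) < e" by blast
  qed
  have "Cauchy u"
  proof (rule cauchy[OF _ K(1)])
    fix n m
    have "(u n + (-1) *\<^sub>R u m, \<lambda>i. F n i + (-1) *\<^sub>R F m i) \<in> W" by (rule comb[OF uF uF])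
    from PW[OF this] have "(norm (u n - u m))\<^sup>2 \<le> K * (\<Sum>b\<in>Basis. (norm (F n b - F m b))\<^sup>2)" by simp
    also have "\<dots> \<le> K * (2 / real (Suc n) + 2 / real (Suc m))" using K(1) by (intro mult_left_mono E) simp
    finally show "(norm (u n - u m))\<^sup>2 \<le> K * (2 / real (Suc n) + 2 / real (Suc m))" .
  qed
  then obtain v where v: "u \<longlonglongrightarrow> v" using Cauchy_convergent convergent_def by blast
  have "\<exists>l. (\<lambda>n. F n b) \<longlonglongrightarrow> l" if b: "b \<in> Basis" for b
  proof -
    have "Cauchy (\<lambda>n. F n b)"
    proof (rule cauchy[of _ 1])
      fix n m
      have "(norm (F n b - F m b))\<^sup>2 \<le> (\<Sum>i\<in>Basis. (norm (F n i - F m i))\<^sup>2)" using b by (intro member_le_sum) auto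
      also have "\<dots> \<le> 1 * (2 / real (Suc n) + 2 / real (Suc m))" using E[of n m] by simp
      finally show "(norm (F n b - F m b))\<^sup>2 \<le> 1 * (2 / real (Suc n) + 2 / real (Suc m))" .
    qed simp
    then show ?thesis using Cauchy_convergent convergent_def by blast
  qed
  then obtain G where G: "\<And>b. b \<in> Basis \<Longrightarrow> (\<lambda>n. F n b) \<longlonglongrightarrow> G b" by metis
  have "has_H10_gradient \<Omega> v G"
    unfolding has_H10_gradient_def
  proof (intro exI[of _ \<phi>] conjI allI ballI \<phi>(1))
    show "(\<lambda>n. l2_of (\<phi> n)) \<longlonglongrightarrow> v" using v by (simp add: \<phi>(2)[symmetric])
    show "(\<lambda>n. l2_of (partial b (\<phi> n))) \<longlonglongrightarrow> G b" if "b \<in> Basis" for b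
      using G[OF that] that by (simp add: \<phi>(3) gr_def)
  qed
  moreover have "(\<Sum>b\<in>Basis. inner (G b) (l2_of (partial b \<psi>))) = inner x (l2_of \<psi>)" if \<psi>: "\<psi> \<in> test_functions \<Omega>" for \<psi>
  proof -
    have "(\<lambda>n. \<Sum>i\<in>Basis. inner (F n i) (gr \<psi> i)) \<longlonglongrightarrow> inner x (l2_of \<psi>)"
      by (rule lim) (use \<psi> in \<open>auto simp: W_def\<close>)
    moreover have "(\<lambda>n. \<Sum>i\<in>Basis. inner (F n i) (gr \<psi> i)) \<longlonglongrightarrow> (\<Sum>i\<in>Basis. inner (G i) (gr \<psi> i))"
      by (intro tendsto_sum tendsto_inner tendsto_const G)
    ultimately have "(\<Sum>i\<in>Basis. inner (G i) (gr \<psi> i)) = inner x (l2_of \<psi>)" using LIMSEQ_unique by blast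
    then show ?thesis by (simp add: gr_def)
  qed
  ultimately show ?thesis unfolding weak_solution_def by blast
qed

definition inverse_laplacian :: "'a l2 \<Rightarrow> 'a l2" where
  "inverse_laplacian x = (SOME v. \<exists>G. weak_solution x v G)"

lemma inverse_laplacian_weak: "\<exists>G. weak_solution x (inverse_laplacian x) G"
  unfolding inverse_laplacian_def by (rule someI_ex[OF weak_solution_exists])

lemma inverse_laplacian_eq: "weak_solution x v G \<Longrightarrow> inverse_laplacian x = v"
  using inverse_laplacian_weak weak_solution_unique by blast

lemma inner_inverse_laplacian:
  assumes "weak_solution x (inverse_laplacian x) G" "weak_solution y (inverse_laplacian y) H"
  shows "inner (inverse_laplacian x) y = (\<Sum>b\<in>Basis. inner (G b) (H b))"
proof -
  have "(\<Sum>b\<in>Basis. inner (H b) (G b)) = inner y (inverse_laplacian x)"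
    by (rule weak_solution_H10[OF assms(2)]) (use assms(1) in \<open>simp add: weak_solution_def\<close>)
  then show ?thesis by (simp add: inner_commute)
qed

text \<open>The bilinear form of the operator is the Dirichlet form of the two solutions, whence
  symmetry and positivity; Poincare and Cauchy-Schwarz give boundedness.\<close>

lemma psd_inverse_laplacian: "psd_operator inverse_laplacian"
proof (rule psd_operator.intro)
  let ?B = inverse_laplacian
  obtain K where K: "K > 0" "\<And>v G. has_H10_gradient \<Omega> v G \<Longrightarrow> (norm v)\<^sup>2 \<le> K * (\<Sum>b\<in>Basis. (norm (G b))\<^sup>2)"
    using poincare by metis
  have comb: "?B (x + c *\<^sub>R y) = ?B x + c *\<^sub>R ?B y" for x y c
  proof -
    obtain G H where "weak_solution x (?B x) G" "weak_solution y (?B y) H" using inverse_laplacian_weak by metis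
    from weak_solution_add_scale[OF this] show ?thesis by (rule inverse_laplacian_eq)
  qed
  have B0: "?B 0 = 0" using comb[of 0 1 0] by simp
  show "bounded_linear ?B"
  proof (rule bounded_linear_intro)
    show "?B (x + y) = ?B x + ?B y" for x y using comb[of x 1 y] by simp
    show "?B (c *\<^sub>R x) = c *\<^sub>R ?B x" for c x using comb[of 0 c x] B0 by simp
    show "norm (?B x) \<le> norm x * K" for x
    proof -
      obtain G where G: "weak_solution x (?B x) G" using inverse_laplacian_weak by blast
      have "(norm (?B x))\<^sup>2 \<le> K * (\<Sum>b\<in>Basis. (norm (G b))\<^sup>2)" using G by (intro K(2)) (simp add: weak_solution_def)
      also have "(\<Sum>b\<in>Basis. (norm (G b))\<^sup>2) = inner (?B x) x"
        unfolding power2_norm_eq_inner by (rule inner_inverse_laplacian[OF G G, symmetric])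
      also have "K * inner (?B x) x \<le> K * (norm (?B x) * norm x)" using K(1) by (intro mult_left_mono norm_cauchy_schwarz) simp
      finally have "norm (?B x) * norm (?B x) \<le> norm (?B x) * (norm x * K)" by (simp add: power2_eq_square algebra_simps)
      then show ?thesis
        using K(1) by (cases "?B x = 0") (auto simp: mult_le_cancel_left_pos)
    qed
  qed
  show "inner (?B x) y = inner x (?B y)" for x y
  proof -
    obtain G H where "weak_solution x (?B x) G" "weak_solution y (?B y) H" using inverse_laplacian_weak by metis
    from inner_inverse_laplacian[OF this] inner_inverse_laplacian[OF this(2,1)]
    show ?thesis by (simp add: inner_commute)
  qed
  show "0 \<le> inner (?B x) x" for x
  proof -
    obtain G where G: "weak_solution x (?B x) G" using inverse_laplacian_weak by blast
    show ?thesis unfolding inner_inverse_laplacian[OF G G] by (rule sum_nonneg) simp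
  qed
qed

lemma inverse_laplacian_in_L2: "inverse_laplacian x \<in> L2 \<Omega>"
proof -
  obtain \<phi> where \<phi>: "\<And>n. \<phi> n \<in> test_functions \<Omega>" "(\<lambda>n. l2_of (\<phi> n)) \<longlonglongrightarrow> inverse_laplacian x"
    using inverse_laplacian_weak[of x] unfolding weak_solution_def has_H10_gradient_def by metis
  have "l2_of (\<phi> n) \<in> L2 \<Omega>" for n
  proof -
    obtain K where "K \<subseteq> \<Omega>" "\<And>x. x \<notin> K \<Longrightarrow> \<phi> n x = 0" using test_functionsE[OF \<phi>(1)] by metis
    then show ?thesis using test_functions_sq_integrable(1)[OF \<phi>(1)] by (auto simp: L2_def vanishes_outside_l2_of)
  qed
  then show ?thesis by (rule closed_sequentially[OF closed_L2[OF lebesgue_\<Omega>] _ \<phi>(2)])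
qed

text \<open>If the solution vanishes, so does its energy \<open><B z, z>\<close>; the weak gradient
  is then zero and \<open>z\<close> is orthogonal to all test functions.\<close>

lemma inverse_laplacian_inject:
  assumes z: "z \<in> L2 \<Omega>" and B: "inverse_laplacian z = 0" shows "z = 0"
proof -
  obtain G where G: "weak_solution z (inverse_laplacian z) G" using inverse_laplacian_weak by blast
  have "(\<Sum>b\<in>Basis. inner (G b) (G b)) = 0" using inner_inverse_laplacian[OF G G] B by simp
  then have G0: "G b = 0" if "b \<in> Basis" for b using that by (simp add: sum_nonneg_eq_0_iff)
  show ?thesis
  proof (rule test_functions_total[OF open_\<Omega> z])
    fix \<psi> assume "\<psi> \<in> test_functions \<Omega>"
    then have "inner z (l2_of \<psi>) = (\<Sum>b\<in>Basis. inner (G b) (l2_of (partial b \<psi>)))" using G by (simp add: weak_solution_def)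
    also have "\<dots> = 0" by (simp add: G0)
    finally show "inner z (l2_of \<psi>) = 0" .
  qed
qed

text \<open>Being in the domain means being a weak solution with right side \<open>- w\<close>, and
  that solution is unique.\<close>

lemma has_dirichlet_laplacian_iff:
  "has_dirichlet_laplacian \<Omega> v w \<longleftrightarrow> w \<in> L2 \<Omega> \<and> v = - inverse_laplacian w"
proof -
  interpret psd_operator inverse_laplacian by (rule psd_inverse_laplacian)
  have "has_dirichlet_laplacian \<Omega> v w \<longleftrightarrow> w \<in> L2 \<Omega> \<and> (\<exists>G. weak_solution (- w) v G)"
    unfolding has_dirichlet_laplacian_def weak_solution_def by simp
  also have "(\<exists>G. weak_solution (- w) v G) \<longleftrightarrow> v = inverse_laplacian (- w)"
    using inverse_laplacian_weak inverse_laplacian_eq by metis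
  finally show ?thesis by (simp add: C.neg)
qed

end

section \<open>The diffusion-wave problem\<close>

lemma C_L2_norm_ge:
  assumes "u \<in> C_L2 T \<Omega>" "t \<in> {0..T}" shows "norm (u t) \<le> C_L2_norm T u"
  unfolding C_L2_norm_def
proof (rule cSUP_upper[OF assms(2)])
  have "continuous_on {0..T} (\<lambda>t. norm (u t))" using assms by (auto simp: C_L2_def intro!: continuous_intros)
  then show "bdd_above ((\<lambda>t. norm (u t)) ` {0..T})"
    by (intro bounded_imp_bdd_above compact_imp_bounded compact_continuous_image) auto
qed

lemma C_L2_norm_le: "T \<ge> 0 \<Longrightarrow> (\<And>t. t \<in> {0..T} \<Longrightarrow> norm (u t) \<le> c) \<Longrightarrow> C_L2_norm T u \<le> c"
  unfolding C_L2_norm_def by (rule cSUP_least) auto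

theorem theorem1:
  fixes \<Omega> :: "'a::euclidean_space set"
    and T \<kappa> L :: real
    and \<alpha> \<alpha>' \<alpha>'' \<alpha>''' :: "real \<Rightarrow> real"
  assumes "T > 0" and "\<kappa> > 0"
    and "1 \<le> DIM('a)" and "DIM('a) \<le> 3"
    and "open \<Omega>" and "connected \<Omega>" and "\<Omega> \<noteq> {}" and "bounded \<Omega>" and "simply_connected \<Omega>"
    and "piecewise_smooth_convex_corners \<Omega>"
    and "\<And>t. t \<in> {0..T} \<Longrightarrow> 1 < \<alpha> t \<and> \<alpha> t < 2"
    and "\<And>t. t \<in> {0..T} \<Longrightarrow> (\<alpha> has_real_derivative \<alpha>' t) (at t within {0..T})"
    and "\<And>t. t \<in> {0..T} \<Longrightarrow> (\<alpha>' has_real_derivative \<alpha>'' t) (at t within {0..T})"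
    and "\<And>t. t \<in> {0..T} \<Longrightarrow> (\<alpha>'' has_real_derivative \<alpha>''' t) (at t within {0..T})"
    and "L > 0"
    and "\<And>t. t \<in> {0..T} \<Longrightarrow> \<bar>\<alpha>' t\<bar> + \<bar>\<alpha>'' t\<bar> + \<bar>\<alpha>''' t\<bar> \<le> L"
  shows "\<exists>Q>0. \<forall>f\<in>C_L2 T \<Omega>. \<forall>u0\<in>L2 \<Omega>. \<forall>u1\<in>L2 \<Omega>.
           \<exists>u. mild_solution T \<kappa> \<Omega> \<alpha> f u0 u1 u \<and>
               (\<forall>v. mild_solution T \<kappa> \<Omega> \<alpha> f u0 u1 v \<longrightarrow> (\<forall>t\<in>{0..T}. v t = u t)) \<and>
               C_L2_norm T u \<le> Q * (C_L2_norm T f + norm u0 + norm u1)"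
  proof -
  interpret vo: variable_order T L \<alpha> \<alpha>'
  proof
    show "continuous_on {0..T} \<alpha>'" by (rule DERIV_continuous_on) (rule assms(13))
    show "\<bar>\<alpha>' t\<bar> \<le> L" if "t \<in> {0..T}" for t using assms(16)[OF that] by linarith
  qed (use assms(1,11,12) in auto)
  interpret dp: dirichlet_problem \<Omega> by unfold_locales (use assms(5,8) in auto)
  obtain M c k' where mk: "memory_kernel T M c (vo_kernel \<alpha>) k'" using vo.memory_kernel_vo_kernel by blast
  let ?B = dp.inverse_laplacian and ?a = "beta_kernel (\<alpha> 0)" and ?h = "deriv (gen_identity \<alpha>)"
  have \<alpha>0: "1 < \<alpha> 0" "\<alpha> 0 < 2" using vo.\<alpha>0 .
  have axioms: "diffusion_wave_axioms T (vo_kernel \<alpha>) ?B \<kappa> (\<alpha> 0 - 1) (gen_identity \<alpha>) ?h (L2 \<Omega>)"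
  proof
    show "gen_identity \<alpha> t = conv (beta_kernel (\<alpha> 0 - 1)) (vo_kernel \<alpha>) t" if "0 < t" "t < T" for t
      using vo.gen_identity_conv that by simp
    show "gen_identity \<alpha> t = 1 + integral {0..t} ?h" if "0 < t" "t < T" for t
      by (rule vo.gen_identity_integral_deriv[OF that])
    show "kern T ?h" by (rule vo.kern_deriv_gen_identity)
    show "z = 0" if "z \<in> L2 \<Omega>" "?B z = 0" for z by (rule dp.inverse_laplacian_inject[OF that])
  qed (use \<alpha>0 assms(2) subspace_L2[OF dp.lebesgue_\<Omega>] closed_L2[OF dp.lebesgue_\<Omega>] dp.inverse_laplacian_in_L2 in auto)
  interpret dw: diffusion_wave T M c "vo_kernel \<alpha>" k' ?B \<kappa> "\<alpha> 0 - 1" "gen_identity \<alpha>" ?h "L2 \<Omega>"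
    by (rule diffusion_wave.intro[OF mk dp.psd_inverse_laplacian axioms])
  note S = subspace_L2[OF dp.lebesgue_\<Omega>]
  \<comment> \<open>The concrete and the abstract equation correspond under
    \<open>x = \<kappa> w\<close>. In the backward direction \<open>w\<close> must belong to
    \<open>L2 \<Omega>\<close>, which holds because every term of \<open>x\<close> does.\<close>
  have mild_iff: "mild_solution T \<kappa> \<Omega> \<alpha> f u0 u1 u \<longleftrightarrow> u \<in> C_L2 T \<Omega> \<and> dw.mild f u0 u1 u"
    if f: "f \<in> C_L2 T \<Omega>" and uS: "u0 \<in> L2 \<Omega>" "u1 \<in> L2 \<Omega>" for f u0 u1 u
  proof (cases "u \<in> C_L2 T \<Omega>")
    case u: True
    have "(\<exists>w. has_dirichlet_laplacian \<Omega> (conv ?a u t) w \<and> u t - u0 - \<kappa> *\<^sub>R w = mild_rhs \<alpha> f u0 u1 u t) \<longleftrightarrow>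
      ?B (u t - u0 + conv ?h (\<lambda>s. u s - u0) t - conv (beta_kernel 1) (gen_identity \<alpha>) t *\<^sub>R u1 - conv ?a f t) + \<kappa> *\<^sub>R conv ?a u t = 0"
      if t: "t \<in> {0..T}" for t
    proof -
      have t': "0 \<le> t" "t \<le> T" using t by auto
      define x where "x = u t - u0 + conv ?h (\<lambda>s. u s - u0) t - conv (beta_kernel 1) (gen_identity \<alpha>) t *\<^sub>R u1 - conv ?a f t"
      have x: "x = u t - u0 - mild_rhs \<alpha> f u0 u1 u t" by (simp add: x_def mild_rhs_def algebra_simps)
      have c: "continuous_on {0..t} u" "continuous_on {0..t} f"
        using u f t' by (auto simp: C_L2_def intro: continuous_on_subset)
      have "conv ?h (\<lambda>s. u s - u0) t \<in> L2 \<Omega>"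
        by (rule conv_in_L2[OF dp.lebesgue_\<Omega> vo.kern_deriv_gen_identity t'(2)])
          (use u uS t' c in \<open>auto simp: C_L2_def intro!: continuous_intros subspace_diff[OF S]\<close>)
      moreover have "conv ?a f t \<in> L2 \<Omega>"
        by (rule conv_in_L2[OF dp.lebesgue_\<Omega> kern_beta t'(2) c(2)]) (use f \<alpha>0 t' in \<open>auto simp: C_L2_def\<close>)
      moreover have "u t \<in> L2 \<Omega>" using u t by (simp add: C_L2_def)
      ultimately have xS: "x \<in> L2 \<Omega>"
        unfolding x_def by (intro subspace_diff[OF S] subspace_add[OF S] subspace_scale[OF S] uS)
      show ?thesis
        unfolding x_def[symmetric]
      proof
        assume "\<exists>w. has_dirichlet_laplacian \<Omega> (conv ?a u t) w \<and> u t - u0 - \<kappa> *\<^sub>R w = mild_rhs \<alpha> f u0 u1 u t"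
        then obtain w where w: "conv ?a u t = - ?B w" "u t - u0 - \<kappa> *\<^sub>R w = mild_rhs \<alpha> f u0 u1 u t"
          unfolding dp.has_dirichlet_laplacian_iff by blast
        have "x = \<kappa> *\<^sub>R w" unfolding x w(2)[symmetric] by simp
        then show "?B x + \<kappa> *\<^sub>R conv ?a u t = 0" by (simp add: w(1) dw.C.scaleR)
      next
        assume e: "?B x + \<kappa> *\<^sub>R conv ?a u t = 0"
        define w where "w = (1 / \<kappa>) *\<^sub>R x"
        have xw: "x = \<kappa> *\<^sub>R w" using assms(2) by (simp add: w_def)
        have "\<kappa> *\<^sub>R (?B w + conv ?a u t) = 0" using e unfolding xw by (simp add: dw.C.scaleR scaleR_add_right)
        then have "?B w + conv ?a u t = 0" using assms(2) by simp
        then have "conv ?a u t = - ?B w" by (simp add: eq_neg_iff_add_eq_0 add.commute)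
        moreover have "w \<in> L2 \<Omega>" unfolding w_def by (rule subspace_scale[OF S xS])
        moreover have "u t - u0 - \<kappa> *\<^sub>R w = mild_rhs \<alpha> f u0 u1 u t" unfolding xw[symmetric] x by simp
        ultimately show "\<exists>w. has_dirichlet_laplacian \<Omega> (conv ?a u t) w \<and> u t - u0 - \<kappa> *\<^sub>R w = mild_rhs \<alpha> f u0 u1 u t"
          unfolding dp.has_dirichlet_laplacian_iff by (intro exI[of _ w] conjI)
      qed
    qed
    then show ?thesis using u unfolding mild_solution_def dw.mild_def by (auto simp: C_L2_def)
  qed (simp add: mild_solution_def)
  obtain Q where Q: "Q > 0" "\<And>f u0 u1 F. continuous_on {0..T} f \<Longrightarrow> (\<And>t. t \<in> {0..T} \<Longrightarrow> f t \<in> L2 \<Omega>) \<Longrightarrow> u0 \<in> L2 \<Omega> \<Longrightarrow> u1 \<in> L2 \<Omega> \<Longrightarrow>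
     (\<And>t. t \<in> {0..T} \<Longrightarrow> norm (f t) \<le> F) \<Longrightarrow>
     \<exists>u. dw.mild f u0 u1 u \<and> (\<forall>t\<in>{0..T}. u t \<in> L2 \<Omega> \<and> norm (u t) \<le> Q * (F + norm u0 + norm u1))"
    using dw.well_posed by metis
  show ?thesis
  proof (intro exI[of _ Q] conjI ballI Q(1))
    fix f u0 u1 assume f: "f \<in> C_L2 T \<Omega>" and uS: "u0 \<in> L2 \<Omega>" "u1 \<in> L2 \<Omega>"
    have "\<exists>u. dw.mild f u0 u1 u \<and> (\<forall>t\<in>{0..T}. u t \<in> L2 \<Omega> \<and> norm (u t) \<le> Q * (C_L2_norm T f + norm u0 + norm u1))"
      by (rule Q(2)[OF _ _ uS]) (use f C_L2_norm_ge[OF f] in \<open>auto simp: C_L2_def\<close>)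
    then obtain u where u: "dw.mild f u0 u1 u" "\<And>t. t \<in> {0..T} \<Longrightarrow> u t \<in> L2 \<Omega> \<and> norm (u t) \<le> Q * (C_L2_norm T f + norm u0 + norm u1)"
      by blast
    have uC: "u \<in> C_L2 T \<Omega>" using u by (simp add: C_L2_def dw.mild_def)
    show "\<exists>u. mild_solution T \<kappa> \<Omega> \<alpha> f u0 u1 u \<and>
             (\<forall>v. mild_solution T \<kappa> \<Omega> \<alpha> f u0 u1 v \<longrightarrow> (\<forall>t\<in>{0..T}. v t = u t)) \<and>
             C_L2_norm T u \<le> Q * (C_L2_norm T f + norm u0 + norm u1)"
    proof (intro exI[of _ u] conjI allI impI ballI)
      show "mild_solution T \<kappa> \<Omega> \<alpha> f u0 u1 u" using mild_iff[OF f uS] u uC by blast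
      show "v t = u t" if "mild_solution T \<kappa> \<Omega> \<alpha> f u0 u1 v" "t \<in> {0..T}" for v t
        using dw.mild_unique[OF _ u(1) that(2)] that(1) mild_iff[OF f uS] by blast
      show "C_L2_norm T u \<le> Q * (C_L2_norm T f + norm u0 + norm u1)"
        by (rule C_L2_norm_le) (use u(2) assms(1) in auto)
    qed
  qed
qed

end
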